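(* Let $X$ be a $1$-dimensional finite cellular stratified space and let $k$ be a positive integer. Let $C(\pi^{\mathrm{comp}}_{k,X})$ be the face category of the stratification $\pi^{\mathrm{comp}}_{k,X}$ on $\mathrm{Conf}_k(X)$ induced by the braid stratification on $X^k$. Then $C(\pi^{\mathrm{comp}}_{k,X})$ is a finite acyclic category, and its classifying space $BC(\pi^{\mathrm{comp}}_{k,X})$ can be embedded in $\mathrm{Conf}_k(X)$ as a strong $\Sigma_k$-equivariant deformation retract.
   Context: Configuration space: $\mathrm{Conf}_k(X)=\{(x_1,\dots,x_k)\in X^k : x_i\neq x_j \text{ for } i\ne j\}$, with the symmetric group $\Sigma_k$ permuting coordinates. Cellular stratified spaces. A stratification on a space $X$ indexed by a poset $\Lambda$ is a map $\pi:X\to\Lambda$ such that $\lambda\le\mu$ iff $\pi^{-1}(\lambda)\subset\overline{\pi^{-1}(\mu)}$, and each stratum $e_\lambda=\pi^{-1}(\lambda)$ is connected and locally closed. For $X$ Hausdorff, an $n$-cell structure on $e_\lambda$ is a pair $(D_\lambda,\varphi_\lambda)$ with $\mathrm{Int}(D^n)\subset D_\lambda\subset D^n$ (unit disk) and $\varphi_\lambda:D_\lambda\to \overline{e_\lambda}\subset X$ a surjective quotient map onto $\overline{e_\lambda}$ restricting to a homeomorphism $\mathrm{Int}(D^n)\to e_\lambda$. A cellular stratification is a stratification with a cell structure on each stratum such that for every $n$-cell $e_\lambda$ the set $\overline{e_\lambda}\setminus e_\lambda$ is covered by finitely many cells of dimension $\le n-1$; then $X$ is a cellular stratified space. It is finite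 if it has finitely many cells. It is $1$-dimensional if its cells have dimension at most $1$ (and dimension $1$ occurs); the domain of a $1$-cell is $[-1,1]$ with some (possibly no) endpoints removed. Face category. The face category $C(Y)$ of a (totally normal) cellular stratified space $Y$ has the cells as objects; a morphism from $e_\mu$ to $e_\lambda$ is a map $b:D_\mu\to D_\lambda$ with $\varphi_\lambda\circ b=\varphi_\mu$; composition is composition of maps. A small category $C$ is acyclic if the only endomorphisms are identities and, for $x\neq y$, at least one of $C(x,y)$, $C(y,x)$ is empty. $BC$ denotes the geometric realization of the nerve. Braid stratification. Let $X$ be a finite $1$-dimensional cellular stratified space. $X^k$ has the product stratification with cells $e_{\lambda_1}\times\cdots\times e_{\lambda_k}$ and characteristic maps $\varphi_{\lambda_1}\times\cdots\times\varphi_{\lambda_k}$ on $D_{\lambda_1}\times\cdots\times D_{\lambda_k}$. The braid stratification $\pi^{\mathrm{braid}}_{k,X}$ subdivides each product cell as follows: for each $1$-cell $e_\mu$ of $X$ let $I_\mu=\{i: e_{\lambda_i}=e_\mu\}$ and write the coordinates as $x_i=\varphi_\mu(t_i)$, $t_i\in(-1,1)$, $i\in I_\mu$; the product cell is cut by all hyperplanes $t_i=t_j$ ($i,j\in I_\mu$, $i\ne j$). Thus its cells are indexed by a product cell together with, for every $1$-cell $e_\mu$, an ordered partition of $I_\mu$ (recording the equalities and strict inequalities among the $t_i$). The domain of the characteristic map of such a cell is the subset of $D_{\lambda_1}\times\cdots\times D_{\lambda_k}$ given by the corresponding equalities and weak inequalities (a convex polytope with some faces removed, identified with a subspace of a disk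 by a homeomorphism radial from the barycenter), and the characteristic map is the restriction of the product characteristic map. $\pi^{\mathrm{comp}}_{k,X}$ is the restriction of $\pi^{\mathrm{braid}}_{k,X}$ to $\mathrm{Conf}_k(X)$, which is a union of cells; domains are restricted to the preimage of $\mathrm{Conf}_k(X)$. $\Sigma_k$ acts on $C(\pi^{\mathrm{comp}}_{k,X})$ and on $BC(\pi^{\mathrm{comp}}_{k,X})$ through its action on $\mathrm{Conf}_k(X)$. *)

theory Defs
  imports "HOL-Homology.Homology" "HOL-Combinatorics.Permutations"
begin

unbundle no m_inv_syntax

section \<open>Cellular stratified spaces\<close>

text \<open>
  The disks live in the library's \<^const>\<open>Euclidean_space\<close>, whose points are the functions
  \<open>nat \<Rightarrow> real\<close> vanishing at all indices \<open>\<ge> n\<close>.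
\<close>

definition closed_disk :: "nat \<Rightarrow> (nat \<Rightarrow> real) set" where
  "closed_disk n = {x \<in> topspace (Euclidean_space n). (\<Sum>i<n. (x i)\<^sup>2) \<le> 1}"

definition open_disk :: "nat \<Rightarrow> (nat \<Rightarrow> real) set" where
  "open_disk n = {x \<in> topspace (Euclidean_space n). (\<Sum>i<n. (x i)\<^sup>2) < 1}"

text \<open>
  A stratified space together with a characteristic map for each stratum: the space, the index
  poset \<open>(Index, Le)\<close>, the stratification map \<open>proj\<close>, and for each index the dimension of the
  cell, the domain of its characteristic map (as a space) and the characteristic map itself.
  The type of points of the domains is left open because the domains of the cells of a product
  are kept as subspaces of products of disks; identifying them with subspaces of a disk would
  only replace the face category by an isomorphic one.
\<close>

record ('a, 'c, 'd) strat_cells =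
  Space :: "'a topology"
  Index :: "'c set"
  Le :: "'c rel"
  proj :: "'a \<Rightarrow> 'c"
  cdim :: "'c \<Rightarrow> nat"
  Dom :: "'c \<Rightarrow> 'd topology"
  Char :: "'c \<Rightarrow> 'd \<Rightarrow> 'a"

definition stratum :: "('a, 'c, 'd) strat_cells \<Rightarrow> 'c \<Rightarrow> 'a set" where
  "stratum X c = {x \<in> topspace (Space X). proj X x = c}"

definition locally_closed_in :: "'a topology \<Rightarrow> 'a set \<Rightarrow> bool" where
  "locally_closed_in T A \<longleftrightarrow> (\<exists>U C. openin T U \<and> closedin T C \<and> A = U \<inter> C)"

definition stratified_space :: "('a, 'c, 'd) strat_cells \<Rightarrow> bool" where
  "stratified_space X \<longleftrightarrow>
     partial_order_on (Index X) (Le X) \<and>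
     proj X \<in> topspace (Space X) \<rightarrow> Index X \<and>
     (\<forall>c\<in>Index X. \<forall>d\<in>Index X.
        (c, d) \<in> Le X \<longleftrightarrow> stratum X c \<subseteq> Space X closure_of stratum X d) \<and>
     (\<forall>c\<in>Index X. connectedin (Space X) (stratum X c) \<and>
        locally_closed_in (Space X) (stratum X c))"

definition cell_structure ::
    "'a topology \<Rightarrow> 'a set \<Rightarrow> nat \<Rightarrow> (nat \<Rightarrow> real) topology \<Rightarrow> ((nat \<Rightarrow> real) \<Rightarrow> 'a) \<Rightarrow> bool" where
  "cell_structure T e n K \<phi> \<longleftrightarrow>
     (\<exists>D. open_disk n \<subseteq> D \<and> D \<subseteq> closed_disk n \<and> K = subtopology (Euclidean_space n) D) \<and>
     quotient_map K (subtopology T (T closure_of e)) \<phi> \<and>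
     homeomorphic_map (subtopology (Euclidean_space n) (open_disk n)) (subtopology T e) \<phi>"

definition cellular_stratified_space :: "('a, 'c, nat \<Rightarrow> real) strat_cells \<Rightarrow> bool" where
  "cellular_stratified_space X \<longleftrightarrow>
     Hausdorff_space (Space X) \<and>
     stratified_space X \<and>
     (\<forall>c\<in>Index X. cell_structure (Space X) (stratum X c) (cdim X c) (Dom X c) (Char X c)) \<and>
     (\<forall>c\<in>Index X. \<exists>F. finite F \<and> F \<subseteq> {d \<in> Index X. cdim X d < cdim X c} \<and>
        (Space X closure_of stratum X c) - stratum X c \<subseteq> (\<Union>d\<in>F. stratum X d))"

definition finite_cells :: "('a, 'c, 'd) strat_cells \<Rightarrow> bool" where
  "finite_cells X \<longleftrightarrow> finite (Index X)"

definition one_dimensional :: "('a, 'c, 'd) strat_cells \<Rightarrow> bool" where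
  "one_dimensional X \<longleftrightarrow>
     (\<forall>c\<in>Index X. cdim X c \<le> 1) \<and> (\<exists>c\<in>Index X. cdim X c = 1)"

definition one_cells :: "('a, 'c, 'd) strat_cells \<Rightarrow> 'c set" where
  "one_cells X = {c \<in> Index X. cdim X c = 1}"

text \<open>
  Restriction to a subspace that is a union of strata; the domains are cut down to the preimage
  of the subspace under the characteristic maps.
\<close>

definition restrict_strat ::
    "('a, 'c, 'd) strat_cells \<Rightarrow> 'a set \<Rightarrow> ('a, 'c, 'd) strat_cells" where
  "restrict_strat X A =
     (let I = {c \<in> Index X. stratum X c \<subseteq> A}; T = subtopology (Space X) A in
      \<lparr> Space = T,
        Index = I,
        Le = {(c, d) \<in> I \<times> I. stratum X c \<subseteq> T closure_of stratum X d},
        proj = proj X,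
        cdim = cdim X,
        Dom = (\<lambda>c. subtopology (Dom X c) {t. Char X c t \<in> A}),
        Char = Char X \<rparr>)"


section \<open>Configuration spaces and the braid stratification\<close>

text \<open>
  Points of the \<open>k\<close>-th power of a space are the functions on \<open>{..<k}\<close> that are
  \<^const>\<open>undefined\<close> elsewhere, as in \<^const>\<open>product_topology\<close>.
\<close>

definition power_space :: "nat \<Rightarrow> 'a topology \<Rightarrow> (nat \<Rightarrow> 'a) topology" where
  "power_space k T = product_topology (\<lambda>_. T) {..<k}"

definition conf :: "nat \<Rightarrow> 'a topology \<Rightarrow> (nat \<Rightarrow> 'a) set" where
  "conf k T = {x \<in> topspace (power_space k T). \<forall>i<k. \<forall>j<k. i \<noteq> j \<longrightarrow> x i \<noteq> x j}"

definition conf_space :: "nat \<Rightarrow> 'a topology \<Rightarrow> (nat \<Rightarrow> 'a) topology" where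
  "conf_space k T = subtopology (power_space k T) (conf k T)"

definition ordered_partition :: "nat set \<Rightarrow> nat set list \<Rightarrow> bool" where
  "ordered_partition I A \<longleftrightarrow>
     \<Union> (set A) = I \<and> {} \<notin> set A \<and>
     (\<forall>a b. a < b \<and> b < length A \<longrightarrow> A ! a \<inter> A ! b = {})"

text \<open>
  The ordered partition of \<open>I\<close> that records the equalities and strict inequalities among the
  numbers \<open>s i\<close>: its blocks are the level sets of \<open>s\<close>, by increasing value.
\<close>

definition level_partition :: "nat set \<Rightarrow> (nat \<Rightarrow> real) \<Rightarrow> nat set list" where
  "level_partition I s = map (\<lambda>v. {i \<in> I. s i = v}) (sorted_list_of_set (s ` I))"

text \<open>
  A braid cell is indexed by \<open>(l, P)\<close>, where \<open>l\<close> indexes a product cell and \<open>P m\<close> is, for each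
  1-cell \<open>m\<close>, an ordered partition of the set of coordinates lying on \<open>m\<close>.
\<close>

type_synonym 'c braid_index = "(nat \<Rightarrow> 'c) \<times> ('c \<Rightarrow> nat set list)"

definition coords_on :: "nat \<Rightarrow> (nat \<Rightarrow> 'c) \<Rightarrow> 'c \<Rightarrow> nat set" where
  "coords_on k l m = {i. i < k \<and> l i = m}"

definition braid_indices :: "nat \<Rightarrow> ('a, 'c, 'd) strat_cells \<Rightarrow> 'c braid_index set" where
  "braid_indices k X =
     {(l, P). l \<in> {..<k} \<rightarrow>\<^sub>E Index X \<and> P \<in> extensional (one_cells X) \<and>
        (\<forall>m\<in>one_cells X. ordered_partition (coords_on k l m) (P m))}"

text \<open>The parameter in \<open>(-1, 1)\<close> of a point of the 1-cell \<open>m\<close>.\<close>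

definition parameter :: "('a, 'c, nat \<Rightarrow> real) strat_cells \<Rightarrow> 'c \<Rightarrow> 'a \<Rightarrow> real" where
  "parameter X m x = inv_into (open_disk 1) (Char X m) x 0"

definition braid_proj ::
    "nat \<Rightarrow> ('a, 'c, nat \<Rightarrow> real) strat_cells \<Rightarrow> (nat \<Rightarrow> 'a) \<Rightarrow> 'c braid_index" where
  "braid_proj k X x =
     (let l = (\<lambda>i\<in>{..<k}. proj X (x i)) in
      (l, \<lambda>m\<in>one_cells X. level_partition (coords_on k l m) (\<lambda>i. parameter X m (x i))))"

definition weakly_ordered :: "nat set list \<Rightarrow> (nat \<Rightarrow> real) \<Rightarrow> bool" where
  "weakly_ordered A s \<longleftrightarrow>
     (\<forall>B\<in>set A. \<forall>i\<in>B. \<forall>j\<in>B. s i = s j) \<and>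
     (\<forall>a b. a < b \<and> b < length A \<longrightarrow> (\<forall>i\<in>A ! a. \<forall>j\<in>A ! b. s i \<le> s j))"

definition braid_Dom :: "nat \<Rightarrow> ('a, 'c, nat \<Rightarrow> real) strat_cells \<Rightarrow> 'c braid_index \<Rightarrow>
    (nat \<Rightarrow> nat \<Rightarrow> real) topology" where
  "braid_Dom k X = (\<lambda>(l, P).
     subtopology (product_topology (\<lambda>i. Dom X (l i)) {..<k})
       {t. \<forall>m\<in>one_cells X. weakly_ordered (P m) (\<lambda>i. t i 0)})"

definition braid_Char :: "nat \<Rightarrow> ('a, 'c, nat \<Rightarrow> real) strat_cells \<Rightarrow> 'c braid_index \<Rightarrow>
    (nat \<Rightarrow> nat \<Rightarrow> real) \<Rightarrow> (nat \<Rightarrow> 'a)" where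
  "braid_Char k X = (\<lambda>(l, P) t. \<lambda>i\<in>{..<k}. Char X (l i) (t i))"

text \<open>
  The number of degrees of freedom of the cell \<open>(l, P)\<close> is the total number of blocks.
\<close>

definition braid_strat :: "nat \<Rightarrow> ('a, 'c, nat \<Rightarrow> real) strat_cells \<Rightarrow>
    (nat \<Rightarrow> 'a, 'c braid_index, nat \<Rightarrow> nat \<Rightarrow> real) strat_cells" where
  "braid_strat k X =
     (let T = power_space k (Space X); I = braid_indices k X;
          e = (\<lambda>c. {x \<in> topspace T. braid_proj k X x = c}) in
      \<lparr> Space = T,
        Index = I,
        Le = {(c, d) \<in> I \<times> I. e c \<subseteq> T closure_of e d},
        proj = braid_proj k X,
        cdim = (\<lambda>(l, P). \<Sum>m\<in>one_cells X. length (P m)),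
        Dom = braid_Dom k X,
        Char = braid_Char k X \<rparr>)"

definition comp_strat :: "nat \<Rightarrow> ('a, 'c, nat \<Rightarrow> real) strat_cells \<Rightarrow>
    (nat \<Rightarrow> 'a, 'c braid_index, nat \<Rightarrow> nat \<Rightarrow> real) strat_cells" where
  "comp_strat k X = restrict_strat (braid_strat k X) (conf k (Space X))"


section \<open>Small categories and the face category\<close>

record ('o, 'm) small_cat =
  Obj :: "'o set"
  Arr :: "'m set"
  Src :: "'m \<Rightarrow> 'o"
  Tgt :: "'m \<Rightarrow> 'o"
  Ident :: "'o \<Rightarrow> 'm"
  Comp :: "'m \<Rightarrow> 'm \<Rightarrow> 'm"

definition cat_hom :: "('o, 'm) small_cat \<Rightarrow> 'o \<Rightarrow> 'o \<Rightarrow> 'm set" where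
  "cat_hom C x y = {f \<in> Arr C. Src C f = x \<and> Tgt C f = y}"

text \<open>\<open>Comp C g f\<close> is \<open>g\<close> after \<open>f\<close>.\<close>

definition category :: "('o, 'm) small_cat \<Rightarrow> bool" where
  "category C \<longleftrightarrow>
     (\<forall>f\<in>Arr C. Src C f \<in> Obj C \<and> Tgt C f \<in> Obj C) \<and>
     (\<forall>x\<in>Obj C. Ident C x \<in> cat_hom C x x) \<and>
     (\<forall>f\<in>Arr C. \<forall>g\<in>Arr C. Tgt C f = Src C g \<longrightarrow>
        Comp C g f \<in> cat_hom C (Src C f) (Tgt C g)) \<and>
     (\<forall>f\<in>Arr C. Comp C f (Ident C (Src C f)) = f \<and> Comp C (Ident C (Tgt C f)) f = f) \<and>
     (\<forall>f\<in>Arr C. \<forall>g\<in>Arr C. \<forall>h\<in>Arr C. Tgt C f = Src C g \<and> Tgt C g = Src C h \<longrightarrow>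
        Comp C h (Comp C g f) = Comp C (Comp C h g) f)"

definition finite_category :: "('o, 'm) small_cat \<Rightarrow> bool" where
  "finite_category C \<longleftrightarrow> category C \<and> finite (Obj C) \<and> finite (Arr C)"

definition acyclic_category :: "('o, 'm) small_cat \<Rightarrow> bool" where
  "acyclic_category C \<longleftrightarrow>
     category C \<and>
     (\<forall>x\<in>Obj C. cat_hom C x x = {Ident C x}) \<and>
     (\<forall>x\<in>Obj C. \<forall>y\<in>Obj C. x \<noteq> y \<longrightarrow> cat_hom C x y = {} \<or> cat_hom C y x = {})"

text \<open>
  Arrows are triples \<open>(c, d, b)\<close>; the underlying map \<open>b\<close> is \<^const>\<open>undefined\<close> outside the
  domain of \<open>c\<close>, so that equality of arrows is equality of maps.
\<close>

definition face_category ::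
    "('a, 'c, 'd) strat_cells \<Rightarrow> ('c, 'c \<times> 'c \<times> ('d \<Rightarrow> 'd)) small_cat" where
  "face_category X =
     \<lparr> Obj = Index X,
       Arr = {(c, d, b). c \<in> Index X \<and> d \<in> Index X \<and>
                b \<in> extensional (topspace (Dom X c)) \<and>
                continuous_map (Dom X c) (Dom X d) b \<and>
                (\<forall>t\<in>topspace (Dom X c). Char X d (b t) = Char X c t)},
       Src = (\<lambda>(c, d, b). c),
       Tgt = (\<lambda>(c, d, b). d),
       Ident = (\<lambda>c. (c, c, \<lambda>t\<in>topspace (Dom X c). t)),
       Comp = (\<lambda>(c', d', b') (c, d, b). (c, d', \<lambda>t\<in>topspace (Dom X c). b' (b t))) \<rparr>"


section \<open>Classifying spaces\<close>

text \<open>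
  An \<open>n\<close>-simplex of the nerve is a functor from the poset \<open>0 \<le> \<dots> \<le> n\<close>, given by its values
  on the arrows \<open>i \<le> j\<close>.
\<close>

definition nerve :: "('o, 'm) small_cat \<Rightarrow> nat \<Rightarrow> (nat \<times> nat \<Rightarrow> 'm) set" where
  "nerve C n =
     {s \<in> extensional {(i, j). i \<le> j \<and> j \<le> n}.
        \<exists>x. (\<forall>i\<le>n. x i \<in> Obj C \<and> s (i, i) = Ident C (x i)) \<and>
            (\<forall>j\<le>n. \<forall>i\<le>j. s (i, j) \<in> cat_hom C (x i) (x j)) \<and>
            (\<forall>l\<le>n. \<forall>j\<le>l. \<forall>i\<le>j. s (i, l) = Comp C (s (j, l)) (s (i, j)))}"

definition nerve_pullback ::
    "nat \<Rightarrow> (nat \<Rightarrow> nat) \<Rightarrow> (nat \<times> nat \<Rightarrow> 'm) \<Rightarrow> (nat \<times> nat \<Rightarrow> 'm)" where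
  "nerve_pullback m \<theta> s = (\<lambda>(i, j)\<in>{(i, j). i \<le> j \<and> j \<le> m}. s (\<theta> i, \<theta> j))"

definition simplex_push :: "nat \<Rightarrow> (nat \<Rightarrow> nat) \<Rightarrow> (nat \<Rightarrow> real) \<Rightarrow> (nat \<Rightarrow> real)" where
  "simplex_push m \<theta> u = (\<lambda>j. \<Sum>i | i \<le> m \<and> \<theta> i = j. u i)"

type_synonym 'm nerve_point = "(nat \<times> (nat \<times> nat \<Rightarrow> 'm)) \<times> (nat \<Rightarrow> real)"

definition nerve_simplices :: "('o, 'm) small_cat \<Rightarrow> 'm nerve_point topology" where
  "nerve_simplices C =
     sum_topology (\<lambda>(n, s). subtopology (powertop_real UNIV) (standard_simplex n))
       {(n, s). s \<in> nerve C n}"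

definition realization_step :: "('o, 'm) small_cat \<Rightarrow> 'm nerve_point rel" where
  "realization_step C =
     {(((m, nerve_pullback m \<theta> s), u), ((n, s), simplex_push m \<theta> u)) | m n \<theta> s u.
        s \<in> nerve C n \<and> \<theta> \<in> {..m} \<rightarrow> {..n} \<and> mono_on {..m} \<theta> \<and> u \<in> standard_simplex m}"

definition realization_rel :: "('o, 'm) small_cat \<Rightarrow> 'm nerve_point rel" where
  "realization_rel C = (realization_step C \<union> (realization_step C)\<inverse>)\<^sup>*"

definition quotient_topology :: "'a topology \<Rightarrow> ('a \<Rightarrow> 'b) \<Rightarrow> 'b topology" where
  "quotient_topology T q =
     topology (\<lambda>U. U \<subseteq> q ` topspace T \<and> openin T {x \<in> topspace T. q x \<in> U})"

lemma openin_quotient_topology: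
  fixes T :: "'a topology" and q :: "'a \<Rightarrow> 'b"
  shows "openin (quotient_topology T q) U \<longleftrightarrow>
     U \<subseteq> q ` topspace T \<and> openin T {x \<in> topspace T. q x \<in> U}"
proof -
  have "istopology (\<lambda>U. U \<subseteq> q ` topspace T \<and> openin T {x \<in> topspace T. q x \<in> U})"
    unfolding istopology_def
  proof (intro conjI allI impI)
    fix S S' :: "'b set"
    assume a: "S \<subseteq> q ` topspace T \<and> openin T {x \<in> topspace T. q x \<in> S}"
      and b: "S' \<subseteq> q ` topspace T \<and> openin T {x \<in> topspace T. q x \<in> S'}"
    have eq: "{x \<in> topspace T. q x \<in> S \<inter> S'} =
        {x \<in> topspace T. q x \<in> S} \<inter> {x \<in> topspace T. q x \<in> S'}" by auto
    show "S \<inter> S' \<subseteq> q ` topspace T" using a by auto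
    show "openin T {x \<in> topspace T. q x \<in> S \<inter> S'}" unfolding eq using a b by auto
  next
    fix K :: "'b set set"
    assume a: "\<forall>U\<in>K. U \<subseteq> q ` topspace T \<and> openin T {x \<in> topspace T. q x \<in> U}"
    have eq: "{x \<in> topspace T. q x \<in> \<Union>K} = (\<Union>U\<in>K. {x \<in> topspace T. q x \<in> U})" by auto
    show "\<Union>K \<subseteq> q ` topspace T" using a by auto
    show "openin T {x \<in> topspace T. q x \<in> \<Union>K}" unfolding eq using a by auto
  qed
  then show ?thesis
    unfolding quotient_topology_def by simp
qed

definition classifying_space :: "('o, 'm) small_cat \<Rightarrow> 'm nerve_point set topology" where
  "classifying_space C =
     quotient_topology (nerve_simplices C) (\<lambda>z. realization_rel C `` {z})"

text \<open>The map induced by a functor into \<open>C\<close>, given by its action \<open>F\<close> on arrows.\<close>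

definition classifying_map ::
    "('o, 'm) small_cat \<Rightarrow> ('n \<Rightarrow> 'm) \<Rightarrow> 'n nerve_point set \<Rightarrow> 'm nerve_point set" where
  "classifying_map C F K =
     realization_rel C ``
       ((\<lambda>((n, s), u). ((n, \<lambda>a\<in>{(i, j). i \<le> j \<and> j \<le> n}. F (s a)), u)) ` K)"


section \<open>The action of the symmetric group\<close>

definition sym_group :: "nat \<Rightarrow> (nat \<Rightarrow> nat) set" where
  "sym_group k = {p. p permutes {..<k}}"

text \<open>The left action on \<open>k\<close>-tuples: the \<open>p i\<close>-th coordinate of \<open>p x\<close> is \<open>x i\<close>.\<close>

definition perm_tuple :: "(nat \<Rightarrow> nat) \<Rightarrow> (nat \<Rightarrow> 'a) \<Rightarrow> (nat \<Rightarrow> 'a)" where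
  "perm_tuple p x = x \<circ> inv p"

text \<open>
  The cell with index \<open>perm_index X p c\<close> is the image of the cell \<open>c\<close> under \<open>perm_tuple p\<close>, and
  \<open>perm_tuple p\<close> identifies the domains of the two cells; arrows are transported by conjugation.
\<close>

definition perm_index ::
    "('a, 'c, 'd) strat_cells \<Rightarrow> (nat \<Rightarrow> nat) \<Rightarrow> 'c braid_index \<Rightarrow> 'c braid_index" where
  "perm_index X p = (\<lambda>(l, P). (perm_tuple p l, \<lambda>m\<in>one_cells X. map ((`) p) (P m)))"

definition perm_arrow :: "nat \<Rightarrow> ('a, 'c, nat \<Rightarrow> real) strat_cells \<Rightarrow> (nat \<Rightarrow> nat) \<Rightarrow>
    'c braid_index \<times> 'c braid_index \<times> ((nat \<Rightarrow> nat \<Rightarrow> real) \<Rightarrow> (nat \<Rightarrow> nat \<Rightarrow> real)) \<Rightarrow>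
    'c braid_index \<times> 'c braid_index \<times> ((nat \<Rightarrow> nat \<Rightarrow> real) \<Rightarrow> (nat \<Rightarrow> nat \<Rightarrow> real))" where
  "perm_arrow k X p = (\<lambda>(c, d, b).
     (perm_index X p c, perm_index X p d,
      \<lambda>t\<in>topspace (Dom (comp_strat k X) (perm_index X p c)).
        perm_tuple p (b (perm_tuple (inv p) t))))"

definition perm_classifying where
  "perm_classifying k X p = classifying_map (face_category (comp_strat k X)) (perm_arrow k X p)"


section \<open>Equivariant strong deformation retracts\<close>

definition equivariant ::
    "'g set \<Rightarrow> ('g \<Rightarrow> 'a \<Rightarrow> 'a) \<Rightarrow> ('g \<Rightarrow> 'b \<Rightarrow> 'b) \<Rightarrow> 'a set \<Rightarrow> ('a \<Rightarrow> 'b) \<Rightarrow> bool" where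
  "equivariant G \<alpha> \<beta> S f \<longleftrightarrow> (\<forall>g\<in>G. \<forall>x\<in>S. f (\<alpha> g x) = \<beta> g (f x))"

definition strong_equivariant_deformation_retract ::
    "'g set \<Rightarrow> ('g \<Rightarrow> 'a \<Rightarrow> 'a) \<Rightarrow> 'a topology \<Rightarrow> 'a set \<Rightarrow> bool" where
  "strong_equivariant_deformation_retract G \<alpha> T A \<longleftrightarrow>
     A \<subseteq> topspace T \<and>
     (\<exists>r. retraction_maps T (subtopology T A) r id \<and>
          homotopic_with (\<lambda>f. (\<forall>a\<in>A. f a = a) \<and> equivariant G \<alpha> \<alpha> (topspace T) f) T T id r)"

end

theory Submission
  imports Defs "HOL-Analysis.Abstract_Topological_Spaces"
begin

text \<open>
  In the parameters of the characteristic maps, the domain of a cell of the configuration space is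
  a product of simplices with some faces removed: on each 1-cell the coordinates keep their order,
  and only the first and the last of them can reach an end of the 1-cell. An arrow of the face
  category does not move the coordinates that stay on their cell and puts each of the others at
  an end of a 1-cell (\<open>arrow_eq_push_pt\<close>). It is determined by its target and by the set of ends
  that receive a coordinate (\<open>arrow_unique\<close>), and every set of ends that the coordinates of the
  target can reach simultaneously occurs (\<open>arrow_exists\<close>). These sets are disjoint for composable
  arrows and are united by composition. This makes the category finite and acyclic.

  Let \<open>c\<^sub>0 \<rightarrow> \<dots> \<rightarrow> c\<^sub>n\<close> be a chain of arrows and let \<open>u\<close> be barycentric coordinates. Give an end \<open>e\<close> of
  a 1-cell the weight \<open>w e \<in> [0, 1]\<close> that adds up the \<open>u\<^sub>i\<close> for which \<open>c\<^sub>i \<rightarrow> c\<^sub>n\<close> puts no coordinate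
  at \<open>e\<close>. The embedding sends the point \<open>u\<close> of this simplex to the configuration in the cell \<open>c\<^sub>n\<close>
  that has on every 1-cell gaps of one unit between neighbouring coordinates and a gap of \<open>w e\<close>
  units at the end \<open>e\<close>. When the first coordinate reaches an end, the second gap turns into the
  gap at this end; it has weight 1 also from the point of view of the face, so the definition is
  compatible with the identifications in the classifying space (\<open>gap_pt_face\<close>, \<open>chain_pt_step\<close>).
  The configuration determines the weights, the weights determine the nondegenerate chain and its
  coordinates (\<open>weighted_filtration_unique\<close>), and the classifying space is compact because a
  nondegenerate chain has length at most \<open>k\<close>. So the map is an embedding. Its image consists of the
  configurations given by positive weights, at most 1, for which the ends of weight less than 1
  can be reached simultaneously (\<open>iota_image_iff\<close>).

  The deformation cuts off all gaps on a 1-cell at the length \<open>\<kappa> = \<tau> \<cdot> M\<close>, where \<open>M\<close> is the largest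
  gap on it, and rescales the resulting gaps to the total length of the 1-cell; the coordinates move
  to their new positions with constant speed. The number \<open>\<tau> \<in> (0, 1]\<close> is a function of the
  configuration that measures how close it is to the complement of the configuration space. It is so
  small that all gaps between neighbours are cut off to \<open>\<kappa>\<close>, and that the ends at distance less than
  \<open>\<kappa>\<close> from a coordinate can be reached simultaneously: none of them is missing, and no two
  coordinates are close to the same vertex. So the final configuration lies in the image
  (\<open>deform_1\<close>). On the image \<open>\<tau> = 1\<close> holds, nothing is cut off and nothing moves (\<open>deform_fixed\<close>).
  Continuity can be checked on the domains of the finitely many cells, because their characteristic
  maps are proper (\<open>deform_continuous\<close>). Equivariance is automatic, since nothing depends on the
  numbering of the coordinates.
\<close>

section \<open>Closed maps\<close>

text \<open>A product of closed maps need not be closed. Finite fibres help: a neighbourhood of a finite fibre of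
  the product map contains a neighbourhood made of boxes, and the tube property of each factor
  provides a box around the image point whose preimage lies in it.\<close>

lemma closed_map_product_finite_fibres:
  assumes fin: "finite I"
    and cl: "\<And>i. i \<in> I \<Longrightarrow> closed_map (A i) (B i) (f i)"
    and fib: "\<And>i y. i \<in> I \<Longrightarrow> y \<in> topspace (B i) \<Longrightarrow> finite {a \<in> topspace (A i). f i a = y}"
  shows "closed_map (product_topology A I) (product_topology B I) (\<lambda>x. \<lambda>i\<in>I. f i (x i))"
  unfolding closed_map_fibre_neighbourhood
proof (intro conjI strip)
  show "(\<lambda>x. \<lambda>i\<in>I. f i (x i)) \<in> topspace (product_topology A I) \<rightarrow> topspace (product_topology B I)"
    using closed_map_imp_subset_topspace[OF cl] by (fastforce simp: PiE_iff)
  fix U y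
  assume "openin (product_topology A I) U \<and> y \<in> topspace (product_topology B I) \<and>
    {x \<in> topspace (product_topology A I). (\<lambda>i\<in>I. f i (x i)) = y} \<subseteq> U"
  then have U: "openin (product_topology A I) U" and y: "y \<in> topspace (product_topology B I)"
    and sub: "{x \<in> topspace (product_topology A I). (\<lambda>i\<in>I. f i (x i)) = y} \<subseteq> U" by auto
  define G where "G = Pi\<^sub>E I (\<lambda>i. {a \<in> topspace (A i). f i a = y i})"
  have finG: "finite G"
    unfolding G_def using fin fib y by (intro finite_PiE) (auto simp: PiE_iff)
  have GU: "G \<subseteq> U"
  proof
    fix a assume a: "a \<in> G"
    have "a \<in> topspace (product_topology A I)" using a by (auto simp: G_def PiE_iff)
    moreover have "(\<lambda>i\<in>I. f i (a i)) = y"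
      using a y by (auto simp: G_def PiE_iff extensional_def restrict_def fun_eq_iff)
    ultimately show "a \<in> U" using sub by blast
  qed
  have "\<forall>a\<in>G. \<exists>W. (\<forall>i\<in>I. openin (A i) (W i)) \<and> a \<in> Pi\<^sub>E I W \<and> Pi\<^sub>E I W \<subseteq> U"
    using U GU unfolding openin_product_topology_alt by (meson subsetD)
  then obtain W where W: "\<And>a i. a \<in> G \<Longrightarrow> i \<in> I \<Longrightarrow> openin (A i) (W a i)"
    "\<And>a. a \<in> G \<Longrightarrow> a \<in> Pi\<^sub>E I (W a)" "\<And>a. a \<in> G \<Longrightarrow> Pi\<^sub>E I (W a) \<subseteq> U"
    by metis
  \<comment> \<open>The boxes around the finitely many points of the fibre are shrunk to boxes whose \<open>i\<close>-th side
    depends on the \<open>i\<close>-th coordinate of the point only.\<close>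
  define N where "N i v = topspace (A i) \<inter> (\<Inter>a\<in>{a \<in> G. a i = v}. W a i)" for i v
  have N: "openin (A i) (N i v)" if "i \<in> I" for i v
  proof -
    have "openin (A i) ((\<Inter>a\<in>{a \<in> G. a i = v}. W a i) \<inter> topspace (A i))"
      using finG W(1) that by (intro openin_INT) auto
    then show ?thesis by (simp add: N_def Int_commute)
  qed
  have "\<exists>V. openin (B i) V \<and> y i \<in> V \<and>
     {x \<in> topspace (A i). f i x \<in> V} \<subseteq> (\<Union>v\<in>{a \<in> topspace (A i). f i a = y i}. N i v)"
    if i: "i \<in> I" for i
  proof -
    have "openin (A i) (\<Union>v\<in>{a \<in> topspace (A i). f i a = y i}. N i v)" using N i by blast
    moreover have "y i \<in> topspace (B i)" using y i by (auto simp: PiE_iff)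
    moreover have "v \<in> N i v" if "v \<in> topspace (A i)" for v
      using that PiE_mem[OF W(2) i] unfolding N_def by blast
    then have "{x \<in> topspace (A i). f i x = y i} \<subseteq> (\<Union>v\<in>{a \<in> topspace (A i). f i a = y i}. N i v)"
      by blast
    ultimately show ?thesis
      using conjunct2[OF iffD1[OF closed_map_fibre_neighbourhood cl[OF i]], rule_format] by presburger
  qed
  then have "\<forall>i\<in>I. \<exists>V. openin (B i) V \<and> y i \<in> V \<and>
     {x \<in> topspace (A i). f i x \<in> V} \<subseteq> (\<Union>v\<in>{a \<in> topspace (A i). f i a = y i}. N i v)" by blast
  from bchoice[OF this] obtain V where V: "\<And>i. i \<in> I \<Longrightarrow> openin (B i) (V i)" "\<And>i. i \<in> I \<Longrightarrow> y i \<in> V i"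
    "\<And>i. i \<in> I \<Longrightarrow> {x \<in> topspace (A i). f i x \<in> V i} \<subseteq> (\<Union>v\<in>{a \<in> topspace (A i). f i a = y i}. N i v)"
    by blast
  show "\<exists>V. openin (product_topology B I) V \<and> y \<in> V \<and>
     {x \<in> topspace (product_topology A I). (\<lambda>i\<in>I. f i (x i)) \<in> V} \<subseteq> U"
  proof (intro exI conjI)
    show "openin (product_topology B I) (Pi\<^sub>E I V)"
      using V(1) fin by (simp add: openin_PiE)
    show "y \<in> Pi\<^sub>E I V" using V(2) y by (auto simp: PiE_iff)
    show "{x \<in> topspace (product_topology A I). (\<lambda>i\<in>I. f i (x i)) \<in> Pi\<^sub>E I V} \<subseteq> U"
    proof
      fix x assume x: "x \<in> {x \<in> topspace (product_topology A I). (\<lambda>i\<in>I. f i (x i)) \<in> Pi\<^sub>E I V}"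
      have "\<exists>v. v \<in> topspace (A i) \<and> f i v = y i \<and> x i \<in> N i v" if i: "i \<in> I" for i
        using V(3)[OF i] x i by (fastforce simp: PiE_iff)
      then obtain v where v: "\<And>i. i \<in> I \<Longrightarrow> v i \<in> topspace (A i) \<and> f i (v i) = y i \<and> x i \<in> N i (v i)"
        by metis
      have r: "restrict v I \<in> G" using v by (auto simp: G_def)
      have "x i \<in> W (restrict v I) i" if "i \<in> I" for i
        using v[OF that] r that unfolding N_def by auto
      then have "x \<in> Pi\<^sub>E I (W (restrict v I))" using x by (simp add: PiE_iff)
      then show "x \<in> U" using W(3) r by blast
    qed
  qed
qed

text \<open>Together the maps \<open>q c\<close> form a closed map from a disjoint union onto \<open>Y\<close>, so a closed set of \<open>Y\<close> can be
  recognized by its preimages. The maps \<open>q c\<close> may overlap: \<open>h\<close> is a function on \<open>Y\<close>.\<close>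

lemma continuous_map_from_closed_cover:
  assumes fin: "finite J"
    and cl: "\<And>c. c \<in> J \<Longrightarrow> closed_map (D c) Y (q c)"
    and cover: "topspace Y \<subseteq> (\<Union>c\<in>J. q c ` topspace (D c))"
    and cont: "\<And>c. c \<in> J \<Longrightarrow> continuous_map (D c) Z (\<lambda>t. h (q c t))"
  shows "continuous_map Y Z h"
  unfolding continuous_map_closedin
proof (intro conjI strip)
  show "h \<in> topspace Y \<rightarrow> topspace Z"
    using cover cont by (fastforce simp: continuous_map_def)
  fix C assume C: "closedin Z C"
  have sub: "q c ` topspace (D c) \<subseteq> topspace Y" if "c \<in> J" for c
    using closed_map_imp_subset_topspace[OF cl[OF that]] by blast
  have "{x \<in> topspace Y. h x \<in> C} = (\<Union>c\<in>J. q c ` {t \<in> topspace (D c). h (q c t) \<in> C})"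
    using cover sub by blast
  moreover have "closedin Y (q c ` {t \<in> topspace (D c). h (q c t) \<in> C})" if "c \<in> J" for c
    using cl[OF that] closedin_continuous_map_preimage[OF cont[OF that] C] by (auto simp: closed_map_def)
  ultimately show "closedin Y {x \<in> topspace Y. h x \<in> C}"
    using fin by (auto intro!: closedin_Union)
qed

lemma continuous_map_Max [continuous_intros]:
  assumes "finite I" "I \<noteq> {}" "\<And>i. i \<in> I \<Longrightarrow> continuous_map T euclideanreal (f i)"
  shows "continuous_map T euclideanreal (\<lambda>x. Max ((\<lambda>i. f i x) ` I))"
  using assms by (induction I rule: finite_ne_induct) (auto intro!: continuous_map_real_max)

section \<open>Ordered partitions\<close>

text \<open>This and the next lemma replace ordered partitions by comparisons of real numbers, which is the form
  in which the cells of the braid stratification are used below.\<close>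

lemma weakly_ordered_level_partition:
  assumes "finite I"
  shows "weakly_ordered (level_partition I s) t \<longleftrightarrow> (\<forall>i\<in>I. \<forall>j\<in>I. s i \<le> s j \<longrightarrow> t i \<le> t j)"
proof -
  define L where "L = sorted_list_of_set (s ` I)"
  have L: "set L = s ` I" "sorted L" "distinct L" "sorted_wrt (<) L"
    unfolding L_def using assms by auto
  have lp: "level_partition I s = map (\<lambda>v. {i \<in> I. s i = v}) L"
    by (simp add: level_partition_def L_def)
  have mono: "L ! a < L ! b" if "a < b" "b < length L" for a b
    using L(4) that by (simp add: sorted_wrt_nth_less)
  show ?thesis
  proof
    assume w: "weakly_ordered (level_partition I s) t"
    show "\<forall>i\<in>I. \<forall>j\<in>I. s i \<le> s j \<longrightarrow> t i \<le> t j"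
    proof (intro ballI impI)
      fix i j assume ij: "i \<in> I" "j \<in> I" "s i \<le> s j"
      obtain a where a: "a < length L" "L ! a = s i" using L(1) ij(1) by (metis imageI in_set_conv_nth)
      obtain b where b: "b < length L" "L ! b = s j" using L(1) ij(2) by (metis imageI in_set_conv_nth)
      show "t i \<le> t j"
      proof (cases "s i = s j")
        case True
        have "{i' \<in> I. s i' = s i} \<in> set (level_partition I s)" using lp L(1) ij by auto
        note block = bspec[OF conjunct1[OF w[unfolded weakly_ordered_def]] this]
        have "t i = t j" by (rule block[rule_format]) (use ij True in auto)
        then show ?thesis by simp
      next
        case False
        then have "a < b" using a b mono[of b a] ij(3) by (cases a b rule: linorder_cases) auto
        then have "\<forall>i\<in>level_partition I s ! a. \<forall>j\<in>level_partition I s ! b. t i \<le> t j"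
          using w b by (auto simp: weakly_ordered_def lp)
        then show ?thesis using a b ij by (auto simp: lp)
      qed
    qed
  next
    assume r: "\<forall>i\<in>I. \<forall>j\<in>I. s i \<le> s j \<longrightarrow> t i \<le> t j"
    show "weakly_ordered (level_partition I s) t"
      unfolding weakly_ordered_def
    proof (intro conjI allI impI ballI)
      fix B i j assume "B \<in> set (level_partition I s)" "i \<in> B" "j \<in> B"
      then have "i \<in> I" "j \<in> I" "s i = s j" by (auto simp: lp)
      then show "t i = t j" using r by (simp add: antisym)
    next
      fix a b i j assume "a < b \<and> b < length (level_partition I s)"
        "i \<in> level_partition I s ! a" "j \<in> level_partition I s ! b"
      then have "i \<in> I" "j \<in> I" "s i < s j" using mono[of a b] by (auto simp: lp)
      then show "t i \<le> t j" using r by simp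
    qed
  qed
qed

lemma level_partition_eq_iff:
  assumes "finite I"
  shows "level_partition I s = level_partition I s' \<longleftrightarrow> (\<forall>i\<in>I. \<forall>j\<in>I. s i \<le> s j \<longleftrightarrow> s' i \<le> s' j)"
proof
  assume eq: "level_partition I s = level_partition I s'"
  have "weakly_ordered (level_partition I s) s'"
    unfolding eq weakly_ordered_level_partition[OF assms] by simp
  moreover have "weakly_ordered (level_partition I s') s"
    unfolding eq[symmetric] weakly_ordered_level_partition[OF assms] by simp
  ultimately show "\<forall>i\<in>I. \<forall>j\<in>I. s i \<le> s j \<longleftrightarrow> s' i \<le> s' j"
    unfolding weakly_ordered_level_partition[OF assms] by blast
next
  assume r: "\<forall>i\<in>I. \<forall>j\<in>I. s i \<le> s j \<longleftrightarrow> s' i \<le> s' j"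
  define h where "h = (\<lambda>v. s' (inv_into I s v))"
  have h: "h (s i) = s' i" if "i \<in> I" for i
  proof -
    define j where "j = inv_into I s (s i)"
    have j: "j \<in> I" "s j = s i" unfolding j_def using that by (auto intro: inv_into_into f_inv_into_f)
    have "s' j \<le> s' i" "s' i \<le> s' j"
      using r[THEN bspec, OF j(1), THEN bspec, OF that] r[THEN bspec, OF that, THEN bspec, OF j(1)] j(2) by simp_all
    then show ?thesis by (simp add: h_def flip: j_def)
  qed
  have sm: "h u < h v" if "u \<in> s ` I" "v \<in> s ` I" "u < v" for u v
  proof -
    obtain i j where "i \<in> I" "j \<in> I" "u = s i" "v = s j" using \<open>u \<in> s ` I\<close> \<open>v \<in> s ` I\<close> by blast
    then show ?thesis using r h \<open>u < v\<close> by (simp flip: not_le)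
  qed
  define L where "L = sorted_list_of_set (s ` I)"
  have L: "set L = s ` I" "sorted_wrt (<) L" unfolding L_def using assms by auto
  have "sorted_wrt (<) (map h L)"
    using L(2) sm nth_mem[of _ L] unfolding L(1) sorted_wrt_iff_nth_less by auto
  moreover have "set (map h L) = s' ` I" using L h by force
  ultimately have eq: "sorted_list_of_set (s' ` I) = map h L"
    using assms by (intro strict_sorted_equal) auto
  have "{i \<in> I. s' i = h v} = {i \<in> I. s i = v}" if v: "v \<in> set L" for v
  proof -
    obtain j where j: "j \<in> I" "v = s j" using v L(1) by auto
    have "s' i = s' j \<longleftrightarrow> s i = s j" if "i \<in> I" for i
      using r that j(1) by (metis order_antisym order_refl)
    then show ?thesis using j h by auto
  qed
  then show "level_partition I s = level_partition I s'"
    unfolding level_partition_def eq L_def[symmetric] by simp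
qed

lemma ordered_partition_level_partition:
  assumes "finite I"
  shows "ordered_partition I (level_partition I s)"
proof -
  define L where "L = sorted_list_of_set (s ` I)"
  have L: "set L = s ` I" "distinct L" unfolding L_def using assms by auto
  have lp: "level_partition I s = map (\<lambda>v. {i \<in> I. s i = v}) L"
    by (simp add: level_partition_def L_def)
  have "L ! a \<noteq> L ! b" if "a < b" "b < length L" for a b
    using L(2) that by (simp add: nth_eq_iff_index_eq)
  then show ?thesis unfolding ordered_partition_def lp using L(1) by (auto simp: set_eq_iff)
qed

text \<open>In particular no stratum of the braid stratification is empty.\<close>

lemma ordered_partition_is_level_partition:
  assumes fin: "finite I" and A: "ordered_partition I A"
  obtains s :: "nat \<Rightarrow> real" where "\<And>i. -1 < s i \<and> s i < 1" "level_partition I s = A"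
proof -
  define N where "N = length A"
  \<comment> \<open>The \<open>N\<close> inner points that divide the interval into \<open>N + 1\<close> equal parts; the value for
    \<open>a \<ge> N\<close> only serves to keep \<open>s\<close> in the interval outside \<open>I\<close>.\<close>
  define val where "val a = (if a < N then -1 + 2 * (real a + 1) / (real N + 1) else 0)" for a
  have val: "-1 < val a" "val a < 1" for a
    unfolding val_def by (auto simp: field_simps)
  have vmono: "val a < val b" if "a < b" "b < N" for a b
    using that by (simp add: val_def divide_strict_right_mono)
  define s where "s i = val (LEAST a. a < N \<and> i \<in> A ! a)" for i
  have disj: "a = b" if "i \<in> A ! a" "i \<in> A ! b" "a < N" "b < N" for i a b
    using A that unfolding ordered_partition_def N_def
    by (metis disjoint_iff linorder_neqE_nat)
  have s: "s i = val a" if "a < N" "i \<in> A ! a" for i a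
  proof -
    have "(LEAST a. a < N \<and> i \<in> A ! a) = a"
      using that disj by (intro Least_equality) (auto intro: ccontr)
    then show ?thesis by (simp add: s_def)
  qed
  have cov: "\<exists>a<N. i \<in> A ! a" if "i \<in> I" for i
    using A that unfolding ordered_partition_def N_def by (metis UnionE in_set_conv_nth)
  have subI: "A ! a \<subseteq> I" "A ! a \<noteq> {}" if "a < N" for a
    using A that unfolding ordered_partition_def N_def by (metis Union_upper nth_mem, metis nth_mem)
  have img: "s ` I = val ` {..<N}"
  proof
    show "s ` I \<subseteq> val ` {..<N}" using cov s by fastforce
    show "val ` {..<N} \<subseteq> s ` I"
    proof
      fix v assume "v \<in> val ` {..<N}"
      then obtain a where a: "a < N" "v = val a" by auto
      then obtain i where "i \<in> A ! a" "i \<in> I" using subI by fastforce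
      then show "v \<in> s ` I" using s a by (metis imageI)
    qed
  qed
  have "sorted_wrt (<) (map val [0..<N])"
    unfolding sorted_wrt_iff_nth_less using vmono by auto
  moreover have "set (map val [0..<N]) = s ` I" using img by auto
  ultimately have "sorted_list_of_set (s ` I) = map val [0..<N]"
    using fin by (intro strict_sorted_equal) auto
  then have lp: "level_partition I s = map (\<lambda>a. {i \<in> I. s i = val a}) [0..<N]"
    by (simp add: level_partition_def)
  have "{i \<in> I. s i = val a} = A ! a" if a: "a < N" for a
  proof
    show "A ! a \<subseteq> {i \<in> I. s i = val a}" using subI s a by blast
    show "{i \<in> I. s i = val a} \<subseteq> A ! a"
    proof clarify
      fix i assume "i \<in> I" "s i = val a"
      then obtain b where b: "b < N" "i \<in> A ! b" using cov by blast
      then have "val a = val b" using s \<open>s i = val a\<close> by simp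
      then have "a = b" using vmono a b by (metis less_irrefl linorder_neqE_nat)
      then show "i \<in> A ! a" using b by simp
    qed
  qed
  then have "level_partition I s = A" unfolding lp by (intro nth_equalityI) (auto simp: N_def)
  then show thesis using that[of s] val by (simp add: s_def)
qed

section \<open>Cells of dimension at most one\<close>

text \<open>A real number as a point of the 1-dimensional disk, or for 0 of the 0-dimensional disk.\<close>

definition disk1 :: "real \<Rightarrow> nat \<Rightarrow> real" where
  "disk1 z = (\<lambda>j. if j = 0 then z else 0)"

lemma disk1_0 [simp]: "disk1 z 0 = z" by (simp add: disk1_def)

lemma disk1_inject [simp]: "disk1 z = disk1 z' \<longleftrightarrow> z = z'"
  by (metis disk1_0)

text \<open>With real parameters, vertices and 1-cells can be treated alike: a vertex has the parameter 0 only.\<close>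

definition params :: "('a, 'c, nat \<Rightarrow> real) strat_cells \<Rightarrow> 'c \<Rightarrow> real set" where
  "params X c = {z. disk1 z \<in> topspace (Dom X c)}"

definition char1 :: "('a, 'c, nat \<Rightarrow> real) strat_cells \<Rightarrow> 'c \<Rightarrow> real \<Rightarrow> 'a" where
  "char1 X c z = Char X c (disk1 z)"

text \<open>The parameter of a point of the space in the open cell that contains it.\<close>

definition param :: "('a, 'c, nat \<Rightarrow> real) strat_cells \<Rightarrow> 'a \<Rightarrow> real" where
  "param X x = (if proj X x \<in> one_cells X then parameter X (proj X x) x else 0)"

lemma continuous_map_disk1: "continuous_map euclideanreal (powertop_real UNIV) disk1"
  by (auto simp: continuous_map_componentwise_UNIV disk1_def)

lemma continuous_map_Euclidean_disk1:
  "continuous_map euclideanreal (Euclidean_space (Suc 0)) disk1"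
  unfolding Euclidean_space_def continuous_map_in_subtopology
  using continuous_map_disk1 by (auto simp: disk1_def)

lemma open_disk_0: "open_disk 0 = {disk1 0}" and closed_disk_0: "closed_disk 0 = {disk1 0}"
  by (auto simp: open_disk_def closed_disk_def topspace_Euclidean_space disk1_def)

lemma open_disk_1: "open_disk (Suc 0) = disk1 ` {-1<..<1}"
proof -
  have "x = disk1 (x 0)" if "\<forall>i\<ge>Suc 0. x i = 0" for x
    using that by (auto simp: disk1_def fun_eq_iff Suc_le_eq)
  moreover have "z\<^sup>2 < 1 \<longleftrightarrow> -1 < z \<and> z < 1" for z :: real
    using abs_square_less_1[of z] by (auto simp: abs_less_iff)
  ultimately show ?thesis
    by (fastforce simp: open_disk_def topspace_Euclidean_space image_iff disk1_def)
qed

lemma closed_disk_1: "closed_disk (Suc 0) = disk1 ` {-1..1}"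
proof -
  have "x = disk1 (x 0)" if "\<forall>i\<ge>Suc 0. x i = 0" for x
    using that by (auto simp: disk1_def fun_eq_iff Suc_le_eq)
  moreover have "z\<^sup>2 \<le> 1 \<longleftrightarrow> -1 \<le> z \<and> z \<le> 1" for z :: real
    using abs_square_le_1[of z] by (auto simp: abs_le_iff)
  ultimately show ?thesis
    by (fastforce simp: closed_disk_def topspace_Euclidean_space image_iff disk1_def)
qed

locale finite_graph =
  fixes X :: "('a, 'c, nat \<Rightarrow> real) strat_cells" and k :: nat
  assumes cellular: "cellular_stratified_space X"
    and finite_X: "finite_cells X"
    and one_dim: "one_dimensional X"
begin

abbreviation "E \<equiv> one_cells X"
abbreviation "V \<equiv> Index X - one_cells X"

lemma E_Index: "m \<in> E \<Longrightarrow> m \<in> Index X"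
  by (simp add: one_cells_def)

lemma finite_Index: "finite (Index X)" and finite_E: "finite E"
  using finite_X by (auto simp: finite_cells_def one_cells_def)

lemma Hausdorff_X: "Hausdorff_space (Space X)"
  using cellular by (simp add: cellular_stratified_space_def)

lemma proj_Index: "x \<in> topspace (Space X) \<Longrightarrow> proj X x \<in> Index X"
  using cellular by (auto simp: cellular_stratified_space_def stratified_space_def)

lemma cell: "c \<in> Index X \<Longrightarrow> cell_structure (Space X) (stratum X c) (cdim X c) (Dom X c) (Char X c)"
  using cellular by (simp add: cellular_stratified_space_def)

lemma cdim_E: "m \<in> E \<Longrightarrow> cdim X m = Suc 0" and cdim_V: "v \<in> V \<Longrightarrow> cdim X v = 0"
  using one_dim by (auto simp: one_cells_def one_dimensional_def le_Suc_eq)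

lemma Dom_V: assumes "v \<in> V" shows "Dom X v = subtopology (Euclidean_space 0) {disk1 0}"
  using cell[of v] assms cdim_V[OF assms]
  by (auto simp: cell_structure_def open_disk_0 closed_disk_0 subset_singleton_iff)

lemma topspace_Dom_V: "v \<in> V \<Longrightarrow> topspace (Dom X v) = {disk1 0}"
  by (auto simp: Dom_V topspace_Euclidean_space disk1_def)

lemma params_V: "v \<in> V \<Longrightarrow> params X v = {0}"
  by (auto simp: params_def topspace_Dom_V)

lemma Dom_E:
  assumes "m \<in> E"
  shows "Dom X m = subtopology (Euclidean_space (Suc 0)) (disk1 ` params X m)"
    and "{-1<..<1} \<subseteq> params X m" "params X m \<subseteq> {-1..1}"
proof -
  obtain D where D: "open_disk (Suc 0) \<subseteq> D" "D \<subseteq> closed_disk (Suc 0)"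
    "Dom X m = subtopology (Euclidean_space (Suc 0)) D"
    using cell[OF E_Index[OF assms]] cdim_E[OF assms] by (auto simp: cell_structure_def)
  then have "D \<subseteq> topspace (Euclidean_space (Suc 0))" by (auto simp: closed_disk_def)
  then have t: "topspace (Dom X m) = D" using D by auto
  have "D = disk1 ` params X m" using D(2) unfolding closed_disk_1 params_def t by blast
  then show "Dom X m = subtopology (Euclidean_space (Suc 0)) (disk1 ` params X m)" using D by simp
  show "{-1<..<1} \<subseteq> params X m" using D(1) unfolding open_disk_1 params_def t by auto
  show "params X m \<subseteq> {-1..1}" using D(2) unfolding closed_disk_1 params_def t by auto
qed

lemma topspace_Dom: assumes "c \<in> Index X" shows "topspace (Dom X c) = disk1 ` params X c"
proof (cases "c \<in> E")
  case True
  have "topspace (Euclidean_space (Suc 0)) \<inter> disk1 ` params X c = disk1 ` params X c"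
    by (auto simp: topspace_Euclidean_space disk1_def)
  then show ?thesis using Dom_E(1)[OF True] by (metis topspace_subtopology)
next
  case False
  then show ?thesis using assms topspace_Dom_V params_V by auto
qed

lemma params_bounds: "c \<in> Index X \<Longrightarrow> z \<in> params X c \<Longrightarrow> -1 \<le> z \<and> z \<le> 1"
  using Dom_E(3)[of c] params_V[of c] by (cases "c \<in> E") auto

lemma continuous_map_Dom_coord: assumes "c \<in> Index X"
  shows "continuous_map (Dom X c) euclideanreal (\<lambda>t. t 0)"
proof (cases "c \<in> E")
  case True
  show ?thesis unfolding Dom_E(1)[OF True] Euclidean_space_def
    by (intro continuous_map_from_subtopology continuous_map_product_projection) auto
next
  case False
  then have "Dom X c = subtopology (Euclidean_space 0) {disk1 0}" using assms Dom_V by auto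
  then show ?thesis unfolding Euclidean_space_def
    by (auto intro!: continuous_map_from_subtopology continuous_map_product_projection)
qed

lemma continuous_map_into_Dom:
  assumes "c \<in> Index X" "continuous_map T euclideanreal f" "f \<in> topspace T \<rightarrow> params X c"
  shows "continuous_map T (Dom X c) (\<lambda>y. disk1 (f y))"
proof (cases "c \<in> E")
  case True
  show ?thesis unfolding Dom_E(1)[OF True] continuous_map_in_subtopology
    using continuous_map_compose[OF assms(2) continuous_map_Euclidean_disk1] assms(3)
    by (auto simp: o_def)
next
  case False
  then have v: "c \<in> V" using assms by simp
  have "continuous_map T (Dom X c) (\<lambda>y. disk1 0)" by (simp add: topspace_Dom_V[OF v])
  then show ?thesis
    by (rule continuous_map_eq) (use assms(3) params_V[OF v] in auto)
qed

lemma Char_quotient: "c \<in> Index X \<Longrightarrow>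
    quotient_map (Dom X c) (subtopology (Space X) (Space X closure_of stratum X c)) (Char X c)"
  using cell by (simp add: cell_structure_def)

lemma Char_continuous: "c \<in> Index X \<Longrightarrow> continuous_map (Dom X c) (Space X) (Char X c)"
  using Char_quotient quotient_imp_continuous_map continuous_map_in_subtopology by metis

lemma Char_homeo_E: "m \<in> E \<Longrightarrow>
   homeomorphic_map (subtopology (Euclidean_space (Suc 0)) (disk1 ` {-1<..<1}))
     (subtopology (Space X) (stratum X m)) (Char X m)"
  using cell[OF E_Index] cdim_E open_disk_1 by (simp add: cell_structure_def)

lemma stratum_subset: "stratum X c \<subseteq> topspace (Space X)"
  by (auto simp: stratum_def)

lemma char1_topspace: "c \<in> Index X \<Longrightarrow> z \<in> params X c \<Longrightarrow> char1 X c z \<in> topspace (Space X)"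
  using Char_continuous by (fastforce simp: char1_def params_def continuous_map_def)

lemma stratum_E: assumes "m \<in> E" shows "stratum X m = char1 X m ` {-1<..<1}"
proof -
  have "Char X m ` topspace (subtopology (Euclidean_space (Suc 0)) (disk1 ` {-1<..<1})) = stratum X m"
    using homeomorphic_imp_surjective_map[OF Char_homeo_E[OF assms]] stratum_subset[of m] by auto
  moreover have "topspace (subtopology (Euclidean_space (Suc 0)) (disk1 ` {-1<..<1})) = disk1 ` {-1<..<1}"
    by (auto simp: topspace_Euclidean_space disk1_def)
  ultimately show ?thesis by (auto simp: char1_def)
qed

lemma char1_inj_E: assumes "m \<in> E" shows "inj_on (char1 X m) {-1<..<1}"
proof -
  have "topspace (subtopology (Euclidean_space (Suc 0)) (disk1 ` {-1<..<1})) = disk1 ` {-1<..<1}"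
    by (auto simp: topspace_Euclidean_space disk1_def)
  then have "inj_on (Char X m) (disk1 ` {-1<..<1})"
    using homeomorphic_imp_injective_map[OF Char_homeo_E[OF assms]] by simp
  then show ?thesis by (auto simp: char1_def inj_on_def)
qed

lemma stratum_V: assumes "v \<in> V" shows "stratum X v = {char1 X v 0}"
proof -
  have "homeomorphic_map (subtopology (Euclidean_space 0) {disk1 0})
     (subtopology (Space X) (stratum X v)) (Char X v)"
    using cell[of v] assms cdim_V open_disk_0 by (simp add: cell_structure_def)
  from homeomorphic_imp_surjective_map[OF this] show ?thesis
    using stratum_subset[of v] by (auto simp: char1_def topspace_Euclidean_space disk1_def)
qed

lemma proj_char1_V [simp]: "v \<in> V \<Longrightarrow> proj X (char1 X v 0) = v"
  using stratum_V[of v] by (auto simp: stratum_def)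

lemma proj_char1_E: "m \<in> E \<Longrightarrow> -1 < z \<Longrightarrow> z < 1 \<Longrightarrow> proj X (char1 X m z) = m"
  using imageI[of z "{-1<..<1}" "char1 X m"] by (simp add: stratum_def flip: stratum_E)

lemma parameter_char1: assumes "m \<in> E" "-1 < z" "z < 1" shows "parameter X m (char1 X m z) = z"
proof -
  have "inj_on (Char X m) (disk1 ` {-1<..<1})"
    using char1_inj_E[OF assms(1)] by (auto simp: inj_on_def char1_def)
  then have "inv_into (disk1 ` {-1<..<1}) (Char X m) (Char X m (disk1 z)) = disk1 z"
    using assms by (intro inv_into_f_f) auto
  then show ?thesis by (simp add: parameter_def char1_def open_disk_1)
qed

lemma param_char1_E: "m \<in> E \<Longrightarrow> -1 < z \<Longrightarrow> z < 1 \<Longrightarrow> param X (char1 X m z) = z"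
  by (simp add: param_def proj_char1_E parameter_char1)

lemma param_char1_V: "v \<in> V \<Longrightarrow> param X (char1 X v 0) = 0"
  by (simp add: param_def)

lemma param_proj:
  assumes "x \<in> topspace (Space X)"
  shows "-1 < param X x" "param X x < 1" "param X x \<in> params X (proj X x)" "char1 X (proj X x) (param X x) = x"
proof -
  have x: "x \<in> stratum X (proj X x)" "proj X x \<in> Index X" using assms proj_Index by (auto simp: stratum_def)
  have "-1 < param X x \<and> param X x < 1 \<and> param X x \<in> params X (proj X x) \<and> char1 X (proj X x) (param X x) = x"
  proof (cases "proj X x \<in> E")
    case True
    then obtain z where "-1 < z" "z < 1" "x = char1 X (proj X x) z" using x stratum_E by auto
    then show ?thesis using param_char1_E[OF True, of z] Dom_E(2)[OF True] by auto
  next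
    case False
    then have v: "proj X x \<in> V" using x by simp
    then have "x = char1 X (proj X x) 0" using x stratum_V by blast
    then show ?thesis using v params_V by (auto simp: param_def)
  qed
  then show "-1 < param X x" "param X x < 1" "param X x \<in> params X (proj X x)" "char1 X (proj X x) (param X x) = x"
    by auto
qed

lemma param_V: "proj X x \<in> V \<Longrightarrow> param X x = 0"
  by (simp add: param_def)

text \<open>An end of a 1-cell cannot be attached to an interior point of the same cell: the preimage of every
  neighbourhood of that point would contain parameters close to the end, while the cell carries the
  topology of the open interval.\<close>

lemma char1_end_not_in_stratum:
  assumes m: "m \<in> E" and z: "z \<in> params X m" "\<bar>z\<bar> = 1"
  shows "char1 X m z \<notin> stratum X m"
proof
  assume "char1 X m z \<in> stratum X m"
  then obtain t0 where t0: "-1 < t0" "t0 < 1" "char1 X m z = char1 X m t0" using stratum_E[OF m] by auto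
  define \<rho> where "\<rho> = (1 + \<bar>t0\<bar>) / 2"
  have \<rho>: "\<bar>t0\<bar> < \<rho>" "0 < \<rho>" "\<rho> < 1" using t0 by (auto simp: \<rho>_def)
  let ?O = "subtopology (Euclidean_space (Suc 0)) (disk1 ` {-1<..<1})"
  have tO: "topspace ?O = disk1 ` {-1<..<1}" by (auto simp: topspace_Euclidean_space disk1_def)
  have "continuous_map ?O euclideanreal (\<lambda>t. t 0)"
    unfolding Euclidean_space_def
    by (intro continuous_map_from_subtopology continuous_map_product_projection) auto
  then have "openin ?O {t \<in> topspace ?O. t 0 \<in> {-\<rho><..<\<rho>}}"
    by (rule openin_continuous_map_preimage) auto
  moreover have "{t \<in> topspace ?O. t 0 \<in> {-\<rho><..<\<rho>}} = disk1 ` {-\<rho><..<\<rho>}"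
    unfolding tO using \<rho> by auto
  ultimately have "openin (subtopology (Space X) (stratum X m)) (Char X m ` disk1 ` {-\<rho><..<\<rho>})"
    using homeomorphic_imp_open_map[OF Char_homeo_E[OF m]] by (simp add: open_map_def)
  then obtain W where W: "openin (Space X) W" "Char X m ` disk1 ` {-\<rho><..<\<rho>} = W \<inter> stratum X m"
    by (metis openin_subtopology)
  have cont: "continuous_map (top_of_set (params X m)) (Space X) (char1 X m)"
    unfolding char1_def
    by (rule continuous_map_compose[OF continuous_map_into_Dom Char_continuous, unfolded o_def, OF E_Index[OF m] _ _ E_Index[OF m]])
       (auto simp: continuous_map_from_subtopology)
  then have "openin (top_of_set (params X m)) {t \<in> params X m. char1 X m t \<in> W}"
    using openin_continuous_map_preimage[OF cont W(1)] by simp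
  moreover have "char1 X m z \<in> W"
    using W(2) t0 \<rho> by (force simp: char1_def)
  ultimately obtain e where e: "e > 0" "\<And>t. t \<in> params X m \<Longrightarrow> dist t z < e \<Longrightarrow> char1 X m t \<in> W"
    unfolding openin_euclidean_subtopology_iff using z by auto
  define \<delta> where "\<delta> = min (e/2) ((1-\<rho>)/2)"
  have \<delta>: "0 < \<delta>" "\<delta> < e" "\<delta> < 1 - \<rho>" using e \<rho> by (auto simp: \<delta>_def min_def)
  define t where "t = z * (1 - \<delta>)"
  have "t - z = - (z * \<delta>)" by (simp add: t_def algebra_simps)
  then have t: "\<bar>t\<bar> = 1 - \<delta>" "\<bar>t - z\<bar> = \<delta>" using z(2) \<delta> \<rho>
    by (simp_all add: t_def abs_mult)
  have tI: "-1 < t" "t < 1" using t \<delta> \<rho> by (auto simp: abs_if split: if_splits)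
  then have "char1 X m t \<in> W" using e(2)[of t] Dom_E(2)[OF m] t \<delta> by (auto simp: dist_real_def)
  then have "char1 X m t \<in> Char X m ` disk1 ` {-\<rho><..<\<rho>}" using W(2) tI stratum_E[OF m] by auto
  then obtain s where s: "-\<rho> < s" "s < \<rho>" "char1 X m t = char1 X m s" by (auto simp: char1_def)
  then have "t = s" using inj_onD[OF char1_inj_E[OF m]] tI \<rho> by auto
  then show False using s t \<delta> by (auto simp: abs_if split: if_splits)
qed

text \<open>The boundary of a 1-cell is covered by cells of smaller dimension.\<close>

lemma proj_char1_end:
  assumes m: "m \<in> E" and z: "z \<in> params X m" "\<bar>z\<bar> = 1"
  shows "proj X (char1 X m z) \<in> V"
proof -
  have I: "m \<in> Index X" using m E_Index by simp
  have "char1 X m z \<in> Space X closure_of stratum X m"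
    using quotient_imp_surjective_map[OF Char_quotient[OF I]] z by (auto simp: char1_def params_def)
  then have "char1 X m z \<in> (Space X closure_of stratum X m) - stratum X m"
    using char1_end_not_in_stratum[OF assms] by simp
  moreover obtain F where "F \<subseteq> {d \<in> Index X. cdim X d < cdim X m}"
     "(Space X closure_of stratum X m) - stratum X m \<subseteq> (\<Union>d\<in>F. stratum X d)"
    using cellular I unfolding cellular_stratified_space_def by meson
  ultimately obtain d where "d \<in> Index X" "cdim X d < cdim X m" "char1 X m z \<in> stratum X d" by blast
  then show ?thesis using cdim_E[OF m] by (auto simp: stratum_def one_cells_def)
qed

lemma end_eq_vertex:
  assumes m: "m \<in> E" and z: "z \<in> params X m" "\<bar>z\<bar> = 1"
  shows "char1 X (proj X (char1 X m z)) 0 = char1 X m z"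
  using param_proj(4)[OF char1_topspace[OF E_Index[OF m] z(1)]] param_V[OF proj_char1_end[OF assms]] by simp

lemma char1_E_cases:
  assumes "m \<in> E" "z \<in> params X m"
  obtains "-1 < z" "z < 1" | "\<bar>z\<bar> = 1"
  using params_bounds[OF E_Index[OF assms(1)] assms(2)] by fastforce

lemma Char_fibre_finite: assumes "c \<in> Index X" shows "finite {t \<in> topspace (Dom X c). Char X c t = x}"
proof (cases "c \<in> E")
  case True
  have "{t \<in> topspace (Dom X c). Char X c t = x} \<subseteq> disk1 ` {param X x, -1, 1}"
  proof
    fix t assume "t \<in> {t \<in> topspace (Dom X c). Char X c t = x}"
    then obtain z where z: "z \<in> params X c" "t = disk1 z" "char1 X c z = x" using topspace_Dom[OF assms] by (auto simp: char1_def)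
    have "z = param X x \<or> \<bar>z\<bar> = 1"
      by (rule char1_E_cases[OF True z(1)]) (use param_char1_E[OF True, of z] z(3) in auto)
    then show "t \<in> disk1 ` {param X x, -1, 1}" using z(2) by (auto simp: abs_if split: if_splits)
  qed
  then show ?thesis by (rule finite_subset) auto
next
  case False
  then show ?thesis using topspace_Dom_V[of c] assms by auto
qed

text \<open>If both ends of a 1-cell are present, the domain is compact; otherwise the characteristic map
  is an injective quotient map onto the closure of the cell, hence a homeomorphism onto a closed
  set.\<close>

lemma Char_closed: assumes c: "c \<in> Index X" shows "closed_map (Dom X c) (Space X) (Char X c)"
proof (cases "compact_space (Dom X c)")
  case True
  then show ?thesis using Char_continuous[OF c] Hausdorff_X continuous_imp_closed_map by blast
next
  case False
  have m: "c \<in> E"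
  proof (rule ccontr)
    assume "c \<notin> E"
    then have "finite (topspace (Dom X c))" using topspace_Dom_V c by auto
    then show False using False by (simp add: compact_space_def finite_imp_compactin)
  qed
  have "\<not> {-1, 1} \<subseteq> params X c"
  proof
    assume "{-1, 1} \<subseteq> params X c"
    then have d: "params X c = {-1..1}" using Dom_E(2,3)[OF m] by force
    have "compactin (Euclidean_space (Suc 0)) (disk1 ` {-1..1})"
      by (rule image_compactin[OF _ continuous_map_Euclidean_disk1]) auto
    then show False using False d Dom_E(1)[OF m] by (metis compact_space_subtopology)
  qed
  then have "\<exists>e. \<forall>z\<in>params X c. \<bar>z\<bar> = 1 \<longrightarrow> z = e" by (auto simp: abs_if)
  then obtain e where e: "\<And>z. z \<in> params X c \<Longrightarrow> \<bar>z\<bar> = 1 \<Longrightarrow> z = e" by blast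
  have "inj_on (Char X c) (topspace (Dom X c))"
  proof (rule inj_onI)
    fix s t assume "s \<in> topspace (Dom X c)" "t \<in> topspace (Dom X c)" "Char X c s = Char X c t"
    then obtain y z where yz: "y \<in> params X c" "z \<in> params X c" "s = disk1 y" "t = disk1 z" "char1 X c y = char1 X c z"
      using topspace_Dom[OF c] by (auto simp: char1_def)
    have "y = z"
      using char1_E_cases[OF m yz(1)]
    proof cases
      case 1
      then have "\<bar>z\<bar> \<noteq> 1" using proj_char1_end[OF m yz(2)] proj_char1_E[OF m, of y] yz(5) m by auto
      then have "-1 < z \<and> z < 1" by (rule_tac char1_E_cases[OF m yz(2)]) auto
      then show ?thesis using 1 inj_onD[OF char1_inj_E[OF m] yz(5)] by auto
    next
      case 2
      then have "\<not> (-1 < z \<and> z < 1)" using proj_char1_end[OF m yz(1)] proj_char1_E[OF m, of z] yz(5) m by auto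
      then have "\<bar>z\<bar> = 1" by (rule_tac char1_E_cases[OF m yz(2)]) auto
      then show ?thesis using 2 e[OF yz(1)] e[OF yz(2)] by simp
    qed
    then show "s = t" using yz by simp
  qed
  then have "homeomorphic_map (Dom X c) (subtopology (Space X) (Space X closure_of stratum X c)) (Char X c)"
    using Char_quotient[OF c] by (simp add: homeomorphic_map_def)
  then have "closed_map (Dom X c) (subtopology (Space X) (Space X closure_of stratum X c)) (Char X c)"
    by (rule homeomorphic_imp_closed_map)
  then show ?thesis by (metis closed_map_in_subtopology closedin_closure_of)
qed

end

section \<open>The cells of the configuration space\<close>

definition label :: "'c braid_index \<Rightarrow> nat \<Rightarrow> 'c" where
  "label c = fst c"

context finite_graph begin

abbreviation "CX \<equiv> comp_strat k X"
abbreviation "CF \<equiv> conf k (Space X)"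

text \<open>The index of a cell records the order of the coordinates by ordered partitions. It is more convenient to
  compare with one configuration chosen in the cell, whose parameters \<open>base_param\<close> also serve as
  a base point of the domain.\<close>

definition rep_conf :: "'c braid_index \<Rightarrow> nat \<Rightarrow> 'a" where
  "rep_conf c = (SOME x. x \<in> CF \<and> braid_proj k X x = c)"

definition base_param :: "'c braid_index \<Rightarrow> nat \<Rightarrow> real" where
  "base_param c i = param X (rep_conf c i)"

text \<open>The position, counted from 0, of a coordinate among those on the same cell.\<close>

definition rank_on :: "'c braid_index \<Rightarrow> nat \<Rightarrow> nat" where
  "rank_on c i = card {j. j < k \<and> label c j = label c i \<and> base_param c j < base_param c i}"

definition npts :: "'c braid_index \<Rightarrow> 'c \<Rightarrow> nat" where
  "npts c m = card {i. i < k \<and> label c i = m}"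

definition conf_of :: "(nat \<Rightarrow> 'c) \<Rightarrow> (nat \<Rightarrow> real) \<Rightarrow> nat \<Rightarrow> 'a" where
  "conf_of l z = (\<lambda>i\<in>{..<k}. char1 X (l i) (z i))"

definition lift_pt :: "(nat \<Rightarrow> real) \<Rightarrow> nat \<Rightarrow> nat \<Rightarrow> real" where
  "lift_pt z = (\<lambda>i\<in>{..<k}. disk1 (z i))"

text \<open>These are the parameters of the points of the domain (see \<open>topspace_Dom_comp\<close>). The braid
  stratification imposes weak inequalities; they become strict because the domain is cut down to
  the preimage of the configuration space.\<close>

definition in_params :: "'c braid_index \<Rightarrow> (nat \<Rightarrow> real) \<Rightarrow> bool" where
  "in_params c z \<longleftrightarrow> (\<forall>i<k. z i \<in> params X (label c i)) \<and>
     (\<forall>i<k. \<forall>j<k. label c i \<in> E \<and> label c j = label c i \<and> base_param c i < base_param c j \<longrightarrow> z i < z j) \<and>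
     (\<forall>i<k. \<forall>j<k. i \<noteq> j \<longrightarrow> char1 X (label c i) (z i) \<noteq> char1 X (label c j) (z j))"

lemma conf_of_cong: "(\<And>i. i < k \<Longrightarrow> char1 X (l i) (z i) = char1 X (l' i) (z' i)) \<Longrightarrow> conf_of l z = conf_of l' z'"
  by (auto simp: conf_of_def)

lemma lift_pt_eq_iff: "lift_pt z = lift_pt z' \<longleftrightarrow> (\<forall>i<k. z i = z' i)"
proof
  assume "lift_pt z = lift_pt z'"
  then have "disk1 (z i) = disk1 (z' i)" if "i < k" for i using that by (metis lessThan_iff restrict_apply' lift_pt_def)
  then show "\<forall>i<k. z i = z' i" by simp
qed (auto simp: lift_pt_def)

lemma lift_pt_apply [simp]: "i < k \<Longrightarrow> lift_pt z i = disk1 (z i)"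
  by (simp add: lift_pt_def)

lemma conf_iff: "x \<in> CF \<longleftrightarrow> x \<in> extensional {..<k} \<and> (\<forall>i<k. x i \<in> topspace (Space X)) \<and>
    (\<forall>i<k. \<forall>j<k. i \<noteq> j \<longrightarrow> x i \<noteq> x j)"
  by (auto simp: conf_def power_space_def PiE_iff)

lemma topspace_power: "x \<in> topspace (power_space k (Space X)) \<longleftrightarrow>
    x \<in> extensional {..<k} \<and> (\<forall>i<k. x i \<in> topspace (Space X))"
  by (auto simp: power_space_def PiE_iff)

lemma conf_power: "x \<in> CF \<Longrightarrow> x \<in> topspace (power_space k (Space X))"
  by (simp add: conf_iff topspace_power)

lemma label_braid_proj: "label (braid_proj k X x) = (\<lambda>i\<in>{..<k}. proj X (x i))"
  by (simp add: label_def braid_proj_def Let_def)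

lemma braid_proj_eq_iff:
  "braid_proj k X x = braid_proj k X y \<longleftrightarrow>
    (\<forall>i<k. proj X (x i) = proj X (y i)) \<and>
    (\<forall>i<k. \<forall>j<k. proj X (x i) \<in> E \<and> proj X (x j) = proj X (x i) \<longrightarrow>
        (param X (x i) \<le> param X (x j) \<longleftrightarrow> param X (y i) \<le> param X (y j)))"
    (is "_ \<longleftrightarrow> ?L \<and> ?O")
proof -
  define l where "l z = (\<lambda>i\<in>{..<k}. proj X (z i))" for z :: "nat \<Rightarrow> 'a"
  define P where "P z = (\<lambda>m\<in>E. level_partition (coords_on k (l z) m) (\<lambda>i. parameter X m (z i)))" for z
  have bp: "braid_proj k X z = (l z, P z)" for z
    by (simp add: braid_proj_def l_def P_def Let_def)
  have leq: "l x = l y \<longleftrightarrow> ?L" by (auto simp: l_def fun_eq_iff restrict_def)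
  have "P x = P y \<longleftrightarrow> ?O" if L: ?L
  proof -
    have l: "l x = l y" using L leq by simp
    have "P x = P y \<longleftrightarrow> (\<forall>m\<in>E. level_partition (coords_on k (l y) m) (\<lambda>i. parameter X m (x i)) =
        level_partition (coords_on k (l y) m) (\<lambda>i. parameter X m (y i)))"
      unfolding P_def l by (auto simp: fun_eq_iff restrict_def)
    also have "\<dots> \<longleftrightarrow> (\<forall>m\<in>E. \<forall>i\<in>coords_on k (l y) m. \<forall>j\<in>coords_on k (l y) m.
        parameter X m (x i) \<le> parameter X m (x j) \<longleftrightarrow> parameter X m (y i) \<le> parameter X m (y j))"
      by (intro ball_cong refl level_partition_eq_iff) (simp add: coords_on_def)
    also have "\<dots> \<longleftrightarrow> ?O" using L by (fastforce simp: coords_on_def l_def param_def)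
    finally show ?thesis .
  qed
  then show ?thesis using leq unfolding bp by auto
qed

text \<open>A stratum of the braid stratification lies in the configuration space as soon as it meets it: two
  coordinates agree if and only if they have the same cell and, on a 1-cell, the same block.\<close>

lemma Index_comp: "Index CX = braid_proj k X ` CF"
proof
  show "Index CX \<subseteq> braid_proj k X ` CF"
  proof
    fix c assume "c \<in> Index CX"
    then have c: "c \<in> braid_indices k X" and sub: "stratum (braid_strat k X) c \<subseteq> CF"
      by (auto simp: comp_strat_def restrict_strat_def braid_strat_def Let_def)
    obtain l P where lP: "c = (l, P)" by (cases c)
    have l: "l \<in> {..<k} \<rightarrow>\<^sub>E Index X" and P: "P \<in> extensional E"
      "\<And>m. m \<in> E \<Longrightarrow> ordered_partition (coords_on k l m) (P m)"
      using c by (auto simp: lP braid_indices_def)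
    have "\<forall>m\<in>E. \<exists>s. (\<forall>i. -1 < s i \<and> s i < (1::real)) \<and> level_partition (coords_on k l m) s = P m"
    proof
      fix m assume "m \<in> E"
      have fin: "finite (coords_on k l m)" by (simp add: coords_on_def)
      show "\<exists>s. (\<forall>i. -1 < s i \<and> s i < (1::real)) \<and> level_partition (coords_on k l m) s = P m"
        by (rule ordered_partition_is_level_partition[OF fin P(2)[OF \<open>m \<in> E\<close>]]) blast
    qed
    from bchoice[OF this] obtain s where s: "\<And>m i. m \<in> E \<Longrightarrow> -1 < s m i \<and> s m i < (1::real)"
      "\<And>m. m \<in> E \<Longrightarrow> level_partition (coords_on k l m) (s m) = P m" by blast
    define x where "x = (\<lambda>i\<in>{..<k}. if l i \<in> E then char1 X (l i) (s (l i) i) else char1 X (l i) 0)"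
    have xE: "x i = char1 X (l i) (s (l i) i)" "proj X (x i) = l i" "parameter X (l i) (x i) = s (l i) i"
      if "i < k" "l i \<in> E" for i
      using that s by (auto simp: x_def proj_char1_E parameter_char1)
    have xV: "x i = char1 X (l i) 0" "proj X (x i) = l i" if "i < k" "l i \<notin> E" for i
    proof -
      have "l i \<in> V" using that l by (auto simp: PiE_iff)
      then show "x i = char1 X (l i) 0" "proj X (x i) = l i" using that by (auto simp: x_def)
    qed
    have "x i \<in> topspace (Space X)" if "i < k" for i
    proof (cases "l i \<in> E")
      case True
      then have "s (l i) i \<in> params X (l i)" using Dom_E(2)[OF True] s(1)[OF True] by auto
      then show ?thesis using xE(1)[OF that True] char1_topspace E_Index True by simp
    next
      case False
      then have "l i \<in> V" using that l by (auto simp: PiE_iff)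
      then show ?thesis using xV(1)[OF that False] char1_topspace[of "l i" 0] params_V[of "l i"] by simp
    qed
    then have xp: "x \<in> topspace (power_space k (Space X))" by (simp add: topspace_power x_def)
    have lx: "(\<lambda>i\<in>{..<k}. proj X (x i)) = l"
      using l xE(2) xV(2) by (fastforce simp: PiE_iff extensional_def restrict_def)
    have "level_partition (coords_on k l m) (\<lambda>i. parameter X m (x i)) = P m" if m: "m \<in> E" for m
    proof -
      have fin: "finite (coords_on k l m)" by (simp add: coords_on_def)
      have "parameter X m (x i) = s m i" if "i \<in> coords_on k l m" for i
        using that m xE(3)[of i] by (auto simp: coords_on_def)
      then have "level_partition (coords_on k l m) (\<lambda>i. parameter X m (x i)) = level_partition (coords_on k l m) (s m)"
        unfolding level_partition_eq_iff[OF fin] by simp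
      then show ?thesis using s(2)[OF m] by simp
    qed
    then have "braid_proj k X x = c"
      unfolding braid_proj_def Let_def lx lP using P(1) by (auto simp: extensional_def fun_eq_iff)
    moreover have "x \<in> stratum (braid_strat k X) c"
      using xp calculation by (simp add: stratum_def braid_strat_def Let_def)
    ultimately show "c \<in> braid_proj k X ` CF" using sub by blast
  qed
  show "braid_proj k X ` CF \<subseteq> Index CX"
  proof
    fix c assume "c \<in> braid_proj k X ` CF"
    then obtain x where x: "x \<in> CF" "c = braid_proj k X x" by blast
    have "c \<in> braid_indices k X"
      using x proj_Index by (auto simp: braid_indices_def braid_proj_def Let_def conf_iff
          intro!: ordered_partition_level_partition) (simp add: coords_on_def)
    moreover have "stratum (braid_strat k X) c \<subseteq> CF"
    proof
      fix y assume "y \<in> stratum (braid_strat k X) c"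
      then have y: "y \<in> topspace (power_space k (Space X))" "braid_proj k X x = braid_proj k X y"
        using x by (auto simp: stratum_def braid_strat_def Let_def)
      have "y i \<noteq> y j" if ij: "i < k" "j < k" "i \<noteq> j" for i j
      proof
        assume eq: "y i = y j"
        then have p: "proj X (x i) = proj X (x j)" using y(2) ij by (simp add: braid_proj_eq_iff)
        have ti: "x i \<in> topspace (Space X)" "x j \<in> topspace (Space X)" using x(1) ij by (auto simp: conf_iff)
        have "param X (x i) = param X (x j)"
        proof (cases "proj X (x i) \<in> E")
          case True
          have 1: "param X (x i) \<le> param X (x j) \<longleftrightarrow> param X (y i) \<le> param X (y j)"
            using y(2) ij True p unfolding braid_proj_eq_iff by metis
          have 2: "param X (x j) \<le> param X (x i) \<longleftrightarrow> param X (y j) \<le> param X (y i)"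
            using y(2) ij True p unfolding braid_proj_eq_iff by metis
          show ?thesis using eq 1 2 by simp
        next
          case False
          then show ?thesis using p by (simp add: param_def)
        qed
        then have "x i = x j" using param_proj(4)[OF ti(1)] param_proj(4)[OF ti(2)] p by metis
        then show False using x(1) ij by (auto simp: conf_iff)
      qed
      then show "y \<in> CF" using y(1) by (simp add: conf_iff topspace_power)
    qed
    ultimately show "c \<in> Index CX"
      by (simp add: comp_strat_def restrict_strat_def braid_strat_def Let_def)
  qed
qed

lemma braid_proj_Index: "x \<in> CF \<Longrightarrow> braid_proj k X x \<in> Index CX"
  by (simp add: Index_comp)

lemma rep_conf: assumes "c \<in> Index CX" shows "rep_conf c \<in> CF" "braid_proj k X (rep_conf c) = c"
proof -
  have "\<exists>x. x \<in> CF \<and> braid_proj k X x = c" using assms by (auto simp: Index_comp)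
  from someI_ex[OF this] show "rep_conf c \<in> CF" "braid_proj k X (rep_conf c) = c" by (auto simp: rep_conf_def)
qed

lemma rep_conf_topspace: "c \<in> Index CX \<Longrightarrow> i < k \<Longrightarrow> rep_conf c i \<in> topspace (Space X)"
  using rep_conf(1) by (simp add: conf_iff)

lemma label_rep_conf: assumes "c \<in> Index CX" "i < k" shows "label c i = proj X (rep_conf c i)"
proof -
  have "label c = label (braid_proj k X (rep_conf c))" using rep_conf[OF assms(1)] by simp
  then show ?thesis using assms(2) unfolding label_braid_proj by simp
qed

lemma label_Index: "c \<in> Index CX \<Longrightarrow> i < k \<Longrightarrow> label c i \<in> Index X"
  by (simp add: label_rep_conf proj_Index rep_conf_topspace)

lemma base_param: assumes "c \<in> Index CX" "i < k"
  shows "-1 < base_param c i" "base_param c i < 1" "base_param c i \<in> params X (label c i)"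
    "char1 X (label c i) (base_param c i) = rep_conf c i"
  using param_proj[OF rep_conf_topspace[OF assms]] by (simp_all add: base_param_def label_rep_conf[OF assms])

lemma base_param_V: "c \<in> Index CX \<Longrightarrow> i < k \<Longrightarrow> label c i \<notin> E \<Longrightarrow> base_param c i = 0"
  using param_V[of "rep_conf c i"] label_Index by (simp add: base_param_def label_rep_conf)

lemma rep_conf_inj: "c \<in> Index CX \<Longrightarrow> i < k \<Longrightarrow> j < k \<Longrightarrow> i \<noteq> j \<Longrightarrow> rep_conf c i \<noteq> rep_conf c j"
  using rep_conf(1) by (simp add: conf_iff)

lemma base_param_inj: "c \<in> Index CX \<Longrightarrow> i < k \<Longrightarrow> j < k \<Longrightarrow> i \<noteq> j \<Longrightarrow> label c i = label c j \<Longrightarrow> base_param c i \<noteq> base_param c j"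
  using rep_conf_inj base_param(4) by metis

lemma in_params_base_param: "c \<in> Index CX \<Longrightarrow> in_params c (base_param c)"
  unfolding in_params_def using base_param rep_conf_inj by auto

lemma conf_of_base_param: assumes "c \<in> Index CX" shows "conf_of (label c) (base_param c) = rep_conf c"
  using base_param(4)[OF assms] rep_conf(1)[OF assms] by (auto simp: conf_of_def conf_iff extensional_def fun_eq_iff)

text \<open>Within a cell the order of the coordinates on each 1-cell is constant.\<close>

lemma braid_proj_eq_cell_iff:
  assumes c: "c \<in> Index CX"
  shows "braid_proj k X x = c \<longleftrightarrow> (\<forall>i<k. proj X (x i) = label c i) \<and>
     (\<forall>i<k. \<forall>j<k. label c i \<in> E \<and> label c j = label c i \<and> base_param c i < base_param c j \<longrightarrow> param X (x i) < param X (x j))"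
    (is "?A \<longleftrightarrow> ?B \<and> ?C")
proof
  assume ?A
  then have "braid_proj k X (rep_conf c) = braid_proj k X x" using rep_conf(2)[OF c] by simp
  then show "?B \<and> ?C"
    unfolding braid_proj_eq_iff by (metis base_param_def label_rep_conf[OF c] linorder_not_le)
next
  assume BC: "?B \<and> ?C"
  have "base_param c i \<le> base_param c j \<longleftrightarrow> param X (x i) \<le> param X (x j)"
    if ij: "i < k" "j < k" "label c i \<in> E" "label c j = label c i" for i j
  proof (cases "i = j")
    case False
    then have "base_param c i \<noteq> base_param c j" using base_param_inj[OF c ij(1,2)] ij by auto
    then consider "base_param c i < base_param c j" | "base_param c j < base_param c i" by linarith
    then show ?thesis
    proof cases
      case 1
      then have "param X (x i) < param X (x j)" using BC ij by blast
      then show ?thesis using 1 by simp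
    next
      case 2
      then have "param X (x j) < param X (x i)" using BC ij by metis
      then show ?thesis using 2 by simp
    qed
  qed simp
  then have "braid_proj k X (rep_conf c) = braid_proj k X x"
    unfolding braid_proj_eq_iff using BC label_rep_conf[OF c] by (simp add: base_param_def)
  then show ?A using rep_conf(2)[OF c] by simp
qed

lemma conf_of_conf: assumes c: "c \<in> Index CX" and z: "in_params c z" shows "conf_of (label c) z \<in> CF"
  using z label_Index[OF c] char1_topspace by (auto simp: conf_iff conf_of_def in_params_def)

lemma braid_proj_conf_of_interior:
  assumes c: "c \<in> Index CX" and z: "in_params c z" "\<And>i. i < k \<Longrightarrow> label c i \<in> E \<Longrightarrow> \<bar>z i\<bar> \<noteq> 1"
  shows "braid_proj k X (conf_of (label c) z) = c"
proof -
  have "proj X (char1 X (label c i) (z i)) = label c i \<and> (label c i \<in> E \<longrightarrow> param X (char1 X (label c i) (z i)) = z i)" if i: "i < k" for i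
  proof (cases "label c i \<in> E")
    case True
    have "z i \<in> params X (label c i)" using z(1) i by (simp add: in_params_def)
    then have "-1 < z i \<and> z i < 1"
      by (rule char1_E_cases[OF True]) (use z(2)[OF i True] in auto)
    then show ?thesis using True by (simp add: proj_char1_E param_char1_E)
  next
    case False
    then have v: "label c i \<in> V" using label_Index[OF c i] by simp
    then have "z i = 0" using z(1) i params_V[OF v] by (auto simp: in_params_def)
    then show ?thesis using v by simp
  qed
  then have "proj X (conf_of (label c) z i) = label c i" "label c i \<in> E \<Longrightarrow> param X (conf_of (label c) z i) = z i" if "i < k" for i
    using that by (simp_all add: conf_of_def)
  then show ?thesis
    unfolding braid_proj_eq_cell_iff[OF c] using z(1) by (simp add: in_params_def)
qed

text \<open>The canonical parameters of a configuration, all of them interior to their cells.\<close>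

lemma in_params_param:
  assumes x: "x \<in> CF" "braid_proj k X x = c"
  shows "in_params c (\<lambda>i. param X (x i))" "conf_of (label c) (\<lambda>i. param X (x i)) = x"
proof -
  have c: "c \<in> Index CX" using x braid_proj_Index by auto
  have p: "\<And>i. i < k \<Longrightarrow> label c i = proj X (x i)"
    using x(2) unfolding braid_proj_eq_cell_iff[OF c] by simp
  have t: "\<And>i. i < k \<Longrightarrow> x i \<in> topspace (Space X)" using x(1) by (simp add: conf_iff)
  show "in_params c (\<lambda>i. param X (x i))"
    unfolding in_params_def
  proof (intro conjI)
    show "\<forall>i<k. param X (x i) \<in> params X (label c i)" using param_proj(3)[OF t] p by simp
    show "\<forall>i<k. \<forall>j<k. label c i \<in> E \<and> label c j = label c i \<and> base_param c i < base_param c j \<longrightarrow> param X (x i) < param X (x j)"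
      using x(2) unfolding braid_proj_eq_cell_iff[OF c] by blast
    show "\<forall>i<k. \<forall>j<k. i \<noteq> j \<longrightarrow> char1 X (label c i) (param X (x i)) \<noteq> char1 X (label c j) (param X (x j))"
      using param_proj(4)[OF t] p x(1) by (simp add: conf_iff)
  qed
  show "conf_of (label c) (\<lambda>i. param X (x i)) = x"
    using param_proj(4)[OF t] p x(1) by (auto simp: conf_of_def conf_iff extensional_def fun_eq_iff)
qed

lemma rank_on_facts:
  assumes c: "c \<in> Index CX"
  shows rank_on_less_iff: "\<And>i j. i < k \<Longrightarrow> j < k \<Longrightarrow> label c i = label c j \<Longrightarrow> rank_on c i < rank_on c j \<longleftrightarrow> base_param c i < base_param c j"
    and rank_on_inj: "\<And>i j. i < k \<Longrightarrow> j < k \<Longrightarrow> label c i = label c j \<Longrightarrow> rank_on c i = rank_on c j \<Longrightarrow> i = j"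
    and rank_on_less_npts: "\<And>i. i < k \<Longrightarrow> rank_on c i < npts c (label c i)"
    and rank_on_surj: "\<And>a m. a < npts c m \<Longrightarrow> \<exists>i<k. label c i = m \<and> rank_on c i = a"
proof -
  have mono: "rank_on c i < rank_on c j" if "i < k" "j < k" "label c i = label c j" "base_param c i < base_param c j" for i j
    unfolding rank_on_def
  proof (rule psubset_card_mono)
    show "{ja. ja < k \<and> label c ja = label c i \<and> base_param c ja < base_param c i}
       \<subset> {ja. ja < k \<and> label c ja = label c j \<and> base_param c ja < base_param c j}"
      using that by (auto intro!: psubsetI)
  qed simp
  show iff: "rank_on c i < rank_on c j \<longleftrightarrow> base_param c i < base_param c j" if "i < k" "j < k" "label c i = label c j" for i j
  proof
    assume r: "rank_on c i < rank_on c j"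
    show "base_param c i < base_param c j"
    proof (rule ccontr)
      assume n: "\<not> base_param c i < base_param c j"
      have "i \<noteq> j" using r by auto
      then have "base_param c j < base_param c i" using n base_param_inj[OF c that(1,2) _ that(3)] by auto
      then show False using mono[of j i] that r by simp
    qed
  qed (use mono that in auto)
  show inj: "i = j" if "i < k" "j < k" "label c i = label c j" "rank_on c i = rank_on c j" for i j
    using base_param_inj[OF c that(1,2) _ that(3)] iff[OF that(1,2,3)] iff[OF that(2,1) that(3)[symmetric]] that(4) by force
  show less: "rank_on c i < npts c (label c i)" if "i < k" for i
    unfolding rank_on_def npts_def by (rule psubset_card_mono) (use that in auto)
  show "\<exists>i<k. label c i = m \<and> rank_on c i = a" if a: "a < npts c m" for a m
  proof -
    let ?S = "{i. i < k \<and> label c i = m}"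
    have "inj_on (rank_on c) ?S" using inj by (auto simp: inj_on_def)
    moreover have "rank_on c ` ?S \<subseteq> {..<npts c m}" using less by auto
    ultimately have "rank_on c ` ?S = {..<npts c m}"
      by (simp add: card_image card_subset_eq npts_def)
    then have "a \<in> rank_on c ` ?S" using a by simp
    then show ?thesis by blast
  qed
qed

lemma npts_pos: "i < k \<Longrightarrow> 0 < npts c (label c i)"
  by (auto simp: npts_def card_gt_0_iff)

lemma rank_on_eq_card:
  assumes c: "c \<in> Index CX" and i: "i < k"
  shows "rank_on c i = card {j. j < k \<and> label c j = label c i \<and> rank_on c j < rank_on c i}"
proof -
  have "{j. j < k \<and> label c j = label c i \<and> rank_on c j < rank_on c i} = {j. j < k \<and> label c j = label c i \<and> base_param c j < base_param c i}"
    using rank_on_less_iff[OF c _ i] by auto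
  then show ?thesis by (simp add: rank_on_def)
qed

lemma in_params_less_iff:
  assumes c: "c \<in> Index CX" and z: "in_params c z" and ij: "i < k" "j < k" "label c i \<in> E" "label c j = label c i"
  shows "z i < z j \<longleftrightarrow> rank_on c i < rank_on c j"
proof -
  have 1: "rank_on c i < rank_on c j \<Longrightarrow> z i < z j" using z ij rank_on_less_iff[OF c ij(1,2)] by (simp add: in_params_def)
  have 2: "rank_on c j < rank_on c i \<Longrightarrow> z j < z i" using z ij rank_on_less_iff[OF c ij(2,1)] by (simp add: in_params_def)
  show ?thesis
  proof (cases "i = j")
    case False
    then show ?thesis using 1 2 rank_on_inj[OF c ij(1,2)] ij(4) by fastforce
  qed simp
qed

subsection \<open>Domains and characteristic maps\<close>

lemma Dom_comp_eq:
  assumes c: "c \<in> Index CX"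
  shows "Dom CX c = subtopology (subtopology (product_topology (\<lambda>i. Dom X (label c i)) {..<k})
        {t. \<forall>i<k. \<forall>j<k. label c i \<in> E \<and> label c j = label c i \<and> base_param c i \<le> base_param c j \<longrightarrow> t i 0 \<le> t j 0})
      {t. (\<lambda>i\<in>{..<k}. Char X (label c i) (t i)) \<in> CF}"
proof -
  obtain l P where lP: "c = (l, P)" by (cases c)
  have "braid_proj k X (rep_conf c) = (l, P)" using rep_conf(2)[OF c] lP by simp
  then have l: "(\<lambda>i\<in>{..<k}. proj X (rep_conf c i)) = l" and
    P: "P = (\<lambda>m\<in>E. level_partition (coords_on k l m) (\<lambda>i. parameter X m (rep_conf c i)))"
    by (auto simp: braid_proj_def Let_def)
  have li: "proj X (rep_conf c i) = l i" if "i < k" for i using l that by (metis lessThan_iff restrict_apply')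
  have "weakly_ordered (P m) t \<longleftrightarrow> (\<forall>i<k. \<forall>j<k. l i = m \<and> l j = m \<and> base_param c i \<le> base_param c j \<longrightarrow> t i \<le> t j)"
    if m: "m \<in> E" for m t
  proof -
    have fin: "finite (coords_on k l m)" by (simp add: coords_on_def)
    have "parameter X m (rep_conf c i) = base_param c i" if "i < k" "l i = m" for i
      using that li[of i] m by (simp add: base_param_def param_def)
    then have "(\<forall>i\<in>coords_on k l m. \<forall>j\<in>coords_on k l m.
          parameter X m (rep_conf c i) \<le> parameter X m (rep_conf c j) \<longrightarrow> t i \<le> t j) \<longleftrightarrow>
        (\<forall>i<k. \<forall>j<k. l i = m \<and> l j = m \<and> base_param c i \<le> base_param c j \<longrightarrow> t i \<le> t j)"
      by (auto simp: coords_on_def)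
    then show ?thesis
      using m unfolding P by (simp add: weakly_ordered_level_partition[OF fin])
  qed
  then have eq: "{t. \<forall>m\<in>E. weakly_ordered (P m) (\<lambda>i. t i 0)} =
     {t. \<forall>i<k. \<forall>j<k. label c i \<in> E \<and> label c j = label c i \<and> base_param c i \<le> base_param c j \<longrightarrow> t i 0 \<le> t j 0}"
    by (auto simp: label_def lP)
  show ?thesis
    unfolding eq[symmetric]
    by (simp add: comp_strat_def restrict_strat_def braid_strat_def Let_def braid_Dom_def braid_Char_def lP label_def)
qed

lemma Char_comp: "Char CX c t = (\<lambda>i\<in>{..<k}. Char X (label c i) (t i))"
  by (cases c) (simp add: comp_strat_def restrict_strat_def braid_strat_def Let_def braid_Char_def label_def)

lemma Char_comp_lift_pt: "Char CX c (lift_pt z) = conf_of (label c) z"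
  by (auto simp: Char_comp conf_of_def char1_def)

text \<open>On a 1-cell no two coordinates of a configuration have the same parameter, so every block of the
  ordered partition is a singleton and the weak inequalities are strict.\<close>

lemma topspace_Dom_comp: assumes c: "c \<in> Index CX" shows "topspace (Dom CX c) = lift_pt ` {z. in_params c z}"
proof
  show "topspace (Dom CX c) \<subseteq> lift_pt ` {z. in_params c z}"
  proof
    fix t assume t: "t \<in> topspace (Dom CX c)"
    define z where "z = (\<lambda>i. t i 0)"
    have ti: "t i \<in> topspace (Dom X (label c i))" if "i < k" for i
      using t that unfolding Dom_comp_eq[OF c] by (auto simp: PiE_iff)
    have tz: "t i = disk1 (z i)" "z i \<in> params X (label c i)" if "i < k" for i
      using ti[OF that] topspace_Dom[OF label_Index[OF c that]] by (auto simp: z_def)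
    have "t \<in> extensional {..<k}" using t unfolding Dom_comp_eq[OF c] by (auto simp: PiE_iff)
    then have tup: "t = lift_pt z" using tz(1) by (auto simp: lift_pt_def extensional_def fun_eq_iff restrict_def)
    have CFt: "(\<lambda>i\<in>{..<k}. Char X (label c i) (t i)) \<in> CF" using t unfolding Dom_comp_eq[OF c] by auto
    then have inj: "char1 X (label c i) (z i) \<noteq> char1 X (label c j) (z j)" if "i < k" "j < k" "i \<noteq> j" for i j
      using that by (simp add: conf_iff char1_def tz)
    have "z i < z j" if ij: "i < k" "j < k" "label c i \<in> E" "label c j = label c i" "base_param c i < base_param c j" for i j
    proof -
      have "z i \<le> z j" using t ij unfolding Dom_comp_eq[OF c] by (auto simp: z_def)
      moreover have "i \<noteq> j" using ij(5) by auto
      then have "z i \<noteq> z j" using inj[OF ij(1,2)] ij(4) by auto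
      ultimately show ?thesis by simp
    qed
    then have "in_params c z" unfolding in_params_def using tz(2) inj by auto
    then show "t \<in> lift_pt ` {z. in_params c z}" using tup by blast
  qed
  show "lift_pt ` {z. in_params c z} \<subseteq> topspace (Dom CX c)"
  proof clarify
    fix z assume z: "in_params c z"
    have "lift_pt z \<in> topspace (product_topology (\<lambda>i. Dom X (label c i)) {..<k})"
      using z by (auto simp: lift_pt_def in_params_def params_def)
    moreover have "z i \<le> z j" if ij: "i < k" "j < k" "label c i \<in> E" "label c j = label c i" "base_param c i \<le> base_param c j" for i j
    proof (cases "i = j")
      case False
      then have "base_param c i < base_param c j" using base_param_inj[OF c ij(1,2)] ij by auto
      then show ?thesis using z ij unfolding in_params_def by (metis less_imp_le)
    qed simp
    moreover have "(\<lambda>i\<in>{..<k}. Char X (label c i) (lift_pt z i)) \<in> CF"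
      using conf_of_conf[OF c z] Char_comp_lift_pt[of c z] by (simp add: Char_comp)
    ultimately show "lift_pt z \<in> topspace (Dom CX c)" unfolding Dom_comp_eq[OF c] by simp
  qed
qed

text \<open>The domain of the cell is closed in the product of the domains of the factors, up to restriction to the
  preimage of the configuration space, so the product of the closed maps with finite fibres can be
  restricted to it.\<close>

lemma Char_comp_closed: assumes c: "c \<in> Index CX" shows "closed_map (Dom CX c) (conf_space k (Space X)) (Char CX c)"
proof -
  let ?P = "product_topology (\<lambda>i. Dom X (label c i)) {..<k}"
  let ?W = "{t. \<forall>i<k. \<forall>j<k. label c i \<in> E \<and> label c j = label c i \<and> base_param c i \<le> base_param c j \<longrightarrow> t i 0 \<le> t j 0}"
  have "closed_map ?P (product_topology (\<lambda>_. Space X) {..<k}) (\<lambda>x. \<lambda>i\<in>{..<k}. Char X (label c i) (x i))"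
    by (rule closed_map_product_finite_fibres) (use label_Index[OF c] Char_closed Char_fibre_finite in auto)
  then have "closed_map ?P (power_space k (Space X)) (Char CX c)"
    by (simp add: power_space_def Char_comp[abs_def])
  moreover have "closedin ?P (topspace ?P \<inter> ?W)"
  proof -
    have cl: "closedin ?P {t \<in> topspace ?P. t i 0 - t j 0 \<in> {..0::real}}" if "i < k" "j < k" for i j
    proof (rule closedin_continuous_map_preimage[where Y = euclideanreal])
      have "continuous_map ?P euclideanreal (\<lambda>t. t i 0)" if "i < k" for i
        using continuous_map_compose[OF continuous_map_product_projection[of i "{..<k}" "\<lambda>i. Dom X (label c i)"]
            continuous_map_Dom_coord[OF label_Index[OF c that]]] that by (simp add: o_def)
      then show "continuous_map ?P euclideanreal (\<lambda>t. t i 0 - t j 0)"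
        using that by (intro continuous_map_diff) auto
    qed auto
    define Q where "Q = {(i, j). i < k \<and> j < k \<and> label c i \<in> E \<and> label c j = label c i \<and> base_param c i \<le> base_param c j}"
    have "Q \<subseteq> {..<k} \<times> {..<k}" by (auto simp: Q_def)
    then have fQ: "finite Q" by (rule finite_subset) auto
    have "topspace ?P \<inter> ?W = topspace ?P \<inter> \<Inter> ((\<lambda>(i, j). {t \<in> topspace ?P. t i 0 - t j 0 \<in> {..0::real}}) ` Q)"
      by (auto simp: Q_def)
    also have "closedin ?P \<dots>"
    proof (cases "Q = {}")
      case True then show ?thesis using closedin_topspace[of ?P] by simp
    next
      case False
      have "closedin ?P T" if T: "T \<in> (\<lambda>(i, j). {t \<in> topspace ?P. t i 0 - t j 0 \<in> {..0::real}}) ` Q" for T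
      proof -
        obtain i j where "(i, j) \<in> Q" "T = {t \<in> topspace ?P. t i 0 - t j 0 \<in> {..0::real}}"
          using T by force
        then show ?thesis using cl[of i j] by (simp only: Q_def mem_Collect_eq case_prod_conv)
      qed
      then show ?thesis using False by (intro closedin_Int closedin_topspace closedin_Inter) auto
    qed
    finally show ?thesis .
  qed
  ultimately have "closed_map (subtopology ?P (topspace ?P \<inter> ?W)) (power_space k (Space X)) (Char CX c)"
    by (rule closed_map_from_subtopology)
  then have "closed_map (subtopology ?P ?W) (power_space k (Space X)) (Char CX c)"
    by (metis subtopology_restrict)
  then have *: "closed_map (subtopology (subtopology ?P ?W) {t \<in> topspace (subtopology ?P ?W). Char CX c t \<in> CF})
      (subtopology (power_space k (Space X)) CF) (Char CX c)"
    by (rule closed_map_restriction) simp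
  have eq: "{t \<in> topspace (subtopology ?P ?W). Char CX c t \<in> CF} =
      topspace (subtopology ?P ?W) \<inter> {t. (\<lambda>i\<in>{..<k}. Char X (label c i) (t i)) \<in> CF}"
    unfolding Char_comp by blast
  show ?thesis
    using * unfolding Dom_comp_eq[OF c] conf_space_def eq subtopology_restrict .
qed

lemma Char_comp_fibre_finite: assumes c: "c \<in> Index CX"
  shows "finite {t \<in> topspace (Dom CX c). Char CX c t = x}"
proof (rule finite_subset)
  show "{t \<in> topspace (Dom CX c). Char CX c t = x} \<subseteq>
     Pi\<^sub>E {..<k} (\<lambda>i. {t \<in> topspace (Dom X (label c i)). Char X (label c i) t = x i})"
    unfolding Dom_comp_eq[OF c] by (auto simp: Char_comp PiE_iff extensional_def)
  show "finite (Pi\<^sub>E {..<k} (\<lambda>i. {t \<in> topspace (Dom X (label c i)). Char X (label c i) t = x i}))"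
    using Char_fibre_finite label_Index[OF c] by (intro finite_PiE) auto
qed

lemma Char_comp_proper: "c \<in> Index CX \<Longrightarrow> proper_map (Dom CX c) (conf_space k (Space X)) (Char CX c)"
  unfolding proper_map_def by (intro conjI Char_comp_closed ballI finite_imp_compactin Char_comp_fibre_finite) auto

lemma topspace_conf_space: "topspace (conf_space k (Space X)) = CF"
  unfolding conf_space_def using conf_power by auto

lemma conf_covered:
  assumes "x \<in> CF"
  obtains c t where "c \<in> Index CX" "t \<in> topspace (Dom CX c)" "Char CX c t = x"
  using that[of "braid_proj k X x" "lift_pt (\<lambda>i. param X (x i))"] in_params_param[OF assms refl]
    braid_proj_Index[OF assms] topspace_Dom_comp Char_comp_lift_pt by auto

lemma continuous_map_Dom_comp_coord:
  assumes c: "c \<in> Index CX" and i: "i < k"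
  shows "continuous_map (Dom CX c) euclideanreal (\<lambda>t. t i 0)"
  unfolding Dom_comp_eq[OF c]
  using continuous_map_compose[OF continuous_map_product_projection[of i "{..<k}" "\<lambda>i. Dom X (label c i)"]
            continuous_map_Dom_coord[OF label_Index[OF c i]]] i
  by (auto simp: o_def intro!: continuous_map_from_subtopology)

lemma continuous_map_into_Dom_comp:
  assumes c: "c \<in> Index CX" and f: "\<And>i. i < k \<Longrightarrow> continuous_map T euclideanreal (\<lambda>y. f y i)"
    and D: "\<And>y. y \<in> topspace T \<Longrightarrow> in_params c (f y)"
  shows "continuous_map T (Dom CX c) (\<lambda>y. lift_pt (f y))"
proof -
  have t: "lift_pt (f y) \<in> topspace (Dom CX c)" if "y \<in> topspace T" for y
    using D[OF that] topspace_Dom_comp[OF c] by auto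
  have "continuous_map T (product_topology (\<lambda>i. Dom X (label c i)) {..<k}) (\<lambda>y. lift_pt (f y))"
    unfolding continuous_map_componentwise
  proof (intro conjI ballI)
    show "(\<lambda>y. lift_pt (f y)) ` topspace T \<subseteq> extensional {..<k}" by (auto simp: lift_pt_def)
    fix i assume i: "i \<in> {..<k}"
    have "continuous_map T (Dom X (label c i)) (\<lambda>y. disk1 (f y i))"
      using i f D label_Index[OF c] by (intro continuous_map_into_Dom) (auto simp: in_params_def)
    then show "continuous_map T (Dom X (label c i)) (\<lambda>y. lift_pt (f y) i)" using i by simp
  qed
  then show ?thesis
    using t unfolding Dom_comp_eq[OF c] continuous_map_in_subtopology by auto
qed

lemma Char_comp_continuous: assumes c: "c \<in> Index CX"
  shows "continuous_map (Dom CX c) (conf_space k (Space X)) (Char CX c)"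
proof -
  have "continuous_map (Dom CX c) (power_space k (Space X)) (Char CX c)"
    unfolding power_space_def continuous_map_componentwise
  proof (intro conjI ballI)
    show "Char CX c ` topspace (Dom CX c) \<subseteq> extensional {..<k}" by (auto simp: Char_comp)
    fix i assume i: "i \<in> {..<k}"
    have "continuous_map (product_topology (\<lambda>i. Dom X (label c i)) {..<k}) (Space X) (\<lambda>t. Char X (label c i) (t i))"
      using continuous_map_compose[OF continuous_map_product_projection[OF i, of "\<lambda>i. Dom X (label c i)"]
        Char_continuous[OF label_Index[OF c]]] i by (simp add: o_def)
    then have "continuous_map (Dom CX c) (Space X) (\<lambda>t. Char X (label c i) (t i))"
      unfolding Dom_comp_eq[OF c] by (intro continuous_map_from_subtopology)
    then show "continuous_map (Dom CX c) (Space X) (\<lambda>t. Char CX c t i)" using i by (simp add: Char_comp)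
  qed
  moreover have "Char CX c t \<in> CF" if "t \<in> topspace (Dom CX c)" for t
    using that topspace_Dom_comp[OF c] conf_of_conf[OF c] by (auto simp: Char_comp_lift_pt)
  ultimately show ?thesis unfolding conf_space_def continuous_map_in_subtopology by auto
qed

lemma finite_Index_comp: "finite (Index CX)"
proof -
  have "finite (braid_indices k X)"
  proof (rule finite_subset)
    let ?L = "{A. set A \<subseteq> Pow {..<k} \<and> length A \<le> 2 ^ k}"
    have "A \<in> ?L" if "ordered_partition (coords_on k l m) A" for A l m
    proof -
      have "distinct A" unfolding distinct_conv_nth
      proof (intro allI impI)
        fix a b assume ab: "a < length A" "b < length A" "a \<noteq> b"
        have "A ! a \<inter> A ! b = {}" using that ab unfolding ordered_partition_def
          by (metis Int_commute linorder_neqE_nat)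
        moreover have "A ! a \<noteq> {}" using that ab unfolding ordered_partition_def by (metis nth_mem)
        ultimately show "A ! a \<noteq> A ! b" by auto
      qed
      moreover have s: "set A \<subseteq> Pow {..<k}" using that by (auto simp: ordered_partition_def coords_on_def)
      moreover have "card (set A) \<le> 2 ^ k" using card_mono[OF _ s] by (simp add: card_Pow)
      ultimately show ?thesis by (simp add: distinct_card)
    qed
    note in_L = this
    show "braid_indices k X \<subseteq> (({..<k} \<rightarrow>\<^sub>E Index X) \<times> (E \<rightarrow>\<^sub>E ?L))"
    proof
      fix c assume c: "c \<in> braid_indices k X"
      obtain l P where lP: "c = (l, P)" by (cases c)
      have "l \<in> {..<k} \<rightarrow>\<^sub>E Index X" "P \<in> extensional E"
        and op: "\<And>m. m \<in> E \<Longrightarrow> ordered_partition (coords_on k l m) (P m)"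
        using c by (auto simp: lP braid_indices_def)
      moreover have "P m \<in> ?L" if "m \<in> E" for m by (rule in_L[OF op[OF that]])
      ultimately show "c \<in> ({..<k} \<rightarrow>\<^sub>E Index X) \<times> (E \<rightarrow>\<^sub>E ?L)"
        unfolding lP by (intro SigmaI PiE_I) (auto simp: extensional_def)
    qed
    show "finite (({..<k} \<rightarrow>\<^sub>E Index X) \<times> (E \<rightarrow>\<^sub>E ?L))"
      using finite_Index finite_E by (intro finite_cartesian_product finite_PiE finite_lists_length_le) auto
  qed
  moreover have "Index CX \<subseteq> braid_indices k X"
    by (auto simp: comp_strat_def restrict_strat_def braid_strat_def Let_def)
  ultimately show ?thesis by (rule rev_finite_subset)
qed

end

section \<open>The face category\<close>

type_synonym 'c face_arrow =
  "'c braid_index \<times> 'c braid_index \<times> ((nat \<Rightarrow> nat \<Rightarrow> real) \<Rightarrow> (nat \<Rightarrow> nat \<Rightarrow> real))"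

context finite_graph begin

abbreviation "FC \<equiv> face_category CX"

text \<open>The parameters of the image of the base point. For a coordinate that changes its cell this is the
  end, -1 or 1, to which the arrow sends it.\<close>

definition end_sign :: "'c face_arrow \<Rightarrow> nat \<Rightarrow> real" where
  "end_sign f i = snd (snd f) (lift_pt (base_param (fst f))) i 0"

text \<open>An end of a 1-cell is a pair of the 1-cell and of -1 or 1.\<close>

definition ends_hit :: "'c braid_index \<Rightarrow> (nat \<Rightarrow> real) \<Rightarrow> ('c \<times> real) set" where
  "ends_hit c z = {(m, \<sigma>). m \<in> E \<and> \<bar>\<sigma>\<bar> = 1 \<and> (\<exists>i<k. label c i = m \<and> z i = \<sigma>)}"

definition arrow_ends :: "'c face_arrow \<Rightarrow> ('c \<times> real) set" where
  "arrow_ends f = ends_hit (fst (snd f)) (end_sign f)"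

lemma Src_FC: "Src FC f = fst f" and Tgt_FC: "Tgt FC f = fst (snd f)"
  and Obj_FC: "Obj FC = Index CX"
  by (auto simp: face_category_def split: prod.splits)

lemma Comp_FC: "Comp FC (c', d', b') (c, d, b) = (c, d', \<lambda>t\<in>topspace (Dom CX c). b' (b t))"
  by (simp add: face_category_def)

lemma Ident_FC: "Ident FC c = (c, c, \<lambda>t\<in>topspace (Dom CX c). t)"
  by (simp add: face_category_def)

lemma Arr_FC: "(c, d, b) \<in> Arr FC \<longleftrightarrow> c \<in> Index CX \<and> d \<in> Index CX \<and>
    b \<in> extensional (topspace (Dom CX c)) \<and> continuous_map (Dom CX c) (Dom CX d) b \<and>
    (\<forall>t\<in>topspace (Dom CX c). Char CX d (b t) = Char CX c t)"
  by (simp add: face_category_def)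

lemma ends_hit_iff: "(m, \<sigma>) \<in> ends_hit c z \<longleftrightarrow> m \<in> E \<and> \<bar>\<sigma>\<bar> = 1 \<and> (\<exists>i<k. label c i = m \<and> z i = \<sigma>)"
  by (simp add: ends_hit_def)

lemma in_params_V: "c \<in> Index CX \<Longrightarrow> in_params c z \<Longrightarrow> i < k \<Longrightarrow> label c i \<notin> E \<Longrightarrow> z i = 0"
  using label_Index[of c i] params_V[of "label c i"] by (auto simp: in_params_def)

lemma in_params_params: "in_params c z \<Longrightarrow> i < k \<Longrightarrow> z i \<in> params X (label c i)"
  by (simp add: in_params_def)

lemma in_params_bounds: "c \<in> Index CX \<Longrightarrow> in_params c z \<Longrightarrow> i < k \<Longrightarrow> -1 \<le> z i \<and> z i \<le> 1"
  using params_bounds[OF label_Index in_params_params] by blast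

lemma in_params_distinct: "in_params c z \<Longrightarrow> i < k \<Longrightarrow> j < k \<Longrightarrow> i \<noteq> j \<Longrightarrow> char1 X (label c i) (z i) \<noteq> char1 X (label c j) (z j)"
  by (simp add: in_params_def)

lemma label_V_inj: "c \<in> Index CX \<Longrightarrow> i < k \<Longrightarrow> j < k \<Longrightarrow> label c i \<notin> E \<Longrightarrow> label c i = label c j \<Longrightarrow> i = j"
  using base_param_inj[of c i j] base_param_V[of c i] base_param_V[of c j] by auto

lemma in_params_cong: "(\<And>i. i < k \<Longrightarrow> z i = z' i) \<Longrightarrow> in_params c z \<longleftrightarrow> in_params c z'"
  unfolding in_params_def by simp

lemma ends_hit_cong: "(\<And>i. i < k \<Longrightarrow> z i = z' i) \<Longrightarrow> ends_hit c z = ends_hit c z'"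
  unfolding ends_hit_def by auto

text \<open>Only a vertex has several preimages, and apart from the vertex itself these are ends of 1-cells.\<close>

lemma char1_interior_eq:
  assumes e: "e \<in> Index X" "z \<in> params X e" "e \<in> E \<Longrightarrow> \<bar>z\<bar> \<noteq> 1"
    and e': "e' \<in> Index X" "y \<in> params X e'" and eq: "char1 X e' y = char1 X e z"
  shows "(e' = e \<and> y = z) \<or> (e \<in> V \<and> e' \<in> E \<and> \<bar>y\<bar> = 1)"
proof -
  have z: "proj X (char1 X e z) = e \<and> param X (char1 X e z) = z"
  proof (cases "e \<in> E")
    case True
    have "-1 < z \<and> z < 1" by (rule char1_E_cases[OF True e(2)]) (use e(3) True in auto)
    then show ?thesis using True by (simp add: proj_char1_E param_char1_E)
  next
    case False
    then show ?thesis using e params_V[of e] by (simp add: param_char1_V)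
  qed
  show ?thesis
  proof (cases "e' \<in> E")
    case True
    show ?thesis
    proof (rule char1_E_cases[OF True e'(2)])
      assume "-1 < y" "y < 1"
      then show ?thesis using z eq True proj_char1_E[of e' y] param_char1_E[of e' y] by simp
    next
      assume "\<bar>y\<bar> = 1"
      then show ?thesis using proj_char1_end[OF True e'(2)] z eq True by simp
    qed
  next
    case False
    then have "e' \<in> V" "y = 0" using e' params_V[of e'] by auto
    then show ?thesis using z eq proj_char1_V[of e'] param_char1_V[of e'] by auto
  qed
qed

text \<open>For interior parameters the images are distinct automatically.\<close>

lemma in_params_interior:
  assumes c: "c \<in> Index CX"
    and d: "\<And>i. i < k \<Longrightarrow> z i \<in> params X (label c i)" "\<And>i. i < k \<Longrightarrow> label c i \<in> E \<Longrightarrow> \<bar>z i\<bar> \<noteq> 1"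
    and o: "\<And>i j. i < k \<Longrightarrow> j < k \<Longrightarrow> label c i \<in> E \<Longrightarrow> label c j = label c i \<Longrightarrow> base_param c i < base_param c j \<Longrightarrow> z i < z j"
  shows "in_params c z"
proof -
  have "char1 X (label c i) (z i) \<noteq> char1 X (label c j) (z j)" if ij: "i < k" "j < k" "i \<noteq> j" for i j
  proof
    assume "char1 X (label c i) (z i) = char1 X (label c j) (z j)"
    from char1_interior_eq[OF label_Index[OF c ij(2)] d(1)[OF ij(2)] d(2)[OF ij(2)] label_Index[OF c ij(1)] d(1)[OF ij(1)] this]
    have eq: "label c i = label c j" "z i = z j" using d(2)[OF ij(1)] by auto
    then have E: "label c i \<in> E" using label_V_inj[OF c ij(1,2)] ij by auto
    have "base_param c i \<noteq> base_param c j" using base_param_inj[OF c ij eq(1)] .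
    then show False using o[OF ij(1,2) E] o[OF ij(2,1)] E eq by (cases "base_param c i < base_param c j") auto
  qed
  then show ?thesis unfolding in_params_def using d(1) o by blast
qed

text \<open>The domain is star-shaped about the base point, and the segments meet the boundary only in their last
  point.\<close>

lemma in_params_segment:
  assumes c: "c \<in> Index CX" and z: "in_params c z" and s: "0 \<le> s" "s < 1"
  shows "in_params c (\<lambda>i. (1 - s) * base_param c i + s * z i)"
    and "\<And>i. i < k \<Longrightarrow> \<bar>(1 - s) * base_param c i + s * z i\<bar> < 1"
proof -
  show b: "\<bar>(1 - s) * base_param c i + s * z i\<bar> < 1" if i: "i < k" for i
  proof -
    have "\<bar>base_param c i\<bar> < 1" using base_param(1,2)[OF c i] by auto
    moreover have "\<bar>z i\<bar> \<le> 1" using in_params_bounds[OF c z i] by auto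
    ultimately have 1: "(1 - s) * \<bar>base_param c i\<bar> < (1 - s) * 1" and 2: "s * \<bar>z i\<bar> \<le> s * 1"
      using s by (intro mult_strict_left_mono mult_left_mono; simp)+
    have "\<bar>(1 - s) * base_param c i + s * z i\<bar> \<le> (1 - s) * \<bar>base_param c i\<bar> + s * \<bar>z i\<bar>"
      using abs_triangle_ineq[of "(1 - s) * base_param c i" "s * z i"] s by (simp add: abs_mult)
    also have "\<dots> < (1 - s) * 1 + s * 1" using 1 2 by (rule add_less_le_mono)
    finally show ?thesis by simp
  qed
  show "in_params c (\<lambda>i. (1 - s) * base_param c i + s * z i)"
  proof (rule in_params_interior[OF c])
    fix i assume i: "i < k"
    show "(1 - s) * base_param c i + s * z i \<in> params X (label c i)"
    proof (cases "label c i \<in> E")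
      case True
      have "w \<in> params X (label c i)" if "\<bar>w\<bar> < 1" for w
        using that Dom_E(2)[OF True] by (auto simp: abs_less_iff)
      then show ?thesis using b[OF i] by blast
    next
      case False
      then show ?thesis using base_param_V[OF c i False] in_params_V[OF c z i False] base_param(3)[OF c i] by simp
    qed
    show "\<bar>(1 - s) * base_param c i + s * z i\<bar> \<noteq> 1" using b[OF i] by simp
  next
    fix i j assume ij: "i < k" "j < k" "label c i \<in> E" "label c j = label c i" "base_param c i < base_param c j"
    then have "z i < z j" using z by (simp add: in_params_def)
    then have "(1 - s) * base_param c i < (1 - s) * base_param c j" "s * z i \<le> s * z j"
      using s ij(5) by (intro mult_strict_left_mono mult_left_mono; simp)+
    then show "(1 - s) * base_param c i + s * z i < (1 - s) * base_param c j + s * z j" by simp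
  qed
qed

text \<open>The only possible formula for the map underlying an arrow.\<close>

definition push_pt :: "'c face_arrow \<Rightarrow> (nat \<Rightarrow> real) \<Rightarrow> nat \<Rightarrow> real" where
  "push_pt f z i = (if label (fst f) i = label (fst (snd f)) i then z i else end_sign f i)"

lemma arrow_value:
  assumes f: "(c, d, b) \<in> Arr FC" and z: "in_params c z"
  obtains z' where "b (lift_pt z) = lift_pt z'" "in_params d z'" "\<And>i. i < k \<Longrightarrow> char1 X (label d i) (z' i) = char1 X (label c i) (z i)"
proof -
  have c: "c \<in> Index CX" and d: "d \<in> Index CX" using f by (auto simp: Arr_FC)
  have t: "lift_pt z \<in> topspace (Dom CX c)" using z topspace_Dom_comp[OF c] by auto
  then have "b (lift_pt z) \<in> topspace (Dom CX d)" using f by (auto simp: Arr_FC continuous_map_def)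
  then obtain z' where z': "b (lift_pt z) = lift_pt z'" "in_params d z'" using topspace_Dom_comp[OF d] by auto
  have "conf_of (label d) z' = conf_of (label c) z" using f t z'(1) Char_comp_lift_pt by (metis Arr_FC)
  then have "char1 X (label d i) (z' i) = char1 X (label c i) (z i)" if "i < k" for i
    using that by (auto simp: conf_of_def dest: fun_cong[of _ _ i])
  then show thesis using that z' by blast
qed

lemma arrow_end_sign:
  assumes f: "(c, d, b) \<in> Arr FC"
  shows "b (lift_pt (base_param c)) = lift_pt (end_sign (c, d, b))" "in_params d (end_sign (c, d, b))"
    and end_sign_eq: "\<And>i. i < k \<Longrightarrow> label c i = label d i \<Longrightarrow> end_sign (c, d, b) i = base_param c i"
    and end_sign_neq: "\<And>i. i < k \<Longrightarrow> label c i \<noteq> label d i \<Longrightarrow>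
        label c i \<in> V \<and> label d i \<in> E \<and> \<bar>end_sign (c, d, b) i\<bar> = 1 \<and> char1 X (label d i) (end_sign (c, d, b) i) = char1 X (label c i) 0"
proof -
  have c: "c \<in> Index CX" and d: "d \<in> Index CX" using f by (auto simp: Arr_FC)
  obtain z' where z': "b (lift_pt (base_param c)) = lift_pt z'" "in_params d z'"
    "\<And>i. i < k \<Longrightarrow> char1 X (label d i) (z' i) = char1 X (label c i) (base_param c i)"
    using arrow_value[OF f in_params_base_param[OF c]] by blast
  have s: "end_sign (c, d, b) i = z' i" if "i < k" for i using that by (simp add: end_sign_def z'(1))
  show "b (lift_pt (base_param c)) = lift_pt (end_sign (c, d, b))" unfolding z'(1) lift_pt_eq_iff using s by simp
  show "in_params d (end_sign (c, d, b))" using in_params_cong[of "end_sign (c, d, b)" z'] s z'(2) by simp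
  have *: "(label d i = label c i \<and> z' i = base_param c i) \<or> (label c i \<in> V \<and> label d i \<in> E \<and> \<bar>z' i\<bar> = 1)" if i: "i < k" for i
    by (rule char1_interior_eq[OF label_Index[OF c i] base_param(3)[OF c i] _ label_Index[OF d i] in_params_params[OF z'(2) i] z'(3)[OF i]])
       (use base_param(1,2)[OF c i] in auto)
  show "end_sign (c, d, b) i = base_param c i" if "i < k" "label c i = label d i" for i
    using *[OF that(1)] s[OF that(1)] that by auto
  show "label c i \<in> V \<and> label d i \<in> E \<and> \<bar>end_sign (c, d, b) i\<bar> = 1 \<and> char1 X (label d i) (end_sign (c, d, b) i) = char1 X (label c i) 0"
    if "i < k" "label c i \<noteq> label d i" for i
    using *[OF that(1)] s[OF that(1)] z'(3)[OF that(1)] base_param_V[OF c that(1)] that by auto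
qed

text \<open>An arrow cannot move the parameters of the coordinates that stay on their cell, and it sends
  each of the other coordinates to an end of a 1-cell. Which end it is cannot vary, because the
  domain is star-shaped, hence connected.\<close>

lemma arrow_eq_push_pt:
  assumes f: "(c, d, b) \<in> Arr FC" and z: "in_params c z"
  shows "b (lift_pt z) = lift_pt (push_pt (c, d, b) z)" "in_params d (push_pt (c, d, b) z)"
proof -
  have c: "c \<in> Index CX" and d: "d \<in> Index CX" using f by (auto simp: Arr_FC)
  define seg where "seg s = (\<lambda>i. (1 - s) * base_param c i + s * z i)" for s :: real
  have seg1: "seg 1 = z" and seg0: "seg 0 = base_param c" by (auto simp: seg_def)
  have inseg: "in_params c (seg s)" if "0 \<le> s" "s \<le> 1" for s
    using in_params_segment(1)[OF c z, of s] that z seg1 by (cases "s = 1") (auto simp: seg_def)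
  have cont: "continuous_on {0..1} (\<lambda>s. b (lift_pt (seg s)) i 0)" if i: "i < k" for i
  proof -
    have "continuous_map (top_of_set {0..1}) (Dom CX c) (\<lambda>s. lift_pt (seg s))"
    proof (rule continuous_map_into_Dom_comp[OF c])
      fix i assume "i < k"
      have "continuous_on {0..1} (\<lambda>s. seg s i)" unfolding seg_def by (intro continuous_intros)
      then show "continuous_map (top_of_set {0..1}) euclideanreal (\<lambda>s. seg s i)" by simp
    qed (use inseg in auto)
    moreover have "continuous_map (Dom CX c) (Dom CX d) b" using f by (simp add: Arr_FC)
    ultimately have "continuous_map (top_of_set {0..1}) euclideanreal (\<lambda>s. b (lift_pt (seg s)) i 0)"
      using continuous_map_compose[OF continuous_map_compose continuous_map_Dom_comp_coord[OF d i]]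
      by (fastforce simp: o_def)
    then show ?thesis by simp
  qed
  have val: "(label d i = label c i \<and> (\<bar>seg s i\<bar> < 1 \<longrightarrow> b (lift_pt (seg s)) i 0 = seg s i)) \<or>
      (label c i \<in> V \<and> label d i \<in> E \<and> \<bar>b (lift_pt (seg s)) i 0\<bar> = 1)"
    if i: "i < k" and s: "0 \<le> s" "s \<le> 1" and ne: "label c i \<noteq> label d i \<or> s < 1" for i s
  proof -
    obtain z' where z': "b (lift_pt (seg s)) = lift_pt z'" "in_params d z'"
      "\<And>i. i < k \<Longrightarrow> char1 X (label d i) (z' i) = char1 X (label c i) (seg s i)"
      using arrow_value[OF f inseg[OF s]] by blast
    have "label c i \<in> E \<Longrightarrow> \<bar>seg s i\<bar> \<noteq> 1"
      using in_params_segment(2)[OF c z s(1) _ i] ne arrow_end_sign(4)[OF f i] by (fastforce simp: seg_def)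
    from char1_interior_eq[OF label_Index[OF c i] in_params_params[OF inseg[OF s] i] this label_Index[OF d i] in_params_params[OF z'(2) i] z'(3)[OF i]]
    show ?thesis using i by (auto simp: z'(1))
  qed
  obtain z' where z': "b (lift_pt z) = lift_pt z'" "in_params d z'" using arrow_value[OF f z] by blast
  have "z' i = push_pt (c, d, b) z i" if i: "i < k" for i
  proof (cases "label c i = label d i")
    case False
    let ?g = "\<lambda>s. b (lift_pt (seg s)) i 0"
    have "?g s \<in> {-1, 1}" if "s \<in> {0..1}" for s
      using val[OF i, of s] that False by (auto simp: abs_if split: if_splits)
    then have "?g ` {0..1} \<subseteq> {-1, 1}" by blast
    then have "finite (?g ` {0..1})" by (rule finite_subset) simp
    then have "?g constant_on {0..1}"
      using continuous_finite_range_constant[OF _ cont[OF i]] by simp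
    then have "?g 1 = ?g 0" unfolding constant_on_def by force
    then have "z' i = end_sign (c, d, b) i" using i z'(1) arrow_end_sign(1)[OF f] by (simp add: seg1 seg0)
    then show ?thesis using False by (simp add: push_pt_def)
  next
    case True
    let ?h = "\<lambda>s. b (lift_pt (seg s)) i 0 - seg s i"
    have "?h s = 0" if "s \<in> {0..<1}" for s
      using val[OF i, of s] that True in_params_segment(2)[OF c z, of s i] i by (auto simp: seg_def)
    moreover have "continuous_on (closure {0..<1}) ?h"
    proof -
      have "continuous_on {0..1} (\<lambda>s. seg s i)" unfolding seg_def by (intro continuous_intros)
      then show ?thesis using cont[OF i] by (simp add: continuous_on_diff)
    qed
    ultimately have "?h 1 = 0"
      by (rule_tac continuous_constant_on_closure[of "{0..<1}" ?h 0]) (assumption, blast, simp)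
    then show ?thesis using True i z'(1) by (simp add: seg1 push_pt_def)
  qed
  then show "b (lift_pt z) = lift_pt (push_pt (c, d, b) z)" "in_params d (push_pt (c, d, b) z)"
    using z' in_params_cong[of z' "push_pt (c, d, b) z"] by (auto simp: lift_pt_eq_iff)
qed

lemma rank_on_end:
  assumes c: "c \<in> Index CX" and z: "in_params c z" and i: "i < k" "label c i \<in> E"
  shows "z i = -1 \<Longrightarrow> rank_on c i = 0" "z i = 1 \<Longrightarrow> Suc (rank_on c i) = npts c (label c i)"
proof -
  show "rank_on c i = 0" if "z i = -1"
  proof (rule ccontr)
    assume r: "rank_on c i \<noteq> 0"
    obtain j where j: "j < k" "label c j = label c i" "rank_on c j = 0" using rank_on_surj[OF c npts_pos[OF i(1)]] by blast
    have "rank_on c j < rank_on c i" using j(3) r by simp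
    then have "z j < z i" using in_params_less_iff[OF c z j(1) i(1)] i(2) j(2) by metis
    then show False using that in_params_bounds[OF c z j(1)] by simp
  qed
  show "Suc (rank_on c i) = npts c (label c i)" if "z i = 1"
  proof (rule ccontr)
    assume "Suc (rank_on c i) \<noteq> npts c (label c i)"
    then have "Suc (rank_on c i) < npts c (label c i)" using rank_on_less_npts[OF c i(1)] by simp
    then obtain j where j: "j < k" "label c j = label c i" "rank_on c j = Suc (rank_on c i)" using rank_on_surj[OF c] by blast
    then have "z i < z j" using in_params_less_iff[OF c z i(1) j(1)] i(2) by simp
    then show False using that in_params_bounds[OF c z j(1)] by simp
  qed
qed

text \<open>Which coordinate is at a given end does not depend on the point of the domain: it is the first or the
  last one on the 1-cell.\<close>

lemma in_params_end_unique:
  assumes c: "c \<in> Index CX" and z: "in_params c z" "in_params c z'" and ij: "i < k" "j < k" "label c i \<in> E" "label c j = label c i"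
    and e: "z i = \<sigma>" "z' j = \<sigma>" "\<bar>\<sigma>\<bar> = 1"
  shows "i = j"
proof (rule rank_on_inj[OF c ij(1,2)])
  have "\<sigma> = -1 \<or> \<sigma> = 1" using e(3) by auto
  then show "rank_on c i = rank_on c j"
    using rank_on_end[OF c z(1) ij(1,3)] rank_on_end[OF c z(2) ij(2)] ij e by auto
qed (use ij in simp)

text \<open>Consequently the set of ends that are reached determines the face on whose open cell the point lies:
  each coordinate is at the same end for both points or interior for both, and the order is
  given by the cell.\<close>

lemma ends_hit_eq_imp:
  assumes c: "c \<in> Index CX" and z: "in_params c z" "in_params c z'" and h: "ends_hit c z = ends_hit c z'"
  shows "\<And>i. i < k \<Longrightarrow> \<bar>z i\<bar> = 1 \<Longrightarrow> z' i = z i"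
    and "braid_proj k X (conf_of (label c) z) = braid_proj k X (conf_of (label c) z')"
proof -
  have hits: "z2 i = z1 i" if "in_params c z1" "in_params c z2" "ends_hit c z1 = ends_hit c z2" "i < k" "\<bar>z1 i\<bar> = 1" for z1 z2 i
  proof -
    have E: "label c i \<in> E" using in_params_V[OF c that(1,4)] that(5) by fastforce
    then have "(label c i, z1 i) \<in> ends_hit c z1" unfolding ends_hit_iff using that(4,5) by blast
    then have "(label c i, z1 i) \<in> ends_hit c z2" using that(3) by simp
    then have "\<exists>j<k. label c j = label c i \<and> z2 j = z1 i" by (simp only: ends_hit_iff)
    then obtain j where j: "j < k" "label c j = label c i" "z2 j = z1 i" by blast
    then have "i = j" using in_params_end_unique[OF c that(1,2,4) j(1) E j(2) refl j(3)] that(5) by simp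
    then show ?thesis using j by simp
  qed
  show "\<And>i. i < k \<Longrightarrow> \<bar>z i\<bar> = 1 \<Longrightarrow> z' i = z i" using hits[OF z h] .
  have int: "proj X (char1 X (label c i) (y i)) = label c i \<and> param X (char1 X (label c i) (y i)) = y i"
    if "in_params c y" "i < k" "\<bar>y i\<bar> \<noteq> 1" for y i
  proof (cases "label c i \<in> E")
    case True
    have "-1 < y i \<and> y i < 1" by (rule char1_E_cases[OF True in_params_params[OF that(1,2)]]) (use that in auto)
    then show ?thesis using True by (simp add: proj_char1_E param_char1_E)
  next
    case False
    then have "label c i \<in> V" using label_Index[OF c that(2)] by simp
    then show ?thesis using in_params_V[OF c that(1,2) False] by (simp add: param_char1_V)
  qed
  have pV: "proj X (char1 X (label c i) (y i)) \<notin> E" if "in_params c y" "i < k" "\<bar>y i\<bar> = 1" for y i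
  proof -
    have "label c i \<in> E" using in_params_V[OF c that(1,2)] that(3) by fastforce
    then show ?thesis using proj_char1_end in_params_params[OF that(1,2)] that(3) by blast
  qed
  have same: "proj X (char1 X (label c i) (z i)) = proj X (char1 X (label c i) (z' i))" if i: "i < k" for i
  proof (cases "\<bar>z i\<bar> = 1 \<or> \<bar>z' i\<bar> = 1")
    case True
    then have "z i = z' i" using hits[OF z h i] hits[OF z(2,1) h[symmetric] i] by metis
    then show ?thesis by simp
  qed (use int[OF z(1) i] int[OF z(2) i] in auto)
  show "braid_proj k X (conf_of (label c) z) = braid_proj k X (conf_of (label c) z')"
    unfolding braid_proj_eq_iff
  proof (intro conjI allI impI)
    fix i assume "i < k"
    then show "proj X (conf_of (label c) z i) = proj X (conf_of (label c) z' i)" using same by (simp add: conf_of_def)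
  next
    fix i j assume ij: "i < k" "j < k" and "proj X (conf_of (label c) z i) \<in> E \<and> proj X (conf_of (label c) z j) = proj X (conf_of (label c) z i)"
    then have p: "proj X (char1 X (label c i) (z i)) \<in> E" "proj X (char1 X (label c j) (z j)) = proj X (char1 X (label c i) (z i))"
      by (auto simp: conf_of_def)
    have pj: "proj X (char1 X (label c j) (z j)) \<in> E" unfolding p(2) by (rule p(1))
    have p': "proj X (char1 X (label c i) (z' i)) \<in> E" "proj X (char1 X (label c j) (z' j)) \<in> E"
      using p(1) pj same ij by metis+
    have z1: "\<bar>z i\<bar> \<noteq> 1" "\<bar>z j\<bar> \<noteq> 1"
      using pV[OF z(1) ij(1)] pV[OF z(1) ij(2)] p(1) pj by blast+
    have z2: "\<bar>z' i\<bar> \<noteq> 1" "\<bar>z' j\<bar> \<noteq> 1"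
      using pV[OF z(2) ij(1)] pV[OF z(2) ij(2)] p' by blast+
    note iz = int[OF z(1) ij(1) z1(1)] int[OF z(1) ij(2) z1(2)]
    have L: "label c j \<in> E" "label c i = label c j" using iz pj p(2) by metis+
    have "z j < z i \<longleftrightarrow> z' j < z' i"
      unfolding in_params_less_iff[OF c z(1) ij(2,1) L] in_params_less_iff[OF c z(2) ij(2,1) L] ..
    then have "z i \<le> z j \<longleftrightarrow> z' i \<le> z' j" by auto
    then show "param X (conf_of (label c) z i) \<le> param X (conf_of (label c) z j) \<longleftrightarrow> param X (conf_of (label c) z' i) \<le> param X (conf_of (label c) z' j)"
      using iz int[OF z(2) ij(1) z2(1)] int[OF z(2) ij(2) z2(2)] ij by (simp add: conf_of_def)
  qed
qed

lemma arrow_source: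
  assumes f: "(c, d, b) \<in> Arr FC"
  shows "conf_of (label d) (end_sign (c, d, b)) = rep_conf c" "braid_proj k X (conf_of (label d) (end_sign (c, d, b))) = c"
proof -
  have c: "c \<in> Index CX" using f by (auto simp: Arr_FC)
  have t: "lift_pt (base_param c) \<in> topspace (Dom CX c)" using in_params_base_param[OF c] topspace_Dom_comp[OF c] by auto
  have "Char CX d (b (lift_pt (base_param c))) = Char CX c (lift_pt (base_param c))" using f t by (auto simp: Arr_FC)
  then show "conf_of (label d) (end_sign (c, d, b)) = rep_conf c"
    unfolding arrow_end_sign(1)[OF f] Char_comp_lift_pt conf_of_base_param[OF c] .
  then show "braid_proj k X (conf_of (label d) (end_sign (c, d, b))) = c" using rep_conf(2)[OF c] by simp
qed

text \<open>An arrow is determined by its target and by the ends to which it sends coordinates: these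
  coordinates are the first or the last ones on their 1-cell.\<close>

lemma arrow_unique:
  assumes f: "(c, d, b) \<in> Arr FC" and g: "(c', d, b') \<in> Arr FC" and e: "arrow_ends (c, d, b) = arrow_ends (c', d, b')"
  shows "(c, d, b) = (c', d, b')"
proof -
  have d: "d \<in> Index CX" and c: "c \<in> Index CX" using f by (auto simp: Arr_FC)
  have h: "ends_hit d (end_sign (c, d, b)) = ends_hit d (end_sign (c', d, b'))" using e by (simp add: arrow_ends_def)
  note hh = ends_hit_eq_imp[OF d arrow_end_sign(2)[OF f] arrow_end_sign(2)[OF g] h]
  have cc: "c = c'" using hh(2) arrow_source(2)[OF f] arrow_source(2)[OF g] by simp
  have "push_pt (c, d, b) z i = push_pt (c', d, b') z i" if "i < k" for z i
    using that hh(1)[OF that] arrow_end_sign(4)[OF f that] cc by (auto simp: push_pt_def)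
  then have "b t = b' t" if "t \<in> topspace (Dom CX c)" for t
    using that topspace_Dom_comp[OF c] arrow_eq_push_pt(1)[OF f] arrow_eq_push_pt(1)[OF g] cc
    by (auto simp: lift_pt_eq_iff)
  then have "b = b'" using f g cc by (intro extensionalityI[of _ "topspace (Dom CX c)"]) (auto simp: Arr_FC)
  then show ?thesis using cc by simp
qed

text \<open>Every point of a domain is the image of an interior point of the domain of a face, namely of the cell
  in which its configuration lies.\<close>

lemma arrow_exists:
  assumes d: "d \<in> Index CX" and z: "in_params d z"
  obtains c b where "(c, d, b) \<in> Arr FC" "c = braid_proj k X (conf_of (label d) z)" "arrow_ends (c, d, b) = ends_hit d z"
proof -
  define x where "x = conf_of (label d) z"
  define c where "c = braid_proj k X x"
  have xCF: "x \<in> CF" unfolding x_def by (rule conf_of_conf[OF d z])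
  have c: "c \<in> Index CX" unfolding c_def by (rule braid_proj_Index[OF xCF])
  have xi: "x i = char1 X (label d i) (z i)" if "i < k" for i using that by (simp add: x_def conf_of_def)
  have lc: "label c i = proj X (x i)" if "i < k" for i using that by (simp add: c_def label_braid_proj)
  have end_iff: "label c i = label d i \<longleftrightarrow> \<bar>z i\<bar> \<noteq> 1" if i: "i < k" for i
  proof (cases "label d i \<in> E")
    case True
    show ?thesis
      by (rule char1_E_cases[OF True in_params_params[OF z i]])
        (use i True lc[OF i] xi[OF i] proj_char1_E[OF True, of "z i"] proj_char1_end[OF True in_params_params[OF z i]] in auto)
  next
    case False
    then have "label d i \<in> V" using label_Index[OF d i] by simp
    then show ?thesis using in_params_V[OF d z i False] lc[OF i] xi[OF i] by simp
  qed
  have arrow_ends_E: "label d i \<in> E \<and> label c i \<in> V \<and> \<bar>z i\<bar> = 1 \<and> char1 X (label c i) 0 = char1 X (label d i) (z i)"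
    if i: "i < k" and ne: "label c i \<noteq> label d i" for i
  proof -
    have a: "\<bar>z i\<bar> = 1" using end_iff[OF i] ne by simp
    then have "label d i \<in> E" using in_params_V[OF d z i] by fastforce
    then show ?thesis using a i lc[OF i] xi[OF i] proj_char1_end[OF _ in_params_params[OF z i]] end_eq_vertex[OF _ in_params_params[OF z i]] by simp
  qed
  have crdx: "param X (x i) = z i" if i: "i < k" and eq: "label c i = label d i" for i
  proof (cases "label d i \<in> E")
    case True
    show ?thesis
      by (rule char1_E_cases[OF True in_params_params[OF z i]]) (use True param_char1_E[OF True, of "z i"] xi[OF i] end_iff[OF i] eq in auto)
  next
    case False
    then have "label d i \<in> V" using label_Index[OF d i] by simp
    then show ?thesis using in_params_V[OF d z i False] xi[OF i] by (simp add: param_char1_V)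
  qed
  \<comment> \<open>The underlying map of the arrow: the coordinates at an end stay there.\<close>
  define g where "g y i = (if label c i = label d i then y i else z i)" for y i
  have gch: "char1 X (label d i) (g y i) = char1 X (label c i) (y i)" if y: "in_params c y" and i: "i < k" for y i
  proof (cases "label c i = label d i")
    case False
    then have "label c i \<notin> E" using arrow_ends_E[OF i] by simp
    then show ?thesis using arrow_ends_E[OF i False] in_params_V[OF c y i] False by (simp add: g_def)
  qed (simp add: g_def)
  have gD: "in_params d (g y)" if y: "in_params c y" for y
    unfolding in_params_def
  proof (intro conjI allI impI)
    fix i assume i: "i < k"
    show "g y i \<in> params X (label d i)"
      using in_params_params[OF y i] in_params_params[OF z i] by (auto simp: g_def)
  next
    fix i j assume ij: "i < k" "j < k" "i \<noteq> j"
    show "char1 X (label d i) (g y i) \<noteq> char1 X (label d j) (g y j)"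
      using in_params_distinct[OF y ij] gch[OF y] ij by simp
  next
    fix i j assume ij: "i < k" "j < k" and h: "label d i \<in> E \<and> label d j = label d i \<and> base_param d i < base_param d j"
    then have zz: "z i < z j" using z unfolding in_params_def by blast
    then have ne: "i \<noteq> j" by auto
    have dist: "char1 X (label d i) (g y i) \<noteq> char1 X (label d j) (g y j)"
      using in_params_distinct[OF y ij ne] gch[OF y] ij by simp
    show "g y i < g y j"
    proof (cases "label c i = label d i")
      case True
      show ?thesis
      proof (cases "label c j = label d j")
        case True2: True
        have "param X (x i) < param X (x j)" using crdx ij True True2 zz by simp
        then have "rank_on c i < rank_on c j"
          using in_params_less_iff[OF c in_params_param(1)[OF xCF c_def[symmetric]] ij] h True True2 by simp
        then have "y i < y j" using in_params_less_iff[OF c y ij] h True True2 by simp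
        then show ?thesis using True True2 by (simp add: g_def)
      next
        case False
        \<comment> \<open>Moving the other coordinates of the 1-cell preserves the order, since coordinate \<open>j\<close> is at
          the right end.\<close>
        then have "z j = 1" using arrow_ends_E[OF ij(2)] zz in_params_bounds[OF d z ij(1)] by auto
        moreover have "y i \<le> 1" using in_params_bounds[OF c y ij(1)] by simp
        ultimately show ?thesis using True False dist h by (auto simp: g_def less_le)
      qed
    next
      case False
      then have zi: "z i = -1" using arrow_ends_E[OF ij(1)] zz in_params_bounds[OF d z ij(2)] by auto
      show ?thesis
      proof (cases "label c j = label d j")
        case True
        have "-1 \<le> y j" using in_params_bounds[OF c y ij(2)] by simp
        then show ?thesis using zi False True dist h by (auto simp: g_def less_le)
      qed (use False zz in \<open>simp add: g_def\<close>)
    qed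
  qed
  define b where "b = (\<lambda>t\<in>topspace (Dom CX c). lift_pt (g (\<lambda>i. t i 0)))"
  have b_lift_pt: "b (lift_pt y) = lift_pt (g y)" if "in_params c y" for y
  proof -
    have "lift_pt y \<in> topspace (Dom CX c)" using that topspace_Dom_comp[OF c] by auto
    then show ?thesis by (simp add: b_def lift_pt_eq_iff g_def)
  qed
  have f: "(c, d, b) \<in> Arr FC"
    unfolding Arr_FC
  proof (intro conjI)
    show "b \<in> extensional (topspace (Dom CX c))" by (simp add: b_def)
    have "continuous_map (Dom CX c) (Dom CX d) (\<lambda>t. lift_pt (g (\<lambda>i. t i 0)))"
    proof (rule continuous_map_into_Dom_comp[OF d])
      fix i assume i: "i < k"
      show "continuous_map (Dom CX c) euclideanreal (\<lambda>y. g (\<lambda>i. y i 0) i)"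
        using continuous_map_Dom_comp_coord[OF c i] by (simp add: g_def)
    next
      fix t assume "t \<in> topspace (Dom CX c)"
      then obtain y where y: "in_params c y" "t = lift_pt y" using topspace_Dom_comp[OF c] by auto
      have "in_params d (g (\<lambda>i. t i 0)) \<longleftrightarrow> in_params d (g y)" by (rule in_params_cong) (simp add: y g_def)
      then show "in_params d (g (\<lambda>i. t i 0))" using gD[OF y(1)] by simp
    qed
    then show "continuous_map (Dom CX c) (Dom CX d) b"
      by (rule continuous_map_eq) (simp add: b_def)
    show "\<forall>t\<in>topspace (Dom CX c). Char CX d (b t) = Char CX c t"
    proof
      fix t assume "t \<in> topspace (Dom CX c)"
      then obtain y where y: "in_params c y" "t = lift_pt y" using topspace_Dom_comp[OF c] by auto
      show "Char CX d (b t) = Char CX c t"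
        unfolding y(2) b_lift_pt[OF y(1)] Char_comp_lift_pt by (rule conf_of_cong) (rule gch[OF y(1)])
    qed
  qed (fact c d)+
  have sgf: "end_sign (c, d, b) i = g (base_param c) i" if "i < k" for i
    using that by (simp add: end_sign_def b_lift_pt[OF in_params_base_param[OF c]])
  have "ends_hit d (end_sign (c, d, b)) = ends_hit d z"
  proof -
    have "\<bar>end_sign (c, d, b) i\<bar> = 1 \<longleftrightarrow> \<bar>z i\<bar> = 1" "\<bar>z i\<bar> = 1 \<Longrightarrow> end_sign (c, d, b) i = z i" if i: "i < k" for i
      using sgf[OF i] end_iff[OF i] base_param(1,2)[OF c i] by (auto simp: g_def)
    then show ?thesis unfolding ends_hit_def by (metis (no_types, lifting))
  qed
  then show thesis using that[of c b] f by (simp add: arrow_ends_def c_def x_def)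
qed

subsection \<open>Composition, finiteness and acyclicity\<close>

lemma Ident_Arr: "c \<in> Index CX \<Longrightarrow> Ident FC c \<in> Arr FC"
  unfolding Ident_FC Arr_FC by (auto intro: continuous_map_eq[OF continuous_map_id])

lemma Comp_Arr:
  assumes "(c, d, b) \<in> Arr FC" "(d, e, b') \<in> Arr FC"
  shows "(c, e, \<lambda>t\<in>topspace (Dom CX c). b' (b t)) \<in> Arr FC"
proof -
  have "continuous_map (Dom CX c) (Dom CX e) (b' \<circ> b)"
    using assms by (auto simp: Arr_FC intro: continuous_map_compose)
  then have "continuous_map (Dom CX c) (Dom CX e) (\<lambda>t\<in>topspace (Dom CX c). b' (b t))"
    by (rule continuous_map_eq) simp
  moreover have "b t \<in> topspace (Dom CX d)" if "t \<in> topspace (Dom CX c)" for t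
    using assms(1) that by (auto simp: Arr_FC continuous_map_def)
  ultimately show ?thesis using assms by (simp add: Arr_FC)
qed

lemma category_FC: "category FC"
  unfolding category_def
proof (intro conjI ballI impI)
  fix f assume "f \<in> Arr FC"
  then show "Src FC f \<in> Obj FC" "Tgt FC f \<in> Obj FC"
    by (cases f; auto simp: Arr_FC Src_FC Tgt_FC Obj_FC)+
next
  fix x assume "x \<in> Obj FC"
  then show "Ident FC x \<in> cat_hom FC x x"
    using Ident_Arr[of x] by (simp add: cat_hom_def Src_FC Tgt_FC Obj_FC) (simp add: Ident_FC)
next
  fix f g assume fg: "f \<in> Arr FC" "g \<in> Arr FC" "Tgt FC f = Src FC g"
  obtain c d b where f: "f = (c, d, b)" by (cases f)
  obtain e b' where g: "g = (d, e, b')" using fg(3) f by (cases g) (auto simp: Src_FC Tgt_FC)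
  show "Comp FC g f \<in> cat_hom FC (Src FC f) (Tgt FC g)"
    using Comp_Arr fg f g by (auto simp: cat_hom_def Comp_FC Src_FC Tgt_FC)
next
  fix f assume F: "f \<in> Arr FC"
  obtain c d b where f: "f = (c, d, b)" by (cases f)
  have b: "b \<in> extensional (topspace (Dom CX c))" "\<And>t. t \<in> topspace (Dom CX c) \<Longrightarrow> b t \<in> topspace (Dom CX d)"
    using F by (auto simp: f Arr_FC continuous_map_def)
  show "Comp FC f (Ident FC (Src FC f)) = f" "Comp FC (Ident FC (Tgt FC f)) f = f"
    using b by (auto simp: f Comp_FC Ident_FC Src_FC Tgt_FC extensional_def fun_eq_iff)
next
  fix f g h assume F: "f \<in> Arr FC" "g \<in> Arr FC" "h \<in> Arr FC" "Tgt FC f = Src FC g \<and> Tgt FC g = Src FC h"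
  obtain c d b where f: "f = (c, d, b)" by (cases f)
  obtain c2 d2 b2 where g: "g = (c2, d2, b2)" by (cases g)
  obtain c3 d3 b3 where h: "h = (c3, d3, b3)" by (cases h)
  have "b t \<in> topspace (Dom CX c2)" if "t \<in> topspace (Dom CX c)" for t
    using F that by (auto simp: f g Arr_FC continuous_map_def Src_FC Tgt_FC)
  then show "Comp FC h (Comp FC g f) = Comp FC (Comp FC h g) f"
    by (auto simp: f g h Comp_FC)
qed

lemma arrow_ends_Ident: "c \<in> Index CX \<Longrightarrow> arrow_ends (Ident FC c) = {}"
proof -
  assume c: "c \<in> Index CX"
  have "lift_pt (base_param c) \<in> topspace (Dom CX c)" using in_params_base_param[OF c] topspace_Dom_comp[OF c] by auto
  then have "end_sign (Ident FC c) i = base_param c i" if "i < k" for i using that by (simp add: Ident_FC end_sign_def)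
  then show ?thesis using base_param(1,2)[OF c] by (fastforce simp: arrow_ends_def ends_hit_def Ident_FC)
qed

lemma arrow_ends_empty_iff:
  assumes "(c, d, b) \<in> Arr FC"
  shows "arrow_ends (c, d, b) = {} \<longleftrightarrow> (c, d, b) = Ident FC d"
proof -
  have d: "d \<in> Index CX" using assms by (auto simp: Arr_FC)
  then show ?thesis
    using arrow_unique[OF assms, of d "\<lambda>t\<in>topspace (Dom CX d). t"] Ident_Arr[OF d] arrow_ends_Ident[OF d]
    by (auto simp: Ident_FC)
qed

text \<open>A coordinate that the first arrow has put at an end is on a 1-cell and stays where it is under the
  second one. The union is disjoint because two coordinates cannot be at the same end.\<close>

lemma arrow_ends_Comp:
  assumes f: "(c, d, b) \<in> Arr FC" and g: "(d, e, b') \<in> Arr FC"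
  shows "arrow_ends (Comp FC (d, e, b') (c, d, b)) = arrow_ends (c, d, b) \<union> arrow_ends (d, e, b')"
    and "arrow_ends (c, d, b) \<inter> arrow_ends (d, e, b') = {}"
proof -
  let ?f = "(c, d, b)" and ?g = "(d, e, b')"
  have c: "c \<in> Index CX" and d: "d \<in> Index CX" and e: "e \<in> Index CX" using f g by (auto simp: Arr_FC)
  have t: "lift_pt (base_param c) \<in> topspace (Dom CX c)" using in_params_base_param[OF c] topspace_Dom_comp[OF c] by auto
  have sgc: "end_sign (Comp FC ?g ?f) i = push_pt ?g (end_sign ?f) i" if "i < k" for i
    using that t arrow_end_sign(1)[OF f] arrow_eq_push_pt(1)[OF g arrow_end_sign(2)[OF f]]
    by (simp add: Comp_FC end_sign_def[of "(c, e, _)"])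
  have mve: "in_params e (push_pt ?g (end_sign ?f))" by (rule arrow_eq_push_pt(2)[OF g arrow_end_sign(2)[OF f]])
  have ef: "label e i = label d i" if "i < k" "label d i \<in> E" for i
    using arrow_end_sign(4)[OF g that(1)] that(2) by (metis DiffE)
  have eg: "label d i \<noteq> label e i" if "i < k" "\<bar>end_sign ?g i\<bar> = 1" for i
    using arrow_end_sign(3)[OF g that(1)] that(2) base_param(1,2)[OF d that(1)] by auto
  have eC: "arrow_ends (Comp FC ?g ?f) = ends_hit e (push_pt ?g (end_sign ?f))"
    using ends_hit_cong[of "end_sign (Comp FC ?g ?f)" "push_pt ?g (end_sign ?f)" e] sgc by (simp add: arrow_ends_def Comp_FC)
  show "arrow_ends (Comp FC ?g ?f) = arrow_ends ?f \<union> arrow_ends ?g"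
  proof
    show "arrow_ends (Comp FC ?g ?f) \<subseteq> arrow_ends ?f \<union> arrow_ends ?g"
    proof
      fix x assume "x \<in> arrow_ends (Comp FC ?g ?f)"
      then obtain m \<sigma> i where x: "x = (m, \<sigma>)" "m \<in> E" "\<bar>\<sigma>\<bar> = 1" "i < k" "label e i = m" "push_pt ?g (end_sign ?f) i = \<sigma>"
        unfolding eC by (auto simp: ends_hit_def)
      show "x \<in> arrow_ends ?f \<union> arrow_ends ?g"
        using x by (cases "label d i = label e i") (auto simp: arrow_ends_def ends_hit_def push_pt_def)
    qed
    show "arrow_ends ?f \<union> arrow_ends ?g \<subseteq> arrow_ends (Comp FC ?g ?f)"
    proof
      fix x assume "x \<in> arrow_ends ?f \<union> arrow_ends ?g"
      then show "x \<in> arrow_ends (Comp FC ?g ?f)"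
      proof
        assume "x \<in> arrow_ends ?f"
        then obtain m \<sigma> i where x: "x = (m, \<sigma>)" "m \<in> E" "\<bar>\<sigma>\<bar> = 1" "i < k" "label d i = m" "end_sign ?f i = \<sigma>"
          by (auto simp: arrow_ends_def ends_hit_def)
        moreover from this have "label e i = label d i" using ef by blast
        ultimately have "label e i = m \<and> push_pt ?g (end_sign ?f) i = \<sigma>" by (simp add: push_pt_def)
        then show ?thesis unfolding eC x(1) ends_hit_iff using x(2,3,4) by blast
      next
        assume "x \<in> arrow_ends ?g"
        then obtain m \<sigma> i where x: "x = (m, \<sigma>)" "m \<in> E" "\<bar>\<sigma>\<bar> = 1" "i < k" "label e i = m" "end_sign ?g i = \<sigma>"
          by (auto simp: arrow_ends_def ends_hit_def)
        moreover from this have "label d i \<noteq> label e i" using eg by blast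
        ultimately have "push_pt ?g (end_sign ?f) i = \<sigma>" by (simp add: push_pt_def)
        then show ?thesis unfolding eC x(1) ends_hit_iff using x(2,3,4,5) by blast
      qed
    qed
  qed
  show "arrow_ends ?f \<inter> arrow_ends ?g = {}"
  proof (rule ccontr)
    assume "arrow_ends ?f \<inter> arrow_ends ?g \<noteq> {}"
    then obtain m \<sigma> i j where i: "i < k" "label d i = m" "end_sign ?f i = \<sigma>" and j: "j < k" "label e j = m" "end_sign ?g j = \<sigma>"
      and m: "m \<in> E" "\<bar>\<sigma>\<bar> = 1" by (auto simp: arrow_ends_def ends_hit_def)
    have 1: "label e i = m" "push_pt ?g (end_sign ?f) i = \<sigma>" using ef[OF i(1)] i m by (auto simp: push_pt_def)
    have 2: "label d j \<noteq> label e j" "push_pt ?g (end_sign ?f) j = \<sigma>" using eg[OF j(1)] j m by (auto simp: push_pt_def)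
    have "i = j" using in_params_end_unique[OF e mve mve i(1) j(1) _ _ 1(2) 2(2) m(2)] 1 j m by simp
    then show False using 1 2 i by simp
  qed
qed

lemma arrow_label_E: "(c, d, b) \<in> Arr FC \<Longrightarrow> i < k \<Longrightarrow> label c i \<in> E \<Longrightarrow> label d i = label c i"
  using arrow_end_sign(4)[of c d b i] by (metis DiffE)

lemma arrow_ends_empty_if_labels:
  assumes f: "(c, d, b) \<in> Arr FC" and l: "\<And>i. i < k \<Longrightarrow> label c i = label d i"
  shows "arrow_ends (c, d, b) = {}"
proof -
  have c: "c \<in> Index CX" using f by (auto simp: Arr_FC)
  have "\<bar>end_sign (c, d, b) i\<bar> < 1" if "i < k" for i
    using arrow_end_sign(3)[OF f that l[OF that]] base_param(1,2)[OF c that] by auto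
  then show ?thesis by (fastforce simp: arrow_ends_def ends_hit_def)
qed

lemma arrow_ends_subset:
  assumes "(c, d, b) \<in> Arr FC" shows "arrow_ends (c, d, b) \<subseteq> E \<times> {-1, 1}"
  by (auto simp: arrow_ends_def ends_hit_def)

text \<open>The target and the set of ends determine an arrow.\<close>

lemma finite_category_FC: "finite_category FC"
proof -
  have "inj_on (\<lambda>f. (fst f, fst (snd f), arrow_ends f)) (Arr FC)"
    by (rule inj_onI) (metis arrow_unique prod.collapse fst_conv snd_conv)
  moreover have "(\<lambda>f. (fst f, fst (snd f), arrow_ends f)) ` Arr FC \<subseteq> Index CX \<times> Index CX \<times> Pow (E \<times> {-1, 1})"
  proof (rule image_subsetI)
    fix f assume "f \<in> Arr FC"
    then show "(fst f, fst (snd f), arrow_ends f) \<in> Index CX \<times> Index CX \<times> Pow (E \<times> {-1, 1})"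
      using arrow_ends_subset[of "fst f" "fst (snd f)" "snd (snd f)"] Arr_FC[of "fst f" "fst (snd f)" "snd (snd f)"] by simp
  qed
  moreover have "finite (Index CX \<times> Index CX \<times> Pow (E \<times> {-1, 1::real}))"
    using finite_Index_comp finite_E by auto
  ultimately have "finite (Arr FC)" by (meson finite_imageD finite_subset)
  then show ?thesis using category_FC finite_Index_comp by (simp add: finite_category_def Obj_FC)
qed

text \<open>A coordinate that is on a 1-cell stays on it, so along arrows in both directions no coordinate changes
  its cell, and both arrows are identities.\<close>

lemma acyclic_category_FC: "acyclic_category FC"
  unfolding acyclic_category_def
proof (intro conjI ballI impI)
  show "category FC" by (rule category_FC)
  fix x assume x: "x \<in> Obj FC"
  show "cat_hom FC x x = {Ident FC x}"
  proof
    show "cat_hom FC x x \<subseteq> {Ident FC x}"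
    proof
      fix f assume f: "f \<in> cat_hom FC x x"
      then obtain b where b: "f = (x, x, b)" "(x, x, b) \<in> Arr FC" by (cases f) (auto simp: cat_hom_def Src_FC Tgt_FC)
      then show "f \<in> {Ident FC x}" using arrow_ends_empty_if_labels[OF b(2)] arrow_ends_empty_iff[OF b(2)] by simp
    qed
    show "{Ident FC x} \<subseteq> cat_hom FC x x" using category_FC x by (simp add: category_def)
  qed
next
  fix x y assume "x \<in> Obj FC" "y \<in> Obj FC" "x \<noteq> y"
  show "cat_hom FC x y = {} \<or> cat_hom FC y x = {}"
  proof (rule ccontr)
    assume "\<not> (cat_hom FC x y = {} \<or> cat_hom FC y x = {})"
    then obtain b b' where b: "(x, y, b) \<in> Arr FC" "(y, x, b') \<in> Arr FC"
      by (auto simp: cat_hom_def Src_FC Tgt_FC)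
    have "label x i = label y i" if "i < k" for i
      using arrow_end_sign(4)[OF b(1) that] arrow_end_sign(4)[OF b(2) that] by auto
    then have "(x, y, b) = Ident FC y"
      using arrow_ends_empty_if_labels[OF b(1)] arrow_ends_empty_iff[OF b(1)] by simp
    then show False using \<open>x \<noteq> y\<close> by (simp add: Ident_FC)
  qed
qed

end

section \<open>Points of a cell with prescribed end gaps\<close>

context finite_graph begin

text \<open>The sets of ends that are reached at some point of the domain of \<open>c\<close>; one direction is
  \<open>admissible_ends_hit\<close>, the other follows from \<open>in_params_gap_pt\<close>. Since a single coordinate cannot
  be at both ends of its 1-cell, the last condition requires two coordinates.\<close>

definition admissible :: "'c braid_index \<Rightarrow> ('c \<times> real) set \<Rightarrow> bool" where
  "admissible c Z \<longleftrightarrow>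
     (\<forall>(m, \<sigma>)\<in>Z. m \<in> E \<and> \<bar>\<sigma>\<bar> = 1 \<and> \<sigma> \<in> params X m \<and> 0 < npts c m \<and>
        (\<forall>i<k. label c i \<notin> E \<longrightarrow> char1 X (label c i) 0 \<noteq> char1 X m \<sigma>)) \<and>
     (\<forall>e\<in>Z. \<forall>e'\<in>Z. e \<noteq> e' \<longrightarrow> char1 X (fst e) (snd e) \<noteq> char1 X (fst e') (snd e')) \<and>
     (\<forall>m. (m, -1) \<in> Z \<and> (m, 1) \<in> Z \<longrightarrow> 2 \<le> npts c m)"

text \<open>On each 1-cell, the gaps between neighbouring coordinates have one unit and the gaps at the ends
  have \<open>w\<close> units; the unit is chosen such that the total length is 2, the length of the interval from
  -1 to 1.\<close>

definition gap_pt :: "'c braid_index \<Rightarrow> ('c \<times> real \<Rightarrow> real) \<Rightarrow> nat \<Rightarrow> real" where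
  "gap_pt c w i = (let m = label c i in
     if m \<in> E then -1 + 2 * ((w (m, -1) + real (rank_on c i)) / (w (m, -1) + w (m, 1) + real (npts c m) - 1)) else 0)"

lemma admissible_mono: assumes "admissible c Z" "Z' \<subseteq> Z" shows "admissible c Z'"
  unfolding admissible_def
proof (intro conjI ballI allI impI)
  fix x assume "x \<in> Z'"
  then show "case x of (m, \<sigma>) \<Rightarrow> m \<in> E \<and> \<bar>\<sigma>\<bar> = 1 \<and> \<sigma> \<in> params X m \<and> 0 < npts c m \<and>
        (\<forall>i<k. label c i \<notin> E \<longrightarrow> char1 X (label c i) 0 \<noteq> char1 X m \<sigma>)"
    using assms(1)[unfolded admissible_def, THEN conjunct1] assms(2) by blast
next
  fix e e' assume "e \<in> Z'" "e' \<in> Z'" "e \<noteq> e'"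
  then show "char1 X (fst e) (snd e) \<noteq> char1 X (fst e') (snd e')"
    using assms(1)[unfolded admissible_def, THEN conjunct2, THEN conjunct1] assms(2) by blast
next
  fix m assume "(m, -1) \<in> Z' \<and> (m, 1) \<in> Z'"
  then show "2 \<le> npts c m"
    using assms(1)[unfolded admissible_def, THEN conjunct2, THEN conjunct2] assms(2) by blast
qed

lemma admissibleD:
  assumes "admissible c Z"
  shows "\<And>m \<sigma>. (m, \<sigma>) \<in> Z \<Longrightarrow> m \<in> E \<and> \<bar>\<sigma>\<bar> = 1 \<and> \<sigma> \<in> params X m \<and> 0 < npts c m"
    and "\<And>m \<sigma> i. (m, \<sigma>) \<in> Z \<Longrightarrow> i < k \<Longrightarrow> label c i \<notin> E \<Longrightarrow> char1 X (label c i) 0 \<noteq> char1 X m \<sigma>"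
    and "\<And>m \<sigma> m' \<sigma>'. (m, \<sigma>) \<in> Z \<Longrightarrow> (m', \<sigma>') \<in> Z \<Longrightarrow> char1 X m \<sigma> = char1 X m' \<sigma>' \<Longrightarrow> (m, \<sigma>) = (m', \<sigma>')"
    and "\<And>m. (m, -1) \<in> Z \<Longrightarrow> (m, 1) \<in> Z \<Longrightarrow> 2 \<le> npts c m"
  using assms unfolding admissible_def by (auto 0 3)

lemma admissible_ends_hit: assumes c: "c \<in> Index CX" and z: "in_params c z" shows "admissible c (ends_hit c z)"
  unfolding admissible_def
proof (intro conjI)
  have ex: "\<exists>i<k. label c i = m \<and> z i = \<sigma>" if "(m, \<sigma>) \<in> ends_hit c z" for m \<sigma> using that by (simp add: ends_hit_iff)
  have neq: "i = j" if "i < k" "j < k" "char1 X (label c i) (z i) = char1 X (label c j) (z j)" for i j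
    using in_params_distinct[OF z that(1,2)] that(3) by blast
  show "\<forall>(m, \<sigma>)\<in>ends_hit c z. m \<in> E \<and> \<bar>\<sigma>\<bar> = 1 \<and> \<sigma> \<in> params X m \<and> 0 < npts c m \<and>
        (\<forall>i<k. label c i \<notin> E \<longrightarrow> char1 X (label c i) 0 \<noteq> char1 X m \<sigma>)"
  proof clarify
    fix m \<sigma> assume h: "(m, \<sigma>) \<in> ends_hit c z"
    then obtain i where i: "i < k" "label c i = m" "z i = \<sigma>" "m \<in> E" "\<bar>\<sigma>\<bar> = 1" by (auto simp: ends_hit_iff)
    have "char1 X (label c j) 0 \<noteq> char1 X m \<sigma>" if "j < k" "label c j \<notin> E" for j
      using neq[OF that(1) i(1)] in_params_V[OF c z that] i that by auto
    then show "m \<in> E \<and> \<bar>\<sigma>\<bar> = 1 \<and> \<sigma> \<in> params X m \<and> 0 < npts c m \<and>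
        (\<forall>i<k. label c i \<notin> E \<longrightarrow> char1 X (label c i) 0 \<noteq> char1 X m \<sigma>)"
      using i in_params_params[OF z i(1)] npts_pos[OF i(1), of c] by auto
  qed
  show "\<forall>e\<in>ends_hit c z. \<forall>e'\<in>ends_hit c z. e \<noteq> e' \<longrightarrow> char1 X (fst e) (snd e) \<noteq> char1 X (fst e') (snd e')"
  proof (intro ballI impI notI)
    fix e e' assume e: "e \<in> ends_hit c z" "e' \<in> ends_hit c z" "e \<noteq> e'" "char1 X (fst e) (snd e) = char1 X (fst e') (snd e')"
    obtain i j where "i < k" "j < k" "e = (label c i, z i)" "e' = (label c j, z j)"
      using ex e(1,2) by (metis prod.collapse)
    then show False using neq[of i j] e by auto
  qed
  show "\<forall>m. (m, -1) \<in> ends_hit c z \<and> (m, 1) \<in> ends_hit c z \<longrightarrow> 2 \<le> npts c m"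
  proof clarify
    fix m assume "(m, -1) \<in> ends_hit c z" "(m, 1) \<in> ends_hit c z"
    then obtain i j where ij: "i < k" "j < k" "label c i = m" "label c j = m" "z i = -1" "z j = 1"
      using ex by meson
    then have "card {i, j} = 2" by (auto simp: card_insert_if)
    moreover have "card {i, j} \<le> npts c m" unfolding npts_def by (rule card_mono) (use ij in auto)
    ultimately show "2 \<le> npts c m" by simp
  qed
qed

lemma gap_total_pos:
  assumes w: "\<And>e. 0 \<le> w e" and a: "admissible c {e. w e = 0}" and i: "i < k" "label c i = m"
  shows "0 < w (m, -1) + w (m, 1) + real (npts c m) - 1"
proof (cases "w (m, -1) = 0 \<and> w (m, 1) = 0")
  case True
  then have "2 \<le> npts c m" using admissibleD(4)[OF a, of m] by simp
  then show ?thesis using True by simp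
next
  case False
  then have "0 < w (m, -1) + w (m, 1)" using w[of "(m, -1)"] w[of "(m, 1)"] by linarith
  moreover have "1 \<le> npts c m" using npts_pos[OF i(1), of c] i by simp
  then have "1 \<le> real (npts c m)" by simp
  ultimately show ?thesis by linarith
qed

lemma gap_pt_values:
  assumes c: "c \<in> Index CX" and w: "\<And>e. 0 \<le> w e" and a: "admissible c {e. w e = 0}" and i: "i < k" "label c i = m" "m \<in> E"
  shows "-1 \<le> gap_pt c w i" "gap_pt c w i \<le> 1"
    and "gap_pt c w i = -1 \<longleftrightarrow> w (m, -1) = 0 \<and> rank_on c i = 0"
    and "gap_pt c w i = 1 \<longleftrightarrow> w (m, 1) = 0 \<and> Suc (rank_on c i) = npts c m"
proof -
  define D where "D = w (m, -1) + w (m, 1) + real (npts c m) - 1"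
  define N where "N = w (m, -1) + real (rank_on c i)"
  have D: "0 < D" unfolding D_def by (rule gap_total_pos[OF w a i(1,2)])
  have "Suc (rank_on c i) \<le> npts c m" using rank_on_less_npts[OF c i(1)] i by simp
  then have r: "real (rank_on c i) + 1 \<le> real (npts c m)" by linarith
  have N: "0 \<le> N" "N \<le> D" using w[of "(m, -1)"] w[of "(m, 1)"] r by (auto simp: N_def D_def)
  have p: "gap_pt c w i = -1 + 2 * (N / D)" using i by (simp add: gap_pt_def Let_def N_def D_def)
  show "-1 \<le> gap_pt c w i" "gap_pt c w i \<le> 1" unfolding p using N D by (auto simp: field_simps)
  have "gap_pt c w i = -1 \<longleftrightarrow> N = 0" unfolding p using D by (auto simp: field_simps)
  also have "\<dots> \<longleftrightarrow> w (m, -1) = 0 \<and> rank_on c i = 0" unfolding N_def using w[of "(m, -1)"] by auto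
  finally show "gap_pt c w i = -1 \<longleftrightarrow> w (m, -1) = 0 \<and> rank_on c i = 0" .
  have "gap_pt c w i = 1 \<longleftrightarrow> N = D" unfolding p using D by (auto simp: field_simps)
  also have "\<dots> \<longleftrightarrow> w (m, 1) = 0 \<and> real (rank_on c i) + 1 = real (npts c m)"
    unfolding N_def D_def using w[of "(m, 1)"] r by auto
  also have "real (rank_on c i) + 1 = real (npts c m) \<longleftrightarrow> Suc (rank_on c i) = npts c m" by linarith
  finally show "gap_pt c w i = 1 \<longleftrightarrow> w (m, 1) = 0 \<and> Suc (rank_on c i) = npts c m" .
qed

lemma gap_pt_V: "label c i \<notin> E \<Longrightarrow> gap_pt c w i = 0"
  by (simp add: gap_pt_def)

lemma gap_pt_less:
  assumes c: "c \<in> Index CX" and w: "\<And>e. 0 \<le> w e" and a: "admissible c {e. w e = 0}"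
    and ij: "i < k" "j < k" "label c i \<in> E" "label c j = label c i" "rank_on c i < rank_on c j"
  shows "gap_pt c w i < gap_pt c w j"
  using gap_total_pos[OF w a ij(1) refl] ij by (simp add: gap_pt_def Let_def divide_strict_right_mono)

text \<open>The coordinates at an end are exactly those whose gap there has weight 0, so the conditions that
  make this set of ends admissible are those that keep the images distinct.\<close>

lemma in_params_gap_pt:
  assumes c: "c \<in> Index CX" and w: "\<And>e. 0 \<le> w e" and a: "admissible c {e. w e = 0}"
  shows "in_params c (gap_pt c w)" "ends_hit c (gap_pt c w) = {e. w e = 0}"
proof -
  note val = gap_pt_values[OF c w a]
  have end_admissible: "(label c i, gap_pt c w i) \<in> {e. w e = 0}" if "i < k" "\<bar>gap_pt c w i\<bar> = 1" for i
  proof -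
    have E: "label c i \<in> E" using gap_pt_V[of c i w] that(2) by fastforce
    have "gap_pt c w i = -1 \<or> gap_pt c w i = 1" using that(2) by auto
    then show ?thesis using val(3,4)[OF that(1) refl E] by auto
  qed
  have params: "gap_pt c w i \<in> params X (label c i)" if i: "i < k" for i
  proof (cases "label c i \<in> E")
    case True
    show ?thesis
    proof (cases "\<bar>gap_pt c w i\<bar> = 1")
      case True
      then show ?thesis using end_admissible[OF i] admissibleD(1)[OF a] by blast
    next
      case False
      then have "gap_pt c w i \<in> {-1<..<1}" using val(1,2)[OF i refl True] by auto
      then show ?thesis using Dom_E(2)[OF True] by blast
    qed
  next
    case False
    then show ?thesis using label_Index[OF c i] params_V gap_pt_V[OF False] by auto
  qed
  show "in_params c (gap_pt c w)"
    unfolding in_params_def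
  proof (intro conjI allI impI)
    fix i j assume ij: "i < k" "j < k" "label c i \<in> E \<and> label c j = label c i \<and> base_param c i < base_param c j"
    then show "gap_pt c w i < gap_pt c w j" using gap_pt_less[OF c w a ij(1,2)] rank_on_less_iff[OF c ij(1,2)] by simp
  next
    fix i j assume ij: "i < k" "j < k" "i \<noteq> j"
    show "char1 X (label c i) (gap_pt c w i) \<noteq> char1 X (label c j) (gap_pt c w j)"
    proof
      assume eq: "char1 X (label c i) (gap_pt c w i) = char1 X (label c j) (gap_pt c w j)"
      have same: "label c i \<noteq> label c j \<or> gap_pt c w i \<noteq> gap_pt c w j"
      proof (rule ccontr)
        assume n: "\<not> ?thesis"
        then have E: "label c i \<in> E" using label_V_inj[OF c ij(1,2)] ij(3) by auto
        have "rank_on c i \<noteq> rank_on c j" using rank_on_inj[OF c ij(1,2)] ij(3) n by auto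
        then show False using gap_pt_less[OF c w a ij(1,2) E] gap_pt_less[OF c w a ij(2,1)] E n by (cases "rank_on c i < rank_on c j") auto
      qed
      have E_of_end: "label c l \<in> E" if "\<bar>gap_pt c w l\<bar> = 1" for l using that gap_pt_V[of c l w] by fastforce
      have vert: False if "l < k" "n < k" "\<bar>gap_pt c w l\<bar> = 1" "label c n \<notin> E"
        "char1 X (label c l) (gap_pt c w l) = char1 X (label c n) (gap_pt c w n)" for l n
        using admissibleD(2)[OF a end_admissible[OF that(1,3)] that(2,4)] that(5) gap_pt_V[OF that(4)] by simp
      show False
      proof (cases "\<bar>gap_pt c w i\<bar> = 1")
        case True
        show False
        proof (cases "\<bar>gap_pt c w j\<bar> = 1")
          case True2: True
          show False using admissibleD(3)[OF a end_admissible[OF ij(1) True] end_admissible[OF ij(2) True2] eq] same by simp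
        next
          case False
          have "label c j \<notin> E"
            using char1_interior_eq[OF label_Index[OF c ij(2)] params[OF ij(2)] False label_Index[OF c ij(1)] params[OF ij(1)] eq] same by auto
          then show False using vert[OF ij(1,2) True _ eq] by simp
        qed
      next
        case False
        have "label c i \<in> V" "\<bar>gap_pt c w j\<bar> = 1"
          using char1_interior_eq[OF label_Index[OF c ij(1)] params[OF ij(1)] False label_Index[OF c ij(2)] params[OF ij(2)] eq[symmetric]] same by auto
        then show False using vert[OF ij(2,1) _ _ eq[symmetric]] by simp
      qed
    qed
  qed (rule params)
  show "ends_hit c (gap_pt c w) = {e. w e = 0}"
  proof
    show "ends_hit c (gap_pt c w) \<subseteq> {e. w e = 0}"
    proof
      fix e assume "e \<in> ends_hit c (gap_pt c w)"
      then obtain i where "i < k" "e = (label c i, gap_pt c w i)" "\<bar>gap_pt c w i\<bar> = 1" by (auto simp: ends_hit_def)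
      then show "e \<in> {e. w e = 0}" using end_admissible by blast
    qed
    show "{e. w e = 0} \<subseteq> ends_hit c (gap_pt c w)"
    proof
      fix e assume e: "e \<in> {e. w e = 0}"
      obtain m \<sigma> where m: "e = (m, \<sigma>)" by (cases e)
      have f: "m \<in> E" "\<bar>\<sigma>\<bar> = 1" "0 < npts c m" using admissibleD(1)[OF a, of m \<sigma>] e m by auto
      consider "\<sigma> = -1" | "\<sigma> = 1" using f(2) by linarith
      then have "\<exists>i<k. label c i = m \<and> gap_pt c w i = \<sigma>"
      proof cases
        case 1
        obtain i where "i < k" "label c i = m" "rank_on c i = 0" using rank_on_surj[OF c f(3)] by blast
        then show ?thesis using val(3)[of i m] f e m 1 by auto
      next
        case 2
        have "npts c m - 1 < npts c m" using f(3) by simp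
        from rank_on_surj[OF c this] obtain i where "i < k" "label c i = m" "rank_on c i = npts c m - 1" by blast
        then show ?thesis using val(4)[of i m] f e m 2 by auto
      qed
      then show "e \<in> ends_hit c (gap_pt c w)" unfolding m ends_hit_iff using f by blast
    qed
  qed
qed

lemma braid_proj_gap_pt:
  assumes c: "c \<in> Index CX" and w: "\<And>e. 0 < w e"
  shows "in_params c (gap_pt c w)" "braid_proj k X (conf_of (label c) (gap_pt c w)) = c"
proof -
  have "{e. w e = 0} = {}" using w by (metis (mono_tags, lifting) Collect_empty_eq less_irrefl)
  then have a: "admissible c {e. w e = 0}" by (simp add: admissible_def)
  have w0: "0 \<le> w e" for e using w[of e] by simp
  show D: "in_params c (gap_pt c w)" by (rule in_params_gap_pt[OF c w0 a])
  have "\<bar>gap_pt c w i\<bar> \<noteq> 1" if "i < k" "label c i \<in> E" for i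
    using gap_pt_values(3,4)[OF c w0 a that(1) refl that(2)] w[of "(label c i, -1)"] w[of "(label c i, 1)"]
    by (auto simp: abs_if)
  then show "braid_proj k X (conf_of (label c) (gap_pt c w)) = c" by (rule braid_proj_conf_of_interior[OF c D])
qed

subsection \<open>Passing to a face\<close>

lemma card_arrow_ends:
  assumes f: "(c, d, b) \<in> Arr FC" and m: "m \<in> E" and s: "\<bar>\<sigma>\<bar> = 1"
  shows "card {i. i < k \<and> label d i = m \<and> label c i \<noteq> m \<and> end_sign (c, d, b) i = \<sigma>} = of_bool ((m, \<sigma>) \<in> arrow_ends (c, d, b))"
    (is "card ?N = _")
proof (cases "(m, \<sigma>) \<in> arrow_ends (c, d, b)")
  case True
  have c: "c \<in> Index CX" and d: "d \<in> Index CX" using f by (auto simp: Arr_FC)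
  obtain i where i: "i < k" "label d i = m" "end_sign (c, d, b) i = \<sigma>" using True by (auto simp: arrow_ends_def ends_hit_def)
  have "label c i \<noteq> m"
    using arrow_end_sign(3)[OF f i(1)] base_param(1,2)[OF c i(1)] i s by auto
  then have "?N = {i}"
    using i in_params_end_unique[OF d arrow_end_sign(2)[OF f] arrow_end_sign(2)[OF f]] m s by auto
  then show ?thesis using True by simp
next
  case False
  then have "?N = {}" using m s by (auto simp: arrow_ends_def ends_hit_iff)
  then show ?thesis using False by simp
qed

lemma card_arrow_ends_sum:
  assumes f: "(c, d, b) \<in> Arr FC" and m: "m \<in> E"
  shows "npts d m = npts c m + of_bool ((m, -1) \<in> arrow_ends (c, d, b)) + of_bool ((m, 1) \<in> arrow_ends (c, d, b))"
proof -
  let ?N = "\<lambda>\<sigma>. {i. i < k \<and> label d i = m \<and> label c i \<noteq> m \<and> end_sign (c, d, b) i = \<sigma>}"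
  have "{i. i < k \<and> label d i = m} = ({i. i < k \<and> label c i = m} \<union> ?N (-1)) \<union> ?N 1"
  proof (intro equalityI subsetI)
    fix i assume "i \<in> {i. i < k \<and> label d i = m}"
    then have i: "i < k" "label d i = m" by auto
    show "i \<in> ({i. i < k \<and> label c i = m} \<union> ?N (-1)) \<union> ?N 1"
      using arrow_end_sign(4)[OF f i(1)] i by (cases "label c i = m") (auto simp: abs_if split: if_splits)
  next
    fix i assume "i \<in> ({i. i < k \<and> label c i = m} \<union> ?N (-1)) \<union> ?N 1"
    then show "i \<in> {i. i < k \<and> label d i = m}" using arrow_label_E[OF f, of i] m by auto
  qed
  then have "npts d m = card (({i. i < k \<and> label c i = m} \<union> ?N (-1)) \<union> ?N 1)" by (simp add: npts_def)
  also have "\<dots> = card ({i. i < k \<and> label c i = m} \<union> ?N (-1)) + card (?N 1)"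
    by (rule card_Un_disjoint) auto
  also have "card ({i. i < k \<and> label c i = m} \<union> ?N (-1)) = npts c m + card (?N (-1))"
    unfolding npts_def by (rule card_Un_disjoint) auto
  finally show ?thesis using card_arrow_ends[OF f m, of 1] card_arrow_ends[OF f m, of "-1"] by simp
qed

text \<open>A new coordinate at the left end comes before all others.\<close>

lemma rank_on_arrow:
  assumes f: "(c, d, b) \<in> Arr FC" and i: "i < k" "label c i = m" and m: "m \<in> E"
  shows "rank_on d i = rank_on c i + of_bool ((m, -1) \<in> arrow_ends (c, d, b))"
proof -
  have c: "c \<in> Index CX" and d: "d \<in> Index CX" using f by (auto simp: Arr_FC)
  let ?s = "end_sign (c, d, b)"
  let ?N = "{i. i < k \<and> label d i = m \<and> label c i \<noteq> m \<and> ?s i = -1}"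
  note sD = arrow_end_sign(2)[OF f]
  have di: "label d i = m" using arrow_label_E[OF f i(1)] i m by simp
  have cmp: "rank_on d j < rank_on d i \<longleftrightarrow> rank_on c j < rank_on c i" if j: "j < k" "label c j = m" for j
  proof -
    have dj: "label d j = m" using arrow_label_E[OF f j(1)] j m by simp
    have "rank_on d j < rank_on d i \<longleftrightarrow> ?s j < ?s i" using in_params_less_iff[OF d sD j(1) i(1)] di dj m by simp
    also have "\<dots> \<longleftrightarrow> base_param c j < base_param c i" using arrow_end_sign(3)[OF f] i j di dj by simp
    also have "\<dots> \<longleftrightarrow> rank_on c j < rank_on c i" using rank_on_less_iff[OF c j(1) i(1)] i j by simp
    finally show ?thesis .
  qed
  have "{j. j < k \<and> label d j = label d i \<and> rank_on d j < rank_on d i} = {j. j < k \<and> label c j = label c i \<and> rank_on c j < rank_on c i} \<union> ?N"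
  proof (intro equalityI subsetI)
    fix j assume "j \<in> {j. j < k \<and> label d j = label d i \<and> rank_on d j < rank_on d i}"
    then have j: "j < k" "label d j = m" "rank_on d j < rank_on d i" using di by auto
    show "j \<in> {j. j < k \<and> label c j = label c i \<and> rank_on c j < rank_on c i} \<union> ?N"
    proof (cases "label c j = m")
      case True
      then show ?thesis using cmp j i by auto
    next
      case False
      then have "\<bar>?s j\<bar> = 1" using arrow_end_sign(4)[OF f j(1)] j by auto
      moreover have "?s j \<noteq> 1"
        using rank_on_end(2)[OF d sD j(1)] j m rank_on_less_npts[OF d i(1)] di by auto
      ultimately show ?thesis using False j by (auto simp: abs_if split: if_splits)
    qed
  next
    fix j assume "j \<in> {j. j < k \<and> label c j = label c i \<and> rank_on c j < rank_on c i} \<union> ?N"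
    then show "j \<in> {j. j < k \<and> label d j = label d i \<and> rank_on d j < rank_on d i}"
    proof
      assume "j \<in> {j. j < k \<and> label c j = label c i \<and> rank_on c j < rank_on c i}"
      then have j: "j < k" "label c j = m" "rank_on c j < rank_on c i" using i by auto
      then show ?thesis using cmp arrow_label_E[OF f j(1)] m di by simp
    next
      assume "j \<in> ?N"
      then have j: "j < k" "label d j = m" "label c j \<noteq> m" "?s j = -1" by auto
      then have r0: "rank_on d j = 0" using rank_on_end(1)[OF d sD j(1)] m by simp
      have "i \<noteq> j" using j i by auto
      then have "rank_on d i \<noteq> 0" using rank_on_inj[OF d i(1) j(1)] di j r0 by auto
      then show ?thesis using r0 j di by simp
    qed
  qed
  then have "rank_on d i = card ({j. j < k \<and> label c j = label c i \<and> rank_on c j < rank_on c i} \<union> ?N)"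
    using rank_on_eq_card[OF d i(1)] by simp
  also have "\<dots> = card {j. j < k \<and> label c j = label c i \<and> rank_on c j < rank_on c i} + card ?N"
    by (rule card_Un_disjoint) (use i in auto)
  finally show ?thesis using rank_on_eq_card[OF c i(1)] card_arrow_ends[OF f m, of "-1"] by simp
qed

text \<open>When the first point on a 1-cell moves to the end, the former second gap becomes the end gap of the
  face. Like all gaps between neighbours it has one unit, so the weight of the face at this end
  is 1.\<close>

lemma gap_pt_face:
  assumes f: "(c, d, b) \<in> Arr FC" and w: "\<And>e. 0 \<le> w e" and a: "admissible d {e. w e = 0}"
    and z: "\<And>e. e \<in> arrow_ends (c, d, b) \<Longrightarrow> w e = 0"
  shows "conf_of (label d) (gap_pt d w) = conf_of (label c) (gap_pt c (\<lambda>e. if e \<in> arrow_ends (c, d, b) then 1 else w e))"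
proof (rule conf_of_cong)
  fix i assume i: "i < k"
  have c: "c \<in> Index CX" and d: "d \<in> Index CX" using f by (auto simp: Arr_FC)
  let ?w = "\<lambda>e. if e \<in> arrow_ends (c, d, b) then 1 else w e"
  show "char1 X (label d i) (gap_pt d w i) = char1 X (label c i) (gap_pt c ?w i)"
  proof (cases "label c i = label d i")
    case True
    have "gap_pt d w i = gap_pt c ?w i"
    proof (cases "label d i \<in> E")
      case m: True
      define m where "m = label d i"
      have m1: "label d i = m" "label c i = m" "m \<in> E" using m True by (auto simp: m_def)
      define A B where "A = (of_bool ((m, -1) \<in> arrow_ends (c, d, b)) :: real)" and "B = (of_bool ((m, 1) \<in> arrow_ends (c, d, b)) :: real)"
      have r: "real (rank_on d i) = real (rank_on c i) + A" using rank_on_arrow[OF f i m1(2,3)] by (simp add: A_def)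
      have n: "real (npts d m) = real (npts c m) + A + B" using card_arrow_ends_sum[OF f m1(3)] by (simp add: A_def B_def)
      have wa: "?w (m, -1) = w (m, -1) + A" "?w (m, 1) = w (m, 1) + B"
        using z by (auto simp: A_def B_def)
      show ?thesis unfolding gap_pt_def Let_def m1 wa r n using m1(3) by (simp add: algebra_simps)
    qed (use True in \<open>simp add: gap_pt_V\<close>)
    then show ?thesis using True by simp
  next
    case False
    define m where "m = label d i"
    note s = arrow_end_sign(4)[OF f i False]
    have m: "m \<in> E" using s by (simp add: m_def)
    have "(m, end_sign (c, d, b) i) \<in> arrow_ends (c, d, b)" using s i unfolding m_def arrow_ends_def snd_conv fst_conv ends_hit_iff by blast
    then have w0: "w (m, end_sign (c, d, b) i) = 0" by (rule z)
    have "end_sign (c, d, b) i = -1 \<or> end_sign (c, d, b) i = 1" using s by auto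
    then have "gap_pt d w i = end_sign (c, d, b) i"
      using gap_pt_values(3,4)[OF d w a i m_def[symmetric] m] rank_on_end[OF d arrow_end_sign(2)[OF f] i] m w0
      by (auto simp: m_def)
    then show ?thesis using s by (simp add: gap_pt_V)
  qed
qed

section \<open>The map from the classifying space\<close>

subsection \<open>Chains of arrows\<close>

lemma nerveD:
  assumes s: "s \<in> nerve FC n"
  shows "\<And>i. i \<le> n \<Longrightarrow> fst (s (i, i)) \<in> Index CX \<and> s (i, i) = Ident FC (fst (s (i, i)))"
    and "\<And>i j. i \<le> j \<Longrightarrow> j \<le> n \<Longrightarrow> s (i, j) \<in> Arr FC \<and> fst (s (i, j)) = fst (s (i, i)) \<and> fst (snd (s (i, j))) = fst (s (j, j))"
    and "\<And>i j l. i \<le> j \<Longrightarrow> j \<le> l \<Longrightarrow> l \<le> n \<Longrightarrow> s (i, l) = Comp FC (s (j, l)) (s (i, j))"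
proof -
  obtain x where x: "\<forall>i\<le>n. x i \<in> Obj FC \<and> s (i, i) = Ident FC (x i)"
    "\<forall>j\<le>n. \<forall>i\<le>j. s (i, j) \<in> cat_hom FC (x i) (x j)"
    "\<forall>l\<le>n. \<forall>j\<le>l. \<forall>i\<le>j. s (i, l) = Comp FC (s (j, l)) (s (i, j))"
    using s unfolding nerve_def by blast
  have f: "fst (s (i, i)) = x i" if "i \<le> n" for i using x(1) that by (simp add: Ident_FC)
  show "fst (s (i, i)) \<in> Index CX \<and> s (i, i) = Ident FC (fst (s (i, i)))" if "i \<le> n" for i
    using x(1) f that by (simp add: Obj_FC)
  show "s (i, j) \<in> Arr FC \<and> fst (s (i, j)) = fst (s (i, i)) \<and> fst (snd (s (i, j))) = fst (s (j, j))"
    if "i \<le> j" "j \<le> n" for i j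
    using x(2) f that by (simp add: cat_hom_def Src_FC Tgt_FC)
  show "s (i, l) = Comp FC (s (j, l)) (s (i, j))" if "i \<le> j" "j \<le> l" "l \<le> n" for i j l
    using x(3) that by blast
qed

lemma nerveI:
  assumes "s \<in> extensional {(i, j). i \<le> j \<and> j \<le> n}"
    and "\<And>i. i \<le> n \<Longrightarrow> x i \<in> Index CX \<and> s (i, i) = Ident FC (x i)"
    and "\<And>i j. i \<le> j \<Longrightarrow> j \<le> n \<Longrightarrow> s (i, j) \<in> Arr FC \<and> fst (s (i, j)) = x i \<and> fst (snd (s (i, j))) = x j"
    and "\<And>i j l. i \<le> j \<Longrightarrow> j \<le> l \<Longrightarrow> l \<le> n \<Longrightarrow> s (i, l) = Comp FC (s (j, l)) (s (i, j))"
  shows "s \<in> nerve FC n"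
  unfolding nerve_def mem_Collect_eq
proof (intro conjI exI[of _ x] allI impI)
  fix i j assume "j \<le> n" "i \<le> j"
  then show "s (i, j) \<in> cat_hom FC (x i) (x j)" using assms(3) by (simp add: cat_hom_def Src_FC Tgt_FC)
next
  fix i assume "i \<le> n"
  then show "x i \<in> Obj FC" "s (i, i) = Ident FC (x i)" using assms(2)[of i] by (simp_all add: Obj_FC)
next
  fix l j i assume "l \<le> n" "j \<le> l" "i \<le> j"
  then show "s (i, l) = Comp FC (s (j, l)) (s (i, j))" by (intro assms(4))
qed (rule assms(1))

lemma nerve_arrow:
  assumes "s \<in> nerve FC n" "i \<le> j" "j \<le> n"
  obtains b where "s (i, j) = (fst (s (i, i)), fst (s (j, j)), b)" "(fst (s (i, i)), fst (s (j, j)), b) \<in> Arr FC"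
  using nerveD(2)[OF assms] that[of "snd (snd (s (i, j)))"] by (cases "s (i, j)") auto

lemma arrow_ends_chain:
  assumes s: "s \<in> nerve FC n" and ijl: "i \<le> j" "j \<le> l" "l \<le> n"
  shows "arrow_ends (s (i, l)) = arrow_ends (s (i, j)) \<union> arrow_ends (s (j, l))" "arrow_ends (s (i, j)) \<inter> arrow_ends (s (j, l)) = {}"
proof -
  obtain b where b: "s (i, j) = (fst (s (i, i)), fst (s (j, j)), b)" "(fst (s (i, i)), fst (s (j, j)), b) \<in> Arr FC"
    by (rule nerve_arrow[OF s ijl(1) order_trans[OF ijl(2,3)]])
  obtain b' where b': "s (j, l) = (fst (s (j, j)), fst (s (l, l)), b')" "(fst (s (j, j)), fst (s (l, l)), b') \<in> Arr FC"
    by (rule nerve_arrow[OF s ijl(2,3)])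
  show "arrow_ends (s (i, l)) = arrow_ends (s (i, j)) \<union> arrow_ends (s (j, l))" "arrow_ends (s (i, j)) \<inter> arrow_ends (s (j, l)) = {}"
    using arrow_ends_Comp[OF b(2) b'(2), folded b(1) b'(1), folded nerveD(3)[OF s ijl]] .
qed

lemma arrow_ends_diag: "s \<in> nerve FC n \<Longrightarrow> i \<le> n \<Longrightarrow> arrow_ends (s (i, i)) = {}"
  using nerveD(1)[of s n i] arrow_ends_Ident by metis

lemma admissible_arrow_ends: assumes "(c, d, b) \<in> Arr FC" shows "admissible d (arrow_ends (c, d, b))"
  using admissible_ends_hit[OF _ arrow_end_sign(2)[OF assms]] assms by (simp add: arrow_ends_def Arr_FC)

lemma nerve_pullback_in_nerve:
  assumes s: "s \<in> nerve FC n" and \<theta>: "\<theta> \<in> {..m} \<rightarrow> {..n}" "mono_on {..m} \<theta>"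
  shows "nerve_pullback m \<theta> s \<in> nerve FC m"
proof -
  have v: "nerve_pullback m \<theta> s (i, j) = s (\<theta> i, \<theta> j)" if "i \<le> j" "j \<le> m" for i j
    using that by (simp add: nerve_pullback_def)
  have t: "\<theta> i \<le> \<theta> j" "\<theta> j \<le> n" if "i \<le> j" "j \<le> m" for i j
    using that \<theta> by (auto simp: mono_on_def Pi_iff)
  show ?thesis
  proof (rule nerveI[where x = "\<lambda>i. fst (s (\<theta> i, \<theta> i))"])
    show "nerve_pullback m \<theta> s \<in> extensional {(i, j). i \<le> j \<and> j \<le> m}"
      by (simp add: nerve_pullback_def)
    fix i assume "i \<le> m"
    then show "fst (s (\<theta> i, \<theta> i)) \<in> Index CX \<and> nerve_pullback m \<theta> s (i, i) = Ident FC (fst (s (\<theta> i, \<theta> i)))"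
      using nerveD(1)[OF s t(2)[OF order_refl]] v by simp
  next
    fix i j assume ij: "i \<le> j" "j \<le> m"
    then show "nerve_pullback m \<theta> s (i, j) \<in> Arr FC \<and> fst (nerve_pullback m \<theta> s (i, j)) = fst (s (\<theta> i, \<theta> i)) \<and>
       fst (snd (nerve_pullback m \<theta> s (i, j))) = fst (s (\<theta> j, \<theta> j))"
      using nerveD(2)[OF s t[OF ij]] v[OF ij] by simp
  next
    fix i j l assume ijl: "i \<le> j" "j \<le> l" "l \<le> m"
    then show "nerve_pullback m \<theta> s (i, l) = Comp FC (nerve_pullback m \<theta> s (j, l)) (nerve_pullback m \<theta> s (i, j))"
      using nerveD(3)[OF s, of "\<theta> i" "\<theta> j" "\<theta> l"] t v by simp
  qed
qed

lemma simplex_push_in_simplex: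
  assumes u: "u \<in> standard_simplex m" and \<theta>: "\<theta> \<in> {..m} \<rightarrow> {..n}"
  shows "simplex_push m \<theta> u \<in> standard_simplex n"
proof -
  have u0: "0 \<le> u i" for i using u by (simp add: standard_simplex_def)
  have sum1: "(\<Sum>j\<le>n. simplex_push m \<theta> u j) = 1"
  proof -
    have "(\<Sum>j\<in>{..n}. \<Sum>i\<in>{i \<in> {..m}. \<theta> i = j}. u i) = sum u {..m}"
      using \<theta> by (intro sum.group) auto
    then show ?thesis using u by (simp add: simplex_push_def standard_simplex_def)
  qed
  have p0: "0 \<le> simplex_push m \<theta> u j" for j unfolding simplex_push_def using u0 by (simp add: sum_nonneg)
  have out: "simplex_push m \<theta> u j = 0" if "j > n" for j
  proof -
    have "\<theta> i \<le> n" if "i \<le> m" for i using \<theta> that by auto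
    then have "{i. i \<le> m \<and> \<theta> i = j} = {}" using \<open>j > n\<close> by fastforce
    then show ?thesis unfolding simplex_push_def by (metis sum.empty)
  qed
  have "simplex_push m \<theta> u j \<le> 1" for j
  proof (cases "j \<le> n")
    case True
    then show ?thesis using member_le_sum[of j "{..n}" "simplex_push m \<theta> u"] p0 sum1 by simp
  qed (use out in simp)
  then show ?thesis unfolding standard_simplex_def using p0 out sum1 by auto
qed

subsection \<open>The weights of a chain\<close>

text \<open>A vertex \<open>i\<close> of the simplex has weight 0 at the ends where the arrow from the \<open>i\<close>-th to the last cell
  puts a coordinate, and weight 1 at the others. This is the image of the point of the \<open>i\<close>-th cell
  with equal gaps. The weights are affine in between.\<close>

definition chain_weight :: "nat \<Rightarrow> (nat \<times> nat \<Rightarrow> 'c face_arrow) \<Rightarrow> (nat \<Rightarrow> real) \<Rightarrow> 'c \<times> real \<Rightarrow> real" where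
  "chain_weight n s u e = (\<Sum>i | i \<le> n \<and> e \<notin> arrow_ends (s (i, n)). u i)"

definition chain_pt :: "'c face_arrow nerve_point \<Rightarrow> nat \<Rightarrow> 'a" where
  "chain_pt z = (case z of ((n, s), u) \<Rightarrow> conf_of (label (fst (s (n, n)))) (gap_pt (fst (s (n, n))) (chain_weight n s u)))"

lemma simplex_nonneg: "u \<in> standard_simplex n \<Longrightarrow> 0 \<le> u i"
  and simplex_sum: "u \<in> standard_simplex n \<Longrightarrow> sum u {..n} = 1"
  and simplex_out: "u \<in> standard_simplex n \<Longrightarrow> n < i \<Longrightarrow> u i = 0"
  by (auto simp: standard_simplex_def)

lemma chain_weight_facts:
  assumes s: "s \<in> nerve FC n" and u: "u \<in> standard_simplex n"
  shows "0 \<le> chain_weight n s u e" "chain_weight n s u e \<le> 1" "chain_weight n s u e < 1 \<Longrightarrow> e \<in> arrow_ends (s (0, n))" "u n \<le> chain_weight n s u e"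
proof -
  show "0 \<le> chain_weight n s u e" unfolding chain_weight_def using simplex_nonneg[OF u] by (simp add: sum_nonneg)
  show "chain_weight n s u e \<le> 1"
    unfolding chain_weight_def simplex_sum[OF u, symmetric] using simplex_nonneg[OF u] by (intro sum_mono2) auto
  show "e \<in> arrow_ends (s (0, n))" if "chain_weight n s u e < 1"
  proof (rule ccontr)
    assume "e \<notin> arrow_ends (s (0, n))"
    then have "{i. i \<le> n \<and> e \<notin> arrow_ends (s (i, n))} = {..n}" using arrow_ends_chain(1)[OF s, of 0 _ n] by auto
    then show False using that simplex_sum[OF u] by (simp add: chain_weight_def)
  qed
  have "u n = sum u {n}" by simp
  also have "\<dots> \<le> chain_weight n s u e"
    unfolding chain_weight_def using simplex_nonneg[OF u] arrow_ends_diag[OF s order_refl] by (intro sum_mono2) auto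
  finally show "u n \<le> chain_weight n s u e" .
qed

lemma admissible_chain_weight: assumes s: "s \<in> nerve FC n" and u: "u \<in> standard_simplex n"
  shows "admissible (fst (s (n, n))) {e. chain_weight n s u e < 1}" "admissible (fst (s (n, n))) {e. chain_weight n s u e = 0}"
proof -
  obtain b where b: "s (0, n) = (fst (s (0, 0)), fst (s (n, n)), b)" "(fst (s (0, 0)), fst (s (n, n)), b) \<in> Arr FC"
    using nerve_arrow[OF s, of 0 n] by auto
  have "admissible (fst (s (n, n))) (arrow_ends (s (0, n)))" unfolding b(1) by (rule admissible_arrow_ends[OF b(2)])
  then show 1: "admissible (fst (s (n, n))) {e. chain_weight n s u e < 1}"
    by (rule admissible_mono) (use chain_weight_facts(3)[OF s u] in blast)
  show "admissible (fst (s (n, n))) {e. chain_weight n s u e = 0}" by (rule admissible_mono[OF 1]) auto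
qed

lemma in_params_chain_weight: assumes s: "s \<in> nerve FC n" and u: "u \<in> standard_simplex n"
  shows "in_params (fst (s (n, n))) (gap_pt (fst (s (n, n))) (chain_weight n s u))"
  using in_params_gap_pt(1)[OF _ chain_weight_facts(1)[OF s u] admissible_chain_weight(2)[OF s u]] nerveD(1)[OF s order_refl] by blast

lemma chain_pt_conf: "s \<in> nerve FC n \<Longrightarrow> u \<in> standard_simplex n \<Longrightarrow> chain_pt ((n, s), u) \<in> CF"
  using conf_of_conf[OF _ in_params_chain_weight] nerveD(1)[of s n n] by (simp add: chain_pt_def)

text \<open>The value only depends on the part of the chain up to the last positive coordinate.\<close>

lemma chain_pt_truncate:
  assumes s: "s \<in> nerve FC n" and u: "u \<in> standard_simplex n" and j: "j \<le> n" "\<And>i. j < i \<Longrightarrow> u i = 0"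
  shows "chain_pt ((n, s), u) = conf_of (label (fst (s (j, j)))) (gap_pt (fst (s (j, j))) (chain_weight j s u))"
proof -
  obtain b where b: "s (j, n) = (fst (s (j, j)), fst (s (n, n)), b)" "(fst (s (j, j)), fst (s (n, n)), b) \<in> Arr FC"
    using nerve_arrow[OF s j(1)] by auto
  have nz: "i \<le> j" if "u i \<noteq> 0" for i using j(2) that by (meson not_le)
  have e: "chain_weight n s u e = (if e \<in> arrow_ends (s (j, n)) then 0 else chain_weight j s u e)" for e
  proof -
    have "chain_weight n s u e = (\<Sum>i | i \<le> j \<and> e \<notin> arrow_ends (s (i, n)). u i)"
      unfolding chain_weight_def using j(1) by (intro sum.mono_neutral_right) (auto dest: nz)
    also have "{i. i \<le> j \<and> e \<notin> arrow_ends (s (i, n))} = (if e \<in> arrow_ends (s (j, n)) then {} else {i. i \<le> j \<and> e \<notin> arrow_ends (s (i, j))})"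
    proof -
      have "arrow_ends (s (i, n)) = arrow_ends (s (i, j)) \<union> arrow_ends (s (j, n))" if "i \<le> j" for i
        by (rule arrow_ends_chain(1)[OF s that j(1) order_refl])
      then have "(i \<le> j \<and> e \<notin> arrow_ends (s (i, n))) \<longleftrightarrow> (e \<notin> arrow_ends (s (j, n)) \<and> i \<le> j \<and> e \<notin> arrow_ends (s (i, j)))" for i
        by blast
      then show ?thesis by simp
    qed
    finally show ?thesis by (simp add: chain_weight_def)
  qed
  have w1: "chain_weight j s u e = 1" if "e \<in> arrow_ends (s (j, n))" for e
  proof -
    have "e \<notin> arrow_ends (s (i, j))" if "i \<le> j" for i
      using arrow_ends_chain(2)[OF s that j(1) order_refl] \<open>e \<in> arrow_ends (s (j, n))\<close> by blast
    then have "{i. i \<le> j \<and> e \<notin> arrow_ends (s (i, j))} = {..j}" by auto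
    moreover have "sum u {..j} = sum u {..n}" using j(1) by (intro sum.mono_neutral_left) (auto dest: nz)
    ultimately show ?thesis using simplex_sum[OF u] by (simp add: chain_weight_def)
  qed
  have z: "chain_weight n s u e = 0" if "e \<in> arrow_ends (s (j, n))" for e using e[of e] that by simp
  have "chain_pt ((n, s), u) = conf_of (label (fst (s (j, j)))) (gap_pt (fst (s (j, j))) (\<lambda>e. if e \<in> arrow_ends (s (j, n)) then 1 else chain_weight n s u e))"
    using gap_pt_face[OF b(2) chain_weight_facts(1)[OF s u] admissible_chain_weight(2)[OF s u], folded b(1), OF z] by (simp add: chain_pt_def)
  also have "(\<lambda>e. if e \<in> arrow_ends (s (j, n)) then 1 else chain_weight n s u e) = chain_weight j s u" using e w1 by auto
  finally show ?thesis .
qed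

text \<open>The two representatives have the same weights once the chain \<open>s\<close> is cut off at the image
  under \<open>\<theta>\<close> of the last vertex.\<close>

lemma chain_pt_step:
  assumes s: "s \<in> nerve FC n" and \<theta>: "\<theta> \<in> {..m} \<rightarrow> {..n}" "mono_on {..m} \<theta>" and u: "u \<in> standard_simplex m"
  shows "chain_pt ((m, nerve_pullback m \<theta> s), u) = chain_pt ((n, s), simplex_push m \<theta> u)"
proof -
  define j where "j = \<theta> m"
  have tj: "\<theta> i \<le> j" if "i \<le> m" for i using \<theta>(2) that by (auto simp: j_def mono_on_def)
  have jn: "j \<le> n" using \<theta>(1) by (auto simp: j_def)
  have "simplex_push m \<theta> u i = 0" if "j < i" for i
  proof -
    have "{l. l \<le> m \<and> \<theta> l = i} = {}" using tj that by fastforce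
    then show ?thesis by (metis simplex_push_def sum.empty)
  qed
  then have "chain_pt ((n, s), simplex_push m \<theta> u) = conf_of (label (fst (s (j, j)))) (gap_pt (fst (s (j, j))) (chain_weight j s (simplex_push m \<theta> u)))"
    by (rule chain_pt_truncate[OF s simplex_push_in_simplex[OF u \<theta>(1)] jn])
  moreover have "chain_weight j s (simplex_push m \<theta> u) e = chain_weight m (nerve_pullback m \<theta> s) u e" for e
  proof -
    let ?T = "{i. i \<le> j \<and> e \<notin> arrow_ends (s (i, j))}"
    let ?S = "{i. i \<le> m \<and> e \<notin> arrow_ends (s (\<theta> i, j))}"
    have "chain_weight j s (simplex_push m \<theta> u) e = (\<Sum>i\<in>?T. \<Sum>l | l \<le> m \<and> \<theta> l = i. u l)"
      by (simp add: chain_weight_def simplex_push_def)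
    also have "\<dots> = (\<Sum>i\<in>?T. \<Sum>l\<in>{l \<in> ?S. \<theta> l = i}. u l)"
      by (intro sum.cong refl) auto
    also have "\<dots> = sum u ?S" using tj by (intro sum.group) auto
    also have "\<dots> = chain_weight m (nerve_pullback m \<theta> s) u e"
      unfolding chain_weight_def by (intro sum.cong refl) (auto simp: nerve_pullback_def j_def)
    finally show ?thesis .
  qed
  then have "chain_weight j s (simplex_push m \<theta> u) = chain_weight m (nerve_pullback m \<theta> s) u" by auto
  ultimately show ?thesis by (simp add: chain_pt_def nerve_pullback_def j_def)
qed

end

subsection \<open>Uniqueness of weighted filtrations\<close>

text \<open>A strictly increasing filtration with positive weights is determined by the function that adds
  up, at each point, the weights of the stages not containing it: the stages are its sublevel
  sets.\<close>

lemma weighted_filtration_levels: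
  fixes v :: "nat \<Rightarrow> real" and Y :: "nat \<Rightarrow> 'e set"
  assumes Y: "\<forall>t<n. Y t \<subset> Y (Suc t)" and v: "\<forall>t\<le>n. 0 < v t"
    and w: "\<forall>e. w e = (\<Sum>t | t \<le> n \<and> e \<notin> Y t. v t)"
  shows "\<And>t e. t \<le> n \<Longrightarrow> e \<in> Y t \<longleftrightarrow> w e \<le> (\<Sum>r<t. v r)"
    and "\<And>t e. t \<le> n \<Longrightarrow> e \<notin> Y t \<Longrightarrow> (\<Sum>r<Suc t. v r) \<le> w e"
    and "\<And>t. t < n \<Longrightarrow> \<exists>e. e \<in> Y (Suc t) \<and> e \<notin> Y t \<and> w e = (\<Sum>r<Suc t. v r)"
proof -
  have mono: "Y a \<subseteq> Y b" if "a \<le> b" "b \<le> n" for a b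
    using that
  proof (induction rule: dec_induct)
    case (step c)
    then have "Y c \<subset> Y (Suc c)" using Y by auto
    then show ?case using step by auto
  qed simp
  have high: "w e \<le> (\<Sum>r<t. v r)" if "t \<le> n" "e \<in> Y t" for t e
    unfolding w[rule_format]
  proof (rule sum_mono2)
    show "{t. t \<le> n \<and> e \<notin> Y t} \<subseteq> {..<t}"
    proof
      fix r assume "r \<in> {t. t \<le> n \<and> e \<notin> Y t}"
      then have r: "r \<le> n" "e \<notin> Y r" by auto
      then have "\<not> t \<le> r" using mono[of t r] that(2) by blast
      then show "r \<in> {..<t}" by simp
    qed
  qed (use v that in \<open>auto intro: less_imp_le\<close>)
  show low: "(\<Sum>r<Suc t. v r) \<le> w e" if "t \<le> n" "e \<notin> Y t" for t e
    unfolding w[rule_format]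
  proof (rule sum_mono2)
    have "e \<notin> Y r" if "r \<le> t" for r using mono[OF that \<open>t \<le> n\<close>] \<open>e \<notin> Y t\<close> by blast
    then show "{..<Suc t} \<subseteq> {t. t \<le> n \<and> e \<notin> Y t}" using that by auto
  qed (use v in \<open>auto intro: less_imp_le\<close>)
  show "e \<in> Y t \<longleftrightarrow> w e \<le> (\<Sum>r<t. v r)" if "t \<le> n" for t e
    using high[OF that, of e] low[OF that, of e] v[rule_format, OF that] by (cases "e \<in> Y t") simp_all
  show "\<exists>e. e \<in> Y (Suc t) \<and> e \<notin> Y t \<and> w e = (\<Sum>r<Suc t. v r)" if t: "t < n" for t
  proof -
    obtain e where "e \<in> Y (Suc t)" "e \<notin> Y t" using Y[rule_format, OF t] by blast
    then show ?thesis using high[of "Suc t" e] low[of t e] t by (intro exI[of _ e]) auto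
  qed
qed

text \<open>By induction on \<open>t\<close>: the least value that the function takes outside the \<open>t\<close>-th stage is the sum of the
  weights up to \<open>t\<close>. The normalization to total weight 1 fixes the last weight, and with it the
  length.\<close>

lemma weighted_filtration_unique:
  fixes v v' :: "nat \<Rightarrow> real" and Y Y' :: "nat \<Rightarrow> 'e set"
  assumes Y: "\<forall>t<n. Y t \<subset> Y (Suc t)" and v: "\<forall>t\<le>n. 0 < v t"
    and w: "\<forall>e. w e = (\<Sum>t | t \<le> n \<and> e \<notin> Y t. v t)" and s: "(\<Sum>t\<le>n. v t) = 1"
    and Y': "\<forall>t<n'. Y' t \<subset> Y' (Suc t)" and v': "\<forall>t\<le>n'. 0 < v' t"
    and w': "\<forall>e. w e = (\<Sum>t | t \<le> n' \<and> e \<notin> Y' t. v' t)" and s': "(\<Sum>t\<le>n'. v' t) = 1"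
  shows "n = n'" "\<And>t. t \<le> n \<Longrightarrow> v t = v' t" "\<And>t. t \<le> n \<Longrightarrow> Y t = Y' t"
proof -
  note L = weighted_filtration_levels[OF Y v w] and L' = weighted_filtration_levels[OF Y' v' w']
  have P: "(\<Sum>r<t. v r) = (\<Sum>r<t. v' r)" if "t \<le> n" "t \<le> n'" for t
    using that
  proof (induction t)
    case (Suc t)
    then have t: "t < n" "t < n'" and eq: "(\<Sum>r<t. v r) = (\<Sum>r<t. v' r)" by auto
    have YY: "e \<in> Y t \<longleftrightarrow> e \<in> Y' t" for e
      using L(1)[of t e] L'(1)[of t e] t eq by simp
    obtain e where e: "e \<notin> Y t" "w e = (\<Sum>r<Suc t. v r)" using L(3)[OF t(1)] by blast
    obtain e' where e': "e' \<notin> Y' t" "w e' = (\<Sum>r<Suc t. v' r)" using L'(3)[OF t(2)] by blast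
    have "(\<Sum>r<Suc t. v' r) \<le> (\<Sum>r<Suc t. v r)" using L'(2)[of t e] e YY t by auto
    moreover have "(\<Sum>r<Suc t. v r) \<le> (\<Sum>r<Suc t. v' r)" using L(2)[of t e'] e' YY t by auto
    ultimately show ?case by simp
  qed simp
  have aux: False if lt: "a < b" and La: "\<And>e. e \<notin> Ya a \<Longrightarrow> (\<Sum>r<Suc a. va r) \<le> w e" and sa: "(\<Sum>t\<le>a. va t) = 1"
    and Lb: "\<exists>e. e \<in> Yb (Suc a) \<and> e \<notin> Yb a \<and> w e = (\<Sum>r<Suc a. vb r)" and sb: "(\<Sum>t\<le>b. vb t) = 1"
    and vb: "\<And>t. t \<le> b \<Longrightarrow> 0 < vb t" and eq: "\<And>e. e \<in> Ya a \<longleftrightarrow> e \<in> Yb a"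
    for a b :: nat and va vb :: "nat \<Rightarrow> real" and Ya Yb :: "nat \<Rightarrow> 'e set"
  proof -
    obtain e where e: "e \<notin> Yb a" "w e = (\<Sum>r<Suc a. vb r)" using Lb by blast
    have "1 \<le> w e" using La[of e] e(1) eq sa by (simp add: lessThan_Suc_atMost)
    moreover have "(\<Sum>r<Suc a. vb r) < (\<Sum>t\<le>b. vb t)"
      by (rule sum_strict_mono2[of _ _ b]) (use lt vb in \<open>auto intro: less_imp_le\<close>)
    ultimately show False using e(2) sb by simp
  qed
  show n: "n = n'"
  proof (rule ccontr)
    assume "n \<noteq> n'"
    then consider "n < n'" | "n' < n" by linarith
    then show False
    proof cases
      case 1
      have "e \<in> Y n \<longleftrightarrow> e \<in> Y' n" for e using L(1)[of n e] L'(1)[of n e] P[of n] 1 by simp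
      then show False using aux[OF 1, of Y v Y' v'] L(2)[of n] s L'(3)[OF 1] s' v' by blast
    next
      case 2
      have "e \<in> Y' n' \<longleftrightarrow> e \<in> Y n'" for e using L(1)[of n' e] L'(1)[of n' e] P[of n'] 2 by simp
      then show False using aux[OF 2, of Y' v' Y v] L'(2)[of n'] s' L(3)[OF 2] s v by blast
    qed
  qed
  show "v t = v' t" if t: "t \<le> n" for t
  proof -
    have "(\<Sum>r<Suc t. v r) = (\<Sum>r<Suc t. v' r)"
    proof (cases "t = n")
      case True
      then show ?thesis using s s' n by (simp only: lessThan_Suc_atMost)
    qed (use P[of "Suc t"] t n in auto)
    then show ?thesis using P[of t] t n by simp
  qed
  show "Y t = Y' t" if "t \<le> n" for t
  proof -
    have "e \<in> Y t \<longleftrightarrow> e \<in> Y' t" for e using L(1)[of t e] L'(1)[of t e] P[of t] that n by simp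
    then show ?thesis by blast
  qed
qed

subsection \<open>The quotient\<close>

context finite_graph begin

abbreviation "NS \<equiv> nerve_simplices FC"
abbreviation "BC \<equiv> classifying_space FC"
abbreviation "RR \<equiv> realization_rel FC"

lemma topspace_NS: "((n, s), u) \<in> topspace NS \<longleftrightarrow> s \<in> nerve FC n \<and> u \<in> standard_simplex n"
  by (auto simp: nerve_simplices_def)

lemma topspace_BC: "topspace BC = (\<lambda>z. RR `` {z}) ` topspace NS"
proof
  show "topspace BC \<subseteq> (\<lambda>z. RR `` {z}) ` topspace NS"
    using openin_topspace[of BC] unfolding classifying_space_def openin_quotient_topology by blast
  have "openin BC ((\<lambda>z. RR `` {z}) ` topspace NS)"
  proof -
    have "{z \<in> topspace NS. RR `` {z} \<in> (\<lambda>z. RR `` {z}) ` topspace NS} = topspace NS" by blast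
    then show ?thesis unfolding classifying_space_def openin_quotient_topology by simp
  qed
  then show "(\<lambda>z. RR `` {z}) ` topspace NS \<subseteq> topspace BC" by (rule openin_subset)
qed

lemma RR_sym: "(z, z') \<in> RR \<Longrightarrow> (z', z) \<in> RR"
  unfolding realization_rel_def by (meson sym_Un_converse sym_rtrancl symD)

lemma RR_trans: "(z, z') \<in> RR \<Longrightarrow> (z', z'') \<in> RR \<Longrightarrow> (z, z'') \<in> RR"
  unfolding realization_rel_def by (rule rtrancl_trans)

lemma RR_refl: "(z, z) \<in> RR"
  unfolding realization_rel_def by simp

lemma RR_class: assumes "(z, z') \<in> RR" shows "RR `` {z} = RR `` {z'}"
  using assms RR_sym RR_trans by blast

lemma RR_step:
  "s \<in> nerve FC n \<Longrightarrow> \<theta> \<in> {..m} \<rightarrow> {..n} \<Longrightarrow> mono_on {..m} \<theta> \<Longrightarrow> u \<in> standard_simplex m \<Longrightarrow>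
    (((m, nerve_pullback m \<theta> s), u), ((n, s), simplex_push m \<theta> u)) \<in> RR"
  unfolding realization_rel_def realization_step_def by (intro r_into_rtrancl) blast

lemma step_facts:
  assumes "(z, z') \<in> realization_step FC"
  shows "z \<in> topspace NS" "z' \<in> topspace NS" "chain_pt z = chain_pt z'"
proof -
  obtain m n \<theta> s u where zz: "z = ((m, nerve_pullback m \<theta> s), u)" "z' = ((n, s), simplex_push m \<theta> u)"
    and a: "s \<in> nerve FC n" "\<theta> \<in> {..m} \<rightarrow> {..n}" "mono_on {..m} \<theta>" "u \<in> standard_simplex m"
    using assms unfolding realization_step_def by blast
  show "z \<in> topspace NS" "z' \<in> topspace NS" "chain_pt z = chain_pt z'"
    unfolding zz topspace_NS
    using a nerve_pullback_in_nerve[OF a(1-3)] simplex_push_in_simplex[OF a(4,2)] chain_pt_step[OF a] by auto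
qed

lemma RR_facts:
  assumes "(z, z') \<in> RR"
  shows "chain_pt z' = chain_pt z" "z \<in> topspace NS \<Longrightarrow> z' \<in> topspace NS"
proof -
  have "chain_pt z' = chain_pt z \<and> (z \<in> topspace NS \<longrightarrow> z' \<in> topspace NS)"
    using assms unfolding realization_rel_def
  proof (induction rule: rtrancl_induct)
    case (step y y')
    then show ?case using step_facts[of y y'] step_facts[of y' y] by auto
  qed simp
  then show "chain_pt z' = chain_pt z" "z \<in> topspace NS \<Longrightarrow> z' \<in> topspace NS" by auto
qed

text \<open>By \<open>RR_facts\<close> all members of an equivalence class give the same configuration, so the choice
  of a representative is harmless.\<close>

definition iota :: "'c face_arrow nerve_point set \<Rightarrow> nat \<Rightarrow> 'a" where
  "iota K = chain_pt (SOME z. z \<in> K)"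

lemma iota_eq: assumes "z \<in> K" "\<And>z'. z' \<in> K \<Longrightarrow> chain_pt z' = chain_pt z" shows "iota K = chain_pt z"
  unfolding iota_def using someI[of "\<lambda>z. z \<in> K", OF assms(1)] assms(2) by blast

lemma iota_class: "iota (RR `` {z}) = chain_pt z"
  by (rule iota_eq) (use RR_refl RR_facts(1) in auto)

lemma chain_weight_continuous: "continuous_map (subtopology (powertop_real UNIV) (standard_simplex n)) euclideanreal (\<lambda>u. chain_weight n s u e)"
  unfolding chain_weight_def
  by (intro continuous_map_sum continuous_map_from_subtopology continuous_map_product_projection) auto

lemma chain_pt_continuous:
  assumes s: "s \<in> nerve FC n"
  shows "continuous_map (subtopology (powertop_real UNIV) (standard_simplex n)) (conf_space k (Space X)) (\<lambda>u. chain_pt ((n, s), u))"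
proof -
  let ?T = "subtopology (powertop_real UNIV) (standard_simplex n)"
  define d where "d = fst (s (n, n))"
  have d: "d \<in> Index CX" unfolding d_def using nerveD(1)[OF s order_refl] by simp
  have "continuous_map ?T (Dom CX d) (\<lambda>u. lift_pt (gap_pt d (chain_weight n s u)))"
  proof (rule continuous_map_into_Dom_comp[OF d])
    fix i assume i: "i < k"
    show "continuous_map ?T euclideanreal (\<lambda>u. gap_pt d (chain_weight n s u) i)"
    proof (cases "label d i \<in> E")
      case True
      have "chain_weight n s u (label d i, -1) + chain_weight n s u (label d i, 1) + real (npts d (label d i)) - 1 \<noteq> 0"
        if "u \<in> topspace ?T" for u
      proof -
        have u: "u \<in> standard_simplex n" using that by simp
        show ?thesis
          using gap_total_pos[OF chain_weight_facts(1)[OF s u] admissible_chain_weight(2)[OF s u] i refl] by (simp add: d_def)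
      qed
      then show ?thesis
        unfolding gap_pt_def Let_def using True by (auto intro!: continuous_intros chain_weight_continuous)
    qed (simp add: gap_pt_V)
  qed (use in_params_chain_weight[OF s] in \<open>simp add: d_def\<close>)
  then have "continuous_map ?T (conf_space k (Space X)) (\<lambda>u. Char CX d (lift_pt (gap_pt d (chain_weight n s u))))"
    using continuous_map_compose[OF _ Char_comp_continuous[OF d]] by (fastforce simp: o_def)
  then show ?thesis by (simp add: Char_comp_lift_pt chain_pt_def d_def)
qed

lemma openin_BC: "openin BC U \<longleftrightarrow> U \<subseteq> topspace BC \<and>
    (\<forall>n s. s \<in> nerve FC n \<longrightarrow> openin (subtopology (powertop_real UNIV) (standard_simplex n))
        {u \<in> standard_simplex n. RR `` {((n, s), u)} \<in> U})"
proof -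
  have top: "openin NS W \<longleftrightarrow> W \<subseteq> topspace NS \<and> (\<forall>n s. s \<in> nerve FC n \<longrightarrow>
      openin (subtopology (powertop_real UNIV) (standard_simplex n)) {u. ((n, s), u) \<in> W})" for W
    by (simp add: nerve_simplices_def openin_sum_topology)
  have "{u. ((n, s), u) \<in> {z \<in> topspace NS. RR `` {z} \<in> U}} = {u \<in> standard_simplex n. RR `` {((n, s), u)} \<in> U}"
    if "s \<in> nerve FC n" for n s using that by (auto simp: topspace_NS)
  then have "openin NS {z \<in> topspace NS. RR `` {z} \<in> U} \<longleftrightarrow>
     (\<forall>n s. s \<in> nerve FC n \<longrightarrow> openin (subtopology (powertop_real UNIV) (standard_simplex n))
        {u \<in> standard_simplex n. RR `` {((n, s), u)} \<in> U})"
    unfolding top by simp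
  then show ?thesis
    unfolding topspace_BC unfolding classifying_space_def openin_quotient_topology by simp
qed

lemma iota_continuous: "continuous_map BC (conf_space k (Space X)) iota"
  unfolding continuous_map_def
proof (intro conjI allI impI)
  show "iota \<in> topspace BC \<rightarrow> topspace (conf_space k (Space X))"
  proof
    fix K assume "K \<in> topspace BC"
    then obtain n s u where "((n, s), u) \<in> topspace NS" "K = RR `` {((n, s), u)}"
      unfolding topspace_BC by (metis (no_types, lifting) imageE prod.collapse)
    then show "iota K \<in> topspace (conf_space k (Space X))"
      by (simp add: iota_class topspace_conf_space topspace_NS chain_pt_conf)
  qed
  fix U assume U: "openin (conf_space k (Space X)) U"
  show "openin BC {K \<in> topspace BC. iota K \<in> U}"
    unfolding openin_BC
  proof (intro conjI allI impI)
    fix n s assume s: "s \<in> nerve FC n"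
    have "{u \<in> standard_simplex n. RR `` {((n, s), u)} \<in> {K \<in> topspace BC. iota K \<in> U}}
        = {u \<in> topspace (subtopology (powertop_real UNIV) (standard_simplex n)). chain_pt ((n, s), u) \<in> U}"
      using s by (auto simp: topspace_BC iota_class topspace_NS)
    then show "openin (subtopology (powertop_real UNIV) (standard_simplex n))
        {u \<in> standard_simplex n. RR `` {((n, s), u)} \<in> {K \<in> topspace BC. iota K \<in> U}}"
      using openin_continuous_map_preimage[OF chain_pt_continuous[OF s] U] by simp
  qed auto
qed

subsection \<open>Nondegenerate representatives\<close>

text \<open>Every point of the classifying space has such a representative (\<open>nondeg_exists\<close>), obtained by deleting
  vertices with coordinate 0 and identity arrows. As the category is acyclic, arrows between different
  cells are exactly the arrows that are not identities.\<close>

definition nondeg :: "nat \<Rightarrow> (nat \<times> nat \<Rightarrow> 'c face_arrow) \<Rightarrow> (nat \<Rightarrow> real) \<Rightarrow> bool" where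
  "nondeg n s u \<longleftrightarrow> s \<in> nerve FC n \<and> u \<in> standard_simplex n \<and> (\<forall>i\<le>n. 0 < u i) \<and>
     (\<forall>i<n. fst (s (i, i)) \<noteq> fst (s (Suc i, Suc i)))"

lemma drop_zero:
  assumes s: "s \<in> nerve FC (Suc n)" and u: "u \<in> standard_simplex (Suc n)" and i: "i \<le> Suc n" "u i = 0"
  shows "\<exists>s' u'. (((Suc n, s), u), ((n, s'), u')) \<in> RR"
proof -
  \<comment> \<open>The coface map that omits vertex \<open>i\<close>.\<close>
  define \<delta> where "\<delta> = (\<lambda>j. if j < i then j else Suc j)"
  define u' where "u' = u \<circ> \<delta>"
  have \<delta>: "\<delta> \<in> {..n} \<rightarrow> {..Suc n}" "mono_on {..n} \<delta>" by (auto simp: \<delta>_def mono_on_def)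
  have push: "simplex_push n \<delta> u' l = u l" for l
  proof -
    consider "l = i" | "l < i" | "i < l" "l \<le> Suc n" | "i < l" "Suc n < l" by linarith
    then show ?thesis
    proof cases
      case 1
      then have "{j. j \<le> n \<and> \<delta> j = l} = {}" by (auto simp: \<delta>_def)
      then show ?thesis using 1 i unfolding simplex_push_def by (metis sum.empty)
    next
      case 2
      then have "{j. j \<le> n \<and> \<delta> j = l} = {l}" using i by (auto simp: \<delta>_def)
      then show ?thesis using 2 by (simp add: simplex_push_def u'_def \<delta>_def)
    next
      case 3
      then have "{j. j \<le> n \<and> \<delta> j = l} = {l - 1}" by (auto simp: \<delta>_def)
      then show ?thesis using 3 by (simp add: simplex_push_def u'_def \<delta>_def)
    next
      case 4
      then have "{j. j \<le> n \<and> \<delta> j = l} = {}" by (auto simp: \<delta>_def)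
      then show ?thesis using 4 simplex_out[OF u, of l] unfolding simplex_push_def by (metis sum.empty)
    qed
  qed
  have "u' \<in> standard_simplex n"
  proof -
    have "(\<Sum>l\<in>{..Suc n}. \<Sum>j\<in>{j \<in> {..n}. \<delta> j = l}. u' j) = sum u' {..n}"
      using \<delta> by (intro sum.group) auto
    moreover have "(\<Sum>j\<in>{j \<in> {..n}. \<delta> j = l}. u' j) = u l" for l using push[of l] by (simp add: simplex_push_def)
    ultimately have "sum u' {..n} = 1" using simplex_sum[OF u] by simp
    moreover have "u' j = 0" if "n < j" for j using simplex_out[OF u, of "\<delta> j"] that i by (auto simp: u'_def \<delta>_def)
    ultimately show ?thesis using u by (simp add: standard_simplex_def u'_def)
  qed
  then have "(((n, nerve_pullback n \<delta> s), u'), ((Suc n, s), simplex_push n \<delta> u')) \<in> RR"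
    by (rule RR_step[OF s \<delta>])
  moreover have "simplex_push n \<delta> u' = u" using push by auto
  ultimately show ?thesis using RR_sym by metis
qed

lemma drop_identity:
  assumes s: "s \<in> nerve FC (Suc n)" and u: "u \<in> standard_simplex (Suc n)" and i: "i < Suc n" "fst (s (i, i)) = fst (s (Suc i, Suc i))"
  shows "\<exists>s' u'. (((Suc n, s), u), ((n, s'), u')) \<in> RR"
proof -
  \<comment> \<open>The coface map that omits vertex \<open>i + 1\<close>, and the codegeneracy that identifies it with vertex \<open>i\<close>;
    the chain is degenerate with respect to the latter.\<close>
  define \<delta> where "\<delta> = (\<lambda>j. if j \<le> i then j else Suc j)"
  define \<sigma> where "\<sigma> = (\<lambda>j. if j \<le> i then j else j - 1)"
  have \<delta>: "\<delta> \<in> {..n} \<rightarrow> {..Suc n}" "mono_on {..n} \<delta>" by (auto simp: \<delta>_def mono_on_def)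
  have \<sigma>: "\<sigma> \<in> {..Suc n} \<rightarrow> {..n}" "mono_on {..Suc n} \<sigma>" using i by (auto simp: \<sigma>_def mono_on_def)
  define s' where "s' = nerve_pullback n \<delta> s"
  have s': "s' \<in> nerve FC n" unfolding s'_def by (rule nerve_pullback_in_nerve[OF s \<delta>])
  have cat_id: "Comp FC f (Ident FC (fst f)) = f" "Comp FC (Ident FC (fst (snd f))) f = f" if "f \<in> Arr FC" for f
    using category_FC that by (auto simp: category_def Src_FC Tgt_FC)
  have id: "s (i, Suc i) = Ident FC (fst (s (i, i)))"
  proof -
    have "s (i, Suc i) \<in> cat_hom FC (fst (s (i, i))) (fst (s (i, i)))"
      using nerveD(2)[OF s, of i "Suc i"] i by (simp add: cat_hom_def Src_FC Tgt_FC)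
    then show ?thesis using acyclic_category_FC nerveD(1)[OF s, of i] i by (auto simp: acyclic_category_def Obj_FC)
  qed
  have r1: "s (i, b) = s (Suc i, b)" if "Suc i \<le> b" "b \<le> Suc n" for b
  proof -
    have "s (i, b) = Comp FC (s (Suc i, b)) (s (i, Suc i))" using nerveD(3)[OF s, of i "Suc i" b] that by simp
    then show ?thesis using cat_id(1)[of "s (Suc i, b)"] nerveD(2)[OF s that] id i(2) by metis
  qed
  have r2: "s (a, Suc i) = s (a, i)" if "a \<le> i" for a
  proof -
    have ai: "s (a, i) \<in> Arr FC \<and> fst (snd (s (a, i))) = fst (s (i, i))" using nerveD(2)[OF s that] i by simp
    have "s (a, Suc i) = Comp FC (s (i, Suc i)) (s (a, i))" using nerveD(3)[OF s that, of "Suc i"] i by simp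
    then show ?thesis using cat_id(2)[of "s (a, i)"] ai id by metis
  qed
  have key: "s (\<delta> (\<sigma> a), \<delta> (\<sigma> b)) = s (a, b)" if ab: "a \<le> b" "b \<le> Suc n" for a b
  proof -
    have ds: "\<delta> (\<sigma> x) = (if x = Suc i then i else x)" for x by (auto simp: \<delta>_def \<sigma>_def)
    show ?thesis
    proof (cases "a = Suc i")
      case True
      then show ?thesis using r1[of b] r1[of "Suc i"] r2[of i] ab unfolding ds by (cases "b = Suc i") auto
    next
      case False
      then show ?thesis using r2[of a] ab unfolding ds by (cases "b = Suc i") auto
    qed
  qed
  have "nerve_pullback (Suc n) \<sigma> s' = s"
  proof (rule ext)
    fix x :: "nat \<times> nat"
    obtain a b where x: "x = (a, b)" by (cases x)
    show "nerve_pullback (Suc n) \<sigma> s' x = s x"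
    proof (cases "a \<le> b \<and> b \<le> Suc n")
      case True
      then have "\<sigma> a \<le> \<sigma> b" "\<sigma> b \<le> n" using \<sigma> by (auto simp: mono_on_def Pi_iff)
      then show ?thesis using True key by (simp add: x nerve_pullback_def s'_def)
    next
      case False
      moreover have "s \<in> extensional {(i, j). i \<le> j \<and> j \<le> Suc n}" using s by (simp add: nerve_def)
      ultimately show ?thesis by (auto simp: x nerve_pullback_def extensional_def)
    qed
  qed
  then show ?thesis using RR_step[OF s' \<sigma> u] by metis
qed

lemma nondeg_exists:
  assumes "((n, s), u) \<in> topspace NS"
  shows "\<exists>n' s' u'. (((n, s), u), ((n', s'), u')) \<in> RR \<and> nondeg n' s' u'"
  using assms
proof (induction n arbitrary: s u rule: less_induct)
  case (less n)
  have s: "s \<in> nerve FC n" and u: "u \<in> standard_simplex n" using less.prems by (auto simp: topspace_NS)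
  have rec: ?case if "\<exists>s' u'. (((n, s), u), ((n0, s'), u')) \<in> RR" "n0 < n" for n0
  proof -
    obtain s' u' where r: "(((n, s), u), ((n0, s'), u')) \<in> RR" using \<open>\<exists>s' u'. _\<close> by blast
    then have "((n0, s'), u') \<in> topspace NS" using RR_facts(2) less.prems by blast
    then show ?thesis using less.IH[OF \<open>n0 < n\<close>] RR_trans[OF r] by blast
  qed
  show ?case
  proof (cases "nondeg n s u")
    case True
    then show ?thesis using RR_refl by blast
  next
    case False
    show ?thesis
    proof (cases n)
      case 0
      then have "u 0 = 1" using simplex_sum[OF u] by simp
      then show ?thesis using False s u 0 by (auto simp: nondeg_def)
    next
      case (Suc n0)
      consider i where "i \<le> n" "u i = 0" | i where "i < n" "fst (s (i, i)) = fst (s (Suc i, Suc i))"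
        using False s u simplex_nonneg[OF u] unfolding nondeg_def by (metis less_eq_real_def)
      then show ?thesis
      proof cases
        case 1
        then show ?thesis using rec[of n0] drop_zero[of s n0 u i] s u Suc by auto
      next
        case 2
        then show ?thesis using rec[of n0] drop_identity[of s n0 u i] s u Suc by auto
      qed
    qed
  qed
qed

text \<open>Every arrow that is not an identity moves a coordinate from a vertex to a 1-cell.\<close>

lemma nondeg_length: assumes N: "nondeg n s u" shows "n \<le> k"
proof -
  have s: "s \<in> nerve FC n" using N by (simp add: nondeg_def)
  define D where "D j = {i. i < k \<and> label (fst (s (j, j))) i \<in> E}" for j
  have "j \<le> card (D j)" if "j \<le> n" for j
    using that
  proof (induction j)
    case (Suc j)
    obtain b where b: "s (j, Suc j) = (fst (s (j, j)), fst (s (Suc j, Suc j)), b)"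
      "(fst (s (j, j)), fst (s (Suc j, Suc j)), b) \<in> Arr FC"
      using nerve_arrow[OF s, of j "Suc j"] Suc.prems by auto
    have sub: "D j \<subseteq> D (Suc j)" using arrow_label_E[OF b(2)] by (auto simp: D_def)
    have "fst (s (j, j)) \<noteq> fst (s (Suc j, Suc j))" using N Suc.prems by (simp add: nondeg_def)
    then have "arrow_ends (fst (s (j, j)), fst (s (Suc j, Suc j)), b) \<noteq> {}"
      using arrow_ends_empty_iff[OF b(2)] by (auto simp: Ident_FC)
    then obtain i where i: "i < k" "label (fst (s (j, j))) i \<noteq> label (fst (s (Suc j, Suc j))) i"
      using arrow_ends_empty_if_labels[OF b(2)] by blast
    then have "i \<in> D (Suc j)" "i \<notin> D j" using arrow_end_sign(4)[OF b(2) i] by (auto simp: D_def)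
    then have "card (D j) < card (D (Suc j))" using sub by (intro psubset_card_mono) (auto simp: D_def)
    then show ?case using Suc by simp
  qed simp
  then have "n \<le> card (D n)" by simp
  also have "\<dots> \<le> card {..<k}" by (rule card_mono) (auto simp: D_def)
  finally show ?thesis by simp
qed

text \<open>Finitely many simplices suffice to cover the classifying space.\<close>

lemma BC_compact: "compact_space BC"
proof -
  define J where "J = (SIGMA n:{..k}. nerve FC n)"
  have finJ: "finite J" unfolding J_def
  proof (intro finite_SigmaI)
    fix n :: nat
    let ?I = "{(i, j). i \<le> j \<and> j \<le> n}"
    have "nerve FC n \<subseteq> ?I \<rightarrow>\<^sub>E Arr FC"
    proof
      fix s assume s: "s \<in> nerve FC n"
      then have "s \<in> extensional ?I" by (simp add: nerve_def)
      then show "s \<in> ?I \<rightarrow>\<^sub>E Arr FC" using nerveD(2)[OF s] by (auto simp: PiE_iff)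
    qed
    moreover have "finite ?I" by (rule finite_subset[of _ "{..n} \<times> {..n}"]) auto
    then have "finite (?I \<rightarrow>\<^sub>E Arr FC)" using finite_category_FC by (intro finite_PiE) (auto simp: finite_category_def)
    ultimately show "finite (nerve FC n)" by (rule finite_subset)
  qed simp
  define Q where "Q j = (\<lambda>u. RR `` {(j, u)}) ` standard_simplex (fst j)" for j
  have "compactin BC (Q j)" if j: "j \<in> J" for j
  proof -
    obtain n s where ns: "j = (n, s)" "s \<in> nerve FC n" using j by (auto simp: J_def)
    have "continuous_map (subtopology (powertop_real UNIV) (standard_simplex n)) BC (\<lambda>u. RR `` {((n, s), u)})"
      unfolding continuous_map_def using ns(2) by (auto simp: topspace_BC topspace_NS openin_BC)
    moreover have "compactin (subtopology (powertop_real UNIV) (standard_simplex n)) (standard_simplex n)"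
      using compactin_standard_simplex by (simp add: compactin_subtopology)
    ultimately have "compactin BC ((\<lambda>u. RR `` {((n, s), u)}) ` standard_simplex n)"
      by (rule image_compactin[rotated])
    then show ?thesis by (simp add: Q_def ns(1))
  qed
  then have "compactin BC (\<Union> (Q ` J))" using finJ by (intro compactin_Union) auto
  moreover have "topspace BC \<subseteq> \<Union> (Q ` J)"
  proof
    fix K assume "K \<in> topspace BC"
    then obtain n s u where z: "((n, s), u) \<in> topspace NS" "K = RR `` {((n, s), u)}"
      unfolding topspace_BC by (metis (no_types, lifting) imageE prod.collapse)
    obtain n' s' u' where z': "(((n, s), u), ((n', s'), u')) \<in> RR" "nondeg n' s' u'" using nondeg_exists[OF z(1)] by blast
    have "(n', s') \<in> J" using nondeg_length[OF z'(2)] z'(2) by (simp add: J_def nondeg_def)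
    moreover have "K \<in> Q (n', s')" using z'(2) RR_class[OF z'(1)] z(2) by (auto simp: Q_def nondeg_def)
    ultimately show "K \<in> \<Union> (Q ` J)" by blast
  qed
  ultimately show ?thesis by (metis compact_space_def compactin_subset_topspace subset_antisym)
qed

subsection \<open>Injectivity\<close>

text \<open>On a 1-cell with at least two coordinates the gap between neighbours is the unit of length. With a
  single coordinate only the ratio of the two weights is visible; but then one of them is 1,
  because the two ends cannot both be reached.\<close>

lemma gap_pt_weights_unique:
  assumes c: "c \<in> Index CX"
    and w: "\<And>e. 0 < w e" "\<And>e. w e \<le> 1" "admissible c {e. w e < 1}"
    and w': "\<And>e. 0 < w' e" "\<And>e. w' e \<le> 1" "admissible c {e. w' e < 1}"
    and eq: "\<And>i. i < k \<Longrightarrow> gap_pt c w i = gap_pt c w' i"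
  shows "w = w'"
proof (rule ext)
  fix e :: "'c \<times> real"
  obtain m \<sigma> where e: "e = (m, \<sigma>)" by (cases e)
  show "w e = w' e"
  proof (cases "m \<in> E \<and> \<bar>\<sigma>\<bar> = 1 \<and> 0 < npts c m")
    case False
    then have "\<not> w e < 1" "\<not> w' e < 1" using admissibleD(1)[OF w(3), of m \<sigma>] admissibleD(1)[OF w'(3), of m \<sigma>] e by auto
    then show ?thesis using w(2)[of e] w'(2)[of e] by simp
  next
    case True
    define a b a' b' where "a = w (m, -1)" and "b = w (m, 1)" and "a' = w' (m, -1)" and "b' = w' (m, 1)"
    define r where "r = real (npts c m)"
    have pos: "0 < a" "0 < b" "0 < a'" "0 < b'" using w(1) w'(1) by (auto simp: a_def b_def a'_def b'_def)
    have le: "a \<le> 1" "b \<le> 1" "a' \<le> 1" "b' \<le> 1" using w(2) w'(2) by (auto simp: a_def b_def a'_def b'_def)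
    have r1: "1 \<le> r" using True by (simp add: r_def)
    have D: "0 < a + b + r - 1" "0 < a' + b' + r - 1" using pos r1 by auto
    have q: "(a + real j) / (a + b + r - 1) = (a' + real j) / (a' + b' + r - 1)" if j: "j < npts c m" for j
    proof -
      obtain i where i: "i < k" "label c i = m" "rank_on c i = j" using rank_on_surj[OF c j] by blast
      have "gap_pt c w i = -1 + 2 * ((a + real j) / (a + b + r - 1))" "gap_pt c w' i = -1 + 2 * ((a' + real j) / (a' + b' + r - 1))"
        using i True by (simp_all add: gap_pt_def Let_def a_def b_def a'_def b'_def r_def)
      then show ?thesis using eq[OF i(1)] by argo
    qed
    have "a = a' \<and> b = b'"
    proof (cases "2 \<le> npts c m")
      case True
      have 0: "a / (a + b + r - 1) = a' / (a' + b' + r - 1)" using q[of 0] True by simp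
      have 1: "(a + 1) / (a + b + r - 1) = (a' + 1) / (a' + b' + r - 1)" using q[of 1] True by simp
      have "1 / (a + b + r - 1) = 1 / (a' + b' + r - 1)" using 0 1 by (simp add: add_divide_distrib)
      then have DD: "a + b + r - 1 = a' + b' + r - 1" using D by (simp add: field_simps)
      then have "a = a'" using 0 D by simp
      then show ?thesis using DD by simp
    next
      case False
      then have r: "r = 1" using \<open>m \<in> E \<and> \<bar>\<sigma>\<bar> = 1 \<and> 0 < npts c m\<close> by (simp add: r_def)
      have "a / (a + b) = a' / (a' + b')" using q[of 0] True r by simp
      then have ab: "a * b' = a' * b" using pos by (simp add: field_simps)
      have "a = 1 \<or> b = 1" using admissibleD(4)[OF w(3), of m] False le by (force simp: a_def b_def)
      moreover have "a' = 1 \<or> b' = 1" using admissibleD(4)[OF w'(3), of m] False le by (force simp: a'_def b'_def)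
      moreover have "x = 1 \<and> y = 1" if "x * y = 1" "x \<le> 1" "y \<le> 1" "0 < x" "0 < y" for x y :: real
        using that mult_left_le[of y x] mult_right_le_one_le[of y x] by (metis dual_order.antisym less_imp_le mult.right_neutral mult_left_mono mult.commute)
      ultimately show ?thesis using ab pos le by (metis mult.commute mult_1)
    qed
    then show ?thesis using True e by (auto simp: a_def b_def a'_def b'_def abs_if split: if_splits)
  qed
qed

text \<open>All weights are positive, so the last cell of the chain is the cell of the configuration, and its
  parameters determine the weights. The sets of ends of the arrows into the last cell form a strictly
  increasing filtration, read from the end of the chain, whose weights are the barycentric
  coordinates; both can be recovered, and the sets of ends determine the arrows.\<close>

lemma chain_pt_nondeg_inject:
  assumes N: "nondeg n s u" and N': "nondeg n' s' u'" and eq: "chain_pt ((n, s), u) = chain_pt ((n', s'), u')"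
  shows "((n, s), u) = ((n', s'), u')"
proof -
  have s: "s \<in> nerve FC n" and u: "u \<in> standard_simplex n" and pos: "\<And>i. i \<le> n \<Longrightarrow> 0 < u i"
    and s': "s' \<in> nerve FC n'" and u': "u' \<in> standard_simplex n'" and pos': "\<And>i. i \<le> n' \<Longrightarrow> 0 < u' i"
    using N N' by (auto simp: nondeg_def)
  define c where "c = fst (s (n, n))"
  have c: "c \<in> Index CX" unfolding c_def using nerveD(1)[OF s order_refl] by simp
  have wp: "0 < chain_weight n s u e" for e using chain_weight_facts(4)[OF s u, of e] pos[of n] by simp
  have wp': "0 < chain_weight n' s' u' e" for e using chain_weight_facts(4)[OF s' u', of e] pos'[of n'] by simp
  have "fst (s' (n', n')) \<in> Index CX" using nerveD(1)[OF s' order_refl] by simp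
  then have c': "fst (s' (n', n')) = c"
    using braid_proj_gap_pt(2)[of c "chain_weight n s u", OF c wp] braid_proj_gap_pt(2)[of _ "chain_weight n' s' u'", OF _ wp'] eq
    by (simp add: chain_pt_def c_def)
  have p: "gap_pt c (chain_weight n s u) i = gap_pt c (chain_weight n' s' u') i" if i: "i < k" for i
  proof (cases "label c i \<in> E")
    case True
    have int: "-1 < gap_pt c w i \<and> gap_pt c w i < 1" if w: "\<And>e. 0 < w e" for w
    proof -
      have "{e. w e = 0} = {}" using w by (metis (mono_tags, lifting) Collect_empty_eq less_irrefl)
      then have a: "admissible c {e. w e = 0}" by (simp add: admissible_def)
      have w0: "0 \<le> w e" for e using w[of e] by simp
      show ?thesis
        using gap_pt_values[OF c w0 a i refl True] w[of "(label c i, -1)"] w[of "(label c i, 1)"] by force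
    qed
    have "conf_of (label c) (gap_pt c (chain_weight n s u)) = conf_of (label c) (gap_pt c (chain_weight n' s' u'))"
      using eq c' by (simp add: chain_pt_def c_def)
    from fun_cong[OF this, of i] have "char1 X (label c i) (gap_pt c (chain_weight n s u) i) = char1 X (label c i) (gap_pt c (chain_weight n' s' u') i)"
      using i by (simp add: conf_of_def)
    moreover have "param X (char1 X (label c i) (gap_pt c (chain_weight n s u) i)) = gap_pt c (chain_weight n s u) i"
      using param_char1_E[OF True] int[of "chain_weight n s u", OF wp] by blast
    moreover have "param X (char1 X (label c i) (gap_pt c (chain_weight n' s' u') i)) = gap_pt c (chain_weight n' s' u') i"
      using param_char1_E[OF True] int[of "chain_weight n' s' u'", OF wp'] by blast
    ultimately show ?thesis by presburger
  qed (simp add: gap_pt_V)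
  have ww: "chain_weight n s u = chain_weight n' s' u'"
    by (rule gap_pt_weights_unique[OF c wp chain_weight_facts(2)[OF s u] _ wp' chain_weight_facts(2)[OF s' u'] _ p])
      (use admissible_chain_weight(1)[OF s u] admissible_chain_weight(1)[OF s' u'] c' in \<open>simp_all add: c_def\<close>)
  have filt: "arrow_ends (s (n - t, n)) \<subset> arrow_ends (s (n - Suc t, n))" if N: "nondeg n s u" and t: "t < n" for n s u t
  proof -
    have s: "s \<in> nerve FC n" using N by (simp add: nondeg_def)
    have i: "n - Suc t \<le> Suc (n - Suc t)" "Suc (n - Suc t) \<le> n" "n - t = Suc (n - Suc t)" using t by auto
    obtain b where b: "s (n - Suc t, Suc (n - Suc t)) = (fst (s (n - Suc t, n - Suc t)), fst (s (Suc (n - Suc t), Suc (n - Suc t))), b)"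
      "(fst (s (n - Suc t, n - Suc t)), fst (s (Suc (n - Suc t), Suc (n - Suc t))), b) \<in> Arr FC"
      by (rule nerve_arrow[OF s i(1,2)])
    have "fst (s (n - Suc t, n - Suc t)) \<noteq> fst (s (Suc (n - Suc t), Suc (n - Suc t)))" using N t by (simp add: nondeg_def)
    then have "arrow_ends (s (n - Suc t, Suc (n - Suc t))) \<noteq> {}"
      unfolding b(1) arrow_ends_empty_iff[OF b(2)] by (simp add: Ident_FC)
    then show ?thesis
      using arrow_ends_chain[OF s i(1,2) order_refl] unfolding i(3) by blast
  qed
  have wsum: "chain_weight n s u e = (\<Sum>t | t \<le> n \<and> e \<notin> arrow_ends (s (n - t, n)). u (n - t))" for n s u e
    unfolding chain_weight_def
    by (rule sum.reindex_bij_witness[of _ "\<lambda>t. n - t" "\<lambda>t. n - t"]) auto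
  have usum: "(\<Sum>t\<le>n. u (n - t)) = 1" if "u \<in> standard_simplex n" for n u
    using simplex_sum[OF that] sum.nat_diff_reindex[of u "Suc n"] by (simp add: lessThan_Suc_atMost)
  have F: "\<forall>t<n. arrow_ends (s (n - t, n)) \<subset> arrow_ends (s (n - Suc t, n))" "\<forall>t\<le>n. 0 < u (n - t)"
    "\<forall>e. chain_weight n s u e = (\<Sum>t | t \<le> n \<and> e \<notin> arrow_ends (s (n - t, n)). u (n - t))"
    using filt[OF N] pos wsum by auto
  have F': "\<forall>t<n'. arrow_ends (s' (n' - t, n')) \<subset> arrow_ends (s' (n' - Suc t, n'))" "\<forall>t\<le>n'. 0 < u' (n' - t)"
    "\<forall>e. chain_weight n s u e = (\<Sum>t | t \<le> n' \<and> e \<notin> arrow_ends (s' (n' - t, n')). u' (n' - t))"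
    unfolding ww using filt[OF N'] pos' wsum by auto
  note U = weighted_filtration_unique[of n "\<lambda>t. arrow_ends (s (n - t, n))" "\<lambda>t. u (n - t)" "chain_weight n s u" n'
      "\<lambda>t. arrow_ends (s' (n' - t, n'))" "\<lambda>t. u' (n' - t)", OF F usum[OF u] F' usum[OF u']]
  have n: "n = n'" and uu: "\<And>t. t \<le> n \<Longrightarrow> u (n - t) = u' (n' - t)"
    and ee: "\<And>t. t \<le> n \<Longrightarrow> arrow_ends (s (n - t, n)) = arrow_ends (s' (n' - t, n'))"
    by (fact U)+
  have "u i = u' i" for i
    using uu[of "n - i"] n simplex_out[OF u, of i] simplex_out[OF u', of i] by (cases "i \<le> n") auto
  then have uu': "u = u'" by auto
  have top: "s (i, n) = s' (i, n)" if i: "i \<le> n" for i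
  proof -
    obtain b where b: "s (i, n) = (fst (s (i, i)), c, b)" "(fst (s (i, i)), c, b) \<in> Arr FC"
      using nerve_arrow[OF s i order_refl] unfolding c_def by blast
    have i': "i \<le> n'" using i n by simp
    obtain b' where b': "s' (i, n) = (fst (s' (i, i)), c, b')" "(fst (s' (i, i)), c, b') \<in> Arr FC"
      by (rule nerve_arrow[OF s' i' order_refl, unfolded c', unfolded n[symmetric]])
    have "arrow_ends (s (i, n)) = arrow_ends (s' (i, n))" using ee[of "n - i"] i n by simp
    then show ?thesis using arrow_unique[OF b(2) b'(2)] b(1) b'(1) by simp
  qed
  have ob: "fst (s (i, i)) = fst (s' (i, i))" if "i \<le> n" for i
    using top[OF that] nerveD(2)[OF s that order_refl] nerveD(2)[OF s', of i n] that n by simp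
  have "s (i, j) = s' (i, j)" if ij: "i \<le> j" "j \<le> n" for i j
  proof -
    have in': "i \<le> j" "j \<le> n'" using ij n by auto
    obtain b where b: "s (i, j) = (fst (s (i, i)), fst (s (j, j)), b)" "(fst (s (i, i)), fst (s (j, j)), b) \<in> Arr FC"
      by (rule nerve_arrow[OF s ij])
    obtain b' where b': "s' (i, j) = (fst (s' (i, i)), fst (s' (j, j)), b')" "(fst (s' (i, i)), fst (s' (j, j)), b') \<in> Arr FC"
      by (rule nerve_arrow[OF s' in'])
    have "arrow_ends (s (i, j)) = arrow_ends (s (i, n)) - arrow_ends (s (j, n))"
      using arrow_ends_chain[OF s ij order_refl] by blast
    also have "\<dots> = arrow_ends (s' (i, n)) - arrow_ends (s' (j, n))" using top[of i] top[of j] ij by simp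
    also have "\<dots> = arrow_ends (s' (i, j))"
      using arrow_ends_chain[OF s' in' order_refl] n by blast
    finally show ?thesis
      unfolding b(1) b'(1) using arrow_unique[OF b(2), of "fst (s' (i, i))" b'] b'(2) ob[OF ij(2)] by simp
  qed
  moreover have "s \<in> extensional {(i, j). i \<le> j \<and> j \<le> n}" "s' \<in> extensional {(i, j). i \<le> j \<and> j \<le> n}"
    using s s' n by (auto simp: nerve_def)
  ultimately have "s = s'" by (intro extensionalityI[of s "{(i, j). i \<le> j \<and> j \<le> n}"]) auto
  then show ?thesis using n uu' by simp
qed

lemma iota_inj: "inj_on iota (topspace BC)"
proof (rule inj_onI)
  have nd: "\<exists>n s u. nondeg n s u \<and> K = RR `` {((n, s), u)}" if K: "K \<in> topspace BC" for K
  proof -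
    obtain n s u where z: "((n, s), u) \<in> topspace NS" "K = RR `` {((n, s), u)}"
      using K unfolding topspace_BC by (metis (no_types, lifting) imageE prod.collapse)
    obtain n' s' u' where z': "(((n, s), u), ((n', s'), u')) \<in> RR" "nondeg n' s' u'" using nondeg_exists[OF z(1)] by blast
    then show ?thesis using RR_class[OF z'(1)] z(2) by blast
  qed
  fix K K' assume K: "K \<in> topspace BC" "K' \<in> topspace BC" "iota K = iota K'"
  obtain n s u where z: "nondeg n s u" "K = RR `` {((n, s), u)}" using nd[OF K(1)] by blast
  obtain n' s' u' where z': "nondeg n' s' u'" "K' = RR `` {((n', s'), u')}" using nd[OF K(2)] by blast
  have "chain_pt ((n, s), u) = chain_pt ((n', s'), u')" using K(3) z(2) z'(2) by (simp add: iota_class)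
  then show "K = K'" using chain_pt_nondeg_inject[OF z(1) z'(1)] z(2) z'(2) by simp
qed

lemma Hausdorff_conf: "Hausdorff_space (conf_space k (Space X))"
  unfolding conf_space_def power_space_def
  by (intro Hausdorff_space_subtopology) (simp add: Hausdorff_space_product_topology Hausdorff_X)

lemma iota_embedding: "embedding_map BC (conf_space k (Space X)) iota"
  by (rule continuous_imp_embedding_map[OF iota_continuous BC_compact Hausdorff_conf iota_inj])

end

section \<open>Equivariance\<close>

lemma level_partition_permute:
  assumes "bij p"
  shows "level_partition (p ` I) (\<lambda>i. s (inv p i)) = map ((`) p) (level_partition I s)"
proof -
  have i: "inv p (p i) = i" for i using assms by (simp add: bij_is_inj)
  have "(\<lambda>i. s (inv p i)) ` p ` I = s ` I" using i by (auto simp: image_image)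
  moreover have "{j \<in> p ` I. s (inv p j) = v} = p ` {i \<in> I. s i = v}" for v using i by auto
  ultimately show ?thesis by (simp add: level_partition_def)
qed

context finite_graph begin

context
  fixes p :: "nat \<Rightarrow> nat"
  assumes p: "p permutes {..<k}"
begin

lemma inv_p [simp]: "inv p (p i) = i" "p (inv p i) = i"
  using permutes_inverses[OF p] by auto

lemma p_less [simp]: "p i < k \<longleftrightarrow> i < k"
  using permutes_in_image[OF p, of i] by simp

lemma inv_p_less [simp]: "inv p i < k \<longleftrightarrow> i < k"
  using p_less[of "inv p i"] by simp

lemma p_ge: "\<not> i < k \<Longrightarrow> p i = i" "\<not> i < k \<Longrightarrow> inv p i = i"
  using permutes_not_in[OF p, of i] permutes_not_in[OF permutes_inv[OF p], of i] by auto

lemma p_eq [simp]: "p i = p j \<longleftrightarrow> i = j"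
  using inv_p(1) by metis

lemma perm_tuple_p: "perm_tuple p x (p i) = x i"
  by (simp add: perm_tuple_def)

lemma perm_tuple_conf: "x \<in> CF \<Longrightarrow> perm_tuple p x \<in> CF"
proof -
  assume x: "x \<in> CF"
  have "inv p i = inv p j \<longleftrightarrow> i = j" for i j by (metis inv_p(2))
  then show ?thesis using x p_ge(2) by (auto simp: conf_iff perm_tuple_def extensional_def)
qed

lemma card_image_p: "card (p ` A) = card A"
  by (rule card_image) (simp add: inj_on_def)

lemma braid_proj_perm: "braid_proj k X (perm_tuple p x) = perm_index X p (braid_proj k X x)"
proof -
  define l where "l = (\<lambda>i\<in>{..<k}. proj X (x i))"
  have l': "(\<lambda>i\<in>{..<k}. proj X (perm_tuple p x i)) = perm_tuple p l"
    using p_ge(2) by (auto simp: l_def perm_tuple_def fun_eq_iff restrict_def)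
  have I: "coords_on k (perm_tuple p l) m = p ` coords_on k l m" for m
  proof (intro equalityI subsetI)
    fix i assume "i \<in> coords_on k (perm_tuple p l) m"
    then have "inv p i \<in> coords_on k l m" by (simp add: coords_on_def perm_tuple_def)
    then show "i \<in> p ` coords_on k l m" by (metis imageI inv_p(2))
  qed (auto simp: coords_on_def perm_tuple_def)
  have "level_partition (coords_on k (perm_tuple p l) m) (\<lambda>i. parameter X m (perm_tuple p x i)) =
      map ((`) p) (level_partition (coords_on k l m) (\<lambda>i. parameter X m (x i)))" for m
    using level_partition_permute[OF permutes_bij[OF p], of "coords_on k l m" "\<lambda>i. parameter X m (x i)"]
    unfolding I by (simp add: perm_tuple_def)
  then show ?thesis
    unfolding braid_proj_def Let_def l' l_def[symmetric] perm_index_def by (auto simp: fun_eq_iff restrict_def)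
qed

lemma perm_index_Index: assumes "c \<in> Index CX" shows "perm_index X p c \<in> Index CX"
  using braid_proj_perm[of "rep_conf c"] rep_conf[OF assms] braid_proj_Index[OF perm_tuple_conf[OF rep_conf(1)[OF assms]]] by simp

lemma label_perm [simp]: "label (perm_index X p c) (p i) = label c i"
  by (cases c) (simp add: perm_index_def label_def perm_tuple_p)

lemma label_perm_inv: "label (perm_index X p c) i = label c (inv p i)"
  using label_perm[of c "inv p i"] by simp

lemma npts_perm: "npts (perm_index X p c) m = npts c m"
proof -
  have "{i. i < k \<and> label (perm_index X p c) i = m} = p ` {i. i < k \<and> label c i = m}"
  proof (intro equalityI subsetI)
    fix i assume "i \<in> {i. i < k \<and> label (perm_index X p c) i = m}"
    then have "inv p i \<in> {i. i < k \<and> label c i = m}" by (simp add: label_perm_inv)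
    then show "i \<in> p ` {i. i < k \<and> label c i = m}" by (metis imageI inv_p(2))
  qed auto
  then show ?thesis by (simp add: npts_def card_image_p)
qed

lemma rank_on_perm:
  assumes c: "c \<in> Index CX" and i: "i < k" "label c i \<in> E"
  shows "rank_on (perm_index X p c) (p i) = rank_on c i"
proof -
  let ?c = "perm_index X p c"
  note pc = perm_index_Index[OF c]
  have less: "rank_on ?c (p j) < rank_on ?c (p i) \<longleftrightarrow> rank_on c j < rank_on c i" if j: "j < k" "label c j = label c i" for j
  proof -
    define x where "x = perm_tuple p (rep_conf c)"
    have x: "x \<in> CF" "braid_proj k X x = ?c"
      using perm_tuple_conf[OF rep_conf(1)[OF c]] braid_proj_perm[of "rep_conf c"] rep_conf(2)[OF c] by (auto simp: x_def)
    have "rank_on ?c (p j) < rank_on ?c (p i) \<longleftrightarrow> param X (x (p j)) < param X (x (p i))"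
      using in_params_less_iff[OF pc in_params_param(1)[OF x], of "p j" "p i"] i j by simp
    also have "\<dots> \<longleftrightarrow> base_param c j < base_param c i" by (simp add: x_def perm_tuple_p base_param_def)
    also have "\<dots> \<longleftrightarrow> rank_on c j < rank_on c i" using rank_on_less_iff[OF c j(1) i(1) j(2)] by simp
    finally show ?thesis .
  qed
  have "{j. j < k \<and> label ?c j = label ?c (p i) \<and> rank_on ?c j < rank_on ?c (p i)} = p ` {j. j < k \<and> label c j = label c i \<and> rank_on c j < rank_on c i}"
  proof (intro equalityI subsetI)
    fix j assume "j \<in> {j. j < k \<and> label ?c j = label ?c (p i) \<and> rank_on ?c j < rank_on ?c (p i)}"
    then have "inv p j \<in> {j. j < k \<and> label c j = label c i \<and> rank_on c j < rank_on c i}"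
      using less[of "inv p j"] by (simp add: label_perm_inv)
    then show "j \<in> p ` {j. j < k \<and> label c j = label c i \<and> rank_on c j < rank_on c i}"
      by (rule image_eqI[rotated]) simp
  qed (use less in auto)
  then show ?thesis
    using rank_on_eq_card[OF pc, of "p i"] rank_on_eq_card[OF c i(1)] i by (simp add: card_image_p)
qed

lemma in_params_perm: assumes c: "c \<in> Index CX" and z: "in_params (perm_index X p c) z" shows "in_params c (\<lambda>i. z (p i))"
  unfolding in_params_def
proof (intro conjI allI impI)
  fix i assume "i < k"
  then show "z (p i) \<in> params X (label c i)" using in_params_params[OF z, of "p i"] by simp
next
  fix i j assume ij: "i < k" "j < k" and h: "label c i \<in> E \<and> label c j = label c i \<and> base_param c i < base_param c j"
  then have "rank_on c i < rank_on c j" using rank_on_less_iff[OF c ij] by simp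
  then show "z (p i) < z (p j)"
    using in_params_less_iff[OF perm_index_Index[OF c] z, of "p i" "p j"] rank_on_perm[OF c] ij h by simp
next
  fix i j assume "i < k" "j < k" "i \<noteq> j"
  then show "char1 X (label c i) (z (p i)) \<noteq> char1 X (label c j) (z (p j))" using in_params_distinct[OF z, of "p i" "p j"] by simp
qed

lemma gap_pt_perm: assumes c: "c \<in> Index CX" and i: "i < k" shows "gap_pt (perm_index X p c) w (p i) = gap_pt c w i"
  using rank_on_perm[OF c i] by (simp add: gap_pt_def Let_def npts_perm)

lemma conf_of_perm:
  assumes c: "c \<in> Index CX"
  shows "conf_of (label (perm_index X p c)) (gap_pt (perm_index X p c) w) = perm_tuple p (conf_of (label c) (gap_pt c w))"
proof
  fix j
  show "conf_of (label (perm_index X p c)) (gap_pt (perm_index X p c) w) j = perm_tuple p (conf_of (label c) (gap_pt c w)) j"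
  proof (cases "j < k")
    case True
    then show ?thesis using gap_pt_perm[OF c, of "inv p j" w] by (simp add: conf_of_def perm_tuple_def label_perm_inv)
  next
    case False
    then show ?thesis by (simp add: conf_of_def perm_tuple_def)
  qed
qed

text \<open>The base point of the permuted cell need not be the permuted base point, but the ends to which an arrow
  sends coordinates can be read off at any point of the domain.\<close>

lemma arrow_ends_perm:
  assumes f: "(c, d, b) \<in> Arr FC"
  shows "arrow_ends (perm_arrow k X p (c, d, b)) = arrow_ends (c, d, b)"
proof -
  have c: "c \<in> Index CX" using f by (simp add: Arr_FC)
  let ?c = "perm_index X p c" and ?d = "perm_index X p d" and ?f = "perm_arrow k X p (c, d, b)"
  note pc = perm_index_Index[OF c]
  have pf: "fst ?f = ?c" "fst (snd ?f) = ?d" by (auto simp: perm_arrow_def)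
  have t: "lift_pt (base_param ?c) \<in> topspace (Dom CX ?c)" using in_params_base_param[OF pc] topspace_Dom_comp[OF pc] by auto
  have y: "in_params c (\<lambda>i. base_param ?c (p i))" by (rule in_params_perm[OF c in_params_base_param[OF pc]])
  have pulled: "perm_tuple (inv p) (lift_pt (base_param ?c)) = lift_pt (\<lambda>i. base_param ?c (p i))"
    using p_ge(1) by (auto simp: perm_tuple_def lift_pt_def fun_eq_iff inv_inv_eq[OF permutes_bij[OF p]])
  have sgp: "end_sign ?f (p i) = push_pt (c, d, b) (\<lambda>i. base_param ?c (p i)) i" if "i < k" for i
  proof -
    have "end_sign ?f (p i) = perm_tuple p (b (perm_tuple (inv p) (lift_pt (base_param ?c)))) (p i) 0"
      using t by (simp add: end_sign_def perm_arrow_def)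
    also have "\<dots> = b (lift_pt (\<lambda>i. base_param ?c (p i))) i 0" by (simp add: perm_tuple_p pulled)
    also have "\<dots> = push_pt (c, d, b) (\<lambda>i. base_param ?c (p i)) i" using arrow_eq_push_pt(1)[OF f y] that by simp
    finally show ?thesis .
  qed
  have val: "end_sign ?f (p i) = \<sigma> \<longleftrightarrow> end_sign (c, d, b) i = \<sigma>" if i: "i < k" and s: "\<bar>\<sigma>\<bar> = 1" for i \<sigma>
  proof (cases "label c i = label d i")
    case True
    have "\<bar>base_param ?c (p i)\<bar> < 1" "\<bar>base_param c i\<bar> < 1" using base_param(1,2)[OF pc, of "p i"] base_param(1,2)[OF c i] i by auto
    then show ?thesis using sgp[OF i] arrow_end_sign(3)[OF f i True] True s by (auto simp: push_pt_def)
  next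
    case False
    then show ?thesis using sgp[OF i] by (simp add: push_pt_def)
  qed
  have "(\<exists>j<k. label ?d j = m \<and> end_sign ?f j = \<sigma>) \<longleftrightarrow> (\<exists>i<k. label d i = m \<and> end_sign (c, d, b) i = \<sigma>)" if "\<bar>\<sigma>\<bar> = 1" for m \<sigma>
  proof
    assume "\<exists>j<k. label ?d j = m \<and> end_sign ?f j = \<sigma>"
    then obtain j where "j < k" "label ?d j = m" "end_sign ?f j = \<sigma>" by blast
    then show "\<exists>i<k. label d i = m \<and> end_sign (c, d, b) i = \<sigma>"
      using val[of "inv p j" \<sigma>] \<open>\<bar>\<sigma>\<bar> = 1\<close> by (intro exI[of _ "inv p j"]) (simp add: label_perm_inv)
  next
    assume "\<exists>i<k. label d i = m \<and> end_sign (c, d, b) i = \<sigma>"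
    then obtain i where "i < k" "label d i = m" "end_sign (c, d, b) i = \<sigma>" by blast
    then show "\<exists>j<k. label ?d j = m \<and> end_sign ?f j = \<sigma>"
      using val[of i \<sigma>] \<open>\<bar>\<sigma>\<bar> = 1\<close> by (intro exI[of _ "p i"]) simp
  qed
  then show ?thesis unfolding arrow_ends_def pf ends_hit_def by auto
qed

lemma chain_pt_perm:
  assumes "((n, s), u) \<in> topspace NS"
  shows "chain_pt ((n, \<lambda>a\<in>{(i, j). i \<le> j \<and> j \<le> n}. perm_arrow k X p (s a)), u) = perm_tuple p (chain_pt ((n, s), u))"
proof -
  have s: "s \<in> nerve FC n" using assms by (simp add: topspace_NS)
  let ?s = "\<lambda>a\<in>{(i, j). i \<le> j \<and> j \<le> n}. perm_arrow k X p (s a)"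
  have e: "arrow_ends (?s (i, n)) = arrow_ends (s (i, n))" if i: "i \<le> n" for i
  proof -
    obtain b where b: "s (i, n) = (fst (s (i, i)), fst (s (n, n)), b)" "(fst (s (i, i)), fst (s (n, n)), b) \<in> Arr FC"
      by (rule nerve_arrow[OF s i order_refl])
    have "arrow_ends (perm_arrow k X p (s (i, n))) = arrow_ends (s (i, n))"
      unfolding b(1) by (rule arrow_ends_perm[OF b(2)])
    then show ?thesis using i by simp
  qed
  have w: "chain_weight n ?s u = chain_weight n s u"
    unfolding chain_weight_def by (intro ext sum.cong) (use e in auto)
  have "fst (?s (n, n)) = perm_index X p (fst (s (n, n)))"
    by (simp add: perm_arrow_def split: prod.splits)
  then show ?thesis
    unfolding chain_pt_def prod.case w using conf_of_perm nerveD(1)[OF s order_refl] by simp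
qed

lemma iota_perm:
  assumes K: "K \<in> topspace BC"
  shows "iota (perm_classifying k X p K) = perm_tuple p (iota K)"
proof -
  obtain z where z: "z \<in> topspace NS" "K = RR `` {z}" using K unfolding topspace_BC by blast
  define g where "g = (\<lambda>((n :: nat, s), u :: nat \<Rightarrow> real). ((n, \<lambda>a\<in>{(i, j). i \<le> j \<and> j \<le> n}. perm_arrow k X p (s a)), u))"
  have gio: "chain_pt (g y) = perm_tuple p (iota K)" if y: "y \<in> K" for y
  proof -
    obtain n s u where nsu: "y = ((n, s), u)" by (metis prod.collapse)
    have "(z, y) \<in> RR" using y z by simp
    then have "y \<in> topspace NS" "chain_pt y = chain_pt z" using RR_facts z by auto
    then show ?thesis using chain_pt_perm[of n s u] nsu z by (simp add: g_def iota_class)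
  qed
  have zK: "z \<in> K" using z RR_refl by simp
  have "perm_classifying k X p K = RR `` (g ` K)" by (simp add: perm_classifying_def classifying_map_def g_def)
  moreover have "iota (RR `` (g ` K)) = chain_pt (g z)"
  proof (rule iota_eq)
    show "g z \<in> RR `` (g ` K)" using zK RR_refl by blast
    fix y assume "y \<in> RR `` (g ` K)"
    then obtain y' where "y' \<in> K" "(g y', y) \<in> RR" by blast
    then show "chain_pt y = chain_pt (g z)" using RR_facts(1)[of "g y'" y] gio zK by simp
  qed
  ultimately show ?thesis using gio[OF zK] by simp
qed

end

section \<open>The image of the classifying space\<close>

text \<open>A coordinate of \<open>c\<close> that sits at an end in \<open>Z\<close> becomes one at a vertex in the face; it does not obstruct
  the remaining ends, since different ends in \<open>Z\<close> are attached to different vertices.\<close>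

lemma admissible_face:
  assumes f: "(c', c, b) \<in> Arr FC" and a: "admissible c Z" and sub: "arrow_ends (c', c, b) \<subseteq> Z"
  shows "admissible c' (Z - arrow_ends (c', c, b))"
proof -
  let ?Z = "arrow_ends (c', c, b)"
  have c: "c \<in> Index CX" and c': "c' \<in> Index CX" using f by (auto simp: Arr_FC)
  have npts: "npts c m = npts c' m + of_bool ((m, -1) \<in> ?Z) + of_bool ((m, 1) \<in> ?Z)" if "m \<in> E" for m
    by (rule card_arrow_ends_sum[OF f that])
  have two: "2 \<le> npts c m" if "(m, -1) \<in> Z" "(m, 1) \<in> Z" for m using admissibleD(4)[OF a that] .
  show ?thesis
    unfolding admissible_def
  proof (intro conjI)
    show "\<forall>(m, \<sigma>)\<in>Z - ?Z. m \<in> E \<and> \<bar>\<sigma>\<bar> = 1 \<and> \<sigma> \<in> params X m \<and> 0 < npts c' m \<and>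
        (\<forall>i<k. label c' i \<notin> E \<longrightarrow> char1 X (label c' i) 0 \<noteq> char1 X m \<sigma>)"
    proof clarify
      fix m \<sigma> assume e: "(m, \<sigma>) \<in> Z" "(m, \<sigma>) \<notin> ?Z"
      have 1: "m \<in> E \<and> \<bar>\<sigma>\<bar> = 1 \<and> \<sigma> \<in> params X m \<and> 0 < npts c m" by (rule admissibleD(1)[OF a e(1)])
      then have m: "m \<in> E" and s: "\<sigma> = 1 \<or> \<sigma> = -1" by (auto simp: abs_if split: if_splits)
      have "0 < npts c' m"
        using npts[OF m] two[of m] s e sub 1 by (auto simp: of_bool_def split: if_splits)
      moreover have "char1 X (label c' i) 0 \<noteq> char1 X m \<sigma>" if i: "i < k" "label c' i \<notin> E" for i
      proof (cases "label c' i = label c i")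
        case True
        then show ?thesis using admissibleD(2)[OF a e(1) i(1)] i(2) by simp
      next
        case False
        note g = arrow_end_sign(4)[OF f i(1) False]
        have "(label c i, end_sign (c', c, b) i) \<in> ?Z"
          using g i(1) unfolding arrow_ends_def fst_conv snd_conv ends_hit_iff by blast
        then have "(label c i, end_sign (c', c, b) i) \<in> Z" "(m, \<sigma>) \<noteq> (label c i, end_sign (c', c, b) i)" using e(2) sub by auto
        then have "char1 X m \<sigma> \<noteq> char1 X (label c i) (end_sign (c', c, b) i)" using admissibleD(3)[OF a e(1)] by blast
        then show ?thesis using g by simp
      qed
      ultimately show "m \<in> E \<and> \<bar>\<sigma>\<bar> = 1 \<and> \<sigma> \<in> params X m \<and> 0 < npts c' m \<and>
        (\<forall>i<k. label c' i \<notin> E \<longrightarrow> char1 X (label c' i) 0 \<noteq> char1 X m \<sigma>)" using 1 by blast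
    qed
    show "\<forall>e\<in>Z - ?Z. \<forall>e'\<in>Z - ?Z. e \<noteq> e' \<longrightarrow> char1 X (fst e) (snd e) \<noteq> char1 X (fst e') (snd e')"
      using admissibleD(3)[OF a] by (metis DiffD1 prod.collapse)
    show "\<forall>m. (m, -1) \<in> Z - ?Z \<and> (m, 1) \<in> Z - ?Z \<longrightarrow> 2 \<le> npts c' m"
    proof clarify
      fix m assume e: "(m, -1) \<in> Z" "(m, -1) \<notin> ?Z" "(m, 1) \<in> Z" "(m, 1) \<notin> ?Z"
      then show "2 \<le> npts c' m" using two[of m] npts[of m] admissibleD(1)[OF a e(1)] by simp
    qed
  qed
qed

text \<open>The chain \<open>s\<close> continued by one more arrow \<open>f\<close>.\<close>

lemma cone_nerve:
  assumes s: "s \<in> nerve FC n" and f: "(fst (s (n, n)), c, b) \<in> Arr FC"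
  defines "f \<equiv> (fst (s (n, n)), c, b)"
  defines "s' \<equiv> (\<lambda>(i, j)\<in>{(i, j). i \<le> j \<and> j \<le> Suc n}.
      if j \<le> n then s (i, j) else if i \<le> n then Comp FC f (s (i, n)) else Ident FC c)"
  shows "s' \<in> nerve FC (Suc n)" "fst (s' (Suc n, Suc n)) = c"
    "\<And>i. i \<le> n \<Longrightarrow> arrow_ends (s' (i, Suc n)) = arrow_ends (s (i, n)) \<union> arrow_ends f" "arrow_ends (s' (Suc n, Suc n)) = {}"
proof -
  have fA: "f \<in> Arr FC" using f by (simp add: f_def)
  have c: "c \<in> Index CX" using f by (simp add: Arr_FC)
  have v1: "s' (i, j) = s (i, j)" if "i \<le> j" "j \<le> n" for i j using that by (simp add: s'_def)
  have v2: "s' (i, Suc n) = Comp FC f (s (i, n))" if "i \<le> n" for i using that by (simp add: s'_def)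
  have v3: "s' (Suc n, Suc n) = Ident FC c" by (simp add: s'_def)
  have cat: "\<And>g. g \<in> Arr FC \<Longrightarrow> Comp FC g (Ident FC (fst g)) = g \<and> Comp FC (Ident FC (fst (snd g))) g = g"
    "\<And>g h. g \<in> Arr FC \<Longrightarrow> h \<in> Arr FC \<Longrightarrow> fst (snd g) = fst h \<Longrightarrow>
       Comp FC h g \<in> Arr FC \<and> fst (Comp FC h g) = fst g \<and> fst (snd (Comp FC h g)) = fst (snd h)"
    "\<And>f g h. f \<in> Arr FC \<Longrightarrow> g \<in> Arr FC \<Longrightarrow> h \<in> Arr FC \<Longrightarrow> fst (snd f) = fst g \<Longrightarrow> fst (snd g) = fst h \<Longrightarrow>
       Comp FC h (Comp FC g f) = Comp FC (Comp FC h g) f"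
    using category_FC by (auto simp: category_def Src_FC Tgt_FC cat_hom_def)
  have sA: "s (i, n) \<in> Arr FC" "fst (s (i, n)) = fst (s (i, i))" "fst (snd (s (i, n))) = fst f" if "i \<le> n" for i
    using nerveD(2)[OF s that order_refl] by (auto simp: f_def)
  show n': "s' \<in> nerve FC (Suc n)"
  proof (rule nerveI[where x = "\<lambda>i. if i \<le> n then fst (s (i, i)) else c"])
    show "s' \<in> extensional {(i, j). i \<le> j \<and> j \<le> Suc n}" unfolding s'_def by simp
  next
    fix i assume i: "i \<le> Suc n"
    show "(if i \<le> n then fst (s (i, i)) else c) \<in> Index CX \<and> s' (i, i) = Ident FC (if i \<le> n then fst (s (i, i)) else c)"
    proof (cases "i \<le> n")
      case True
      then show ?thesis using nerveD(1)[OF s True] v1[of i i] by simp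
    next
      case False
      then have "i = Suc n" using i by simp
      then show ?thesis using v3 c by simp
    qed
  next
    fix i j assume ij: "i \<le> j" "j \<le> Suc n"
    show "s' (i, j) \<in> Arr FC \<and> fst (s' (i, j)) = (if i \<le> n then fst (s (i, i)) else c) \<and>
      fst (snd (s' (i, j))) = (if j \<le> n then fst (s (j, j)) else c)"
    proof (cases "j \<le> n")
      case True
      then show ?thesis using nerveD(2)[OF s ij(1) True] v1[OF ij(1) True] ij by simp
    next
      case False
      then have j: "j = Suc n" using ij by simp
      show ?thesis
      proof (cases "i \<le> n")
        case True
        show ?thesis unfolding j v2[OF True] using cat(2)[OF sA(1)[OF True] fA sA(3)[OF True]] sA(2)[OF True] True
          by (simp add: f_def)
      next
        case False
        then have "i = Suc n" using ij j by simp
        then show ?thesis unfolding j using v3 Ident_Arr[OF c] by (simp add: Ident_FC)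
      qed
    qed
  next
    fix i j l assume ijl: "i \<le> j" "j \<le> l" "l \<le> Suc n"
    show "s' (i, l) = Comp FC (s' (j, l)) (s' (i, j))"
    proof (cases "l \<le> n")
      case True
      then have "i \<le> l" "j \<le> n" using ijl by auto
      then show ?thesis using v1 ijl True nerveD(3)[OF s ijl(1,2) True] by simp
    next
      case False
      then have l: "l = Suc n" using ijl by simp
      show ?thesis
      proof (cases "j \<le> n")
        case True
        have i: "i \<le> n" using ijl True by simp
        have sij: "s (i, j) \<in> Arr FC" "fst (snd (s (i, j))) = fst (s (j, n))"
          using nerveD(2)[OF s ijl(1) True] sA(2)[OF True] by auto
        have "Comp FC f (s (i, n)) = Comp FC f (Comp FC (s (j, n)) (s (i, j)))"
          using nerveD(3)[OF s ijl(1) True order_refl] by simp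
        also have "\<dots> = Comp FC (Comp FC f (s (j, n))) (s (i, j))"
          by (rule cat(3)[OF sij(1) sA(1)[OF True] fA sij(2) sA(3)[OF True]])
        finally show ?thesis unfolding l v2[OF i] v2[OF True] v1[OF ijl(1) True] .
      next
        case False
        then have j: "j = Suc n" using ijl l by simp
        show ?thesis
        proof (cases "i \<le> n")
          case True
          have "Comp FC f (s (i, n)) \<in> Arr FC" "fst (snd (Comp FC f (s (i, n)))) = c"
            using cat(2)[OF sA(1)[OF True] fA sA(3)[OF True]] by (auto simp: f_def)
          then show ?thesis unfolding l j v2[OF True] v3 using cat(1) by metis
        next
          case False
          then have i: "i = Suc n" using ijl j by simp
          show ?thesis unfolding i j l v3 using cat(1)[OF Ident_Arr[OF c]] by (simp add: Ident_FC)
        qed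
      qed
    qed
  qed
  show "fst (s' (Suc n, Suc n)) = c" unfolding v3 by (simp add: Ident_FC)
  show "arrow_ends (s' (Suc n, Suc n)) = {}" unfolding v3 by (rule arrow_ends_Ident[OF c])
  show "arrow_ends (s' (i, Suc n)) = arrow_ends (s (i, n)) \<union> arrow_ends f" if i: "i \<le> n" for i
  proof -
    obtain b' where b': "s (i, n) = (fst (s (i, i)), fst (s (n, n)), b')" "(fst (s (i, i)), fst (s (n, n)), b') \<in> Arr FC"
      by (rule nerve_arrow[OF s i order_refl])
    show ?thesis unfolding v2[OF i] f_def
      by (subst (1 2) b'(1)) (rule arrow_ends_Comp(1)[OF b'(2) f])
  qed
qed

text \<open>The minimal weight \<open>\<mu>\<close> has to be the coordinate of the last vertex \<open>c\<close>, and the ends where it is attained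
  have to be those of the last arrow. Removing \<open>\<mu>\<close> and rescaling leaves weights for the face at
  these ends, with fewer ends of weight less than 1. If there is no such end, a single vertex
  suffices.\<close>

lemma chain_exists:
  assumes "c \<in> Index CX" "\<And>e. 0 \<le> w e" "\<And>e. w e \<le> 1" "admissible c {e. w e < 1}"
  shows "\<exists>n s u. s \<in> nerve FC n \<and> u \<in> standard_simplex n \<and> fst (s (n, n)) = c \<and> chain_weight n s u = w"
  using assms
proof (induction "card {e. w e < 1}" arbitrary: c w rule: less_induct)
  case less
  let ?W = "{e. w e < 1}"
  note c = less.prems(1) and a = less.prems(4)
  have fin: "finite ?W"
  proof (rule finite_subset)
    show "?W \<subseteq> E \<times> {-1, 1}"
    proof
      fix e assume "e \<in> ?W"
      then show "e \<in> E \<times> {-1, 1}" using admissibleD(1)[OF a, of "fst e" "snd e"] by (cases e) (auto simp: abs_if split: if_splits)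
    qed
  qed (use finite_E in simp)
  show ?case
  proof (cases "?W = {}")
    case True
    then have w1: "w e = 1" for e using less.prems(3)[of e] by (metis (mono_tags) Collect_empty_eq less_eq_real_def)
    define s where "s = (\<lambda>x\<in>{(i :: nat, j). i \<le> j \<and> j \<le> 0}. Ident FC c)"
    have s0: "s (0, 0) = Ident FC c" by (simp add: s_def)
    have "s \<in> nerve FC 0"
    proof (rule nerveI[where x = "\<lambda>i. c"])
      show "s (i, l) = Comp FC (s (j, l)) (s (i, j))" if "i \<le> j" "j \<le> l" "l \<le> 0" for i j l
      proof -
        have "Comp FC (Ident FC c) (Ident FC c) = Ident FC c" by (auto simp: Ident_FC Comp_FC)
        then show ?thesis using that s0 by simp
      qed
    qed (use Ident_Arr[OF c] c in \<open>auto simp: s_def Ident_FC\<close>)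
    moreover have "(\<lambda>j. if j = 0 then 1 else 0) \<in> standard_simplex 0" by (simp add: standard_simplex_0)
    moreover have "chain_weight 0 s (\<lambda>j. if j = 0 then 1 else 0) = w"
    proof
      fix e
      have "{i. i \<le> 0 \<and> e \<notin> arrow_ends (s (i, 0))} = {0}" using arrow_ends_Ident[OF c] s0 by auto
      then show "chain_weight 0 s (\<lambda>j. if j = 0 then 1 else 0) e = w e" by (simp add: chain_weight_def w1)
    qed
    moreover have "fst (s (0, 0)) = c" using s0 by (simp add: Ident_FC)
    ultimately show ?thesis by blast
  next
    case False
    define \<mu> where "\<mu> = Min (w ` ?W)"
    have "\<mu> \<in> w ` ?W" unfolding \<mu>_def using fin False by (intro Min_in) auto
    then obtain e0 where e0: "w e0 = \<mu>" "\<mu> < 1" by auto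
    have le: "\<mu> \<le> w e" for e
    proof (cases "w e < 1")
      case True
      then show ?thesis unfolding \<mu>_def using fin by (intro Min_le) auto
    qed (use e0 in simp)
    have \<mu>0: "0 \<le> \<mu>" using less.prems(2)[of e0] e0 by simp
    define Z where "Z = {e. w e = \<mu>}"
    have ZW: "Z \<subseteq> ?W" using e0 by (auto simp: Z_def)
    \<comment> \<open>A point of the domain that reaches exactly the ends in \<open>Z\<close>; it yields the last arrow.\<close>
    define v where "v e = (if e \<in> Z then 0 else 1 :: real)" for e
    have "{e. v e = 0} = Z" by (auto simp: v_def)
    then have "admissible c {e. v e = 0}" using admissible_mono[OF a ZW] by simp
    moreover have "0 \<le> v e" for e by (simp add: v_def)
    ultimately have D: "in_params c (gap_pt c v)" "ends_hit c (gap_pt c v) = Z"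
      using in_params_gap_pt[OF c, of v] \<open>{e. v e = 0} = Z\<close> by auto
    obtain c' b where f: "(c', c, b) \<in> Arr FC" "arrow_ends (c', c, b) = Z" using arrow_exists[OF c D(1)] D(2) by metis
    have c': "c' \<in> Index CX" using f(1) by (simp add: Arr_FC)
    define w' where "w' e = (if e \<in> Z then 1 else (w e - \<mu>) / (1 - \<mu>))" for e
    have w'0: "0 \<le> w' e" and w'1: "w' e \<le> 1" for e
      using le[of e] less.prems(3)[of e] e0 by (auto simp: w'_def field_simps)
    have W': "{e. w' e < 1} = ?W - Z" using e0 by (auto simp: w'_def field_simps)
    have "admissible c' {e. w' e < 1}" unfolding W' using admissible_face[OF f(1) a] f(2) ZW by simp
    moreover have "card {e. w' e < 1} < card ?W"
      unfolding W' by (rule psubset_card_mono[OF fin]) (use e0 ZW in \<open>auto simp: Z_def\<close>)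
    ultimately obtain n s u where nsu: "s \<in> nerve FC n" "u \<in> standard_simplex n" "fst (s (n, n)) = c'" "chain_weight n s u = w'"
      using less.hyps[of w' c'] c' w'0 w'1 by blast
    define s' where "s' = (\<lambda>(i, j)\<in>{(i, j). i \<le> j \<and> j \<le> Suc n}.
      if j \<le> n then s (i, j) else if i \<le> n then Comp FC (c', c, b) (s (i, n)) else Ident FC c)"
    have "(fst (s (n, n)), c, b) \<in> Arr FC" using f(1) nsu(3) by simp
    note C = cone_nerve[OF nsu(1) this, unfolded nsu(3), folded s'_def]
    define u' where "u' i = (if i \<le> n then (1 - \<mu>) * u i else if i = Suc n then \<mu> else 0)" for i
    have su: "sum u' {..n} = (1 - \<mu>) * sum u {..n}" unfolding sum_distrib_left by (intro sum.cong) (auto simp: u'_def)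
    have "u' \<in> standard_simplex (Suc n)"
    proof -
      have "sum u' {..Suc n} = 1" using su simplex_sum[OF nsu(2)] by (simp add: u'_def)
      moreover have "0 \<le> u' i \<and> u' i \<le> 1" for i
        using nsu(2) \<mu>0 e0 by (auto simp: u'_def standard_simplex_def intro: mult_le_one)
      moreover have "u' i = 0" if "Suc n < i" for i using that by (simp add: u'_def)
      ultimately show ?thesis by (simp add: standard_simplex_def)
    qed
    moreover have "chain_weight (Suc n) s' u' e = w e" for e
    proof -
      have "{i. i \<le> Suc n \<and> e \<notin> arrow_ends (s' (i, Suc n))} = insert (Suc n) {i. i \<le> n \<and> e \<notin> arrow_ends (s (i, n)) \<and> e \<notin> Z}"
        using C(3,4) f(2) by (auto simp: le_Suc_eq)
      then have "chain_weight (Suc n) s' u' e = \<mu> + sum u' {i. i \<le> n \<and> e \<notin> arrow_ends (s (i, n)) \<and> e \<notin> Z}"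
        by (simp add: chain_weight_def u'_def)
      also have "sum u' {i. i \<le> n \<and> e \<notin> arrow_ends (s (i, n)) \<and> e \<notin> Z} = (if e \<in> Z then 0 else (1 - \<mu>) * chain_weight n s u e)"
        unfolding chain_weight_def sum_distrib_left by (auto simp: u'_def intro!: sum.cong)
      finally show ?thesis using e0 by (auto simp: nsu(4) w'_def Z_def)
    qed
    then have "chain_weight (Suc n) s' u' = w" by auto
    ultimately show ?thesis using C(1,2) by blast
  qed
qed

text \<open>For a nondegenerate representative the last coordinate is positive and bounds the weights from below.
  Conversely, weights of this kind come from a chain.\<close>

lemma iota_image_iff:
  "x \<in> iota ` topspace BC \<longleftrightarrow>
    (\<exists>c w. c \<in> Index CX \<and> (\<forall>e. 0 < w e \<and> w e \<le> 1) \<and> admissible c {e. w e < 1} \<and> x = conf_of (label c) (gap_pt c w))"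
    (is "_ \<longleftrightarrow> ?R")
proof
  assume "x \<in> iota ` topspace BC"
  then obtain n s u where z: "((n, s), u) \<in> topspace NS" "x = chain_pt ((n, s), u)"
    unfolding topspace_BC by (metis (no_types, lifting) imageE prod.collapse iota_class)
  obtain n' s' u' where z': "(((n, s), u), ((n', s'), u')) \<in> RR" "nondeg n' s' u'" using nondeg_exists[OF z(1)] by blast
  have s: "s' \<in> nerve FC n'" and u: "u' \<in> standard_simplex n'" and pos: "0 < u' n'" using z'(2) by (auto simp: nondeg_def)
  have x: "x = conf_of (label (fst (s' (n', n')))) (gap_pt (fst (s' (n', n'))) (chain_weight n' s' u'))"
    using RR_facts(1)[OF z'(1)] z(2) by (simp add: chain_pt_def)
  have c: "fst (s' (n', n')) \<in> Index CX" using nerveD(1)[OF s order_refl] by simp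
  have "0 < chain_weight n' s' u' e \<and> chain_weight n' s' u' e \<le> 1" for e using chain_weight_facts(2,4)[OF s u, of e] pos by simp
  then show ?R using x c admissible_chain_weight(1)[OF s u] by blast
next
  assume ?R
  then obtain c w where c: "c \<in> Index CX" and w: "\<And>e. 0 < w e" "\<And>e. w e \<le> 1" and a: "admissible c {e. w e < 1}"
    and x: "x = conf_of (label c) (gap_pt c w)" by blast
  obtain n s u where nsu: "s \<in> nerve FC n" "u \<in> standard_simplex n" "fst (s (n, n)) = c" "chain_weight n s u = w"
    using chain_exists[OF c less_imp_le[OF w(1)] w(2) a] by blast
  have "iota (RR `` {((n, s), u)}) = x" using nsu x by (simp add: iota_class chain_pt_def)
  moreover have "RR `` {((n, s), u)} \<in> topspace BC" unfolding topspace_BC using nsu by (auto simp: topspace_NS)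
  ultimately show "x \<in> iota ` topspace BC" by blast
qed

end

section \<open>Evening out the gaps of a finite set\<close>

definition gap :: "real set \<Rightarrow> real \<Rightarrow> real" where
  "gap S a = Min {b \<in> S. a < b} - a"

definition maxgap :: "real set \<Rightarrow> real" where
  "maxgap S = Max (gap S ` {a \<in> S. a < 1})"

text \<open>The distance of \<open>z\<close> from the left end once every gap is truncated at \<open>\<kappa>\<close>, in units of \<open>\<kappa>\<close>. Adding over the
  points of the set instead of the coordinates makes the result independent of their numbering, and
  a coordinate at -1 or 1 does not contribute a gap of its own.\<close>

definition gap_sum :: "real set \<Rightarrow> real \<Rightarrow> real \<Rightarrow> real" where
  "gap_sum S \<kappa> z = (\<Sum>a | a \<in> S \<and> a < z. min 1 (gap S a / \<kappa>))"

locale marked_interval =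
  fixes S :: "real set"
  assumes fin: "finite S" and ends_in: "-1 \<in> S" "1 \<in> S" and bounds: "S \<subseteq> {-1..1}"
begin

lemma gap_pos: "a \<in> S \<Longrightarrow> a < 1 \<Longrightarrow> 0 < gap S a"
proof -
  assume "a \<in> S" "a < 1"
  then have "Min {b \<in> S. a < b} \<in> {b \<in> S. a < b}" using fin ends_in by (intro Min_in) auto
  then show "0 < gap S a" by (simp add: gap_def)
qed

lemma gap_le: "a \<in> S \<Longrightarrow> a < 1 \<Longrightarrow> gap S a \<le> 2"
proof -
  assume a: "a \<in> S" "a < 1"
  have "Min {b \<in> S. a < b} \<le> 1" by (rule Min_le) (use fin ends_in a in auto)
  then show ?thesis using a(1) bounds by (force simp: gap_def)
qed

lemma maxgap_ge: "a \<in> S \<Longrightarrow> a < 1 \<Longrightarrow> gap S a \<le> maxgap S"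
  unfolding maxgap_def using fin by (intro Max_ge) auto

lemma maxgap_in: obtains a where "a \<in> S" "a < 1" "maxgap S = gap S a"
proof -
  have "-1 \<in> {a \<in> S. a < 1}" using ends_in by simp
  then have "maxgap S \<in> gap S ` {a \<in> S. a < 1}"
    unfolding maxgap_def using fin by (intro Max_in) auto
  then show thesis using that by blast
qed

lemma maxgap_pos: "0 < maxgap S" and maxgap_le: "maxgap S \<le> 2"
proof -
  obtain a where a: "a \<in> S" "a < 1" "maxgap S = gap S a" by (rule maxgap_in)
  show "0 < maxgap S" "maxgap S \<le> 2" unfolding a(3) by (rule gap_pos[OF a(1,2)], rule gap_le[OF a(1,2)])
qed

lemma gap_sum_strict_mono:
  assumes \<kappa>: "0 < \<kappa>" and ab: "a \<in> S" "b \<in> S" "a < b"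
  shows "gap_sum S \<kappa> a < gap_sum S \<kappa> b"
  unfolding gap_sum_def
proof (rule sum_strict_mono2[of _ _ a])
  show "finite {a \<in> S. a < b}" using fin by simp
  have pos: "0 < min 1 (gap S x / \<kappa>)" if "x \<in> S" "x < 1" for x using gap_pos[OF that] \<kappa> by simp
  have "b \<le> 1" using ab bounds by auto
  then show "0 < min 1 (gap S a / \<kappa>)" using pos[of a] ab by simp
  show "0 \<le> min 1 (gap S x / \<kappa>)" if "x \<in> {a \<in> S. a < b}" for x
    using pos[of x] that \<open>b \<le> 1\<close> by auto
qed (use ab in auto)

lemma gap_sum_bot: "gap_sum S \<kappa> (-1) = 0"
proof -
  have "{a. a \<in> S \<and> a < -1} = {}" using bounds by force
  then show ?thesis unfolding gap_sum_def by (metis sum.empty)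
qed

lemma gap_sum_top_pos: "0 < \<kappa> \<Longrightarrow> 0 < gap_sum S \<kappa> 1"
  using gap_sum_strict_mono[of \<kappa> "-1" 1] gap_sum_bot[of \<kappa>] ends_in by simp

end

text \<open>A weakly increasing enumeration, in which points may be repeated. It turns the gaps into continuous
  functions of the coordinates, also where the first or last coordinate reaches an end; repeated
  points add gaps of length 0.\<close>

locale enumeration =
  fixes q :: "nat \<Rightarrow> real" and N :: nat
  assumes step: "\<And>i. i \<le> N \<Longrightarrow> q i \<le> q (Suc i)" and q0: "q 0 = -1" and qN: "q (Suc N) = 1"
begin

abbreviation "S \<equiv> q ` {..Suc N}"

lemma q_mono: "i \<le> j \<Longrightarrow> j \<le> Suc N \<Longrightarrow> q i \<le> q j"
proof (induction rule: dec_induct)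
  case (step n)
  then show ?case using enumeration.step[OF enumeration_axioms, of n] by auto
qed simp

sublocale marked_interval S
proof
  show "S \<subseteq> {-1..1}" using q_mono[of 0] q_mono[of _ "Suc N"] q0 qN by fastforce
qed (use q0 qN in \<open>force+\<close>)

lemma gap_eq: assumes "i \<le> N" "q i < q (Suc i)" shows "gap S (q i) = q (Suc i) - q i"
proof -
  have "Min {b \<in> S. q i < b} = q (Suc i)"
  proof (rule Min_eqI)
    fix y assume "y \<in> {b \<in> S. q i < b}"
    then obtain j where j: "j \<le> Suc N" "y = q j" "q i < q j" by auto
    then have "\<not> j \<le> i" using q_mono[of j i] assms(1) by auto
    then show "q (Suc i) \<le> y" using q_mono[of "Suc i" j] j by simp
  qed (use assms in auto)
  then show ?thesis by (simp add: gap_def)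
qed

lemma sum_gaps:
  assumes g: "g 0 = (0 :: real)" and j: "j \<le> Suc N"
  shows "(\<Sum>a | a \<in> S \<and> a < q j. g (gap S a)) = (\<Sum>i<j. g (q (Suc i) - q i))"
  using j
proof (induction j)
  case 0
  have "{a. a \<in> S \<and> a < q 0} = {}" using bounds q0 by force
  then show ?case by (simp only: sum.empty lessThan_0)
next
  case (Suc j)
  then have jN: "j \<le> N" by simp
  show ?case
  proof (cases "q j < q (Suc j)")
    case True
    have "{a. a \<in> S \<and> a < q (Suc j)} = insert (q j) {a. a \<in> S \<and> a < q j}"
    proof (intro equalityI subsetI)
      fix a assume "a \<in> {a. a \<in> S \<and> a < q (Suc j)}"
      then obtain i where i: "i \<le> Suc N" "a = q i" "q i < q (Suc j)" by auto
      then have "i \<le> j" using q_mono[of "Suc j" i] by (metis not_le not_less_eq_eq)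
      then have "a \<le> q j" using i q_mono[of i j] jN by simp
      then show "a \<in> insert (q j) {a. a \<in> S \<and> a < q j}" using i by auto
    qed (use True jN in auto)
    moreover have "finite {a. a \<in> S \<and> a < q j}" using fin by simp
    ultimately have "(\<Sum>a | a \<in> S \<and> a < q (Suc j). g (gap S a)) = g (gap S (q j)) + (\<Sum>a | a \<in> S \<and> a < q j. g (gap S a))"
      by simp
    then show ?thesis using Suc gap_eq[OF jN True] by simp
  next
    case False
    then have "q (Suc j) = q j" using step[OF jN] by simp
    then show ?thesis using Suc g by simp
  qed
qed

lemma gap_sum_q: assumes "0 < \<kappa>" "j \<le> Suc N"
  shows "gap_sum S \<kappa> (q j) = (\<Sum>i<j. min 1 ((q (Suc i) - q i) / \<kappa>))"
  unfolding gap_sum_def by (rule sum_gaps[where g = "\<lambda>x. min 1 (x / \<kappa>)"]) (use assms in auto)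

lemma maxgap_q: "maxgap S = Max ((\<lambda>i. q (Suc i) - q i) ` {..N})"
proof (rule antisym)
  obtain a where a: "a \<in> S" "a < 1" "maxgap S = gap S a" by (rule maxgap_in)
  define j where "j = Max {i. i \<le> Suc N \<and> q i = a}"
  have fne: "finite {i. i \<le> Suc N \<and> q i = a}" "{i. i \<le> Suc N \<and> q i = a} \<noteq> {}" using a(1) by auto
  have j: "j \<le> Suc N" "q j = a" using Max_in[OF fne] by (auto simp: j_def)
  then have jN: "j \<le> N" using a(2) qN by (metis le_SucE less_irrefl)
  have "q (Suc j) \<noteq> a"
  proof
    assume "q (Suc j) = a"
    then have "Suc j \<le> j" unfolding j_def using fne(1) jN by (intro Max_ge) (auto simp: j_def)
    then show False by simp
  qed
  then have "q j < q (Suc j)" using step[OF jN] j(2) by simp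
  then have "maxgap S = q (Suc j) - q j" using a(3) j(2) gap_eq[OF jN] by simp
  then show "maxgap S \<le> Max ((\<lambda>i. q (Suc i) - q i) ` {..N})" using jN by (auto intro!: Max_ge)
next
  show "Max ((\<lambda>i. q (Suc i) - q i) ` {..N}) \<le> maxgap S"
  proof (rule Max.boundedI)
    fix x assume "x \<in> (\<lambda>i. q (Suc i) - q i) ` {..N}"
    then obtain i where i: "i \<le> N" "x = q (Suc i) - q i" by auto
    show "x \<le> maxgap S"
    proof (cases "q i < q (Suc i)")
      case True
      have "q (Suc i) \<le> 1" using q_mono[of "Suc i" "Suc N"] qN i by simp
      then show ?thesis using maxgap_ge[of "q i"] gap_eq[OF i(1) True] i True by simp
    next
      case False
      then show ?thesis using i(2) maxgap_pos by simp
    qed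
  qed auto
qed

lemma gap_q_le: "i \<le> N \<Longrightarrow> q (Suc i) - q i \<le> maxgap S"
  unfolding maxgap_q by (rule Max_ge) auto

text \<open>Truncation at the largest gap has no effect.\<close>

lemma gap_sum_maxgap: assumes "j \<le> Suc N" shows "gap_sum S (maxgap S) (q j) = (q j + 1) / maxgap S"
proof -
  have "gap_sum S (maxgap S) (q j) = (\<Sum>i<j. min 1 ((q (Suc i) - q i) / maxgap S))"
    by (rule gap_sum_q[OF maxgap_pos assms])
  also have "\<dots> = (\<Sum>i<j. (q (Suc i) - q i) / maxgap S)"
    using gap_q_le maxgap_pos assms by (intro sum.cong) auto
  also have "\<dots> = (q j - q 0) / maxgap S"
    by (simp add: sum_lessThan_telescope flip: sum_divide_distrib)
  finally show ?thesis using q0 by simp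
qed

end

text \<open>A minimum that is also capped by 1, so that an empty index set is allowed.\<close>

definition min_over :: "'i set \<Rightarrow> ('i \<Rightarrow> real) \<Rightarrow> real" where
  "min_over I f = Min (insert 1 (f ` I))"

lemma le_min_over_iff: "finite I \<Longrightarrow> \<theta> \<le> min_over I f \<longleftrightarrow> \<theta> \<le> 1 \<and> (\<forall>i\<in>I. \<theta> \<le> f i)"
  by (simp add: min_over_def)

lemma less_min_over_iff: "finite I \<Longrightarrow> \<theta> < min_over I f \<longleftrightarrow> \<theta> < 1 \<and> (\<forall>i\<in>I. \<theta> < f i)"
  by (simp add: min_over_def)

lemma min_over_cong: "(\<And>i. i \<in> I \<Longrightarrow> f i = g i) \<Longrightarrow> min_over I f = min_over I g"
  by (simp add: min_over_def)

lemma min_over_le: "finite I \<Longrightarrow> min_over I f \<le> 1" "finite I \<Longrightarrow> i \<in> I \<Longrightarrow> min_over I f \<le> f i"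
  using le_min_over_iff[of I "min_over I f" f] by auto

lemma continuous_map_min_over:
  assumes "finite I" "\<And>i. i \<in> I \<Longrightarrow> continuous_map T euclideanreal (\<lambda>x. f x i)"
  shows "continuous_map T euclideanreal (\<lambda>x. min_over I (f x))"
  using assms
proof (induction I rule: finite_induct)
  case empty
  then show ?case by (simp add: min_over_def)
next
  case (insert a I)
  have "min_over (insert a I) (f x) = min (f x a) (min_over I (f x))" for x
    unfolding min_over_def image_insert by (subst insert_commute, subst Min_insert) (use insert.hyps in auto)
  then show ?case using insert by (auto intro: continuous_map_real_min)
qed

section \<open>The deformation\<close>

context finite_graph begin

definition marks :: "(nat \<Rightarrow> 'c) \<Rightarrow> (nat \<Rightarrow> real) \<Rightarrow> 'c \<Rightarrow> real set" where
  "marks l z m = {-1, 1} \<union> z ` {i. i < k \<and> l i = m}"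

definition mesh :: "(nat \<Rightarrow> 'c) \<Rightarrow> (nat \<Rightarrow> real) \<Rightarrow> 'c \<Rightarrow> real" where
  "mesh l z m = maxgap (marks l z m)"

text \<open>The distance of the point with parameter \<open>y\<close> on the cell \<open>m\<close> to the vertex \<open>v\<close>, measured along \<open>m\<close> in units
  of \<open>M\<close> and capped by 1. A coordinate on a vertex is at distance 0 or 1.\<close>

definition near_vertex :: "real \<Rightarrow> 'c \<Rightarrow> 'c \<Rightarrow> real \<Rightarrow> real" where
  "near_vertex M v m y = (if m \<in> E then
      min 1 (min (if -1 \<in> params X m \<and> proj X (char1 X m (-1)) = v then \<bar>y + 1\<bar> / M else 1)
                 (if 1 \<in> params X m \<and> proj X (char1 X m 1) = v then \<bar>y - 1\<bar> / M else 1))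
    else if m = v then 0 else 1)"

text \<open>The distance to the ends of \<open>m\<close> that do not belong to the space, measured in the same way.\<close>

definition near_absent :: "real \<Rightarrow> 'c \<Rightarrow> real \<Rightarrow> real" where
  "near_absent M m y = (if m \<in> E then
      min 1 (min (if -1 \<in> params X m then 1 else \<bar>y + 1\<bar> / M) (if 1 \<in> params X m then 1 else \<bar>y - 1\<bar> / M))
    else 1)"

definition tau_term :: "(nat \<Rightarrow> 'c) \<Rightarrow> (nat \<Rightarrow> real) \<Rightarrow> nat \<times> nat \<Rightarrow> real" where
  "tau_term l z = (\<lambda>(i, j).
     if i = j then near_absent (mesh l z (l i)) (l i) (z i)
     else min (if l i = l j \<and> l i \<in> E then \<bar>z i - z j\<bar> / mesh l z (l i) else 1)
       (min_over V (\<lambda>v. max (near_vertex (mesh l z (l i)) v (l i) (z i)) (near_vertex (mesh l z (l j)) v (l j) (z j)))))"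

text \<open>The minimum of all relative distances that must not vanish in the configuration space: those to
  missing ends (the terms with \<open>i = j\<close>), those between two coordinates on a 1-cell, and for every vertex
  the larger one of the distances of two coordinates to it.\<close>

definition tau :: "(nat \<Rightarrow> 'c) \<Rightarrow> (nat \<Rightarrow> real) \<Rightarrow> real" where
  "tau l z = min_over ({..<k} \<times> {..<k}) (tau_term l z)"

definition even_pos :: "(nat \<Rightarrow> 'c) \<Rightarrow> (nat \<Rightarrow> real) \<Rightarrow> nat \<Rightarrow> real" where
  "even_pos l z i = (let S = marks l z (l i); \<kappa> = mesh l z (l i) * tau l z in
     -1 + 2 * (gap_sum S \<kappa> (z i) / gap_sum S \<kappa> 1))"

text \<open>The straight line in the parameters from the given to the evened-out positions.\<close>

definition move_pt :: "(nat \<Rightarrow> 'c) \<Rightarrow> (nat \<Rightarrow> real) \<Rightarrow> real \<Rightarrow> nat \<Rightarrow> real" where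
  "move_pt l z s i = (if l i \<in> E then (1 - s) * z i + s * even_pos l z i else z i)"

text \<open>Here each point is described by the open cell that contains it. That the same formula holds in
  the parameters of every closed cell, also at the ends of 1-cells, is \<open>deform_eq\<close>; this is what
  makes continuity accessible.\<close>

definition deform :: "real \<Rightarrow> (nat \<Rightarrow> 'a) \<Rightarrow> nat \<Rightarrow> 'a" where
  "deform s x = conf_of (\<lambda>i. proj X (x i)) (move_pt (\<lambda>i. proj X (x i)) (\<lambda>i. param X (x i)) s)"

lemma finite_V: "finite V"
  using finite_Index by simp

subsection \<open>Enumerating the points on a 1-cell\<close>

definition place :: "'c braid_index \<Rightarrow> 'c \<Rightarrow> nat \<Rightarrow> nat" where
  "place c m r = (SOME i. i < k \<and> label c i = m \<and> rank_on c i = r)"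

text \<open>The enumeration of \<open>marks\<close> in increasing order; index 0 is the left end and the last one the right end.\<close>

definition mark_seq :: "'c braid_index \<Rightarrow> 'c \<Rightarrow> (nat \<Rightarrow> real) \<Rightarrow> nat \<Rightarrow> real" where
  "mark_seq c m z j = (if j = 0 then -1 else if j \<le> npts c m then z (place c m (j - 1)) else 1)"

lemma place: assumes "c \<in> Index CX" "r < npts c m" shows "place c m r < k" "label c (place c m r) = m" "rank_on c (place c m r) = r"
proof -
  have "\<exists>i. i < k \<and> label c i = m \<and> rank_on c i = r" using rank_on_surj[OF assms] by blast
  from someI_ex[OF this] show "place c m r < k" "label c (place c m r) = m" "rank_on c (place c m r) = r" by (auto simp: place_def)
qed

lemma place_rank_on: "c \<in> Index CX \<Longrightarrow> i < k \<Longrightarrow> label c i = m \<Longrightarrow> place c m (rank_on c i) = i"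
  using place[of c "rank_on c i" m] rank_on_less_npts[of c i] rank_on_inj[of c "place c m (rank_on c i)" i] by auto

lemma mark_seq_rank_on: "c \<in> Index CX \<Longrightarrow> i < k \<Longrightarrow> label c i = m \<Longrightarrow> mark_seq c m z (Suc (rank_on c i)) = z i"
  using rank_on_less_npts[of c i] place_rank_on[of c i m] by (auto simp: mark_seq_def Suc_le_eq)

lemma marks_mark_seq: assumes c: "c \<in> Index CX" shows "marks (label c) z m = mark_seq c m z ` {..Suc (npts c m)}"
proof (intro equalityI subsetI)
  fix a assume "a \<in> marks (label c) z m"
  then consider "a = -1" | "a = 1" | i where "i < k" "label c i = m" "a = z i" by (auto simp: marks_def)
  then show "a \<in> mark_seq c m z ` {..Suc (npts c m)}"
  proof cases
    case 1 then show ?thesis by (intro image_eqI[of _ _ 0]) (auto simp: mark_seq_def)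
  next
    case 2 then show ?thesis by (intro image_eqI[of _ _ "Suc (npts c m)"]) (auto simp: mark_seq_def)
  next
    case 3
    then show ?thesis using mark_seq_rank_on[OF c 3(1,2)] rank_on_less_npts[OF c 3(1)]
      by (intro image_eqI[of _ _ "Suc (rank_on c i)"]) auto
  qed
next
  fix a assume "a \<in> mark_seq c m z ` {..Suc (npts c m)}"
  then obtain j where j: "j \<le> Suc (npts c m)" "a = mark_seq c m z j" by auto
  show "a \<in> marks (label c) z m"
  proof (cases "j = 0 \<or> \<not> j \<le> npts c m")
    case True
    then show ?thesis using j by (auto simp: mark_seq_def marks_def)
  next
    case False
    then have "j - 1 < npts c m" by auto
    then show ?thesis using place[OF c, of "j - 1" m] j False by (auto simp: mark_seq_def marks_def)
  qed
qed

lemma enumeration_mark_seq: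
  assumes c: "c \<in> Index CX" and z: "in_params c z" and m: "m \<in> E"
  shows "enumeration (mark_seq c m z) (npts c m)"
proof
  fix j assume j: "j \<le> npts c m"
  have b: "-1 \<le> mark_seq c m z j \<and> mark_seq c m z j \<le> 1" for j
  proof (cases "0 < j \<and> j \<le> npts c m")
    case True
    then have "j - 1 < npts c m" by auto
    then show ?thesis using in_params_bounds[OF c z place(1)[OF c]] True by (simp add: mark_seq_def)
  qed (auto simp: mark_seq_def)
  show "mark_seq c m z j \<le> mark_seq c m z (Suc j)"
  proof (cases "j = 0 \<or> j = npts c m")
    case True
    then show ?thesis using b[of j] b[of "Suc j"] by (auto simp: mark_seq_def)
  next
    case False
    then have j': "j - 1 < npts c m" "j < npts c m" "0 < j" using j by auto
    note a = place[OF c j'(1)] and a' = place[OF c j'(2)]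
    have "z (place c m (j - 1)) < z (place c m j)"
      using in_params_less_iff[OF c z a(1) a'(1)] a a' m j'(3) by simp
    then show ?thesis using j' by (simp add: mark_seq_def)
  qed
qed (auto simp: mark_seq_def)

lemma marked_interval_marks: "c \<in> Index CX \<Longrightarrow> in_params c z \<Longrightarrow> m \<in> E \<Longrightarrow> marked_interval (marks (label c) z m)"
proof -
  assume a: "c \<in> Index CX" "in_params c z" "m \<in> E"
  interpret enumeration "mark_seq c m z" "npts c m" by (rule enumeration_mark_seq[OF a])
  show ?thesis unfolding marks_mark_seq[OF a(1)] by (rule marked_interval_axioms)
qed

lemma mesh_bounds: "c \<in> Index CX \<Longrightarrow> in_params c z \<Longrightarrow> m \<in> E \<Longrightarrow> 0 < mesh (label c) z m \<and> mesh (label c) z m \<le> 2"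
  unfolding mesh_def using marked_interval.maxgap_pos marked_interval.maxgap_le marked_interval_marks by blast

subsection \<open>Independence of the cell\<close>

text \<open>At an end the value is that of the vertex to which the end is attached. A largest gap is at most 2, so
  the distance to the opposite end is capped by 1.\<close>

lemma near_vertex_end:
  assumes m: "m \<in> E" "y \<in> params X m" "\<bar>y\<bar> = 1" and M: "0 < M" "M \<le> 2"
  shows "near_vertex M v m y = (if proj X (char1 X m y) = v then 0 else 1)" "near_absent M m y = 1"
proof -
  have "1 \<le> 2 / M" using M by (simp add: field_simps)
  moreover have "y = 1 \<or> y = -1" using m(3) by auto
  ultimately show "near_vertex M v m y = (if proj X (char1 X m y) = v then 0 else 1)" "near_absent M m y = 1"
    using m(1,2) M by (auto simp: near_vertex_def near_absent_def min_def)
qed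

lemma near_vertex_range: "0 < M \<Longrightarrow> 0 \<le> near_vertex M v m y" "near_vertex M v m y \<le> 1"
  by (auto simp: near_vertex_def min_def)

lemma near_vertex_le: "m \<in> E \<Longrightarrow> \<sigma> \<in> params X m \<Longrightarrow> \<bar>\<sigma>\<bar> = 1 \<Longrightarrow> proj X (char1 X m \<sigma>) = v \<Longrightarrow> near_vertex M v m y \<le> \<bar>y - \<sigma>\<bar> / M"
proof -
  assume a: "m \<in> E" "\<sigma> \<in> params X m" "\<bar>\<sigma>\<bar> = 1" "proj X (char1 X m \<sigma>) = v"
  have "\<sigma> = 1 \<or> \<sigma> = -1" using a(3) by auto
  then show ?thesis using a by (auto simp: near_vertex_def min_def)
qed

text \<open>A point \<open>z\<close> of the domain of \<open>c\<close>, possibly at ends of 1-cells, compared with the description \<open>l'\<close>, \<open>z'\<close> of the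
  same configuration by open cells.\<close>

context
  fixes c :: "'c braid_index" and z :: "nat \<Rightarrow> real" and l' :: "nat \<Rightarrow> 'c" and z' :: "nat \<Rightarrow> real"
  assumes c: "c \<in> Index CX" and z: "in_params c z"
  defines "l' \<equiv> (\<lambda>i. proj X (conf_of (label c) z i))" and "z' \<equiv> (\<lambda>i. param X (conf_of (label c) z i))"
begin

lemma can_char1: "i < k \<Longrightarrow> l' i = proj X (char1 X (label c i) (z i)) \<and> z' i = param X (char1 X (label c i) (z i))"
  by (simp add: l'_def z'_def conf_of_def)

lemma can_interior: assumes "i < k" "\<bar>z i\<bar> \<noteq> 1" shows "l' i = label c i" "z' i = z i"
proof -
  have "l' i = label c i \<and> z' i = z i"
  proof (cases "label c i \<in> E")
    case True
    have "-1 < z i \<and> z i < 1" by (rule char1_E_cases[OF True in_params_params[OF z assms(1)]]) (use assms(2) in auto)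
    then show ?thesis using can_char1[OF assms(1)] True by (simp add: proj_char1_E param_char1_E)
  next
    case False
    then have "label c i \<in> V" using label_Index[OF c assms(1)] by simp
    then show ?thesis using can_char1[OF assms(1)] in_params_V[OF c z assms(1) False] by (simp add: param_char1_V)
  qed
  then show "l' i = label c i" "z' i = z i" by auto
qed

lemma can_end: assumes "i < k" "\<bar>z i\<bar> = 1" shows "label c i \<in> E" "l' i \<in> V" "z' i = 0" "char1 X (l' i) 0 = char1 X (label c i) (z i)"
proof -
  show E: "label c i \<in> E" using in_params_V[OF c z assms(1)] assms(2) by fastforce
  show v: "l' i \<in> V" using proj_char1_end[OF E in_params_params[OF z assms(1)] assms(2)] can_char1[OF assms(1)] by simp
  then show "z' i = 0" using can_char1[OF assms(1)] param_V[of "char1 X (label c i) (z i)"] by simp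
  show "char1 X (l' i) 0 = char1 X (label c i) (z i)"
    using end_eq_vertex[OF E in_params_params[OF z assms(1)] assms(2)] can_char1[OF assms(1)] by simp
qed

lemma marks_can: assumes m: "m \<in> E" shows "marks l' z' m = marks (label c) z m"
proof (intro equalityI subsetI)
  fix a assume "a \<in> marks l' z' m"
  then consider "a \<in> {-1, 1}" | i where "i < k" "l' i = m" "a = z' i" by (auto simp: marks_def)
  then show "a \<in> marks (label c) z m"
  proof cases
    case 2
    then have "\<bar>z i\<bar> \<noteq> 1" using can_end(2)[of i] m by auto
    then show ?thesis using can_interior[of i] 2 by (auto simp: marks_def)
  qed (auto simp: marks_def)
next
  fix a assume "a \<in> marks (label c) z m"
  then consider "a \<in> {-1, 1}" | i where "i < k" "label c i = m" "a = z i" by (auto simp: marks_def)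
  then show "a \<in> marks l' z' m"
  proof cases
    case 2
    show ?thesis
    proof (cases "\<bar>z i\<bar> = 1")
      case True
      then show ?thesis using 2 by (auto simp: marks_def abs_if split: if_splits)
    next
      case False
      then have "l' i = m \<and> a = z' i" using can_interior[of i] 2 by simp
      then show ?thesis using 2(1) by (auto simp: marks_def)
    qed
  qed (auto simp: marks_def)
qed

lemma mesh_can: "m \<in> E \<Longrightarrow> mesh l' z' m = mesh (label c) z m"
  by (simp add: mesh_def marks_can)

lemma near_vertex_can: assumes i: "i < k" shows "near_vertex (mesh l' z' (l' i)) v (l' i) (z' i) = near_vertex (mesh (label c) z (label c i)) v (label c i) (z i)"
    and "near_absent (mesh l' z' (l' i)) (l' i) (z' i) = near_absent (mesh (label c) z (label c i)) (label c i) (z i)"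
proof -
  have "near_vertex (mesh l' z' (l' i)) v (l' i) (z' i) = near_vertex (mesh (label c) z (label c i)) v (label c i) (z i) \<and>
    near_absent (mesh l' z' (l' i)) (l' i) (z' i) = near_absent (mesh (label c) z (label c i)) (label c i) (z i)"
  proof (cases "\<bar>z i\<bar> = 1")
    case False
    show ?thesis
    proof (cases "label c i \<in> E")
      case True
      then show ?thesis using can_interior[OF i False] mesh_can by simp
    qed (use can_interior[OF i False] in \<open>simp add: near_vertex_def near_absent_def\<close>)
  next
    case True
    note e = can_end[OF i True]
    have M: "0 < mesh (label c) z (label c i)" "mesh (label c) z (label c i) \<le> 2" using mesh_bounds[OF c z e(1)] by auto
    show ?thesis
      using near_vertex_end[OF e(1) in_params_params[OF z i] True M] e(2) can_char1[OF i] by (simp add: near_vertex_def near_absent_def)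
  qed
  then show "near_vertex (mesh l' z' (l' i)) v (l' i) (z' i) = near_vertex (mesh (label c) z (label c i)) v (label c i) (z i)"
    "near_absent (mesh l' z' (l' i)) (l' i) (z' i) = near_absent (mesh (label c) z (label c i)) (label c i) (z i)" by auto
qed

text \<open>If two points approach each other on a 1-cell while one of them reaches an end, their distance
  ceases to be recorded as a distance along the cell, but it is bounded below by the term for the
  vertex at that end.\<close>

lemma tau_term_can: assumes ij: "i < k" "j < k" shows "tau_term l' z' (i, j) = tau_term (label c) z (i, j)"
proof (cases "i = j")
  case True
  then show ?thesis using near_vertex_can(2)[OF ij(1)] by (simp add: tau_term_def)
next
  case False
  define H where "H = min_over V (\<lambda>v. max (near_vertex (mesh (label c) z (label c i)) v (label c i) (z i)) (near_vertex (mesh (label c) z (label c j)) v (label c j) (z j)))"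
  have H1: "H \<le> 1" unfolding H_def by (rule min_over_le(1)[OF finite_V])
  define P where "P = (if label c i = label c j \<and> label c i \<in> E then \<bar>z i - z j\<bar> / mesh (label c) z (label c i) else 1)"
  define P' where "P' = (if l' i = l' j \<and> l' i \<in> E then \<bar>z' i - z' j\<bar> / mesh l' z' (l' i) else 1)"
  have HP: "H \<le> P" if "\<bar>z i\<bar> = 1 \<or> \<bar>z j\<bar> = 1"
  proof (cases "label c i = label c j \<and> label c i \<in> E")
    case True
    define m where "m = label c i"
    have m: "label c i = m" "label c j = m" "m \<in> E" using True by (auto simp: m_def)
    have M: "0 < mesh (label c) z m" "mesh (label c) z m \<le> 2" using mesh_bounds[OF c z m(3)] by auto
    have near_end_le: "max (near_vertex (mesh (label c) z m) v m (z a)) (near_vertex (mesh (label c) z m) v m (z b)) \<le> \<bar>z a - z b\<bar> / mesh (label c) z m"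
      if a: "a < k" "label c a = m" "\<bar>z a\<bar> = 1" and v: "v = proj X (char1 X m (z a))" for a b v
    proof -
      have d: "z a \<in> params X m" using in_params_params[OF z a(1)] a(2) by simp
      have "near_vertex (mesh (label c) z m) v m (z a) = 0" using near_vertex_end(1)[OF m(3) d a(3) M] v by simp
      moreover have "near_vertex (mesh (label c) z m) v m (z b) \<le> \<bar>z b - z a\<bar> / mesh (label c) z m"
        by (rule near_vertex_le[OF m(3) d a(3) v[symmetric]])
      ultimately show ?thesis using M by (simp add: abs_minus_commute)
    qed
    have vV: "proj X (char1 X m (z a)) \<in> V" if "a < k" "label c a = m" "\<bar>z a\<bar> = 1" for a
      using proj_char1_end[OF m(3) _ that(3)] in_params_params[OF z that(1)] that(2) by simp
    have Pm: "P = \<bar>z i - z j\<bar> / mesh (label c) z m" using m by (simp add: P_def)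
    show ?thesis
    proof (cases "\<bar>z i\<bar> = 1")
      case zi: True
      have "H \<le> max (near_vertex (mesh (label c) z m) (proj X (char1 X m (z i))) m (z i)) (near_vertex (mesh (label c) z m) (proj X (char1 X m (z i))) m (z j))"
        unfolding H_def m(1,2) by (rule min_over_le(2)[OF finite_V vV[OF ij(1) m(1) zi]])
      also have "\<dots> \<le> P" unfolding Pm by (rule near_end_le[OF ij(1) m(1) zi refl])
      finally show ?thesis .
    next
      case zi: False
      then have zj: "\<bar>z j\<bar> = 1" using that by simp
      have "H \<le> max (near_vertex (mesh (label c) z m) (proj X (char1 X m (z j))) m (z i)) (near_vertex (mesh (label c) z m) (proj X (char1 X m (z j))) m (z j))"
        unfolding H_def m(1,2) by (rule min_over_le(2)[OF finite_V vV[OF ij(2) m(2) zj]])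
      also have "\<dots> \<le> P" unfolding Pm using near_end_le[OF ij(2) m(2) zj refl, of i] by (simp add: max.commute abs_minus_commute)
      finally show ?thesis .
    qed
  next
    case False
    then have "P = 1" unfolding P_def by (rule if_not_P)
    then show ?thesis using H1 by simp
  qed
  have "min P' H = min P H"
  proof (cases "\<bar>z i\<bar> = 1 \<or> \<bar>z j\<bar> = 1")
    case True
    have "\<not> (l' i = l' j \<and> l' i \<in> E)" using True can_end(2)[OF ij(1)] can_end(2)[OF ij(2)] by auto
    then have "P' = 1" unfolding P'_def by (rule if_not_P)
    then show ?thesis using HP[OF True] H1 by simp
  next
    case False
    then have n: "l' i = label c i" "z' i = z i" "l' j = label c j" "z' j = z j"
      using can_interior[OF ij(1)] can_interior[OF ij(2)] by auto
    have "P' = P" unfolding P_def P'_def n by (intro if_cong refl) (auto simp: mesh_can)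
    then show ?thesis by simp
  qed
  moreover have "min_over V (\<lambda>v. max (near_vertex (mesh l' z' (l' i)) v (l' i) (z' i)) (near_vertex (mesh l' z' (l' j)) v (l' j) (z' j))) = H"
    unfolding H_def near_vertex_can(1)[OF ij(1)] near_vertex_can(1)[OF ij(2)] ..
  ultimately show ?thesis using False by (simp add: tau_term_def P_def P'_def H_def)
qed

lemma tau_can: "tau l' z' = tau (label c) z"
  unfolding tau_def by (rule min_over_cong) (auto simp: tau_term_can)

text \<open>A vanishing term would be a missing end that is reached or a vertex at which two coordinates meet, or two
  coordinates with the same parameter.\<close>

lemma tau_pos: "0 < tau (label c) z"
proof -
  have fin: "finite ({..<k} \<times> {..<k})" by simp
  have "0 < tau_term (label c) z (i, j)" if ij: "i < k" "j < k" for i j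
  proof (cases "i = j")
    case True
    have "0 < near_absent (mesh (label c) z (label c i)) (label c i) (z i)"
    proof (cases "label c i \<in> E")
      case E: True
      have M: "0 < mesh (label c) z (label c i)" using mesh_bounds[OF c z E] by simp
      have "z i \<in> params X (label c i)" by (rule in_params_params[OF z ij(1)])
      then have "-1 \<notin> params X (label c i) \<Longrightarrow> z i + 1 \<noteq> 0" "1 \<notin> params X (label c i) \<Longrightarrow> z i - 1 \<noteq> 0"
        by (auto simp: add_eq_0_iff2)
      then show ?thesis using E M by (simp add: near_absent_def)
    qed (simp add: near_absent_def)
    then show ?thesis using True by (simp add: tau_term_def)
  next
    case False
    have zero: "char1 X v 0 = char1 X (label c a) (z a)" if "a < k" and near0: "near_vertex (mesh (label c) z (label c a)) v (label c a) (z a) = 0" for a v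
    proof (cases "label c a \<in> E")
      case True
      have M: "0 < mesh (label c) z (label c a)" using mesh_bounds[OF c z True] by simp
      consider "-1 \<in> params X (label c a)" "proj X (char1 X (label c a) (-1)) = v" "z a = -1"
        | "1 \<in> params X (label c a)" "proj X (char1 X (label c a) 1) = v" "z a = 1"
        using near0 M True by (auto simp: near_vertex_def min_def split: if_splits)
      then show ?thesis using end_eq_vertex[OF True, of "-1"] end_eq_vertex[OF True, of 1] by cases auto
    next
      case False
      then have "label c a = v" using that(2) by (auto simp: near_vertex_def split: if_splits)
      then show ?thesis using in_params_V[OF c z that(1) False] by simp
    qed
    have dist: "char1 X (label c i) (z i) \<noteq> char1 X (label c j) (z j)" by (rule in_params_distinct[OF z ij False])
    have nn: "0 \<le> near_vertex (mesh (label c) z (label c a)) v (label c a) (z a)" for a v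
    proof (cases "label c a \<in> E")
      case True
      then show ?thesis using near_vertex_range(1) mesh_bounds[OF c z True] by blast
    qed (simp add: near_vertex_def)
    have "0 < max (near_vertex (mesh (label c) z (label c i)) v (label c i) (z i)) (near_vertex (mesh (label c) z (label c j)) v (label c j) (z j))" for v
    proof -
      have "near_vertex (mesh (label c) z (label c i)) v (label c i) (z i) \<noteq> 0 \<or> near_vertex (mesh (label c) z (label c j)) v (label c j) (z j) \<noteq> 0"
        using zero[OF ij(1), of v] zero[OF ij(2), of v] dist by force
      then show ?thesis using nn[of i v] nn[of j v] unfolding less_max_iff_disj by force
    qed
    then have "0 < min_over V (\<lambda>v. max (near_vertex (mesh (label c) z (label c i)) v (label c i) (z i))
        (near_vertex (mesh (label c) z (label c j)) v (label c j) (z j)))"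
      unfolding less_min_over_iff[OF finite_V] by simp
    moreover have "0 < (if label c i = label c j \<and> label c i \<in> E then \<bar>z i - z j\<bar> / mesh (label c) z (label c i) else 1)"
    proof (cases "label c i = label c j \<and> label c i \<in> E")
      case True
      then have "z i \<noteq> z j" using dist by auto
      then have "0 < \<bar>z i - z j\<bar> / mesh (label c) z (label c i)"
        using mesh_bounds[OF c z, of "label c i"] True by (intro divide_pos_pos) auto
      then show ?thesis unfolding if_P[OF True] .
    next
      case False
      then show ?thesis unfolding if_not_P[OF False] by simp
    qed
    ultimately show ?thesis
      unfolding tau_term_def prod.case if_not_P[OF False] by (simp only: min_less_iff_conj)
  qed
  then show ?thesis unfolding tau_def less_min_over_iff[OF fin] by auto
qed

lemma tau_le: "tau (label c) z \<le> 1" "i < k \<Longrightarrow> j < k \<Longrightarrow> tau (label c) z \<le> tau_term (label c) z (i, j)"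
  unfolding tau_def by (auto intro!: min_over_le)

lemma kappa_pos: "m \<in> E \<Longrightarrow> 0 < mesh (label c) z m * tau (label c) z"
  using mesh_bounds[OF c z] tau_pos by simp

text \<open>The truncated gaps remain positive, so the order is preserved and only the coordinates at an end are
  sent to an end.\<close>

lemma even_pos_facts:
  assumes i: "i < k" "label c i \<in> E"
  shows "z i = -1 \<Longrightarrow> even_pos (label c) z i = -1" "z i = 1 \<Longrightarrow> even_pos (label c) z i = 1"
    and "z i < 1 \<Longrightarrow> even_pos (label c) z i < 1" "-1 < z i \<Longrightarrow> -1 < even_pos (label c) z i"
    and "\<And>j. j < k \<Longrightarrow> label c j = label c i \<Longrightarrow> z i < z j \<Longrightarrow> even_pos (label c) z i < even_pos (label c) z j"
proof -
  define m where "m = label c i"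
  define S where "S = marks (label c) z m"
  define \<kappa> where "\<kappa> = mesh (label c) z m * tau (label c) z"
  have m: "m \<in> E" "label c i = m" using i by (auto simp: m_def)
  interpret marked_interval S unfolding S_def by (rule marked_interval_marks[OF c z m(1)])
  have k0: "0 < \<kappa>" unfolding \<kappa>_def by (rule kappa_pos[OF m(1)])
  have np: "even_pos (label c) z j = -1 + 2 * (gap_sum S \<kappa> (z j) / gap_sum S \<kappa> 1)" if "label c j = m" for j
    using that by (simp add: even_pos_def Let_def S_def \<kappa>_def)
  have zS: "z j \<in> S" if "j < k" "label c j = m" for j using that by (auto simp: S_def marks_def)
  note T = gap_sum_top_pos[OF k0]
  show "even_pos (label c) z i = -1" if "z i = -1" using np[OF m(2)] that gap_sum_bot by simp
  show "even_pos (label c) z i = 1" if "z i = 1" using np[OF m(2)] that T by simp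
  show "even_pos (label c) z i < 1" if "z i < 1"
  proof -
    have "gap_sum S \<kappa> (z i) / gap_sum S \<kappa> 1 < 1"
      using T gap_sum_strict_mono[OF k0 zS[OF i(1) m(2)] ends_in(2) that] by simp
    then show ?thesis unfolding np[OF m(2)] by linarith
  qed
  show "-1 < even_pos (label c) z i" if "-1 < z i"
    using np[OF m(2)] T gap_sum_strict_mono[OF k0 ends_in(1) zS[OF i(1) m(2)] that] gap_sum_bot[of \<kappa>] by simp
  show "even_pos (label c) z i < even_pos (label c) z j" if "j < k" "label c j = label c i" "z i < z j" for j
  proof -
    have j: "label c j = m" using that(2) m(2) by simp
    have "gap_sum S \<kappa> (z i) < gap_sum S \<kappa> (z j)" by (rule gap_sum_strict_mono[OF k0 zS[OF i(1) m(2)] zS[OF that(1) j] that(3)])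
    then show ?thesis unfolding np[OF m(2)] np[OF j] using T by (simp add: divide_strict_right_mono)
  qed
qed

lemma move_pt_interior: assumes i: "i < k" and s: "0 \<le> s" "s \<le> 1" and a: "\<bar>z i\<bar> < 1" shows "\<bar>move_pt (label c) z s i\<bar> < 1"
proof (cases "label c i \<in> E")
  case True
  have n: "-1 < even_pos (label c) z i" "even_pos (label c) z i < 1" using even_pos_facts(3,4)[OF i True] a by auto
  have "(1 - s) * z i + s * even_pos (label c) z i < 1" "-1 < (1 - s) * z i + s * even_pos (label c) z i"
  proof -
    have "z i < 1" "-1 < z i" using a by auto
    then show "(1 - s) * z i + s * even_pos (label c) z i < 1" using n s convex_bound_lt[of "z i" 1 "even_pos (label c) z i" "1 - s" s] by simp
    have "- z i < 1" "- even_pos (label c) z i < 1" using a n by auto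
    then have "(1 - s) * (- z i) + s * (- even_pos (label c) z i) < 1" using s convex_bound_lt[of "- z i" 1 "- even_pos (label c) z i" "1 - s" s] by simp
    then show "-1 < (1 - s) * z i + s * even_pos (label c) z i" by simp
  qed
  then show ?thesis using True by (simp add: move_pt_def)
qed (use a in \<open>simp add: move_pt_def\<close>)

lemma move_pt_end: assumes i: "i < k" and a: "\<bar>z i\<bar> = 1" shows "move_pt (label c) z s i = z i"
proof -
  have E: "label c i \<in> E" by (rule can_end(1)[OF i a])
  have "even_pos (label c) z i = z i" using even_pos_facts(1,2)[OF i E] a by (auto simp: abs_if split: if_splits)
  then show ?thesis by (simp add: move_pt_def algebra_simps)
qed

lemma move_pt_params: assumes i: "i < k" and s: "0 \<le> s" "s \<le> 1" shows "move_pt (label c) z s i \<in> params X (label c i)"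
proof (cases "\<bar>z i\<bar> = 1")
  case True
  then show ?thesis using move_pt_end[OF i True] in_params_params[OF z i] by simp
next
  case False
  then have "\<bar>z i\<bar> < 1" using in_params_bounds[OF c z i] by auto
  then have h: "\<bar>move_pt (label c) z s i\<bar> < 1" by (rule move_pt_interior[OF i s])
  show ?thesis
  proof (cases "label c i \<in> E")
    case True
    have "move_pt (label c) z s i \<in> {-1<..<1}" using h by auto
    then show ?thesis using Dom_E(2)[OF True] by blast
  next
    case False
    then show ?thesis using in_params_params[OF z i] by (simp add: move_pt_def)
  qed
qed

lemma deform_eq: "deform s (conf_of (label c) z) = conf_of (label c) (move_pt (label c) z s)"
  unfolding deform_def l'_def[symmetric] z'_def[symmetric]
proof (rule conf_of_cong)
  fix i assume i: "i < k"
  show "char1 X (l' i) (move_pt l' z' s i) = char1 X (label c i) (move_pt (label c) z s i)"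
  proof (cases "\<bar>z i\<bar> = 1")
    case True
    note e = can_end[OF i True]
    have "move_pt l' z' s i = 0" using e(2,3) by (simp add: move_pt_def)
    then show ?thesis using e(4) move_pt_end[OF i True] by simp
  next
    case False
    note n = can_interior[OF i False]
    have "move_pt l' z' s i = move_pt (label c) z s i"
    proof (cases "label c i \<in> E")
      case True
      then have "even_pos l' z' i = even_pos (label c) z i" using n marks_can mesh_can tau_can by (simp add: even_pos_def)
      then show ?thesis using n by (simp add: move_pt_def)
    qed (use n in \<open>simp add: move_pt_def\<close>)
    then show ?thesis using n by simp
  qed
qed

end

text \<open>Starting from interior parameters, the deformation stays in the open cell.\<close>

lemma deform_conf: assumes x: "x \<in> CF" and s: "0 \<le> s" "s \<le> 1" shows "deform s x \<in> CF"
proof -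
  define c where "c = braid_proj k X x"
  define z where "z = (\<lambda>i. param X (x i))"
  have c: "c \<in> Index CX" unfolding c_def by (rule braid_proj_Index[OF x])
  have z: "in_params c z" "conf_of (label c) z = x" using in_params_param[OF x] by (auto simp: c_def z_def)
  have zb: "\<bar>z i\<bar> < 1" if "i < k" for i using param_proj(1,2)[of "x i"] x that by (auto simp: z_def conf_iff)
  have "in_params c (move_pt (label c) z s)"
  proof (rule in_params_interior[OF c])
    fix i assume i: "i < k"
    show "move_pt (label c) z s i \<in> params X (label c i)" by (rule move_pt_params[OF c z(1) i s])
    show "\<bar>move_pt (label c) z s i\<bar> \<noteq> 1" using move_pt_interior[OF c z(1) i s zb[OF i]] by simp
  next
    fix i j assume ij: "i < k" "j < k" "label c i \<in> E" "label c j = label c i" "base_param c i < base_param c j"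
    then have lt: "z i < z j" using z(1) by (simp add: in_params_def)
    have "even_pos (label c) z i < even_pos (label c) z j" by (rule even_pos_facts(5)[OF c z(1) ij(1,3,2,4) lt])
    then have "(1 - s) * z i + s * even_pos (label c) z i < (1 - s) * z j + s * even_pos (label c) z j"
    proof (cases "s = 0")
      case False
      then have "s * even_pos (label c) z i < s * even_pos (label c) z j" using s \<open>even_pos (label c) z i < _\<close> by simp
      moreover have "(1 - s) * z i \<le> (1 - s) * z j" using s lt by (intro mult_left_mono) auto
      ultimately show ?thesis by simp
    qed (use lt in simp)
    then show "move_pt (label c) z s i < move_pt (label c) z s j" using ij by (simp add: move_pt_def)
  qed
  then have "conf_of (label c) (move_pt (label c) z s) \<in> CF" by (rule conf_of_conf[OF c])
  then show ?thesis using deform_eq[OF c z(1), of s] z(2) by simp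
qed

end

lemma one_le_abs_diff: assumes "a \<noteq> b" shows "1 \<le> \<bar>real a - real b\<bar>"
proof -
  have "1 \<le> \<bar>int a - int b\<bar>" using assms by linarith
  then have "real_of_int 1 \<le> real_of_int \<bar>int a - int b\<bar>" by (simp only: of_int_le_iff)
  then show ?thesis by simp
qed

context finite_graph begin

subsection \<open>Continuity\<close>

lemma in_params_of_Dom:
  assumes c: "c \<in> Index CX" and t: "t \<in> topspace (Dom CX c)"
  shows "in_params c (\<lambda>i. t i 0)" "Char CX c t = conf_of (label c) (\<lambda>i. t i 0)"
proof -
  obtain y where y: "in_params c y" "t = lift_pt y" using t topspace_Dom_comp[OF c] by auto
  show "in_params c (\<lambda>i. t i 0)" using y in_params_cong[of "\<lambda>i. t i 0" y c] by simp
  show "Char CX c t = conf_of (label c) (\<lambda>i. t i 0)" unfolding y(2) Char_comp_lift_pt by (rule conf_of_cong) simp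
qed

context
  fixes c :: "'c braid_index"
  assumes c: "c \<in> Index CX"
begin

abbreviation "zz t \<equiv> (\<lambda>i. (t :: nat \<Rightarrow> nat \<Rightarrow> real) i 0)"

lemma continuous_mark_seq: "continuous_map (Dom CX c) euclideanreal (\<lambda>t. mark_seq c m (zz t) j)"
proof (cases "0 < j \<and> j \<le> npts c m")
  case True
  then have "j - 1 < npts c m" by auto
  then show ?thesis using continuous_map_Dom_comp_coord[OF c place(1)[OF c]] True by (simp add: mark_seq_def)
next
  case False
  then show ?thesis by (auto simp: mark_seq_def)
qed

lemma continuous_mesh: assumes m: "m \<in> E" shows "continuous_map (Dom CX c) euclideanreal (\<lambda>t. mesh (label c) (zz t) m)"
proof -
  have "continuous_map (Dom CX c) euclideanreal (\<lambda>t. Max ((\<lambda>i. mark_seq c m (zz t) (Suc i) - mark_seq c m (zz t) i) ` {..npts c m}))"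
    by (intro continuous_map_Max continuous_map_diff continuous_mark_seq) auto
  moreover have "Max ((\<lambda>i. mark_seq c m (zz t) (Suc i) - mark_seq c m (zz t) i) ` {..npts c m}) = mesh (label c) (zz t) m"
    if "t \<in> topspace (Dom CX c)" for t
    using enumeration.maxgap_q[OF enumeration_mark_seq[OF c in_params_of_Dom(1)[OF c that] m]]
    by (simp add: mesh_def marks_mark_seq[OF c])
  ultimately show ?thesis by (rule continuous_map_eq)
qed

lemma mesh_nonzero: "m \<in> E \<Longrightarrow> t \<in> topspace (Dom CX c) \<Longrightarrow> mesh (label c) (zz t) m \<noteq> 0"
  using mesh_bounds[OF c in_params_of_Dom(1)[OF c], of t m] by auto

lemma continuous_near_vertex:
  assumes i: "i < k"
  shows "continuous_map (Dom CX c) euclideanreal (\<lambda>t. near_vertex (mesh (label c) (zz t) (label c i)) v (label c i) (zz t i))"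
    and "continuous_map (Dom CX c) euclideanreal (\<lambda>t. near_absent (mesh (label c) (zz t) (label c i)) (label c i) (zz t i))"
proof -
  let ?g = "\<lambda>\<sigma> t. \<bar>zz t i + \<sigma>\<bar> / mesh (label c) (zz t) (label c i)"
  have g: "continuous_map (Dom CX c) euclideanreal (?g \<sigma>)" if "label c i \<in> E" for \<sigma>
    using that by (intro continuous_map_real_divide continuous_map_real_abs continuous_map_add
        continuous_map_Dom_comp_coord[OF c i] continuous_mesh mesh_nonzero) auto
  have g': "continuous_map (Dom CX c) euclideanreal (\<lambda>t. \<bar>zz t i - 1\<bar> / mesh (label c) (zz t) (label c i))" if "label c i \<in> E"
    using g[OF that, of "-1"] by simp
  show "continuous_map (Dom CX c) euclideanreal (\<lambda>t. near_vertex (mesh (label c) (zz t) (label c i)) v (label c i) (zz t i))"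
    unfolding near_vertex_def by (cases "label c i \<in> E") (auto intro!: continuous_map_real_min g g')
  show "continuous_map (Dom CX c) euclideanreal (\<lambda>t. near_absent (mesh (label c) (zz t) (label c i)) (label c i) (zz t i))"
    unfolding near_absent_def by (cases "label c i \<in> E") (auto intro!: continuous_map_real_min g g')
qed

lemma continuous_tau: "continuous_map (Dom CX c) euclideanreal (\<lambda>t. tau (label c) (zz t))"
  unfolding tau_def
proof (rule continuous_map_min_over)
  fix ij assume "ij \<in> {..<k} \<times> {..<k}"
  then obtain i j where ij: "ij = (i, j)" "i < k" "j < k" by auto
  have d: "continuous_map (Dom CX c) euclideanreal
      (\<lambda>t. if label c i = label c j \<and> label c i \<in> E then \<bar>zz t i - zz t j\<bar> / mesh (label c) (zz t) (label c i) else 1)"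
  proof (cases "label c i = label c j \<and> label c i \<in> E")
    case True
    then have "continuous_map (Dom CX c) euclideanreal (\<lambda>t. \<bar>zz t i - zz t j\<bar> / mesh (label c) (zz t) (label c i))"
      by (intro continuous_map_real_divide continuous_map_real_abs continuous_map_diff
          continuous_map_Dom_comp_coord[OF c ij(2)] continuous_map_Dom_comp_coord[OF c ij(3)] continuous_mesh mesh_nonzero) auto
    then show ?thesis unfolding if_P[OF True] .
  next
    case False
    show ?thesis unfolding if_not_P[OF False] by simp
  qed
  have H: "continuous_map (Dom CX c) euclideanreal (\<lambda>t. min_over V (\<lambda>v.
      max (near_vertex (mesh (label c) (zz t) (label c i)) v (label c i) (zz t i)) (near_vertex (mesh (label c) (zz t) (label c j)) v (label c j) (zz t j))))"
    by (intro continuous_map_min_over[OF finite_V] continuous_map_real_max continuous_near_vertex ij)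
  show "continuous_map (Dom CX c) euclideanreal (\<lambda>t. tau_term (label c) (zz t) ij)"
  proof (cases "i = j")
    case True
    then show ?thesis using continuous_near_vertex(2)[OF ij(2)] by (simp add: ij(1) tau_term_def)
  next
    case False
    show ?thesis unfolding ij(1) tau_term_def prod.case if_not_P[OF False]
      by (rule continuous_map_real_min[OF d H])
  qed
qed simp

lemma even_pos_mark_seq:
  assumes z: "in_params c z" and i: "i < k" "label c i = m" and m: "m \<in> E"
  defines "\<kappa> \<equiv> mesh (label c) z m * tau (label c) z"
  shows "even_pos (label c) z i = -1 + 2 * ((\<Sum>r<Suc (rank_on c i). min 1 ((mark_seq c m z (Suc r) - mark_seq c m z r) / \<kappa>)) /
     (\<Sum>r<Suc (npts c m). min 1 ((mark_seq c m z (Suc r) - mark_seq c m z r) / \<kappa>)))"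
proof -
  interpret enumeration "mark_seq c m z" "npts c m" by (rule enumeration_mark_seq[OF c z m])
  have k0: "0 < \<kappa>" unfolding \<kappa>_def by (rule kappa_pos[OF c z m])
  have r: "Suc (rank_on c i) \<le> Suc (npts c m)" using rank_on_less_npts[OF c i(1)] i by simp
  have "gap_sum S \<kappa> (z i) = (\<Sum>r<Suc (rank_on c i). min 1 ((mark_seq c m z (Suc r) - mark_seq c m z r) / \<kappa>))"
    using gap_sum_q[OF k0 r] mark_seq_rank_on[OF c i] by simp
  moreover have "gap_sum S \<kappa> 1 = (\<Sum>r<Suc (npts c m). min 1 ((mark_seq c m z (Suc r) - mark_seq c m z r) / \<kappa>))"
    using gap_sum_q[OF k0 order_refl] unfolding qN .
  ultimately show ?thesis
    unfolding even_pos_def Let_def i(2) marks_mark_seq[OF c] \<kappa>_def[symmetric] by simp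
qed

lemma continuous_even_pos:
  assumes i: "i < k" "label c i = m" and m: "m \<in> E"
  shows "continuous_map (Dom CX c) euclideanreal (\<lambda>t. even_pos (label c) (zz t) i)"
proof -
  let ?\<kappa> = "\<lambda>t. mesh (label c) (zz t) m * tau (label c) (zz t)"
  let ?s = "\<lambda>n t. \<Sum>r<n. min 1 ((mark_seq c m (zz t) (Suc r) - mark_seq c m (zz t) r) / ?\<kappa> t)"
  have k0: "?\<kappa> t \<noteq> 0" if "t \<in> topspace (Dom CX c)" for t
    by (rule less_imp_neq[OF kappa_pos[OF c in_params_of_Dom(1)[OF c that] m], symmetric])
  have s: "continuous_map (Dom CX c) euclideanreal (?s n)" for n
    by (intro continuous_map_sum continuous_map_real_min continuous_map_real_divide continuous_map_diff
        continuous_mark_seq continuous_map_real_mult continuous_mesh[OF m] continuous_tau k0) auto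
  have s0: "?s (Suc (npts c m)) t \<noteq> 0" if t: "t \<in> topspace (Dom CX c)" for t
  proof -
    interpret enumeration "mark_seq c m (zz t)" "npts c m" by (rule enumeration_mark_seq[OF c in_params_of_Dom(1)[OF c t] m])
    have k0: "0 < ?\<kappa> t" by (rule kappa_pos[OF c in_params_of_Dom(1)[OF c t] m])
    show ?thesis using gap_sum_q[OF k0 order_refl] gap_sum_top_pos[OF k0] unfolding qN by simp
  qed
  have "continuous_map (Dom CX c) euclideanreal (\<lambda>t. -1 + 2 * (?s (Suc (rank_on c i)) t / ?s (Suc (npts c m)) t))"
    by (intro continuous_map_add continuous_map_real_mult continuous_map_real_divide s s0) auto
  then show ?thesis
    by (rule continuous_map_eq) (rule even_pos_mark_seq[OF in_params_of_Dom(1)[OF c] i m, symmetric])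
qed

lemma deform_continuous_cell:
  "continuous_map (prod_topology (top_of_set {0..1}) (Dom CX c)) (conf_space k (Space X)) (\<lambda>(s, t). deform s (Char CX c t))"
proof -
  let ?P = "prod_topology (top_of_set {0..1::real}) (Dom CX c)"
  let ?f = "\<lambda>(s, t). conf_of (label c) (move_pt (label c) (zz t) s)"
  have fst: "continuous_map ?P euclideanreal fst"
    using continuous_map_fst[of "top_of_set {0..1::real}" "Dom CX c"] by (simp add: continuous_map_in_subtopology)
  have snd: "continuous_map ?P euclideanreal (\<lambda>p. g (snd p))" if "continuous_map (Dom CX c) euclideanreal g" for g
    using continuous_map_compose[OF continuous_map_snd that] by (simp add: o_def)
  have top: "0 \<le> s" "s \<le> 1" "in_params c (zz t)" "Char CX c t = conf_of (label c) (zz t)" if "(s, t) \<in> topspace ?P" for s t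
    using that in_params_of_Dom[OF c, of t] by auto
  have eq: "?f (s, t) = deform s (Char CX c t)" if "(s, t) \<in> topspace ?P" for s t
    using deform_eq[OF c top(3)[OF that], of s] top(4)[OF that] by simp
  have comp: "continuous_map ?P (Space X) (\<lambda>p. ?f p i)" if i: "i < k" for i
  proof -
    have h: "continuous_map ?P euclideanreal (\<lambda>p. move_pt (label c) (zz (snd p)) (fst p) i)"
    proof (cases "label c i \<in> E")
      case True
      have "continuous_map ?P euclideanreal
          (\<lambda>p. (1 - fst p) * zz (snd p) i + fst p * even_pos (label c) (zz (snd p)) i)"
        by (intro continuous_map_add continuous_map_real_mult continuous_map_diff fst snd
            continuous_map_Dom_comp_coord[OF c i] continuous_even_pos[OF i refl True]) auto
      then show ?thesis using True by (simp add: move_pt_def)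
    next
      case False
      then show ?thesis using snd[OF continuous_map_Dom_comp_coord[OF c i]] by (simp add: move_pt_def)
    qed
    have "continuous_map ?P (Dom X (label c i)) (\<lambda>p. disk1 (move_pt (label c) (zz (snd p)) (fst p) i))"
      by (rule continuous_map_into_Dom[OF label_Index[OF c i] h]) (use move_pt_params[OF c top(3) i top(1,2)] in auto)
    then have "continuous_map ?P (Space X) (\<lambda>p. Char X (label c i) (disk1 (move_pt (label c) (zz (snd p)) (fst p) i)))"
      using continuous_map_compose[OF _ Char_continuous[OF label_Index[OF c i]]] by (fastforce simp: o_def)
    then show ?thesis by (rule continuous_map_eq) (use i in \<open>auto simp: conf_of_def char1_def\<close>)
  qed
  have "continuous_map ?P (power_space k (Space X)) ?f"
    unfolding power_space_def continuous_map_componentwise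
  proof (intro conjI ballI)
    show "?f ` topspace ?P \<subseteq> extensional {..<k}" by (auto simp: conf_of_def)
    fix i assume "i \<in> {..<k}"
    then show "continuous_map ?P (Space X) (\<lambda>p. ?f p i)" by (intro comp) simp
  qed
  moreover have "?f p \<in> CF" if "p \<in> topspace ?P" for p
  proof -
    obtain s t where p: "p = (s, t)" by (cases p)
    have st: "(s, t) \<in> topspace ?P" using that p by simp
    have "Char CX c t \<in> CF" unfolding top(4)[OF st] by (rule conf_of_conf[OF c top(3)[OF st]])
    then show ?thesis unfolding p eq[OF st] by (rule deform_conf[OF _ top(1,2)[OF st]])
  qed
  ultimately have "continuous_map ?P (conf_space k (Space X)) ?f"
    unfolding conf_space_def continuous_map_in_subtopology by blast
  then show ?thesis by (rule continuous_map_eq) (use eq in auto)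
qed

end

text \<open>The characteristic maps of the cells are proper, so their products with the identity of the unit
  interval are still closed maps.\<close>

lemma deform_continuous:
  "continuous_map (prod_topology (top_of_set {0..1::real}) (conf_space k (Space X))) (conf_space k (Space X)) (\<lambda>(s, x). deform s x)"
proof (rule continuous_map_from_closed_cover[OF finite_Index_comp, where
      D = "\<lambda>c. prod_topology (top_of_set {0..1::real}) (Dom CX c)" and q = "\<lambda>c (s, t). (s, Char CX c t)"])
  fix c assume c: "c \<in> Index CX"
  have "proper_map (top_of_set {0..1::real}) (top_of_set {0..1::real}) (\<lambda>s. s)"
    using proper_map_id[of "top_of_set {0..1::real}"] by (simp add: id_def)
  then have "proper_map (prod_topology (top_of_set {0..1::real}) (Dom CX c)) (prod_topology (top_of_set {0..1::real}) (conf_space k (Space X)))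
      (\<lambda>(s, t). (s, Char CX c t))"
    using Char_comp_proper[OF c] by (subst proper_map_prod) blast
  then show "closed_map (prod_topology (top_of_set {0..1::real}) (Dom CX c)) (prod_topology (top_of_set {0..1::real}) (conf_space k (Space X)))
      (\<lambda>(s, t). (s, Char CX c t))" by (rule proper_imp_closed_map)
  show "continuous_map (prod_topology (top_of_set {0..1::real}) (Dom CX c)) (conf_space k (Space X))
     (\<lambda>t. (\<lambda>(s, x). deform s x) ((\<lambda>(s, t). (s, Char CX c t)) t))"
    using deform_continuous_cell[OF c] by (simp add: case_prod_unfold)
next
  show "topspace (prod_topology (top_of_set {0..1::real}) (conf_space k (Space X)))
    \<subseteq> (\<Union>c\<in>Index CX. (\<lambda>(s, t). (s, Char CX c t)) ` topspace (prod_topology (top_of_set {0..1::real}) (Dom CX c)))"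
  proof
    fix y assume y: "y \<in> topspace (prod_topology (top_of_set {0..1::real}) (conf_space k (Space X)))"
    obtain s x where sx: "y = (s, x)" "s \<in> {0..1}" "x \<in> CF" using y by (auto simp: topspace_conf_space)
    then obtain c t where "c \<in> Index CX" "t \<in> topspace (Dom CX c)" "Char CX c t = x" by (metis conf_covered)
    then show "y \<in> (\<Union>c\<in>Index CX. (\<lambda>(s, t). (s, Char CX c t)) ` topspace (prod_topology (top_of_set {0..1::real}) (Dom CX c)))"
      using sx by (intro UN_I[of c] image_eqI[of _ _ "(s, t)"]) auto
  qed
qed

lemma deform_0: assumes x: "x \<in> CF" shows "deform 0 x = x"
proof -
  have "deform 0 x i = x i" for i
    using param_proj(4)[of "x i"] x by (cases "i < k") (auto simp: deform_def conf_of_def move_pt_def conf_iff extensional_def)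
  then show ?thesis by auto
qed

subsection \<open>Invariance\<close>

lemma deform_perm: assumes p: "p permutes {..<k}" shows "deform s (perm_tuple p x) = perm_tuple p (deform s x)"
proof -
  define l where "l = (\<lambda>i. proj X (x i))"
  define z where "z = (\<lambda>i. param X (x i))"
  have pl: "(\<lambda>i. proj X (perm_tuple p x i)) = l \<circ> inv p" "(\<lambda>i. param X (perm_tuple p x i)) = z \<circ> inv p"
    by (auto simp: perm_tuple_def l_def z_def)
  have marks: "marks (l \<circ> inv p) (z \<circ> inv p) m = marks l z m" for m
  proof -
    have "(z \<circ> inv p) ` {i. i < k \<and> (l \<circ> inv p) i = m} = z ` {i. i < k \<and> l i = m}"
    proof (intro equalityI subsetI)
      fix a assume "a \<in> (z \<circ> inv p) ` {i. i < k \<and> (l \<circ> inv p) i = m}"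
      then show "a \<in> z ` {i. i < k \<and> l i = m}" using inv_p_less[OF p] by auto
    next
      fix a assume "a \<in> z ` {i. i < k \<and> l i = m}"
      then obtain i where "i < k" "l i = m" "a = z i" by auto
      then show "a \<in> (z \<circ> inv p) ` {i. i < k \<and> (l \<circ> inv p) i = m}"
        using p_less[OF p] inv_p(1)[OF p] by (intro image_eqI[of _ _ "p i"]) auto
    qed
    then show ?thesis by (simp add: marks_def)
  qed
  have mesh: "mesh (l \<circ> inv p) (z \<circ> inv p) m = mesh l z m" for m by (simp add: mesh_def marks)
  have inj: "inv p i = inv p j \<longleftrightarrow> i = j" for i j by (metis inv_p(2)[OF p])
  have tt: "tau_term (l \<circ> inv p) (z \<circ> inv p) (i, j) = tau_term l z (inv p i, inv p j)" for i j
    by (simp only: tau_term_def prod.case mesh o_apply inj)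
  have "tau_term (l \<circ> inv p) (z \<circ> inv p) ` ({..<k} \<times> {..<k}) = tau_term l z ` ({..<k} \<times> {..<k})"
  proof (intro equalityI subsetI)
    fix a assume "a \<in> tau_term (l \<circ> inv p) (z \<circ> inv p) ` ({..<k} \<times> {..<k})"
    then obtain i j where "i < k" "j < k" "a = tau_term l z (inv p i, inv p j)" using tt by auto
    then show "a \<in> tau_term l z ` ({..<k} \<times> {..<k})"
      using inv_p_less[OF p] by (intro image_eqI[of _ _ "(inv p i, inv p j)"]) auto
  next
    fix a assume "a \<in> tau_term l z ` ({..<k} \<times> {..<k})"
    then obtain i j where "i < k" "j < k" "a = tau_term l z (i, j)" by auto
    then show "a \<in> tau_term (l \<circ> inv p) (z \<circ> inv p) ` ({..<k} \<times> {..<k})"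
      using p_less[OF p] tt[of "p i" "p j"] inv_p(1)[OF p] by (intro image_eqI[of _ _ "(p i, p j)"]) auto
  qed
  then have tau: "tau (l \<circ> inv p) (z \<circ> inv p) = tau l z" by (simp add: tau_def min_over_def)
  have "move_pt (l \<circ> inv p) (z \<circ> inv p) s i = move_pt l z s (inv p i)" for i
    by (simp add: move_pt_def even_pos_def marks mesh tau)
  then have "deform s (perm_tuple p x) j = perm_tuple p (deform s x) j" for j
    using inv_p_less[OF p, of j] p_ge(2)[OF p, of j]
    unfolding deform_def pl by (auto simp: conf_of_def perm_tuple_def l_def z_def)
  then show ?thesis by auto
qed

subsection \<open>The retract is fixed\<close>

text \<open>The unit of length is the largest gap: it occurs between neighbours, and with a single coordinate at
  one of the ends, because the two ends cannot both be reached.\<close>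

lemma gap_pt_gaps:
  assumes c: "c \<in> Index CX" and w: "\<And>e. 0 < w e" "\<And>e. w e \<le> 1" and a: "admissible c {e. w e < 1}"
    and i: "i < k" "label c i = m" and m: "m \<in> E"
  defines "D \<equiv> w (m, -1) + w (m, 1) + real (npts c m) - 1"
  shows "0 < D" "gap_pt c w i = -1 + 2 * ((w (m, -1) + real (rank_on c i)) / D)" "mesh (label c) (gap_pt c w) m = 2 / D"
proof -
  let ?N = "npts c m"
  let ?q = "mark_seq c m (gap_pt c w)"
  have N: "0 < ?N" using npts_pos[OF i(1), of c] i(2) by simp
  then have N1: "1 \<le> real ?N" by simp
  show D: "0 < D" using w(1)[of "(m, -1)"] w(1)[of "(m, 1)"] N1 by (simp add: D_def)
  have gap_pt: "gap_pt c w j = -1 + 2 * ((w (m, -1) + real (rank_on c j)) / D)" if "label c j = m" for j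
    using that m by (simp add: gap_pt_def Let_def D_def)
  show "gap_pt c w i = -1 + 2 * ((w (m, -1) + real (rank_on c i)) / D)" by (rule gap_pt[OF i(2)])
  have in_params: "in_params c (gap_pt c w)" by (rule braid_proj_gap_pt(1)[OF c w(1)])
  interpret enumeration ?q ?N by (rule enumeration_mark_seq[OF c in_params m])
  have q: "?q j = -1 + 2 * ((w (m, -1) + real j - 1) / D)" if "0 < j" "j \<le> ?N" for j
  proof -
    have j: "j - 1 < ?N" using that by auto
    have "?q j = gap_pt c w (place c m (j - 1))" using that by (simp add: mark_seq_def)
    also have "\<dots> = -1 + 2 * ((w (m, -1) + real (j - 1)) / D)" using gap_pt place(2,3)[OF c j] by simp
    finally show ?thesis using that by (simp add: of_nat_diff)
  qed
  have gap0: "?q 1 - ?q 0 = 2 * w (m, -1) / D" using q[of 1] q0 N by simp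
  have gapN: "?q (Suc ?N) - ?q ?N = 2 * w (m, 1) / D"
  proof -
    have "?q (Suc ?N) - ?q ?N = 2 * (1 - (w (m, -1) + real ?N - 1) / D)" using q[of ?N] qN N by simp
    also have "1 - (w (m, -1) + real ?N - 1) / D = w (m, 1) / D"
      using D by (simp add: D_def field_simps)
    finally show ?thesis by simp
  qed
  have gapI: "?q (Suc j) - ?q j = 2 / D" if "0 < j" "j < ?N" for j
  proof -
    have "?q (Suc j) - ?q j = 2 * ((w (m, -1) + real (Suc j) - 1) / D - (w (m, -1) + real j - 1) / D)"
      using q[of "Suc j"] q[of j] that by simp
    also have "(w (m, -1) + real (Suc j) - 1) / D - (w (m, -1) + real j - 1) / D = 1 / D"
      by (simp add: diff_divide_distrib[symmetric])
    finally show ?thesis by simp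
  qed
  have le: "2 * w e / D \<le> 2 / D" for e using w(2)[of e] D by (simp add: divide_right_mono)
  have "maxgap S = 2 / D"
    unfolding maxgap_q
  proof (rule Max_eqI)
    fix y assume "y \<in> (\<lambda>i. ?q (Suc i) - ?q i) ` {..?N}"
    then obtain j where j: "j \<le> ?N" "y = ?q (Suc j) - ?q j" by auto
    consider "j = 0" | "j = ?N" | "0 < j" "j < ?N" using j by linarith
    then show "y \<le> 2 / D" using gap0 gapN gapI[of j] le j(2) by cases auto
  next
    show "2 / D \<in> (\<lambda>i. ?q (Suc i) - ?q i) ` {..?N}"
    proof (cases "2 \<le> ?N")
      case True
      then show ?thesis using gapI[of 1] by (intro image_eqI[of _ _ 1]) auto
    next
      case False
      then have N1: "?N = 1" using N by simp
      have "\<not> (w (m, -1) < 1 \<and> w (m, 1) < 1)" using admissibleD(4)[OF a, of m] False by auto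
      then have "w (m, -1) = 1 \<or> w (m, 1) = 1" using w(2)[of "(m, -1)"] w(2)[of "(m, 1)"] by auto
      then show ?thesis
      proof
        assume "w (m, -1) = 1"
        then show ?thesis using gap0 by (intro image_eqI[of _ _ 0]) auto
      next
        assume "w (m, 1) = 1"
        then show ?thesis using gapN N1 by (intro image_eqI[of _ _ 1]) auto
      qed
    qed
  qed simp
  then show "mesh (label c) (gap_pt c w) m = 2 / D" by (simp add: mesh_def marks_mark_seq[OF c])
qed

text \<open>Measured in units, the distances are sums of weights and of numbers of gaps.\<close>

lemma gap_pt_distances:
  assumes c: "c \<in> Index CX" and w: "\<And>e. 0 < w e" "\<And>e. w e \<le> 1" and a: "admissible c {e. w e < 1}"
    and i: "i < k" "label c i = m" and m: "m \<in> E"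
  shows "\<bar>gap_pt c w i + 1\<bar> / mesh (label c) (gap_pt c w) m = w (m, -1) + real (rank_on c i)"
    and "\<bar>gap_pt c w i - 1\<bar> / mesh (label c) (gap_pt c w) m = w (m, 1) + (real (npts c m) - 1 - real (rank_on c i))"
    and "\<And>j. j < k \<Longrightarrow> label c j = m \<Longrightarrow> \<bar>gap_pt c w i - gap_pt c w j\<bar> / mesh (label c) (gap_pt c w) m = \<bar>real (rank_on c i) - real (rank_on c j)\<bar>"
proof -
  define D where "D = w (m, -1) + w (m, 1) + real (npts c m) - 1"
  note G = gap_pt_gaps[OF c w a _ _ m, folded D_def]
  have D: "0 < D" by (rule G(1)[OF i])
  have M: "mesh (label c) (gap_pt c w) m = 2 / D" by (rule G(3)[OF i])
  define A where "A j = (w (m, -1) + real (rank_on c j)) / D" for j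
  have p: "gap_pt c w j = -1 + 2 * A j" if "j < k" "label c j = m" for j unfolding A_def by (rule G(2)[OF that])
  have AD: "A j * D = w (m, -1) + real (rank_on c j)" for j using D by (simp add: A_def)
  have r: "real (rank_on c i) + 1 \<le> real (npts c m)" using rank_on_less_npts[OF c i(1)] i(2) by simp
  have A0: "0 \<le> A i" unfolding A_def using D w(1)[of "(m, -1)"] by simp
  show "\<bar>gap_pt c w i + 1\<bar> / mesh (label c) (gap_pt c w) m = w (m, -1) + real (rank_on c i)"
    unfolding M p[OF i] using A0 AD[of i] by simp
  have A1: "A i \<le> 1" unfolding A_def using D w(1)[of "(m, 1)"] r by (simp add: D_def)
  have "\<bar>gap_pt c w i - 1\<bar> / mesh (label c) (gap_pt c w) m = (1 - A i) * D"
    unfolding M p[OF i] using A1 by simp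
  also have "\<dots> = w (m, 1) + (real (npts c m) - 1 - real (rank_on c i))"
    unfolding left_diff_distrib AD by (simp add: D_def)
  finally show "\<bar>gap_pt c w i - 1\<bar> / mesh (label c) (gap_pt c w) m = w (m, 1) + (real (npts c m) - 1 - real (rank_on c i))" .
  show "\<bar>gap_pt c w i - gap_pt c w j\<bar> / mesh (label c) (gap_pt c w) m = \<bar>real (rank_on c i) - real (rank_on c j)\<bar>" if j: "j < k" "label c j = m" for j
  proof -
    have "\<bar>gap_pt c w i - gap_pt c w j\<bar> / mesh (label c) (gap_pt c w) m = \<bar>A i - A j\<bar> * D"
    proof -
      have "gap_pt c w i - gap_pt c w j = 2 * (A i - A j)" using p[OF i] p[OF j] by simp
      then have "\<bar>gap_pt c w i - gap_pt c w j\<bar> = 2 * \<bar>A i - A j\<bar>" by (simp only: abs_mult abs_numeral)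
      then show ?thesis unfolding M by simp
    qed
    also have "\<dots> = \<bar>(A i - A j) * D\<bar>" using D by (simp add: abs_mult)
    also have "(A i - A j) * D = real (rank_on c i) - real (rank_on c j)" unfolding left_diff_distrib AD by simp
    finally show ?thesis .
  qed
qed

text \<open>In units, the distances between coordinates on a 1-cell are integers, and the distance to a missing end is at least 1.
  Two coordinates closer than one unit to the same vertex would be extreme coordinates next to two ends
  of weight less than 1 attached to this vertex, or one of them would be on the vertex; both
  contradict admissibility.\<close>

lemma tau_gap_pt:
  assumes c: "c \<in> Index CX" and w: "\<And>e. 0 < w e" "\<And>e. w e \<le> 1" and a: "admissible c {e. w e < 1}"
  shows "tau (label c) (gap_pt c w) = 1"
proof -
  note dist = gap_pt_distances[OF c w a]
  have in_params: "in_params c (gap_pt c w)" by (rule braid_proj_gap_pt(1)[OF c w(1)])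
  let ?M = "\<lambda>i. mesh (label c) (gap_pt c w) (label c i)"
  have rk1: "real (rank_on c i) + 1 \<le> real (npts c (label c i))" if "i < k" for i using rank_on_less_npts[OF c that] by simp
  \<comment> \<open>A point is close to a vertex only if it is the extreme point at an end attached to that vertex.\<close>
  have near_vertex: "\<exists>\<sigma>. w (label c i, \<sigma>) < 1 \<and> \<sigma> \<in> params X (label c i) \<and> \<bar>\<sigma>\<bar> = 1 \<and> proj X (char1 X (label c i) \<sigma>) = v \<and>
      (\<sigma> = -1 \<longrightarrow> rank_on c i = 0) \<and> (\<sigma> = 1 \<longrightarrow> Suc (rank_on c i) = npts c (label c i))"
    if i: "i < k" "label c i \<in> E" and n: "near_vertex (?M i) v (label c i) (gap_pt c w i) < 1" for i v
  proof -
    consider "-1 \<in> params X (label c i)" "proj X (char1 X (label c i) (-1)) = v" "\<bar>gap_pt c w i + 1\<bar> / ?M i < 1"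
      | "1 \<in> params X (label c i)" "proj X (char1 X (label c i) 1) = v" "\<bar>gap_pt c w i - 1\<bar> / ?M i < 1"
      using n i(2) by (auto simp: near_vertex_def min_def split: if_splits)
    then show ?thesis
    proof cases
      case 1
      then have s: "w (label c i, -1) + real (rank_on c i) < 1" using dist(1)[OF i(1) refl i(2)] by simp
      then have "w (label c i, -1) < 1" by simp
      moreover have "real (rank_on c i) < 1" using s w(1)[of "(label c i, -1)"] by linarith
      then have "rank_on c i = 0" by simp
      ultimately show ?thesis using 1 by (intro exI[of _ "-1"]) simp
    next
      case 2
      then have s: "w (label c i, 1) + (real (npts c (label c i)) - 1 - real (rank_on c i)) < 1" using dist(2)[OF i(1) refl i(2)] by simp
      then have "w (label c i, 1) < 1" using rk1[OF i(1)] by linarith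
      moreover have "real (npts c (label c i)) < real (rank_on c i) + 2" using s w(1)[of "(label c i, 1)"] by linarith
      then have "Suc (rank_on c i) = npts c (label c i)" using rank_on_less_npts[OF c i(1)] by linarith
      ultimately show ?thesis using 2 by (intro exI[of _ 1]) simp
    qed
  qed
  have "1 \<le> tau_term (label c) (gap_pt c w) (i, j)" if ij: "i < k" "j < k" for i j
  proof (cases "i = j")
    case True
    have "1 \<le> near_absent (?M i) (label c i) (gap_pt c w i)"
    proof (cases "label c i \<in> E")
      case E: True
      have n: "w (label c i, \<sigma>) = 1" if "\<sigma> \<notin> params X (label c i)" for \<sigma>
        using admissibleD(1)[OF a, of "label c i" \<sigma>] w(2)[of "(label c i, \<sigma>)"] that by fastforce
      have "-1 \<notin> params X (label c i) \<Longrightarrow> 1 \<le> \<bar>gap_pt c w i + 1\<bar> / ?M i" using dist(1)[OF ij(1) refl E] n[of "-1"] by simp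
      moreover have "1 \<notin> params X (label c i) \<Longrightarrow> 1 \<le> \<bar>gap_pt c w i - 1\<bar> / ?M i"
        using dist(2)[OF ij(1) refl E] n[of 1] rk1[OF ij(1)] by simp
      ultimately show ?thesis using E by (simp add: near_absent_def)
    qed (simp add: near_absent_def)
    then show ?thesis using True by (simp add: tau_term_def)
  next
    case False
    have "1 \<le> max (near_vertex (?M i) v (label c i) (gap_pt c w i)) (near_vertex (?M j) v (label c j) (gap_pt c w j))" if v: "v \<in> V" for v
    proof (rule ccontr)
      assume "\<not> ?thesis"
      then have n: "near_vertex (?M i) v (label c i) (gap_pt c w i) < 1" "near_vertex (?M j) v (label c j) (gap_pt c w j) < 1" by auto
      have V: "label c l = v" if "label c l \<notin> E" "near_vertex (?M l) v (label c l) (gap_pt c w l) < 1" for l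
        using that by (auto simp: near_vertex_def split: if_splits)
      have mixed: False if l: "l < k" "label c l \<notin> E" "near_vertex (?M l) v (label c l) (gap_pt c w l) < 1"
        and h: "h < k" "label c h \<in> E" "near_vertex (?M h) v (label c h) (gap_pt c w h) < 1" for l h
      proof -
        obtain \<sigma> where s: "w (label c h, \<sigma>) < 1" "\<sigma> \<in> params X (label c h)" "\<bar>\<sigma>\<bar> = 1" "proj X (char1 X (label c h) \<sigma>) = v"
          using near_vertex[OF h] by blast
        have "char1 X (label c l) 0 = char1 X (label c h) \<sigma>"
          using end_eq_vertex[OF h(2) s(2,3)] s(4) V[OF l(2,3)] by simp
        then show False using admissibleD(2)[OF a, of "label c h" \<sigma> l] s(1) l by simp
      qed
      show False
      proof (cases "label c i \<in> E"; cases "label c j \<in> E")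
        assume E: "label c i \<in> E" "label c j \<in> E"
        obtain \<sigma> where s: "w (label c i, \<sigma>) < 1" "\<sigma> \<in> params X (label c i)" "\<bar>\<sigma>\<bar> = 1" "proj X (char1 X (label c i) \<sigma>) = v"
          "\<sigma> = -1 \<longrightarrow> rank_on c i = 0" "\<sigma> = 1 \<longrightarrow> Suc (rank_on c i) = npts c (label c i)"
          using near_vertex[OF ij(1) E(1) n(1)] by blast
        obtain \<sigma>' where s': "w (label c j, \<sigma>') < 1" "\<sigma>' \<in> params X (label c j)" "\<bar>\<sigma>'\<bar> = 1" "proj X (char1 X (label c j) \<sigma>') = v"
          "\<sigma>' = -1 \<longrightarrow> rank_on c j = 0" "\<sigma>' = 1 \<longrightarrow> Suc (rank_on c j) = npts c (label c j)"
          using near_vertex[OF ij(2) E(2) n(2)] by blast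
        have "char1 X (label c i) \<sigma> = char1 X (label c j) \<sigma>'"
          using end_eq_vertex[OF E(1) s(2,3)] end_eq_vertex[OF E(2) s'(2,3)] s(4) s'(4) by simp
        then have eq: "label c i = label c j" "\<sigma> = \<sigma>'"
          using admissibleD(3)[OF a, of "label c i" \<sigma> "label c j" \<sigma>'] s(1) s'(1) by auto
        have "\<sigma> = -1 \<or> \<sigma> = 1" using s(3) by auto
        then have "rank_on c i = rank_on c j" using s(5,6) s'(5,6) eq by auto
        then show False using rank_on_inj[OF c ij eq(1)] False by blast
      next
        assume "label c i \<notin> E" "label c j \<notin> E"
        then show False using V[OF _ n(1)] V[OF _ n(2)] label_V_inj[OF c ij] False by simp
      qed (use mixed ij n in blast)+
    qed
    then have "1 \<le> min_over V (\<lambda>v. max (near_vertex (?M i) v (label c i) (gap_pt c w i)) (near_vertex (?M j) v (label c j) (gap_pt c w j)))"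
      unfolding le_min_over_iff[OF finite_V] by simp
    moreover have "1 \<le> (if label c i = label c j \<and> label c i \<in> E then \<bar>gap_pt c w i - gap_pt c w j\<bar> / ?M i else 1)"
    proof (cases "label c i = label c j \<and> label c i \<in> E")
      case True
      have "rank_on c i \<noteq> rank_on c j" using rank_on_inj[OF c ij] True False by blast
      then have "1 \<le> \<bar>real (rank_on c i) - real (rank_on c j)\<bar>" by (rule one_le_abs_diff)
      moreover have E: "label c i \<in> E" and eq: "label c j = label c i" using True by auto
      ultimately have "1 \<le> \<bar>gap_pt c w i - gap_pt c w j\<bar> / ?M i"
        using dist(3)[OF ij(1) refl E ij(2) eq] by (metis order_trans)
      then show ?thesis unfolding if_P[OF True] .
    next
      case False
      show ?thesis unfolding if_not_P[OF False] by simp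
    qed
    ultimately show ?thesis
      unfolding tau_term_def prod.case if_not_P[OF False] by (simp only: min.bounded_iff)
  qed
  then have "1 \<le> tau (label c) (gap_pt c w)" unfolding tau_def by (subst le_min_over_iff) auto
  then show ?thesis using tau_le(1)[OF c in_params] by simp
qed

lemma deform_fixed:
  assumes "x \<in> iota ` topspace BC" shows "deform s x = x"
proof -
  obtain c w where c: "c \<in> Index CX" and w: "\<And>e. 0 < w e" "\<And>e. w e \<le> 1" and a: "admissible c {e. w e < 1}"
    and x: "x = conf_of (label c) (gap_pt c w)" using assms unfolding iota_image_iff by blast
  have in_params: "in_params c (gap_pt c w)" by (rule braid_proj_gap_pt(1)[OF c w(1)])
  have "even_pos (label c) (gap_pt c w) i = gap_pt c w i" if i: "i < k" "label c i = m" and m: "m \<in> E" for i m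
  proof -
    interpret enumeration "mark_seq c m (gap_pt c w)" "npts c m" by (rule enumeration_mark_seq[OF c in_params m])
    have S: "marks (label c) (gap_pt c w) m = S" by (rule marks_mark_seq[OF c])
    have M: "mesh (label c) (gap_pt c w) m * tau (label c) (gap_pt c w) = maxgap S"
      unfolding tau_gap_pt[OF c w a] mesh_def S by simp
    have r: "Suc (rank_on c i) \<le> Suc (npts c m)" using rank_on_less_npts[OF c i(1)] i by simp
    have F: "gap_sum S (maxgap S) (gap_pt c w i) = (gap_pt c w i + 1) / maxgap S"
      using gap_sum_maxgap[OF r] unfolding mark_seq_rank_on[OF c i] .
    have F1: "gap_sum S (maxgap S) 1 = 2 / maxgap S" using gap_sum_maxgap[OF order_refl] unfolding qN by simp
    have "(gap_pt c w i + 1) / maxgap S / (2 / maxgap S) = (gap_pt c w i + 1) / 2" using maxgap_pos by simp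
    then show ?thesis unfolding even_pos_def Let_def i(2) M S F F1 by (simp add: field_simps)
  qed
  then have "move_pt (label c) (gap_pt c w) s i = gap_pt c w i" if "i < k" for i
    using that by (auto simp: move_pt_def algebra_simps)
  then have "conf_of (label c) (move_pt (label c) (gap_pt c w) s) = conf_of (label c) (gap_pt c w)" by (intro conf_of_cong) simp
  then show ?thesis using deform_eq[OF c in_params, of s] x by simp
qed

subsection \<open>The end of the deformation\<close>

text \<open>The weights of the final configuration are the end gaps in units of \<open>\<kappa>\<close>, truncated at 1. Gaps between
  neighbours are at least \<open>\<tau> M = \<kappa>\<close> and are cut off to one unit. The ends of weight less than 1 are
  closer than \<open>\<kappa>\<close> to a coordinate; by the choice of \<open>\<tau>\<close> they are present and no other coordinate is
  that close to the vertices to which they are attached, so they form an admissible set.\<close>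

lemma deform_1:
  assumes x: "x \<in> CF" shows "deform 1 x \<in> iota ` topspace BC"
proof -
  define c where "c = braid_proj k X x"
  define z where "z = (\<lambda>i. param X (x i))"
  have c: "c \<in> Index CX" unfolding c_def by (rule braid_proj_Index[OF x])
  have z: "in_params c z" "conf_of (label c) z = x" using in_params_param[OF x] by (auto simp: c_def z_def)
  have zb: "-1 < z i" "z i < 1" if "i < k" for i using param_proj(1,2)[of "x i"] x that by (auto simp: z_def conf_iff)
  define T where "T = tau (label c) z"
  define \<kappa> where "\<kappa> m = mesh (label c) z m * T" for m
  have T1: "T \<le> 1" unfolding T_def by (rule tau_le(1)[OF c z(1)])
  have Tt: "T \<le> tau_term (label c) z (i, j)" if "i < k" "j < k" for i j unfolding T_def by (rule tau_le(2)[OF c z(1) that])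
  have M: "0 < mesh (label c) z m" if "m \<in> E" for m using mesh_bounds[OF c z(1) that] by simp
  have k0: "0 < \<kappa> m" if "m \<in> E" for m unfolding \<kappa>_def T_def by (rule kappa_pos[OF c z(1) that])
  have kdiv: "a / \<kappa> m < 1 \<longleftrightarrow> a / mesh (label c) z m < T" if "m \<in> E" for a m
    using M[OF that] k0[OF that] by (simp add: \<kappa>_def divide_less_eq mult.commute)
  \<comment> \<open>The extreme points on a 1-cell, and their distances to the ends.\<close>
  define ext where "ext m \<sigma> = (if \<sigma> = -1 then place c m 0 else place c m (npts c m - 1))" for m and \<sigma> :: real
  define w where "w = (\<lambda>(m, \<sigma>). if m \<in> E \<and> 0 < npts c m \<and> \<bar>\<sigma>\<bar> = 1 then min 1 (\<bar>z (ext m \<sigma>) - \<sigma>\<bar> / \<kappa> m) else 1)"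
  have ext: "ext m \<sigma> < k" "label c (ext m \<sigma>) = m" if "0 < npts c m" for m \<sigma>
    using place[OF c, of 0 m] place[OF c, of "npts c m - 1" m] that by (auto simp: ext_def)
  have w0: "0 < w e" for e
  proof -
    obtain m \<sigma> where e: "e = (m, \<sigma>)" by (cases e)
    show ?thesis
    proof (cases "m \<in> E \<and> 0 < npts c m \<and> \<bar>\<sigma>\<bar> = 1")
      case True
      then have "z (ext m \<sigma>) \<noteq> \<sigma>" using zb[OF ext(1), of m \<sigma>] by auto
      then show ?thesis using True k0[of m] by (simp add: w_def e)
    next
      case False
      then show ?thesis by (auto simp: w_def e)
    qed
  qed
  have w1: "w e \<le> 1" for e by (auto simp: w_def split: prod.splits)
  have wlt: "m \<in> E \<and> 0 < npts c m \<and> \<bar>\<sigma>\<bar> = 1 \<and> \<bar>z (ext m \<sigma>) - \<sigma>\<bar> / mesh (label c) z m < T" if "w (m, \<sigma>) < 1" for m \<sigma>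
  proof -
    have "m \<in> E \<and> 0 < npts c m \<and> \<bar>\<sigma>\<bar> = 1" using that by (auto simp: w_def split: if_splits)
    moreover from this have "min 1 (\<bar>z (ext m \<sigma>) - \<sigma>\<bar> / \<kappa> m) < 1" using that by (simp add: w_def)
    then have "\<bar>z (ext m \<sigma>) - \<sigma>\<bar> / \<kappa> m < 1" by (simp add: min_less_iff_disj)
    ultimately show ?thesis using kdiv[of m] by blast
  qed
  \<comment> \<open>A single coordinate has distance \<open>M \<ge> \<kappa>\<close> to one of the ends.\<close>
  have both: "2 \<le> npts c m" if lt: "w (m, -1) < 1" "w (m, 1) < 1" for m
  proof (rule ccontr)
    assume "\<not> 2 \<le> npts c m"
    note h = wlt[OF lt(1)] wlt[OF lt(2)]
    have m: "m \<in> E" and N: "npts c m = 1" using h \<open>\<not> 2 \<le> npts c m\<close> by auto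
    let ?i = "place c m 0"
    interpret enumeration "mark_seq c m z" "npts c m" by (rule enumeration_mark_seq[OF c z(1) m])
    have q: "mark_seq c m z 0 = -1" "mark_seq c m z 1 = z ?i" "mark_seq c m z 2 = 1" using N by (auto simp: mark_seq_def)
    have "{..npts c m} = {0, 1}" using N by auto
    then have "mesh (label c) z m = max (z ?i + 1) (1 - z ?i)"
      unfolding mesh_def marks_mark_seq[OF c] maxgap_q using q by (simp add: numeral_2_eq_2 max.commute)
    moreover have "\<bar>z ?i + 1\<bar> < mesh (label c) z m" "\<bar>z ?i - 1\<bar> < mesh (label c) z m"
    proof -
      have "T * mesh (label c) z m \<le> mesh (label c) z m" using mult_right_mono[OF T1, of "mesh (label c) z m"] M[OF m] by simp
      moreover have "\<bar>z ?i + 1\<bar> < T * mesh (label c) z m" "\<bar>z ?i - 1\<bar> < T * mesh (label c) z m"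
        using h N M[OF m] by (auto simp: ext_def divide_less_eq)
      ultimately show "\<bar>z ?i + 1\<bar> < mesh (label c) z m" "\<bar>z ?i - 1\<bar> < mesh (label c) z m"
        by (blast intro: less_le_trans)+
    qed
    ultimately show False by linarith
  qed
  have extreme_near_vertex: "near_vertex (mesh (label c) z m) v m (z (ext m \<sigma>)) < T"
    if "w (m, \<sigma>) < 1" "\<sigma> \<in> params X m" "proj X (char1 X m \<sigma>) = v" for m \<sigma> v
    using near_vertex_le[of m \<sigma> v "mesh (label c) z m" "z (ext m \<sigma>)"] wlt[OF that(1)] that(2,3) by fastforce
  \<comment> \<open>No two coordinates are closer to the same vertex than \<open>T\<close>.\<close>
  have clash: False if "i < k" "j < k" "i \<noteq> j" "v \<in> V" "near_vertex (mesh (label c) z (label c i)) v (label c i) (z i) < T"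
      "near_vertex (mesh (label c) z (label c j)) v (label c j) (z j) < T" for i j v
  proof -
    have "tau_term (label c) z (i, j) \<le> max (near_vertex (mesh (label c) z (label c i)) v (label c i) (z i)) (near_vertex (mesh (label c) z (label c j)) v (label c j) (z j))"
      unfolding tau_term_def prod.case if_not_P[OF that(3)]
      by (rule min.coboundedI2) (rule min_over_le(2)[OF finite_V that(4)])
    then show False using Tt[OF that(1,2)] that(5,6) by simp
  qed
  have in_params: "\<sigma> \<in> params X m" if "w (m, \<sigma>) < 1" for m \<sigma>
  proof (rule ccontr)
    assume n: "\<sigma> \<notin> params X m"
    note h = wlt[OF that]
    have "\<sigma> = -1 \<or> \<sigma> = 1" using h by auto
    then have "near_absent (mesh (label c) z m) m (z (ext m \<sigma>)) \<le> \<bar>z (ext m \<sigma>) - \<sigma>\<bar> / mesh (label c) z m"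
      using n h by (auto simp: near_absent_def min_def)
    moreover have "T \<le> near_absent (mesh (label c) z m) m (z (ext m \<sigma>))"
      using Tt[of "ext m \<sigma>" "ext m \<sigma>"] ext[of m \<sigma>] h by (simp add: tau_term_def)
    ultimately show False using h by simp
  qed
  have vertex: "proj X (char1 X m \<sigma>) \<in> V" if "w (m, \<sigma>) < 1" for m \<sigma>
    using proj_char1_end[OF _ in_params[OF that]] wlt[OF that] by blast
  have admissible: "admissible c {e. w e < 1}"
    unfolding admissible_def
  proof (intro conjI)
    show "\<forall>(m, \<sigma>)\<in>{e. w e < 1}. m \<in> E \<and> \<bar>\<sigma>\<bar> = 1 \<and> \<sigma> \<in> params X m \<and> 0 < npts c m \<and>
        (\<forall>i<k. label c i \<notin> E \<longrightarrow> char1 X (label c i) 0 \<noteq> char1 X m \<sigma>)"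
    proof clarify
      fix m \<sigma> assume lt: "w (m, \<sigma>) < 1"
      note h = wlt[OF lt]
      have "char1 X (label c i) 0 \<noteq> char1 X m \<sigma>" if i: "i < k" "label c i \<notin> E" for i
      proof
        assume eq: "char1 X (label c i) 0 = char1 X m \<sigma>"
        have v: "label c i \<in> V" using label_Index[OF c i(1)] i(2) by simp
        then have pv: "proj X (char1 X m \<sigma>) = label c i" using eq[symmetric] by simp
        have n1: "near_vertex (mesh (label c) z (label c i)) (label c i) (label c i) (z i) < T"
          using i(2) T_def tau_pos[OF c z(1)] by (simp add: near_vertex_def)
        have n2: "near_vertex (mesh (label c) z (label c (ext m \<sigma>))) (label c i) (label c (ext m \<sigma>)) (z (ext m \<sigma>)) < T"
          using extreme_near_vertex[OF lt in_params[OF lt] pv] ext(2)[of m \<sigma>] h by simp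
        have neq: "i \<noteq> ext m \<sigma>" using ext(2)[of m \<sigma>] h i(2) by auto
        have pos: "0 < npts c m" using h by simp
        note e = ext(1)[OF pos, of \<sigma>]
        show False by (rule clash[OF i(1) e neq v n1 n2])
      qed
      then show "m \<in> E \<and> \<bar>\<sigma>\<bar> = 1 \<and> \<sigma> \<in> params X m \<and> 0 < npts c m \<and>
        (\<forall>i<k. label c i \<notin> E \<longrightarrow> char1 X (label c i) 0 \<noteq> char1 X m \<sigma>)" using h in_params[OF lt] by blast
    qed
    show "\<forall>e\<in>{e. w e < 1}. \<forall>e'\<in>{e. w e < 1}. e \<noteq> e' \<longrightarrow> char1 X (fst e) (snd e) \<noteq> char1 X (fst e') (snd e')"
    proof (intro ballI impI notI)
      fix e e' assume "e \<in> {e. w e < 1}" "e' \<in> {e. w e < 1}" and ne: "e \<noteq> e'"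
        and eq: "char1 X (fst e) (snd e) = char1 X (fst e') (snd e')"
      then obtain m \<sigma> m' \<sigma>' where e: "e = (m, \<sigma>)" "e' = (m', \<sigma>')" and lt: "w (m, \<sigma>) < 1" "w (m', \<sigma>') < 1"
        by (cases e; cases e') auto
      note h = wlt[OF lt(1)] wlt[OF lt(2)]
      let ?v = "proj X (char1 X m \<sigma>)"
      have char1: "proj X (char1 X m' \<sigma>') = ?v" using eq e by simp
      have n: "near_vertex (mesh (label c) z (label c (ext m \<sigma>))) ?v (label c (ext m \<sigma>)) (z (ext m \<sigma>)) < T"
        "near_vertex (mesh (label c) z (label c (ext m' \<sigma>'))) ?v (label c (ext m' \<sigma>')) (z (ext m' \<sigma>')) < T"
        using extreme_near_vertex[OF lt(1) in_params[OF lt(1)] refl] extreme_near_vertex[OF lt(2) in_params[OF lt(2)] char1]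
          ext(2)[of m \<sigma>] ext(2)[of m' \<sigma>'] h by simp_all
      have same: "ext m \<sigma> = ext m' \<sigma>'"
      proof (rule ccontr)
        assume ne': "ext m \<sigma> \<noteq> ext m' \<sigma>'"
        have pos: "0 < npts c m" "0 < npts c m'" using h by simp_all
        note e = ext(1)[OF pos(1), of \<sigma>] ext(1)[OF pos(2), of \<sigma>']
        show False by (rule clash[OF e ne' vertex[OF lt(1)] n])
      qed
      then have mm: "m = m'" using ext(2)[of m \<sigma>] ext(2)[of m' \<sigma>'] h by simp
      then have ss: "\<sigma> \<noteq> \<sigma>'" using ne e by simp
      have "(\<sigma> = -1 \<or> \<sigma> = 1) \<and> (\<sigma>' = -1 \<or> \<sigma>' = 1)" using h by auto
      then have pm: "(\<sigma> = -1 \<and> \<sigma>' = 1) \<or> (\<sigma> = 1 \<and> \<sigma>' = -1)" using ss by auto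
      then have N: "2 \<le> npts c m" using both[of m] lt mm by auto
      have "place c m 0 = place c m (npts c m - 1)" using same pm mm by (auto simp: ext_def)
      then have "0 = npts c m - 1" using place(3)[OF c, of 0 m] place(3)[OF c, of "npts c m - 1" m] N by simp
      then show False using N by simp
    qed
    show "\<forall>m. (m, -1) \<in> {e. w e < 1} \<and> (m, 1) \<in> {e. w e < 1} \<longrightarrow> 2 \<le> npts c m" using both by simp
  qed
  have np: "even_pos (label c) z i = gap_pt c w i" if i: "i < k" "label c i = m" and m: "m \<in> E" for i m
  proof -
    let ?q = "mark_seq c m z" and ?N = "npts c m"
    let ?g = "\<lambda>r. min 1 ((?q (Suc r) - ?q r) / \<kappa> m)"
    have N: "0 < ?N" using npts_pos[OF i(1), of c] i(2) by simp
    have g0: "?g 0 = w (m, -1)"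
    proof -
      have "-1 < z (place c m 0)" using zb(1)[OF place(1)[OF c N]] .
      then show ?thesis using m N by (simp add: w_def ext_def mark_seq_def)
    qed
    have gN: "?g ?N = w (m, 1)"
    proof -
      have "?N - 1 < ?N" using N by simp
      then have "z (place c m (?N - 1)) < 1" by (rule zb(2)[OF place(1)[OF c]])
      then show ?thesis using m N by (simp add: w_def ext_def mark_seq_def)
    qed
    have gI: "?g r = 1" if r: "0 < r" "r < ?N" for r
    proof -
      have r': "r - 1 < ?N" using r by simp
      let ?i = "place c m (r - 1)" and ?j = "place c m r"
      note a = place[OF c r'] and b = place[OF c r(2)]
      have ne: "?i \<noteq> ?j" using a(3) b(3) r by auto
      have "T \<le> tau_term (label c) z (?i, ?j)" by (rule Tt[OF a(1) b(1)])
      also have "\<dots> \<le> \<bar>z ?i - z ?j\<bar> / mesh (label c) z m"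
        unfolding tau_term_def prod.case if_not_P[OF ne] using a(2) b(2) m by simp
      finally have "T \<le> \<bar>z ?i - z ?j\<bar> / mesh (label c) z m" .
      moreover have "z ?i < z ?j" using in_params_less_iff[OF c z(1) a(1) b(1)] a b m r by simp
      ultimately have "\<not> (z ?j - z ?i) / \<kappa> m < 1" using kdiv[OF m, of "z ?j - z ?i"] by (simp add: abs_if)
      moreover have "?q (Suc r) - ?q r = z ?j - z ?i" using r by (simp add: mark_seq_def)
      ultimately show ?thesis by simp
    qed
    have s: "(\<Sum>r<Suc n. ?g r) = w (m, -1) + real n" if "n < ?N" for n
    proof -
      have "(\<Sum>r<Suc n. ?g r) = ?g 0 + (\<Sum>r<n. ?g (Suc r))" by (rule sum.lessThan_Suc_shift)
      also have "(\<Sum>r<n. ?g (Suc r)) = (\<Sum>r<n. 1)" using gI that by (intro sum.cong) auto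
      finally show ?thesis using g0 by simp
    qed
    have sN: "(\<Sum>r<Suc ?N. ?g r) = w (m, -1) + w (m, 1) + real ?N - 1"
    proof -
      have "(\<Sum>r<Suc ?N. ?g r) = (\<Sum>r<Suc (?N - 1). ?g r) + ?g ?N" using N by simp
      also have "\<dots> = w (m, -1) + real (?N - 1) + w (m, 1)" using s[of "?N - 1"] N gN by simp
      finally show ?thesis using N by (simp add: of_nat_diff)
    qed
    have r: "rank_on c i < ?N" using rank_on_less_npts[OF c i(1)] i(2) by simp
    have "even_pos (label c) z i = -1 + 2 * ((\<Sum>r<Suc (rank_on c i). ?g r) / (\<Sum>r<Suc ?N. ?g r))"
      unfolding even_pos_mark_seq[OF c z(1) i m] \<kappa>_def T_def ..
    also have "\<dots> = gap_pt c w i" unfolding s[OF r] sN using i m by (simp add: gap_pt_def Let_def)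
    finally show ?thesis .
  qed
  have "deform 1 x = conf_of (label c) (move_pt (label c) z 1)" using deform_eq[OF c z(1), of 1] z(2) by simp
  also have "\<dots> = conf_of (label c) (gap_pt c w)"
  proof (rule conf_of_cong)
    fix i assume i: "i < k"
    have "move_pt (label c) z 1 i = gap_pt c w i"
      using np[OF i refl] in_params_V[OF c z(1) i] by (auto simp: move_pt_def gap_pt_V)
    then show "char1 X (label c i) (move_pt (label c) z 1 i) = char1 X (label c i) (gap_pt c w i)" by simp
  qed
  finally show ?thesis unfolding iota_image_iff using c w0 w1 admissible by blast
qed

lemma deformation_retract:
  "strong_equivariant_deformation_retract (sym_group k) perm_tuple (conf_space k (Space X)) (iota ` topspace BC)"
  unfolding strong_equivariant_deformation_retract_def
proof (intro conjI exI)
  let ?A = "iota ` topspace BC"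
  let ?T = "conf_space k (Space X)"
  \<comment> \<open>\<open>homotopic_with\<close> prescribes the values at times 0 and 1 on the whole type, so \<open>deform\<close> is replaced
    by the identity outside the configuration space.\<close>
  define h where "h = (\<lambda>(s :: real, x). if x \<in> CF then deform s x else x)"
  define r where "r x = h (1, x)" for x
  have sub: "?A \<subseteq> CF" using iota_continuous topspace_conf_space by (auto simp: continuous_map_def)
  show "?A \<subseteq> topspace ?T" using sub topspace_conf_space by simp
  have hc: "continuous_map (prod_topology (top_of_set {0..1}) ?T) ?T h"
    by (rule continuous_map_eq[OF deform_continuous]) (auto simp: h_def topspace_conf_space)
  have fixed: "h (s, a) = a" if "a \<in> ?A" for s a using deform_fixed[OF that, of s] by (simp add: h_def)
  have "continuous_map ?T (prod_topology (top_of_set {0..1::real}) ?T) (\<lambda>x. (1, x))"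
    by (intro continuous_map_pairedI) (auto simp: continuous_map_id[unfolded id_def])
  from continuous_map_compose[OF this hc] have rc: "continuous_map ?T ?T r" by (simp add: o_def r_def[abs_def])
  have rA: "r x \<in> ?A" if "x \<in> CF" for x using deform_1[OF that] that by (simp add: r_def h_def)
  show "retraction_maps ?T (subtopology ?T ?A) r id"
    unfolding retraction_maps_def
  proof (intro conjI ballI)
    show "continuous_map ?T (subtopology ?T ?A) r"
      unfolding continuous_map_in_subtopology using rc rA by (auto simp: topspace_conf_space)
    show "continuous_map (subtopology ?T ?A) ?T id" by (simp add: continuous_map_from_subtopology)
    fix x assume "x \<in> topspace (subtopology ?T ?A)"
    then show "r (id x) = x" using fixed[of x 1] by (auto simp: r_def)
  qed
  show "homotopic_with (\<lambda>f. (\<forall>a\<in>?A. f a = a) \<and> equivariant (sym_group k) perm_tuple perm_tuple (topspace ?T) f) ?T ?T id r"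
    unfolding homotopic_with_def
  proof (intro exI[of _ h] conjI allI ballI)
    show "continuous_map (prod_topology (top_of_set {0..1}) ?T) ?T h" by (rule hc)
    show "h (0, x) = id x" for x using deform_0[of x] by (simp add: h_def)
    show "h (1, x) = r x" for x by (simp add: r_def)
    show "h (s, a) = a" if "a \<in> ?A" for s a by (rule fixed[OF that])
    show "equivariant (sym_group k) perm_tuple perm_tuple (topspace ?T) (\<lambda>x. h (s, x))" for s
      unfolding equivariant_def sym_group_def
      using deform_perm perm_tuple_conf by (simp add: h_def topspace_conf_space)
  qed
qed

lemma face_category_retract:
  "finite_category FC \<and> acyclic_category FC \<and>
    (\<exists>\<iota>. embedding_map BC (conf_space k (Space X)) \<iota> \<and>
       equivariant (sym_group k) (perm_classifying k X) perm_tuple (topspace BC) \<iota> \<and>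
       strong_equivariant_deformation_retract (sym_group k) perm_tuple (conf_space k (Space X)) (\<iota> ` topspace BC))"
proof (intro conjI exI[of _ iota])
  show "equivariant (sym_group k) (perm_classifying k X) perm_tuple (topspace BC) iota"
    unfolding equivariant_def sym_group_def using iota_perm by simp
qed (rule finite_category_FC acyclic_category_FC iota_embedding deformation_retract)+

end

theorem theorem1p4:
  fixes X :: "('a, 'c, nat \<Rightarrow> real) strat_cells" and k :: nat
  assumes "cellular_stratified_space X"
    and "finite_cells X"
    and "one_dimensional X"
    and "k > 0"
  shows "finite_category (face_category (comp_strat k X)) \<and>
    acyclic_category (face_category (comp_strat k X)) \<and>
    (\<exists>\<iota>. embedding_map (classifying_space (face_category (comp_strat k X)))
               (conf_space k (Space X)) \<iota> \<and>
             equivariant (sym_group k) (perm_classifying k X) perm_tuple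
               (topspace (classifying_space (face_category (comp_strat k X)))) \<iota> \<and>
             strong_equivariant_deformation_retract (sym_group k) perm_tuple
               (conf_space k (Space X))
               (\<iota> ` topspace (classifying_space (face_category (comp_strat k X)))))"
proof -
  interpret finite_graph X k
    using assms by unfold_locales
  show ?thesis by (rule face_category_retract)
qed

end
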